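(* Let $\mathcal{U}\subset\mathbb{R}^5$ be open and let $A,B,C,E:\mathcal{U}\to\mathbb{R}$ be real analytic functions satisfying the ellipticity condition $\mathcal{D}:=AC-B^2+E>0$ on $\mathcal{U}$. Consider the equation $$A z_{xx}+2B z_{xy}+C z_{yy}+z_{xx}z_{yy}-z_{xy}^2=E,\qquad( ** )$$ where $A,B,C,E$ are evaluated at $(x,y,z,z_x,z_y)$. Let $\gamma(u)=(\alpha(u),\beta(u))$ be a real analytic, $2\pi$-periodic curve in $\mathbb{R}^2$ such that $(0,0,0,\gamma(u))\in\mathcal{U}$ for all $u\in\mathbb{R}$. Then there exist $R>0$ and a real analytic map $\psi=(x,y,z):\widehat{\Gamma_R}\to\mathbb{R}^3$ such that: 1. $\psi(u,0)=(0,0,0)$ for every $u\in\mathbb{R}$. 2. There exists a real analytic map $(p,q):\widehat{\Gamma_R}\to\mathbb{R}^2$ such that $(p,q)(u,0)=\gamma(u)$ for every $u\in\mathbb{R}$ and $(\psi,p,q)(\Gamma_R)\subset\mathcal{U}$. Moreover, the map $N:\widehat{\Gamma_R}\to\mathbb{S}^2$ defined by $$N(u,v)=\frac{(-p,-q,1)}{\sqrt{1+p^2+q^2}}(u,v)$$ satisfies $\langle\psi_u,N\rangle=\langle\psi_v,N\rangle=0$ in $\Gamma_R$. 3. If the map $(x(u,v),y(u,v))$ is an orientation preserving local diffeomorphism at some point $(u_0,v_0)\in\Gamma_R$, then the image of $\psi$ around that point is the graph in $\mathbb{R}^3$ of some real analytic solution $z=z(x,y)$ to $( ** )$ for the coefficients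 $A,B,C,E$, such that $C+z_{xx}>0$. 4. If $\gamma(u)$ is a regular, negatively oriented, strictly convex parametrized Jordan curve (so $\gamma'(u)\neq 0$ and the curvature of $\gamma(u)$ is strictly negative for every $u$), then for $R>0$ small enough, $\psi(\Gamma_R)$ is the graph of a solution $z$ to $( ** )$ for the coefficients $A,B,C,E$ which is defined on a punctured neighborhood of the origin and has an isolated singularity at the puncture. Moreover, the limit gradient of this solution at the origin is the curve $\gamma(\mathbb{R})$, and $C+z_{xx}>0$.
   Context: For $R>0$: $\Gamma_R=\{w=u+iv\in\mathbb{C}:0<v<R\}/(2\pi\mathbb{Z})$ and $\widehat{\Gamma_R}=\{w=u+iv\in\mathbb{C}:-R<v<R\}/(2\pi\mathbb{Z})$, the quotients being by $u\mapsto u+2\pi$; so $\Gamma_R\subset\widehat{\Gamma_R}$ and maps on them are $2\pi$-periodic maps in $u$. Equation $( ** )$ can be rewritten as $(A+z_{yy})(C+z_{xx})-(B-z_{xy})^2=\mathcal{D}$; it is the general elliptic equation of Monge-Ampère type in dimension two. A solution is required to satisfy $(x,y,z,z_x,z_y)\in\mathcal{U}$ on its domain. A solution on a punctured neighborhood of the origin has an isolated singularity at the origin if it extends continuously to the origin (here with value $0$) but the extension is not of class $C^2$ there. Its limit gradient at the origin is the set of points $\xi\in\mathbb{R}^2$ for which there is a sequence $q_n\to(0,0)$ in the punctured neighborhood with $(z_x,z_y)(q_n)\to\xi$. For a strictly convex (nowhere-zero curvature) regular Jordan curve $\gamma(u)=(\alpha(u),\beta(u))$, negatively oriented means traversed clockwise,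 i.e. $\alpha''\beta'-\alpha'\beta''>0$ for all $u$; here $\gamma$ traverses the Jordan curve once over each period $2\pi$. *)

theory Defs
  imports "HOL-Analysis.Analysis"
begin

section \<open>Real analytic maps and maps of class $C^k$\<close>

text \<open>The multi-indices are the functions from the canonical basis to the naturals. The
  convergence is unconditional, hence absolute when the codomain has finite dimension.\<close>

definition real_analytic_at :: "('a::euclidean_space \<Rightarrow> 'b::real_normed_vector) \<Rightarrow> 'a \<Rightarrow> bool" where
  "real_analytic_at f a \<longleftrightarrow>
     (\<exists>r>0. \<exists>c :: ('a \<Rightarrow> nat) \<Rightarrow> 'b. \<forall>x\<in>ball a r.
        ((\<lambda>m. (\<Prod>b\<in>Basis. ((x - a) \<bullet> b) ^ m b) *\<^sub>R c m) has_sum f x) (Basis \<rightarrow>\<^sub>E UNIV))"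

text \<open>Only used on open sets: there the radius can be shrunk so that no value of \<open>f\<close> outside
  of \<open>S\<close> matters.\<close>

definition real_analytic_on :: "('a::euclidean_space \<Rightarrow> 'b::real_normed_vector) \<Rightarrow> 'a set \<Rightarrow> bool" where
  "real_analytic_on f S \<longleftrightarrow> (\<forall>a\<in>S. real_analytic_at f a)"

text \<open>Also meant for open sets only.\<close>

fun Ck_on :: "nat \<Rightarrow> ('a::real_normed_vector \<Rightarrow> 'b::real_normed_vector) \<Rightarrow> 'a set \<Rightarrow> bool" where
  "Ck_on 0 f S \<longleftrightarrow> continuous_on S f"
| "Ck_on (Suc k) f S \<longleftrightarrow>
     (\<forall>w\<in>S. f differentiable (at w)) \<and> (\<forall>h. Ck_on k (\<lambda>w. frechet_derivative f (at w) h) S)"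

definition D1 :: "(real \<times> real \<Rightarrow> 'b::real_normed_vector) \<Rightarrow> real \<times> real \<Rightarrow> 'b" where
  "D1 f w = frechet_derivative f (at w) (1, 0)"

definition D2 :: "(real \<times> real \<Rightarrow> 'b::real_normed_vector) \<Rightarrow> real \<times> real \<Rightarrow> 'b" where
  "D2 f w = frechet_derivative f (at w) (0, 1)"

definition or_pres_local_diffeo_at :: "(real \<times> real \<Rightarrow> real \<times> real) \<Rightarrow> real \<times> real \<Rightarrow> bool" where
  "or_pres_local_diffeo_at f w\<^sub>0 \<longleftrightarrow>
     (\<exists>V V' g. open V \<and> w\<^sub>0 \<in> V \<and> open V' \<and> homeomorphism V V' f g \<and>
        Ck_on 1 f V \<and> Ck_on 1 g V' \<and>
        (\<forall>w\<in>V. fst (D1 f w) * snd (D2 f w) - fst (D2 f w) * snd (D1 f w) > 0))"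


section \<open>The annuli\<close>

text \<open>The quotients by \<open>u \<mapsto> u + 2\<pi>\<close> are represented by the strips themselves; a map on a
  quotient is a map on the strip satisfying \<open>periodic_on\<close>.\<close>

definition Strip :: "real \<Rightarrow> (real \<times> real) set" where
  "Strip R = {(u, v). 0 < v \<and> v < R}"

definition Strip_hat :: "real \<Rightarrow> (real \<times> real) set" where
  "Strip_hat R = {(u, v). - R < v \<and> v < R}"

definition periodic_on :: "(real \<times> real \<Rightarrow> 'b) \<Rightarrow> (real \<times> real) set \<Rightarrow> bool" where
  "periodic_on f S \<longleftrightarrow> (\<forall>u v. (u, v) \<in> S \<longrightarrow> f (u + 2 * pi, v) = f (u, v))"


section \<open>The Monge-Ampere equation\<close>

type_synonym R5 = "real \<times> real \<times> real \<times> real \<times> real"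

definition grad :: "(real \<times> real \<Rightarrow> real) \<Rightarrow> real \<times> real \<Rightarrow> real \<times> real" where
  "grad z w = (D1 z w, D2 z w)"

definition jet1 :: "(real \<times> real \<Rightarrow> real) \<Rightarrow> real \<times> real \<Rightarrow> R5" where
  "jet1 z w = (fst w, snd w, z w, D1 z w, D2 z w)"

definition MA_solution ::
  "R5 set \<Rightarrow> (R5 \<Rightarrow> real) \<Rightarrow> (R5 \<Rightarrow> real) \<Rightarrow> (R5 \<Rightarrow> real) \<Rightarrow> (R5 \<Rightarrow> real) \<Rightarrow>
   (real \<times> real) set \<Rightarrow> (real \<times> real \<Rightarrow> real) \<Rightarrow> bool" where
  "MA_solution U A B C E \<Omega> z \<longleftrightarrow>
     open \<Omega> \<and> Ck_on 2 z \<Omega> \<and>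
     (\<forall>w\<in>\<Omega>. jet1 z w \<in> U \<and>
        A (jet1 z w) * D1 (D1 z) w + 2 * B (jet1 z w) * D2 (D1 z) w + C (jet1 z w) * D2 (D2 z) w
          + D1 (D1 z) w * D2 (D2 z) w - (D2 (D1 z) w)\<^sup>2 = E (jet1 z w))"

definition graph_over :: "(real \<times> real) set \<Rightarrow> (real \<times> real \<Rightarrow> real) \<Rightarrow> (real \<times> real \<times> real) set" where
  "graph_over \<Omega> z = {(x, y, z (x, y)) | x y. (x, y) \<in> \<Omega>}"

definition punctured_nhd :: "(real \<times> real) set \<Rightarrow> bool" where
  "punctured_nhd W \<longleftrightarrow> (0, 0) \<notin> W \<and> open (insert (0, 0) W)"

text \<open>The singularities considered here are those at which the extension takes the value 0.\<close>

definition isolated_sing :: "(real \<times> real) set \<Rightarrow> (real \<times> real \<Rightarrow> real) \<Rightarrow> bool" where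
  "isolated_sing W z \<longleftrightarrow>
     punctured_nhd W \<and>
     continuous_on (insert (0, 0) W) (z((0, 0) := 0)) \<and>
     \<not> (\<exists>V. open V \<and> (0, 0) \<in> V \<and> V \<subseteq> insert (0, 0) W \<and> Ck_on 2 (z((0, 0) := 0)) V)"

definition limit_gradient :: "(real \<times> real) set \<Rightarrow> (real \<times> real \<Rightarrow> real) \<Rightarrow> (real \<times> real) set" where
  "limit_gradient W z =
     {\<xi>. \<exists>s. (\<forall>n. s n \<in> W) \<and> s \<longlonglongrightarrow> (0, 0) \<and> (\<lambda>n. grad z (s n)) \<longlonglongrightarrow> \<xi>}"


section \<open>Normal vectors and curves\<close>

definition unit_normal :: "real \<times> real \<Rightarrow> real \<times> real \<times> real" where
  "unit_normal = (\<lambda>(p, q). (1 / sqrt (1 + p\<^sup>2 + q\<^sup>2)) *\<^sub>R (- p, - q, 1))"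

definition neg_convex_Jordan :: "(real \<Rightarrow> real \<times> real) \<Rightarrow> bool" where
  "neg_convex_Jordan \<gamma> \<longleftrightarrow>
     (\<forall>u. \<gamma> (u + 2 * pi) = \<gamma> u) \<and> inj_on \<gamma> {0..<2 * pi} \<and>
     (let \<alpha> = (\<lambda>u. fst (\<gamma> u)); \<beta> = (\<lambda>u. snd (\<gamma> u)) in
        \<forall>u. (deriv \<alpha> u, deriv \<beta> u) \<noteq> (0, 0) \<and>
            deriv (deriv \<alpha>) u * deriv \<beta> u - deriv \<alpha> u * deriv (deriv \<beta>) u > 0)"

end

(*
  In conformal coordinates (u, v) of the metric
  (C + z_xx) dx^2 + 2 (z_xy - B) dx dy + (A + z_yy) dy^2, of determinant AC - B^2 + E, the equation
  is a first order quasilinear system for X = (x, y, z, p, q) solved for X_v, and a cone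
  singularity is a solution with X(u, 0) = (0, 0, 0, gamma(u)).  The system is solved over the
  complex numbers by Picard iteration on a periodic strip, in sup norms weighted by
  (distance to the boundary)^(1/2); Cauchy's estimate costs one power of the distance and the
  integration in v gains it back, with a factor that is small for a thin strip.
  If gamma is convex, (x, y)(u, v) = v (n(u) + O(v)) with n orthogonal to gamma' and rotating once
  (Hopf's Umlaufsatz), so that (u, v) behave like polar coordinates around the origin.
*)
theory Submission
  imports Defs "HOL-Complex_Analysis.Complex_Analysis"
begin

section \<open>Complex structures on Euclidean spaces\<close>

text \<open>The equation is elliptic, so a Picard step in \<open>v\<close> loses a
  \<open>u\<close>-derivative that real variables cannot give back; analytic data allow a
  holomorphic extension and with it Cauchy's estimate. Only the equations for \<open>x\<close>,
  \<open>y\<close>, \<open>p\<close>, \<open>q\<close> come from the conformal structure. The fifth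
  prescribes \<open>z_v = p x_v + q y_v\<close>; then \<open>z_u = p x_u + q y_u\<close> follows,
  because its defect is constant in \<open>v\<close> and vanishes on the axis. The obstacle in the
  convex case is that the whole axis \<open>v = 0\<close> goes to one point, where the Jacobian of
  \<open>(x, y)\<close> vanishes. Its \<open>v\<close>-derivative there is
  \<open>\<alpha>'' \<beta>' - \<alpha>' \<beta>''\<close> divided by the determinant
  \<open>A C - B^2 + E\<close>, which is how orientation and strict convexity enter locally.
  Injectivity modulo the period is a global matter and rests on the Umlaufsatz; that the image fills
  a punctured disc follows from connectedness. Analyticity is handled as existence of local
  holomorphic extensions; multi-index series occur only where hypotheses are read and conclusions
  are delivered.\<close>

class complex_space = euclidean_space +
  fixes jop :: "'a \<Rightarrow> 'a"
  assumes jop_add: "jop (x + y) = jop x + jop y"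
    and jop_scaleR: "jop (r *\<^sub>R x) = r *\<^sub>R jop x"
    and jop_jop [simp]: "jop (jop x) = - x"
    and inner_jop: "inner (jop x) (jop y) = inner x y"

instantiation complex :: complex_space
begin
definition "jop_complex (z::complex) = \<i> * z"
instance
  by standard (auto simp: jop_complex_def algebra_simps inner_complex_def)
end
instantiation prod :: (complex_space, complex_space) complex_space
begin
definition "jop_prod z = (jop (fst z), jop (snd z))"
instance
  by standard (auto simp: jop_prod_def jop_add jop_scaleR inner_jop inner_prod_def)
end
lemma jop_Pair [simp]: "jop (a, b) = (jop a, jop b)"
  by (simp add: jop_prod_def)

lemma norm_jop [simp]: "norm (jop x) = norm (x::'a::complex_space)"
  by (simp add: norm_eq_sqrt_inner inner_jop)

lemma linear_jop: "linear jop"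
  by (rule linearI) (simp_all add: jop_add jop_scaleR)

lemma bounded_linear_jop: "bounded_linear (jop::'a::complex_space \<Rightarrow> 'a)"
  by (simp add: linear_jop linear_conv_bounded_linear[symmetric])

lemmas jop_0 [simp] = linear_0[OF linear_jop]
lemmas jop_minus = linear_neg[OF linear_jop]

lemma inner_jop_self [simp]: "inner x (jop x) = 0" for x :: "'a::complex_space"
  using inner_jop[of x "jop x"] by (simp add: inner_commute)

text \<open>\<open>jop\<close> acts as multiplication by \<open>i\<close>; being orthogonal, it
  makes the norm homogeneous for the complex scalars defined here
  (\<open>norm_cscale\<close>).\<close>

definition cscale :: "complex \<Rightarrow> 'a::complex_space \<Rightarrow> 'a" (infixr "*\<^sub>C" 75)
  where "c *\<^sub>C x = Re c *\<^sub>R x + Im c *\<^sub>R jop x"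

lemma cscale_complex [simp]: "c *\<^sub>C (z::complex) = c * z"
  by (simp add: cscale_def jop_complex_def complex_eq_iff)

lemma cscale_Pair [simp]: "c *\<^sub>C (a, b) = (c *\<^sub>C a, c *\<^sub>C b)"
  by (simp add: cscale_def)

lemma norm_cscale [simp]: "norm (c *\<^sub>C x) = cmod c * norm x"
proof -
  have "(norm (c *\<^sub>C x))\<^sup>2 = (cmod c * norm x)\<^sup>2"
    by (simp only: power_mult_distrib cmod_power2 cscale_def power2_norm_eq_inner)
       (simp add: inner_add inner_jop inner_commute[of "jop x" x] power2_eq_square algebra_simps)
  then show ?thesis by (simp add: power2_eq_iff_nonneg)
qed

lemma cscale_of_real [simp]: "complex_of_real r *\<^sub>C x = r *\<^sub>R x"
  by (simp add: cscale_def)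

lemma cscale_1 [simp]: "1 *\<^sub>C x = x" and cscale_0 [simp]: "0 *\<^sub>C x = 0"
  and cscale_0_right [simp]: "c *\<^sub>C 0 = 0"
  by (simp_all add: cscale_def)

lemma jop_cscale: "jop (c *\<^sub>C x) = (\<i> * c) *\<^sub>C x" "jop (c *\<^sub>C x) = c *\<^sub>C jop x"
  by (simp_all add: cscale_def jop_add jop_scaleR algebra_simps)

lemma bounded_bilinear_cscale: "bounded_bilinear (cscale :: complex \<Rightarrow> 'a::complex_space \<Rightarrow> 'a)"
proof
  show "\<exists>K. \<forall>c (x::'a). norm (c *\<^sub>C x) \<le> cmod c * norm x * K"
    by (auto intro!: exI[of _ 1])
qed (auto simp: cscale_def jop_add jop_scaleR algebra_simps)

text \<open>Reduces vector valued Cauchy estimates to scalar ones.\<close>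

definition cfun :: "'a::complex_space \<Rightarrow> 'a \<Rightarrow> complex"
  where "cfun e x = Complex (x \<bullet> e) (x \<bullet> jop e)"

lemma bounded_linear_cfun: "bounded_linear (cfun e)"
  unfolding linear_conv_bounded_linear[symmetric]
  by (rule linearI) (auto simp: cfun_def complex_eq_iff inner_add_left)

lemma cfun_jop: "cfun e (jop x) = \<i> * cfun e x"
  using inner_jop[of x e] inner_jop[of "jop x" e] by (simp add: cfun_def complex_eq_iff)

lemma cfun_cscale: "cfun e (c *\<^sub>C x) = c * cfun e x"
proof -
  interpret bounded_linear "cfun e" by (rule bounded_linear_cfun)
  show ?thesis
    by (simp add: cscale_def add scaleR cfun_jop complex_eq_iff)
qed

text \<open>Rotating \<open>x\<close> by the unit scalar \<open>c\<close> makes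
  \<open>cfun e x\<close> real and nonnegative without changing the norm of \<open>x\<close>, and
  real Cauchy-Schwarz applies to the real part.\<close>

lemma norm_cfun_le: "cmod (cfun e x) \<le> norm x * norm e"
proof (cases "cfun e x = 0")
  case False
  define c where "c = cnj (cfun e x) / cmod (cfun e x)"
  have c: "cmod c = 1" using False by (simp add: c_def norm_divide)
  have "c * cfun e x = cmod (cfun e x)"
    using False by (simp add: c_def mult.commute[of _ "cfun e x"] complex_norm_square[symmetric] power2_eq_square)
  then have "cfun e (c *\<^sub>C x) = cmod (cfun e x)" by (simp add: cfun_cscale)
  then have "(c *\<^sub>C x) \<bullet> e = cmod (cfun e x)" by (simp add: cfun_def complex_eq_iff)
  then show ?thesis using norm_cauchy_schwarz[of "c *\<^sub>C x" e] c by simp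
qed auto

section \<open>Complex differentiable maps\<close>

text \<open>Holomorphy in any number of variables is real Frechet differentiability with a complex
  linear derivative; the calculus of \<open>has_derivative\<close> stays usable and only commutation
  with \<open>jop\<close> has to be checked.\<close>

definition cdiff :: "('a::complex_space \<Rightarrow> 'b::complex_space) \<Rightarrow> 'a \<Rightarrow> bool" where
  "cdiff f x \<longleftrightarrow> (\<exists>D. (f has_derivative D) (at x) \<and> (\<forall>h. D (jop h) = jop (D h)))"

definition chol_on :: "('a::complex_space \<Rightarrow> 'b::complex_space) \<Rightarrow> 'a set \<Rightarrow> bool" where
  "chol_on f S \<longleftrightarrow> (\<forall>x\<in>S. cdiff f x)"

abbreviation dd :: "('a::real_normed_vector \<Rightarrow> 'b::real_normed_vector) \<Rightarrow> 'a \<Rightarrow> 'a \<Rightarrow> 'b" where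
  "dd f x \<equiv> frechet_derivative f (at x)"

lemma dd_eq: "(f has_derivative D) (at x) \<Longrightarrow> dd f x = D"
  using frechet_derivative_at by metis

lemma cdiffI: "(f has_derivative D) (at x) \<Longrightarrow> (\<And>h. D (jop h) = jop (D h)) \<Longrightarrow> cdiff f x"
  by (auto simp: cdiff_def)

lemma cdiff_has_derivative: "cdiff f x \<Longrightarrow> (f has_derivative dd f x) (at x)"
  unfolding cdiff_def using dd_eq by metis

lemma dd_jop: "cdiff f x \<Longrightarrow> dd f x (jop h) = jop (dd f x h)"
  unfolding cdiff_def using dd_eq by metis

lemma dd_linear: "cdiff f x \<Longrightarrow> linear (dd f x)"
  using cdiff_has_derivative has_derivative_linear by blast

lemma dd_cscale: "cdiff f x \<Longrightarrow> dd f x (c *\<^sub>C h) = c *\<^sub>C dd f x h"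
  using dd_linear[of f x] by (simp add: cscale_def linear_add linear_cmul dd_jop)

lemma cdiff_isCont: "cdiff f x \<Longrightarrow> isCont f x"
  using cdiff_has_derivative has_derivative_continuous by blast

lemma chol_on_continuous: "chol_on f S \<Longrightarrow> continuous_on S f"
  by (meson cdiff_isCont chol_on_def continuous_at_imp_continuous_on)

lemma chol_on_subset: "chol_on f S \<Longrightarrow> T \<subseteq> S \<Longrightarrow> chol_on f T"
  by (auto simp: chol_on_def)

lemma cdiff_cong: "cdiff f x \<Longrightarrow> open S \<Longrightarrow> x \<in> S \<Longrightarrow> (\<And>y. y \<in> S \<Longrightarrow> f y = g y) \<Longrightarrow> cdiff g x"
  unfolding cdiff_def using has_derivative_transform_within_open by blast

lemma cdiff_linear: "linear f \<Longrightarrow> (\<And>h. f (jop h) = jop (f h)) \<Longrightarrow> cdiff f x"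
  using bounded_linear_imp_has_derivative cdiffI linear_conv_bounded_linear by blast

lemma cdiff_const [simp]: "cdiff (\<lambda>x. c) x"
  by (rule cdiffI[where D="\<lambda>_. 0"]) auto

lemma cdiff_id [simp]: "cdiff (\<lambda>x. x) x"
  by (rule cdiffI[where D="\<lambda>x. x"]) auto

lemma cdiff_add: "cdiff f x \<Longrightarrow> cdiff g x \<Longrightarrow> cdiff (\<lambda>x. f x + g x) x"
  by (rule cdiffI[where D="\<lambda>h. dd f x h + dd g x h"])
     (auto intro!: derivative_eq_intros cdiff_has_derivative simp: dd_jop jop_add)

lemma cdiff_minus: "cdiff f x \<Longrightarrow> cdiff (\<lambda>x. - f x) x"
  by (rule cdiffI[where D="\<lambda>h. - dd f x h"])
     (auto intro!: derivative_eq_intros cdiff_has_derivative simp: dd_jop jop_minus)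

lemma cdiff_diff: "cdiff f x \<Longrightarrow> cdiff g x \<Longrightarrow> cdiff (\<lambda>x. f x - g x) x"
  using cdiff_add[of f x "\<lambda>x. - g x"] cdiff_minus[of g x] by simp

lemma cdiff_scaleR: "cdiff f x \<Longrightarrow> cdiff (\<lambda>x. r *\<^sub>R f x) x"
  by (rule cdiffI[where D="\<lambda>h. r *\<^sub>R dd f x h"])
     (auto intro!: derivative_eq_intros cdiff_has_derivative simp: dd_jop jop_scaleR)

lemma cdiff_cscale:
  assumes "cdiff f x" "cdiff g x" shows "cdiff (\<lambda>x. f x *\<^sub>C g x) x"
proof (rule cdiffI[OF bounded_bilinear.FDERIV[OF bounded_bilinear_cscale
        cdiff_has_derivative[OF assms(1)] cdiff_has_derivative[OF assms(2)]]])
  fix h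
  show "f x *\<^sub>C dd g x (jop h) + dd f x (jop h) *\<^sub>C g x
      = jop (f x *\<^sub>C dd g x h + dd f x h *\<^sub>C g x)"
    unfolding dd_jop[OF assms(1)] dd_jop[OF assms(2)] jop_add jop_cscale(1)[of "dd f x h"]
      jop_cscale(2)[of "f x"] jop_complex_def ..
qed

lemma cdiff_mult: "cdiff f x \<Longrightarrow> cdiff g x \<Longrightarrow> cdiff (\<lambda>x. f x * g x :: complex) x"
  using cdiff_cscale[of f x g] by simp

lemma cdiff_power: "cdiff f x \<Longrightarrow> cdiff (\<lambda>x. f x ^ n :: complex) x"
  by (induction n) (auto intro: cdiff_mult)

lemma cdiff_sum: "(\<And>i. i \<in> I \<Longrightarrow> cdiff (f i) x) \<Longrightarrow> cdiff (\<lambda>x. \<Sum>i\<in>I. f i x) x"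
  by (induction I rule: infinite_finite_induct) (auto intro: cdiff_add)

lemma cdiff_prod: "(\<And>i. i \<in> I \<Longrightarrow> cdiff (f i) x) \<Longrightarrow> cdiff (\<lambda>x. \<Prod>i\<in>I. f i x :: complex) x"
  by (induction I rule: infinite_finite_induct) (auto intro: cdiff_mult)

lemma cdiff_Pair: "cdiff f x \<Longrightarrow> cdiff g x \<Longrightarrow> cdiff (\<lambda>x. (f x, g x)) x"
  by (rule cdiffI[OF has_derivative_Pair[OF cdiff_has_derivative cdiff_has_derivative]])
     (auto simp: dd_jop)

lemma cdiff_compose: "cdiff f (g x) \<Longrightarrow> cdiff g x \<Longrightarrow> cdiff (\<lambda>x. f (g x)) x"
  by (rule cdiffI[OF has_derivative_compose[OF cdiff_has_derivative cdiff_has_derivative]])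
     (auto simp: dd_jop)

lemma dd_compose: "cdiff f (g x) \<Longrightarrow> cdiff g x \<Longrightarrow> dd (\<lambda>x. f (g x)) x = (\<lambda>h. dd f (g x) (dd g x h))"
  by (rule dd_eq) (rule has_derivative_compose[OF cdiff_has_derivative cdiff_has_derivative])

lemma cdiff_fst: "cdiff f x \<Longrightarrow> cdiff (\<lambda>x. fst (f x)) x"
  by (rule cdiffI[OF has_derivative_fst[OF cdiff_has_derivative]])
     (auto simp: dd_jop jop_prod_def)

lemma cdiff_snd: "cdiff f x \<Longrightarrow> cdiff (\<lambda>x. snd (f x)) x"
  by (rule cdiffI[OF has_derivative_snd[OF cdiff_has_derivative]])
     (auto simp: dd_jop jop_prod_def)

lemma cdiff_field: "(f has_field_derivative f') (at z) \<Longrightarrow> cdiff f z" for f :: "complex \<Rightarrow> complex"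
  by (rule cdiffI[where D="\<lambda>h. f' * h"]) (auto simp: has_field_derivative_def jop_complex_def)

lemma cdiff_imp_field:
  fixes f :: "complex \<Rightarrow> complex"
  assumes "cdiff f z"
  shows "(f has_field_derivative dd f z 1) (at z)"
proof -
  have "dd f z h = dd f z 1 * h" for h
    using dd_cscale[OF assms, of h 1] by simp
  then show ?thesis
    using cdiff_has_derivative[OF assms] by (metis ext has_field_derivative_def)
qed

lemma chol_on_imp_holomorphic: "chol_on f S \<Longrightarrow> f holomorphic_on S" for f :: "complex \<Rightarrow> complex"
  by (meson cdiff_imp_field chol_on_def field_differentiable_at_within field_differentiable_def holomorphic_onI)

lemma cdiff_inverse: "cdiff f x \<Longrightarrow> f x \<noteq> 0 \<Longrightarrow> cdiff (\<lambda>x. inverse (f x) :: complex) x"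
  by (rule cdiff_compose[where f=inverse], rule cdiff_field[OF DERIV_inverse]) auto

lemma cdiff_divide: "cdiff f x \<Longrightarrow> cdiff g x \<Longrightarrow> g x \<noteq> 0 \<Longrightarrow> cdiff (\<lambda>x. f x / g x :: complex) x"
  unfolding divide_inverse by (intro cdiff_mult cdiff_inverse)

lemma cdiff_csqrt: "cdiff f x \<Longrightarrow> f x \<notin> \<real>\<^sub>\<le>\<^sub>0 \<Longrightarrow> cdiff (\<lambda>x. csqrt (f x)) x"
  by (rule cdiff_compose[where f=csqrt], rule cdiff_field[OF has_field_derivative_csqrt]) auto

section \<open>Restriction to complex lines and Cauchy estimates\<close>

lemma cdiff_line: "cdiff (\<lambda>l. x + l *\<^sub>C h) l"
  by (intro cdiff_add cdiff_const cdiff_cscale cdiff_id)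

lemma dd_line: "dd (\<lambda>l. x + l *\<^sub>C h) l = (\<lambda>k. k *\<^sub>C h)"
  by (rule dd_eq)
     (auto intro!: derivative_eq_intros bounded_bilinear.FDERIV[OF bounded_bilinear_cscale, THEN has_derivative_eq_rhs])

lemma cdiff_cfun_line:
  assumes "cdiff f (x + l *\<^sub>C h)"
  shows "((\<lambda>l. cfun e (f (x + l *\<^sub>C h))) has_field_derivative cfun e (dd f (x + l *\<^sub>C h) h)) (at l)"
proof -
  have 1: "cdiff (\<lambda>l. f (x + l *\<^sub>C h)) l"
    by (rule cdiff_compose[OF assms cdiff_line])
  have 2: "cdiff (\<lambda>l. cfun e (f (x + l *\<^sub>C h))) l"
    by (rule cdiff_compose[OF _ 1])
       (auto intro!: cdiff_linear simp: cfun_jop jop_complex_def bounded_linear.linear[OF bounded_linear_cfun])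
  have "dd (\<lambda>l. f (x + l *\<^sub>C h)) l 1 = dd f (x + l *\<^sub>C h) h"
    using dd_compose[OF assms cdiff_line] by (simp add: dd_line)
  moreover have "dd (\<lambda>l. cfun e (f (x + l *\<^sub>C h))) l 1 = cfun e (dd (\<lambda>l. f (x + l *\<^sub>C h)) l 1)"
    using dd_eq[OF bounded_linear.has_derivative[OF bounded_linear_cfun cdiff_has_derivative[OF 1]]] by metis
  ultimately show ?thesis using cdiff_imp_field[OF 2] by simp
qed

text \<open>The norm is attained by the functional \<open>cfun\<close> of the normalised vector, so
  a bound for one scalar function bounds a vector valued one.\<close>

lemma norm_le_cfun:
  assumes "cmod (cfun (y /\<^sub>R norm y) y) \<le> B" "0 \<le> B" shows "norm y \<le> B"
proof (cases "y = 0")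
  case False
  have "norm y = Re (cfun (y /\<^sub>R norm y) y)"
    using False by (simp add: cfun_def dot_square_norm power2_eq_square)
  also have "\<dots> \<le> B" using assms complex_Re_le_cmod order_trans by blast
  finally show ?thesis .
qed (use assms in simp)

text \<open>Composed with the functional that attains the norm of the derivative, \<open>f\<close>
  on the line \<open>x + l h\<close> becomes a function of one variable, to which Cauchy's
  inequality applies. Lines rather than balls permit discs in the \<open>u\<close>-direction alone,
  as the weighted estimates require.\<close>

lemma cauchy_line:
  assumes "chol_on f S" and r: "0 < r"
    and S: "\<And>l. cmod l \<le> r \<Longrightarrow> x + l *\<^sub>C h \<in> S"
    and B: "\<And>l. cmod l \<le> r \<Longrightarrow> norm (f (x + l *\<^sub>C h)) \<le> B"
  shows "norm (dd f x h) \<le> B / r"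
proof (rule norm_le_cfun)
  define e where "e = dd f x h /\<^sub>R norm (dd f x h)"
  have e: "norm e \<le> 1" by (simp add: e_def field_simps)
  have B0: "0 \<le> B" using B[of 0] r norm_ge_zero order_trans by (metis norm_zero less_imp_le)
  show "0 \<le> B / r" using B0 r by simp
  define g where "g = (\<lambda>l. cfun e (f (x + l *\<^sub>C h)))"
  have g: "(g has_field_derivative cfun e (dd f (x + l *\<^sub>C h) h)) (at l)" if "cmod l \<le> r" for l
    unfolding g_def by (rule cdiff_cfun_line) (use S[OF that] assms(1) in \<open>auto simp: chol_on_def\<close>)
  have "norm ((deriv ^^ 1) g 0) \<le> fact 1 * B / r ^ 1"
  proof (rule Cauchy_inequality[OF _ _ r])
    show "g holomorphic_on ball 0 r"
      using g unfolding holomorphic_on_open[OF open_ball] by (metis less_imp_le mem_ball_0)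
    show "continuous_on (cball 0 r) g"
      by (intro continuous_at_imp_continuous_on ballI DERIV_isCont[OF g]) auto
    fix l :: complex assume "norm (0 - l) = r"
    then have "norm (f (x + l *\<^sub>C h)) \<le> B" by (intro B) auto
    then show "norm (g l) \<le> B"
      unfolding g_def using norm_cfun_le[of e "f (x + l *\<^sub>C h)"] e
      by (meson mult_left_le norm_ge_zero order_trans)
  qed
  then show "cmod (cfun (dd f x h /\<^sub>R norm (dd f x h)) (dd f x h)) \<le> B / r"
    using DERIV_imp_deriv[OF g[of 0]] r by (simp add: e_def)
qed

lemma cauchy_ball:
  assumes "chol_on f S" "cball x r \<subseteq> S" "0 < r" and B: "\<And>y. y \<in> cball x r \<Longrightarrow> norm (f y) \<le> B"
  shows "norm (dd f x h) \<le> B / r * norm h"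
proof (cases "h = 0")
  case True
  then have "dd f x h = 0"
    using assms dd_linear[of f x] linear_0 centre_in_cball[of x r] unfolding chol_on_def
    by (metis less_imp_le subsetD)
  then show ?thesis using True by simp
next
  case False
  have "x + l *\<^sub>C h \<in> cball x r" if "cmod l \<le> r / norm h" for l
    using that False by (simp add: dist_norm field_simps)
  then have "norm (dd f x h) \<le> B / (r / norm h)"
    using assms False by (intro cauchy_line[OF assms(1)]) auto
  then show ?thesis by simp
qed

text \<open>Cauchy's inequality on discs of radius \<open>r\<close> inside the disc of radius
  \<open>2 r\<close> bounds the second derivative, and Taylor's formula of first order gives the
  remainder. The bound depends on \<open>f\<close> only through \<open>B\<close>, so difference
  quotients converge uniformly in \<open>x\<close>.\<close>

lemma cauchy_line_taylor:
  assumes "chol_on f S" and r: "0 < r"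
    and S: "\<And>l. cmod l \<le> 2 * r \<Longrightarrow> x + l *\<^sub>C h \<in> S"
    and B: "\<And>l. cmod l \<le> 2 * r \<Longrightarrow> norm (f (x + l *\<^sub>C h)) \<le> B"
    and l: "cmod l \<le> r"
  shows "norm (f (x + l *\<^sub>C h) - f x - l *\<^sub>C dd f x h) \<le> 2 * B / r\<^sup>2 * (cmod l)\<^sup>2"
proof (rule norm_le_cfun)
  define y where "y = f (x + l *\<^sub>C h) - f x - l *\<^sub>C dd f x h"
  define e where "e = y /\<^sub>R norm y"
  have e: "norm e \<le> 1" by (simp add: e_def field_simps)
  have B0: "0 \<le> B" using B[of 0] r norm_ge_zero order_trans by (metis norm_zero less_imp_le zero_le_mult_iff zero_le_numeral)
  show "0 \<le> 2 * B / r\<^sup>2 * (cmod l)\<^sup>2" using B0 r by simp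
  define g where "g = (\<lambda>l. cfun e (f (x + l *\<^sub>C h)))"
  have g: "(g has_field_derivative cfun e (dd f (x + l *\<^sub>C h) h)) (at l)" if "cmod l \<le> 2*r" for l
    unfolding g_def by (rule cdiff_cfun_line) (use S[OF that] assms(1) in \<open>auto simp: chol_on_def\<close>)
  have hol: "g holomorphic_on ball 0 (2*r)"
    using g unfolding holomorphic_on_open[OF open_ball] by (metis less_imp_le mem_ball_0)
  have gB: "norm (g l) \<le> B" if "cmod l \<le> 2*r" for l
    unfolding g_def using norm_cfun_le[of e "f (x + l *\<^sub>C h)"] e B[OF that]
    by (meson mult_left_le norm_ge_zero order_trans)
  have cont: "continuous_on (cball 0 (2*r)) g"
    by (intro continuous_at_imp_continuous_on ballI DERIV_isCont[OF g]) auto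
  have d2: "norm ((deriv ^^ 2) g w) \<le> 2 * B / r\<^sup>2" if "w \<in> cball 0 r" for w
  proof -
    have sub: "cball w r \<subseteq> cball 0 (2*r)" using that norm_triangle_sub
      by (auto simp: dist_norm) (smt (verit) norm_minus_commute norm_triangle_sub)
    have sub2: "ball w r \<subseteq> ball 0 (2*r)" using that
      by (auto simp: dist_norm) (smt (verit) norm_minus_commute norm_triangle_sub)
    have "norm ((deriv ^^ 2) g w) \<le> fact 2 * B / r^2"
    proof (rule Cauchy_inequality[OF _ _ r])
      show "g holomorphic_on ball w r" using hol sub2 holomorphic_on_subset by blast
      show "continuous_on (cball w r) g" using cont sub continuous_on_subset by blast
      fix l assume "norm (w - l) = r"
      then have "l \<in> cball w r" by (simp add: dist_norm)
      then have "l \<in> cball 0 (2*r)" using sub by blast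
      then show "norm (g l) \<le> B" by (intro gB) auto
    qed
    then show ?thesis by (simp add: fact_2)
  qed
  have "cmod ((deriv ^^ 0) g l - (\<Sum>i\<le>1. (deriv ^^ i) g 0 * (l - 0) ^ i / fact i))
      \<le> (2 * B / r\<^sup>2) * cmod (l - 0) ^ Suc 1 / fact 1"
  proof (rule complex_Taylor[of "cball 0 r"])
    fix i w assume "w \<in> cball (0::complex) r" "i \<le> (1::nat)"
    moreover have "(deriv ^^ i) g holomorphic_on ball 0 (2*r)"
      by (rule holomorphic_higher_deriv[OF hol]) auto
    ultimately show "((deriv ^^ i) g has_field_derivative (deriv ^^ Suc i) g w) (at w within cball 0 r)"
      using r holomorphic_derivI[of "(deriv ^^ i) g" "ball 0 (2*r)" w] by auto
  next
    fix w :: complex assume "w \<in> cball 0 r"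
    then show "cmod ((deriv ^^ Suc 1) g w) \<le> 2 * B / r\<^sup>2" using d2[of w] by (simp add: numeral_2_eq_2)
  qed (use l r in auto)
  moreover have "deriv g 0 = cfun e (dd f x h)"
    using DERIV_imp_deriv[OF g[of 0]] r by simp
  moreover have "cfun e y = g l - g 0 - l * cfun e (dd f x h)"
    unfolding y_def g_def using bounded_linear_cfun[of e, THEN bounded_linear.linear]
    by (simp add: linear_diff cfun_cscale)
  ultimately have "cmod (cfun e y) \<le> 2 * B / r\<^sup>2 * (cmod l)\<^sup>2"
    by (simp add: diff_diff_eq power2_eq_square ac_simps)
  then show "cmod (cfun ((f (x + l *\<^sub>C h) - f x - l *\<^sub>C dd f x h) /\<^sub>R
      norm (f (x + l *\<^sub>C h) - f x - l *\<^sub>C dd f x h)) (f (x + l *\<^sub>C h) - f x - l *\<^sub>C dd f x h))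
      \<le> 2 * B / r\<^sup>2 * (cmod l)\<^sup>2"
    by (simp add: e_def y_def)
qed

section \<open>Uniform limits of holomorphic maps, and derivatives as such limits\<close>

lemma dd_diff: "cdiff f x \<Longrightarrow> cdiff g x \<Longrightarrow> dd (\<lambda>x. f x - g x) x h = dd f x h - dd g x h"
  by (simp add: dd_eq[OF has_derivative_diff[OF cdiff_has_derivative cdiff_has_derivative]])

lemma dd_add: "cdiff f x \<Longrightarrow> cdiff g x \<Longrightarrow> dd (\<lambda>x. f x + g x) x h = dd f x h + dd g x h"
  by (simp add: dd_eq[OF has_derivative_add[OF cdiff_has_derivative cdiff_has_derivative]])

lemma chol_on_diff: "chol_on f S \<Longrightarrow> chol_on g S \<Longrightarrow> chol_on (\<lambda>x. f x - g x) S"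
  by (simp add: chol_on_def cdiff_diff)

text \<open>Weierstrass: on a ball of half the available radius, Cauchy's estimate turns the uniform
  Cauchy property of the maps into the same property of their derivatives, so the limit is
  differentiable. Complex linearity passes to the limit.\<close>

lemma cdiff_uniform_limit:
  fixes F :: "nat \<Rightarrow> 'a::complex_space \<Rightarrow> 'b::complex_space"
  assumes S: "open S" and F: "\<And>n. chol_on (F n) S" and lim: "uniform_limit S F f sequentially"
    and x: "x \<in> S"
  shows "cdiff f x" "(\<lambda>n. dd (F n) x h) \<longlonglongrightarrow> dd f x h"
proof -
  obtain R where R: "0 < R" "cball x R \<subseteq> S"
    using S x open_contains_cball by blast
  define r where "r = R / 2"
  have r: "0 < r" using R by (simp add: r_def)
  have sub: "cball y r \<subseteq> S" if "y \<in> ball x r" for y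
  proof
    fix z assume "z \<in> cball y r"
    then have "dist x z \<le> R" using that dist_triangle[of x z y] by (simp add: r_def)
    then show "z \<in> S" using R(2) by auto
  qed
  have yS: "y \<in> S" if "y \<in> ball x r" for y
    using sub[OF that] r by auto
  have close: "\<exists>N. \<forall>m\<ge>N. \<forall>n\<ge>N. \<forall>y\<in>ball x r. \<forall>h. norm (dd (F m) y h - dd (F n) y h) \<le> e * norm h"
    if "0 < e" for e
  proof -
    have "uniformly_Cauchy_on S F"
      using lim uniformly_convergent_Cauchy uniformly_convergent_on_def by blast
    moreover have "0 < e * r" using that r by simp
    ultimately obtain N where N: "\<And>m n y. m \<ge> N \<Longrightarrow> n \<ge> N \<Longrightarrow> y \<in> S \<Longrightarrow> dist (F m y) (F n y) < e * r"
      unfolding uniformly_Cauchy_on_def by blast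
    have "norm (dd (F m) y h - dd (F n) y h) \<le> e * norm h" if "m \<ge> N" "n \<ge> N" "y \<in> ball x r" for m n y h
    proof -
      have "norm (dd (\<lambda>y. F m y - F n y) y h) \<le> (e * r) / r * norm h"
        by (rule cauchy_ball[OF chol_on_diff[OF F F] sub[OF that(3)] r])
           (metis N[OF that(1,2)] sub[OF that(3)] subsetD dist_norm less_imp_le)
      moreover have "dd (\<lambda>y. F m y - F n y) y h = dd (F m) y h - dd (F n) y h"
        using F yS[OF that(3)] by (intro dd_diff) (auto simp: chol_on_def)
      ultimately show ?thesis using r by simp
    qed
    then show ?thesis by blast
  qed
  define g' where "g' y h = lim (\<lambda>n. dd (F n) y h)" for y h
  have g': "(\<lambda>n. dd (F n) y h) \<longlonglongrightarrow> g' y h" if y: "y \<in> ball x r" for y h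
  proof -
    have "Cauchy (\<lambda>n. dd (F n) y h)"
    proof (rule CauchyI)
      fix e :: real assume e: "0 < e"
      then obtain N where N: "\<forall>m\<ge>N. \<forall>n\<ge>N. \<forall>y\<in>ball x r. \<forall>k. norm (dd (F m) y k - dd (F n) y k) \<le> e / (norm h + 1) * norm k"
        using close[of "e / (norm h + 1)"] by (metis add_nonneg_pos divide_pos_pos norm_ge_zero zero_less_one)
      have "e / (norm h + 1) * norm h < e"
        using e pos_divide_less_eq[of "norm h + 1" "e * norm h" e]
        by (simp add: add_nonneg_pos distrib_left)
      then show "\<exists>M. \<forall>m\<ge>M. \<forall>n\<ge>M. norm (dd (F m) y h - dd (F n) y h) < e"
        using N y by (meson order_le_less_trans)
    qed
    then show ?thesis unfolding g'_def
      by (simp add: Cauchy_convergent_iff convergent_LIMSEQ_iff)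
  qed
  have "\<exists>g. \<forall>y\<in>ball x r. (\<lambda>n. F n y) \<longlonglongrightarrow> g y \<and> (g has_derivative g' y) (at y within ball x r)"
  proof (rule has_derivative_sequence[of "ball x r" F "\<lambda>n. dd (F n)" g' x "f x"])
    show "(F n has_derivative dd (F n) y) (at y within ball x r)" if "y \<in> ball x r" for n y
      using F[of n] yS[OF that] cdiff_has_derivative has_derivative_at_withinI by (metis chol_on_def)
    show "\<forall>\<^sub>F n in sequentially. \<forall>y\<in>ball x r. \<forall>h. norm (dd (F n) y h - g' y h) \<le> e * norm h" if e: "0 < e" for e
    proof -
      obtain N where N: "\<And>m n y h. m\<ge>N \<Longrightarrow> n\<ge>N \<Longrightarrow> y\<in>ball x r \<Longrightarrow> norm (dd (F m) y h - dd (F n) y h) \<le> e * norm h"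
        using close[OF e] by blast
      have "norm (dd (F n) y h - g' y h) \<le> e * norm h" if "n \<ge> N" "y \<in> ball x r" for n y h
      proof (rule tendsto_upperbound)
        show "(\<lambda>m. norm (dd (F n) y h - dd (F m) y h)) \<longlonglongrightarrow> norm (dd (F n) y h - g' y h)"
          by (intro tendsto_intros g' that)
        show "\<forall>\<^sub>F m in sequentially. norm (dd (F n) y h - dd (F m) y h) \<le> e * norm h"
          by (rule eventually_sequentiallyI[of N]) (rule N[OF that(1) _ that(2)])
      qed simp
      then show ?thesis unfolding eventually_sequentially by blast
    qed
    show "(\<lambda>n. F n x) \<longlonglongrightarrow> f x" by (rule tendsto_uniform_limitI[OF lim x])
  qed (use r in auto)
  then obtain g where g: "\<forall>y\<in>ball x r. (\<lambda>n. F n y) \<longlonglongrightarrow> g y \<and> (g has_derivative g' y) (at y within ball x r)" ..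
  have gf: "g y = f y" if "y \<in> ball x r" for y
    by (rule LIMSEQ_unique[OF _ tendsto_uniform_limitI[OF lim yS[OF that]]]) (use g that in simp)
  have "(g has_derivative g' x) (at x)"
    using g[rule_format, of x] r at_within_open[of x "ball x r"] by simp
  then have f': "(f has_derivative g' x) (at x)"
    by (rule has_derivative_transform_within_open[of _ _ _ _ "ball x r"]) (use r gf in auto)
  have "g' x (jop h) = jop (g' x h)" for h
  proof (rule LIMSEQ_unique)
    show "(\<lambda>n. dd (F n) x (jop h)) \<longlonglongrightarrow> g' x (jop h)" using g' r by simp
    have "dd (F n) x (jop h) = jop (dd (F n) x h)" for n
      using F x by (intro dd_jop) (auto simp: chol_on_def)
    then show "(\<lambda>n. dd (F n) x (jop h)) \<longlonglongrightarrow> jop (g' x h)"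
      using bounded_linear.tendsto[OF bounded_linear_jop g'[of x h]] r by simp
  qed
  then show "cdiff f x" using f' cdiffI by blast
  show "(\<lambda>n. dd (F n) x h) \<longlonglongrightarrow> dd f x h"
    using g'[of x h] r dd_eq[OF f'] by simp
qed

text \<open>Presents a directional derivative locally as a uniform limit of holomorphic difference
  quotients. The index starts late enough for the shifted points to stay in \<open>S\<close>, and
  every later start \<open>N\<close> is allowed so that two functions can share one sequence of
  steps.\<close>

lemma cdiff_dquot:
  assumes S: "open S" and f: "chol_on f S" and x: "x \<in> S"
  shows "\<exists>r N0. 0 < r \<and> ball x r \<subseteq> S \<and>
    (\<forall>N\<ge>N0. (\<forall>n. \<forall>y\<in>ball x r. y + (1 / real (n + Suc N)) *\<^sub>R h \<in> S) \<and>
      uniform_limit (ball x r)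
        (\<lambda>n y. real (n + Suc N) *\<^sub>R (f (y + (1 / real (n + Suc N)) *\<^sub>R h) - f y)) (\<lambda>y. dd f y h) sequentially)"
proof -
  obtain R where R: "0 < R" "cball x R \<subseteq> S"
    using S x open_contains_cball by blast
  have "compact (f ` cball x R)"
    using chol_on_continuous[OF chol_on_subset[OF f R(2)]] compact_continuous_image compact_cball by blast
  then obtain B where B: "\<And>y. y \<in> cball x R \<Longrightarrow> norm (f y) \<le> B"
    by (meson bounded_iff compact_imp_bounded imageI)
  \<comment> \<open>Steps up to \<open>2 r\<close> in the direction \<open>h\<close> then move a
    point by at most \<open>R / 2\<close>; the summand \<open>1\<close> takes care of
    \<open>h = 0\<close>.\<close>
  define r where "r = R / (4 * (norm h + 1))"
  have nh: "0 < norm h + 1" by (simp add: add_nonneg_pos)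
  have r: "0 < r" unfolding r_def using R nh by auto
  have rh: "2 * r * norm h \<le> R / 2"
    unfolding r_def using R nh by (simp add: field_simps)
  have in_cball: "y + l *\<^sub>C h \<in> cball x R" if "y \<in> ball x (R/2)" "cmod l \<le> 2 * r" for y l
  proof -
    have "cmod l * norm h \<le> 2 * r * norm h" using that by (intro mult_right_mono) auto
    then have "dist y (y + l *\<^sub>C h) \<le> R / 2" using rh by (simp add: dist_norm)
    then show ?thesis using that dist_triangle[of x "y + l *\<^sub>C h" y] by auto
  qed
  obtain N0 where N0: "1 / real (Suc N0) < r"
    using r nat_approx_posE by blast
  have small: "1 / real (n + Suc N) \<le> r" if "N \<ge> N0" for n N
  proof -
    have "1 / real (n + Suc N) \<le> 1 / real (Suc N0)" using that by (intro divide_left_mono) auto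
    then show ?thesis using N0 by linarith
  qed
  have real_cs: "y + complex_of_real s *\<^sub>C h = y + s *\<^sub>R h" for y s by simp
  have inS: "y + (1 / real (n + Suc N)) *\<^sub>R h \<in> S" if "N \<ge> N0" "y \<in> ball x (R/2)" for N n y
  proof -
    have "cmod (complex_of_real (1 / real (n + Suc N))) \<le> 2 * r"
      using small[OF that(1), of n] r by (simp only: norm_of_real) simp
    from in_cball[OF that(2) this] show ?thesis unfolding real_cs using R by blast
  qed
  have ul: "uniform_limit (ball x (R/2))
      (\<lambda>n y. real (n + Suc N) *\<^sub>R (f (y + (1 / real (n + Suc N)) *\<^sub>R h) - f y)) (\<lambda>y. dd f y h) sequentially"
    if N: "N \<ge> N0" for N
  proof (rule uniform_limitI)
    fix e :: real assume e: "0 < e"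
    define C where "C = 2 * B / r\<^sup>2"
    have "(\<lambda>n. C * inverse (real (Suc n))) \<longlonglongrightarrow> C * 0"
      by (intro tendsto_intros LIMSEQ_inverse_real_of_nat)
    then have "(\<lambda>n. C * inverse (real (Suc (n + N)))) \<longlonglongrightarrow> 0"
      using LIMSEQ_ignore_initial_segment by fastforce
    then have "\<forall>\<^sub>F n in sequentially. C * inverse (real (Suc (n + N))) < e"
      using e by (rule order_tendstoD(2))
    then show "\<forall>\<^sub>F n in sequentially. \<forall>y\<in>ball x (R/2).
        dist (real (n + Suc N) *\<^sub>R (f (y + (1 / real (n + Suc N)) *\<^sub>R h) - f y)) (dd f y h) < e"
    proof eventually_elim
      case (elim n)
      define k where "k = real (n + Suc N)"
      have k: "0 < k" "1 / k \<le> r" using small[OF N, of n] by (auto simp: k_def)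
      have "dist (k *\<^sub>R (f (y + (1 / k) *\<^sub>R h) - f y)) (dd f y h) < e" if y: "y \<in> ball x (R/2)" for y
      proof -
        have "norm (f (y + complex_of_real (1/k) *\<^sub>C h) - f y - complex_of_real (1/k) *\<^sub>C dd f y h)
            \<le> 2 * B / r\<^sup>2 * (cmod (complex_of_real (1/k)))\<^sup>2"
          by (rule cauchy_line_taylor[OF f r])
             (use in_cball[OF y] B R(2) k in \<open>auto simp: norm_divide\<close>)
        then have *: "norm (f (y + (1/k) *\<^sub>R h) - f y - (1/k) *\<^sub>R dd f y h) \<le> C * (1/k)\<^sup>2"
          unfolding cscale_of_real norm_of_real using k by (simp add: C_def abs_of_pos)
        have "k *\<^sub>R (f (y + (1/k) *\<^sub>R h) - f y) - dd f y h
            = k *\<^sub>R (f (y + (1/k) *\<^sub>R h) - f y - (1/k) *\<^sub>R dd f y h)"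
          using k by (simp add: algebra_simps)
        then have "dist (k *\<^sub>R (f (y + (1 / k) *\<^sub>R h) - f y)) (dd f y h)
            = k * norm (f (y + (1/k) *\<^sub>R h) - f y - (1/k) *\<^sub>R dd f y h)"
          using k by (simp add: dist_norm)
        also have "\<dots> \<le> k * (C * (1/k)\<^sup>2)" using * k by (intro mult_left_mono) auto
        also have "\<dots> = C * inverse k" using k by (simp add: power2_eq_square field_simps)
        also have "\<dots> < e" using elim by (simp add: k_def)
        finally show ?thesis .
      qed
      then show ?case by (simp add: k_def)
    qed
  qed
  show ?thesis
    using R inS ul by (intro exI[of _ "R/2"] exI[of _ N0] conjI allI impI ballI) auto
qed

text \<open>The derivative is a uniform limit of holomorphic difference quotients, so Weierstrass
  makes it holomorphic.\<close>

lemma chol_on_dd: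
  assumes S: "open S" and f: "chol_on f S"
  shows "chol_on (\<lambda>x. dd f x h) S"
  unfolding chol_on_def
proof
  fix x assume x: "x \<in> S"
  obtain r N where r: "0 < r" "ball x r \<subseteq> S"
    "\<And>M n y. M \<ge> N \<Longrightarrow> y \<in> ball x r \<Longrightarrow> y + (1 / real (n + Suc M)) *\<^sub>R h \<in> S"
    "\<And>M. M \<ge> N \<Longrightarrow> uniform_limit (ball x r)
      (\<lambda>n y. real (n + Suc M) *\<^sub>R (f (y + (1 / real (n + Suc M)) *\<^sub>R h) - f y)) (\<lambda>y. dd f y h) sequentially"
    using cdiff_dquot[OF S f x, of h] by blast
  show "cdiff (\<lambda>x. dd f x h) x"
  proof (rule cdiff_uniform_limit(1)[OF open_ball _ r(4)[OF order_refl]])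
    show "chol_on (\<lambda>y. real (n + Suc N) *\<^sub>R (f (y + (1 / real (n + Suc N)) *\<^sub>R h) - f y)) (ball x r)" for n
      unfolding chol_on_def
    proof (intro ballI cdiff_scaleR cdiff_diff)
      fix y assume y: "y \<in> ball x r"
      show "cdiff (\<lambda>y. f (y + (1 / real (n + Suc N)) *\<^sub>R h)) y"
        by (rule cdiff_compose[where f=f]) (use f r(3)[OF order_refl y] in \<open>auto simp: chol_on_def intro: cdiff_add\<close>)
      show "cdiff f y" using f r(2) y by (auto simp: chol_on_def)
    qed
  qed (use r in auto)
qed

text \<open>The \<open>k\<close>-derivative of the \<open>h\<close>-quotient of \<open>f\<close> has
  two limits: one mixed derivative by convergence of derivatives in the Weierstrass theorem, the
  other because it is itself the \<open>h\<close>-quotient of the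
  \<open>k\<close>-derivative.\<close>

lemma dd_commute:
  assumes S: "open S" and f: "chol_on f S" and x: "x \<in> S"
  shows "dd (\<lambda>x. dd f x h) x k = dd (\<lambda>x. dd f x k) x h"
proof -
  obtain r N1 where r: "0 < r" "ball x r \<subseteq> S"
    "\<And>M n y. M \<ge> N1 \<Longrightarrow> y \<in> ball x r \<Longrightarrow> y + (1 / real (n + Suc M)) *\<^sub>R h \<in> S"
    "\<And>M. M \<ge> N1 \<Longrightarrow> uniform_limit (ball x r)
      (\<lambda>n y. real (n + Suc M) *\<^sub>R (f (y + (1 / real (n + Suc M)) *\<^sub>R h) - f y)) (\<lambda>y. dd f y h) sequentially"
    using cdiff_dquot[OF S f x, of h] by blast
  obtain r' N2 where r': "0 < r'" "ball x r' \<subseteq> S"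
    "\<And>M n y. M \<ge> N2 \<Longrightarrow> y \<in> ball x r' \<Longrightarrow> y + (1 / real (n + Suc M)) *\<^sub>R h \<in> S"
    "\<And>M. M \<ge> N2 \<Longrightarrow> uniform_limit (ball x r')
      (\<lambda>n y. real (n + Suc M) *\<^sub>R (dd f (y + (1 / real (n + Suc M)) *\<^sub>R h) k - dd f y k)) (\<lambda>y. dd (\<lambda>x. dd f x k) y h) sequentially"
    using cdiff_dquot[OF S chol_on_dd[OF S f] x, of h k] by blast
  \<comment> \<open>A common start makes the quotients of \<open>f\<close> and of its
    \<open>k\<close>-derivative use the same step sizes.\<close>
  define N where "N = max N1 N2"
  define F where "F = (\<lambda>n y. real (n + Suc N) *\<^sub>R (f (y + (1 / real (n + Suc N)) *\<^sub>R h) - f y))"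
  have cd: "cdiff f y" "cdiff (\<lambda>y. f (y + (1 / real (n + Suc N)) *\<^sub>R h)) y"
    "dd (\<lambda>y. f (y + (1 / real (n + Suc N)) *\<^sub>R h)) y k = dd f (y + (1 / real (n + Suc N)) *\<^sub>R h) k"
    if y: "y \<in> ball x r" for y n
  proof -
    show "cdiff f y" using f r(2) y by (auto simp: chol_on_def)
    have 1: "cdiff f (y + (1 / real (n + Suc N)) *\<^sub>R h)"
      using f r(3)[OF _ y, of N n] by (auto simp: chol_on_def N_def)
    have 2: "((\<lambda>y. y + (1 / real (n + Suc N)) *\<^sub>R h) has_derivative (\<lambda>h. h)) (at y)"
      by (auto intro!: derivative_eq_intros)
    have 3: "cdiff (\<lambda>y. y + (1 / real (n + Suc N)) *\<^sub>R h) y" by (intro cdiff_add) auto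
    show "cdiff (\<lambda>y. f (y + (1 / real (n + Suc N)) *\<^sub>R h)) y" by (rule cdiff_compose[OF 1 3])
    show "dd (\<lambda>y. f (y + (1 / real (n + Suc N)) *\<^sub>R h)) y k = dd f (y + (1 / real (n + Suc N)) *\<^sub>R h) k"
      using dd_compose[OF 1 3] dd_eq[OF 2] by simp
  qed
  have xr: "x \<in> ball x r" using r by simp
  have "(\<lambda>n. dd (F n) x k) \<longlonglongrightarrow> dd (\<lambda>x. dd f x h) x k"
  proof (rule cdiff_uniform_limit(2)[OF open_ball _ _ xr])
    show "chol_on (F n) (ball x r)" for n
      unfolding chol_on_def F_def by (intro ballI cdiff_scaleR cdiff_diff cd)
    show "uniform_limit (ball x r) F (\<lambda>x. dd f x h) sequentially"
      unfolding F_def by (rule r(4)) (simp add: N_def)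
  qed
  moreover have "dd (F n) x k = real (n + Suc N) *\<^sub>R (dd f (x + (1 / real (n + Suc N)) *\<^sub>R h) k - dd f x k)" for n
  proof -
    have "(F n has_derivative (\<lambda>k. real (n + Suc N) *\<^sub>R
        (dd (\<lambda>y. f (y + (1 / real (n + Suc N)) *\<^sub>R h)) x k - dd f x k))) (at x)"
      unfolding F_def by (intro has_derivative_scaleR_right has_derivative_diff cdiff_has_derivative cd xr)
    from dd_eq[OF this] show ?thesis using cd(3)[OF xr] by simp
  qed
  moreover have "(\<lambda>n. real (n + Suc N) *\<^sub>R (dd f (x + (1 / real (n + Suc N)) *\<^sub>R h) k - dd f x k))
      \<longlonglongrightarrow> dd (\<lambda>x. dd f x k) x h"
    by (rule tendsto_uniform_limitI[OF r'(4)]) (use r' in \<open>auto simp: N_def\<close>)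
  ultimately show ?thesis using LIMSEQ_unique by simp
qed

section \<open>Primitives in the second variable\<close>

text \<open>Averaging over the segment from \<open>(u, 0)\<close> to \<open>(u, v)\<close> puts the
  primitive in the form \<open>v\<close> times an integral over the fixed interval from 0 to 1,
  which can be differentiated under the integral sign. The mean alone serves again as the quotient
  by \<open>v\<close>.\<close>

definition vmean :: "(complex \<times> complex \<Rightarrow> 'w::complex_space) \<Rightarrow> complex \<times> complex \<Rightarrow> 'w" where
  "vmean g x = integral {0..1} (\<lambda>t. g (fst x, t *\<^sub>R snd x))"

definition prim :: "(complex \<times> complex \<Rightarrow> 'w::complex_space) \<Rightarrow> complex \<times> complex \<Rightarrow> 'w" where
  "prim g x = snd x *\<^sub>C vmean g x"

definition vstar :: "(complex \<times> complex) set \<Rightarrow> bool" where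
  "vstar S \<longleftrightarrow> (\<forall>u v. \<forall>t\<in>{0..1}. (u, v) \<in> S \<longrightarrow> (u, t *\<^sub>R v) \<in> S)"

lemma vstarD: "vstar S \<Longrightarrow> x \<in> S \<Longrightarrow> t \<in> {0..1} \<Longrightarrow> (fst x, t *\<^sub>R snd x) \<in> S"
  by (cases x) (simp add: vstar_def)

lemma continuous_on_ray:
  assumes "continuous_on S f" "vstar S" "x \<in> S"
  shows "continuous_on {0..1} (\<lambda>t. f (fst x, t *\<^sub>R snd x))"
  by (rule continuous_on_compose2[OF assms(1)]) (use vstarD[OF assms(2,3)] in \<open>auto intro!: continuous_intros\<close>)

text \<open>Differentiation under the integral sign; commutation with \<open>jop\<close> holds for
  each \<open>t\<close> and passes through the integral because \<open>jop\<close> is bounded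
  linear.\<close>

lemma vmean_cdiff:
  assumes S: "open S" "vstar S" and g: "chol_on g S" and x: "x \<in> S"
  shows "cdiff (vmean g) x"
    "dd (vmean g) x h = integral {0..1} (\<lambda>t. dd g (fst x, t *\<^sub>R snd x) (fst h, t *\<^sub>R snd h))"
proof -
  define L where "L = (\<lambda>(x :: complex \<times> complex) (t::real). (fst x, t *\<^sub>R snd x))"
  define D where "D = (\<lambda>x t h. dd g (L x t) (L h t))"
  have gL: "cdiff g (L y t)" if "y \<in> S" "t \<in> {0..1}" for y t
    using vstarD[OF S(2) that] g by (simp add: L_def chol_on_def)
  have der: "((\<lambda>y. g (L y t)) has_derivative D y t) (at y)" if "y \<in> S" "t \<in> {0..1}" for y t
  proof -
    have "((\<lambda>y. L y t) has_derivative (\<lambda>h. L h t)) (at y)"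
      unfolding L_def by (auto intro!: derivative_eq_intros)
    from has_derivative_compose[OF this cdiff_has_derivative[OF gL[OF that]]]
    show ?thesis by (simp add: D_def)
  qed
  have blD: "blinfun_apply (Blinfun (D y t)) = D y t" if "y \<in> S" "t \<in> {0..1}" for y t
    using der[OF that] has_derivative_bounded_linear bounded_linear_Blinfun_apply by blast
  have contD: "continuous_on (S \<times> {0..1}) (\<lambda>(y, t). D y t h)" for h
  proof -
    have 1: "continuous_on (S \<times> {0..1}) (\<lambda>(y, t). dd g (L y t) k)" for k
    proof -
      have "continuous_on (S \<times> {0..1}) (\<lambda>z. dd g (L (fst z) (snd z)) k)"
        by (rule continuous_on_compose2[OF chol_on_continuous[OF chol_on_dd[OF S(1) g]]])
           (use vstarD[OF S(2)] in \<open>auto simp: L_def intro!: continuous_intros\<close>)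
      then show ?thesis by (simp add: case_prod_unfold)
    qed
    have "D y t h = dd g (L y t) (fst h, 0) + t *\<^sub>R dd g (L y t) (0, snd h)" if "y \<in> S" "t \<in> {0..1}" for y t
    proof -
      have "L h t = (fst h, 0) + t *\<^sub>R (0, snd h)" by (simp add: L_def)
      then show ?thesis unfolding D_def
        using dd_linear[OF gL[OF that]] by (simp add: linear_add linear_cmul del: scaleR_Pair add_Pair)
    qed
    then have "continuous_on (S \<times> {0..1}) (\<lambda>(y, t). D y t h) \<longleftrightarrow>
        continuous_on (S \<times> {0..1}) (\<lambda>z. dd g (L (fst z) (snd z)) (fst h, 0) + snd z *\<^sub>R dd g (L (fst z) (snd z)) (0, snd h))"
      by (intro continuous_on_cong) auto
    then show ?thesis using 1[of "(fst h, 0)"] 1[of "(0, snd h)"]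
      by (auto simp: case_prod_unfold intro!: continuous_intros)
  qed
  obtain e where e: "0 < e" "ball x e \<subseteq> S" using S(1) x open_contains_ball by blast
  have cont: "continuous_on (ball x e \<times> cbox 0 1) (\<lambda>(y, t). Blinfun (D y t))"
  proof (rule continuous_on_blinfun_componentwise)
    fix i :: "complex \<times> complex" assume "i \<in> Basis"
    have "continuous_on (ball x e \<times> {0..1}) (\<lambda>(y, t). D y t i)"
      by (rule continuous_on_subset[OF contD]) (use e in auto)
    then show "continuous_on (ball x e \<times> cbox 0 1) (\<lambda>z. blinfun_apply (case z of (y, t) \<Rightarrow> Blinfun (D y t)) i)"
      by (rule continuous_on_cong[THEN iffD1, rotated 2]) (use e blD in auto)
  qed
  have int: "(\<lambda>t. Blinfun (D x t)) integrable_on {0..1}"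
  proof -
    have "continuous_on {0..1} (\<lambda>t. Blinfun (D x t))"
    proof -
      have c: "continuous_on {0..1} (\<lambda>t. (x, t))" by (intro continuous_intros)
      show ?thesis using continuous_on_compose2[OF cont c] e by (simp add: image_subset_iff)
    qed
    then show ?thesis by (rule integrable_continuous_real)
  qed
  have "((\<lambda>y. integral (cbox 0 1) (\<lambda>t. g (L y t))) has_derivative integral (cbox 0 1) (\<lambda>t. Blinfun (D x t)))
      (at x within ball x e)"
  proof (rule leibniz_rule[OF _ _ cont])
    show "((\<lambda>y. g (L y t)) has_derivative blinfun_apply (Blinfun (D y t))) (at y within ball x e)"
      if "y \<in> ball x e" "t \<in> cbox 0 1" for y t
    proof -
      have "y \<in> S" "t \<in> {0..1}" using that e by auto
      then show ?thesis using der[of y t] blD[of y t] by (simp add: has_derivative_at_withinI)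
    qed
    show "(\<lambda>t. g (L y t)) integrable_on cbox 0 1" if "y \<in> ball x e" for y
      unfolding L_def box_real using that e
      by (intro integrable_continuous_real continuous_on_ray[OF chol_on_continuous[OF g] S(2)]) auto
  qed (use e in auto)
  then have d: "(vmean g has_derivative integral {0..1} (\<lambda>t. Blinfun (D x t))) (at x)"
    using at_within_open[of x "ball x e"] e by (simp add: vmean_def[abs_def] L_def)
  have app: "blinfun_apply (integral {0..1} (\<lambda>t. Blinfun (D x t))) h = integral {0..1} (\<lambda>t. D x t h)" for h
    unfolding blinfun_apply_integral[OF int] by (rule integral_cong) (simp add: blD x)
  show "dd (vmean g) x h = integral {0..1} (\<lambda>t. dd g (fst x, t *\<^sub>R snd x) (fst h, t *\<^sub>R snd h))"
    using dd_eq[OF d] app by (simp add: D_def L_def)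
  have "D x t (jop h) = jop (D x t h)" if "t \<in> {0..1}" for t h
  proof -
    have "L (jop h) t = jop (L h t)" by (cases h) (simp add: L_def jop_scaleR)
    then show ?thesis unfolding D_def using dd_jop[OF gL[OF x that]] by simp
  qed
  then have "integral {0..1} (\<lambda>t. D x t (jop h)) = integral {0..1} (jop \<circ> (\<lambda>t. D x t h))" for h
    by (intro integral_cong) simp
  also have "integral {0..1} (jop \<circ> (\<lambda>t. D x t h)) = jop (integral {0..1} (\<lambda>t. D x t h))" for h
  proof (rule integral_linear[OF _ bounded_linear_jop])
    show "(\<lambda>t. D x t h) integrable_on {0..1}"
    proof (rule integrable_continuous_real)
      have c: "continuous_on {0..1} (\<lambda>t. (x, t))" by (intro continuous_intros)
      show "continuous_on {0..1} (\<lambda>t. D x t h)"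
        using continuous_on_compose2[OF contD[of h] c] x by (simp add: image_subset_iff)
    qed
  qed
  finally show "cdiff (vmean g) x"
    using d app cdiffI by metis
qed

text \<open>For the \<open>v\<close>-derivative, \<open>g + t v g_v\<close> along the ray is the
  \<open>t\<close>-derivative of \<open>t g(u, t v)\<close>, so the two terms of the product rule
  integrate to the value at \<open>t = 1\<close>. For the \<open>u\<close>-derivative the factor
  \<open>v\<close> is a constant.\<close>

lemma prim_cdiff:
  assumes S: "open S" "vstar S" and g: "chol_on g S" and x: "x \<in> S"
  shows "cdiff (prim g) x"
    "dd (prim g) x (1, 0) = snd x *\<^sub>C integral {0..1} (\<lambda>t. dd g (fst x, t *\<^sub>R snd x) (1, 0))"
    "dd (prim g) x (0, 1) = g x"
proof -
  note v = vmean_cdiff[OF assms]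
  have s: "cdiff snd x" by (intro cdiff_snd[where f="\<lambda>x. x"]) simp
  have "((\<lambda>x. snd x *\<^sub>C vmean g x) has_derivative (\<lambda>h. snd x *\<^sub>C dd (vmean g) x h + snd h *\<^sub>C vmean g x)) (at x)"
    by (rule bounded_bilinear.FDERIV[OF bounded_bilinear_cscale _ cdiff_has_derivative[OF v(1)]])
       (auto intro!: derivative_eq_intros)
  from dd_eq[OF this] have dp: "dd (prim g) x h = snd x *\<^sub>C dd (vmean g) x h + snd h *\<^sub>C vmean g x" for h
    by (simp add: prim_def[abs_def])
  show "cdiff (prim g) x"
    unfolding prim_def[abs_def] by (intro cdiff_cscale s v)
  show "dd (prim g) x (1, 0) = snd x *\<^sub>C integral {0..1} (\<lambda>t. dd g (fst x, t *\<^sub>R snd x) (1, 0))"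
    by (simp add: dp v(2))
  have gd: "cdiff g (fst x, t *\<^sub>R snd x)" if "t \<in> {0..1}" for t
    using vstarD[OF S(2) x that] g by (simp add: chol_on_def)
  have ray: "((\<lambda>t. g (fst x, t *\<^sub>R snd x)) has_vector_derivative dd g (fst x, t *\<^sub>R snd x) (0, snd x))
      (at t within {0..1})" if t: "t \<in> {0..1}" for t
  proof -
    have "((\<lambda>t. (fst x, t *\<^sub>R snd x)) has_derivative (\<lambda>k. (0, k *\<^sub>R snd x))) (at t within {0..1})"
      by (auto intro!: derivative_eq_intros)
    from has_derivative_compose[OF this cdiff_has_derivative[OF gd[OF t]]]
    have *: "((\<lambda>t. g (fst x, t *\<^sub>R snd x)) has_derivative (\<lambda>k. dd g (fst x, t *\<^sub>R snd x) (0, k *\<^sub>R snd x))) (at t within {0..1})" .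
    have "dd g (fst x, t *\<^sub>R snd x) (0, k *\<^sub>R snd x) = k *\<^sub>R dd g (fst x, t *\<^sub>R snd x) (0, snd x)" for k
      using linear_cmul[OF dd_linear[OF gd[OF t]], of k "(0, snd x)"] by simp
    then show ?thesis using * by (simp add: has_vector_derivative_def)
  qed
  have dray: "dd g (fst x, t *\<^sub>R snd x) (0, t *\<^sub>R 1) = t *\<^sub>R dd g (fst x, t *\<^sub>R snd x) (0, 1)"
    "dd g (fst x, t *\<^sub>R snd x) (0, snd x) = snd x *\<^sub>C dd g (fst x, t *\<^sub>R snd x) (0, 1)" if "t \<in> {0..1}" for t
    using linear_cmul[OF dd_linear[OF gd[OF that]], of t "(0, 1)"] dd_cscale[OF gd[OF that], of "snd x" "(0, 1)"] by simp_all
  have "((\<lambda>t. g (fst x, t *\<^sub>R snd x) + t *\<^sub>R dd g (fst x, t *\<^sub>R snd x) (0, snd x)) has_integral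
      (1 *\<^sub>R g (fst x, 1 *\<^sub>R snd x) - 0 *\<^sub>R g (fst x, 0 *\<^sub>R snd x))) {0..1}"
    by (rule fundamental_theorem_of_calculus)
       (auto intro!: derivative_eq_intros ray simp: add.commute)
  then have ftc: "integral {0..1} (\<lambda>t. g (fst x, t *\<^sub>R snd x) + t *\<^sub>R dd g (fst x, t *\<^sub>R snd x) (0, snd x)) = g x"
    by (simp add: integral_unique)
  have dc: "continuous_on {0..1} (\<lambda>t. t *\<^sub>R dd g (fst x, t *\<^sub>R snd x) (0, 1))"
    by (intro continuous_intros continuous_on_ray[OF chol_on_continuous[OF chol_on_dd[OF S(1) g]] S(2) x])
  have "snd x *\<^sub>C dd (vmean g) x (0, 1) = snd x *\<^sub>C integral {0..1} (\<lambda>t. t *\<^sub>R dd g (fst x, t *\<^sub>R snd x) (0, 1))"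
    unfolding v(2) using dray(1) by (intro arg_cong[where f="cscale (snd x)"] integral_cong) simp
  also have "\<dots> = integral {0..1} (cscale (snd x) \<circ> (\<lambda>t. t *\<^sub>R dd g (fst x, t *\<^sub>R snd x) (0, 1)))"
    by (rule integral_linear[symmetric])
       (use dc integrable_continuous_real bounded_bilinear.bounded_linear_right[OF bounded_bilinear_cscale] in auto)
  also have "\<dots> = integral {0..1} (\<lambda>t. t *\<^sub>R dd g (fst x, t *\<^sub>R snd x) (0, snd x))"
    by (rule integral_cong) (simp add: dray(2) bounded_bilinear.scaleR_right[OF bounded_bilinear_cscale])
  finally have "dd (prim g) x (0, 1) = integral {0..1} (\<lambda>t. g (fst x, t *\<^sub>R snd x)) +
      integral {0..1} (\<lambda>t. t *\<^sub>R dd g (fst x, t *\<^sub>R snd x) (0, snd x))"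
    by (simp add: dp vmean_def)
  also have "\<dots> = g x"
    unfolding ftc[symmetric]
    by (intro integral_add[symmetric] integrable_continuous_real continuous_intros
        continuous_on_ray[OF chol_on_continuous S(2) x] chol_on_dd S g)
  finally show "dd (prim g) x (0, 1) = g x" .
qed

lemma vmean_0: "vmean g (u, 0) = g (u, 0)"
  by (simp add: vmean_def)

lemma prim_0: "prim g (u, 0) = 0"
  by (simp add: prim_def)

lemma prim_diff:
  assumes "continuous_on S f" "continuous_on S g" "vstar S" "x \<in> S"
  shows "prim (\<lambda>x. f x - g x) x = prim f x - prim g x"
proof -
  have "vmean (\<lambda>x. f x - g x) x = vmean f x - vmean g x"
    unfolding vmean_def
    by (intro integral_diff integrable_continuous_real continuous_on_ray[OF _ assms(3,4)] assms)
  then show ?thesis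
    by (simp add: prim_def bounded_bilinear.diff_right[OF bounded_bilinear_cscale])
qed

section \<open>Weighted estimates on cones\<close>

text \<open>The slope \<open>\<eta>\<close> of the domain is the small parameter that makes the Picard iteration contract;
  \<open>depth\<close> is the weight of the Nagumo norms.\<close>

definition depth :: "real \<Rightarrow> real \<Rightarrow> complex \<times> complex \<Rightarrow> real" where
  "depth \<eta> r x = r - \<bar>Im (fst x)\<bar> - cmod (snd x) / \<eta>"

definition cone :: "real \<Rightarrow> real \<Rightarrow> (complex \<times> complex) set" where
  "cone \<eta> r = {x. 0 < depth \<eta> r x}"

lemma open_cone: "open (cone \<eta> r)"
  unfolding cone_def depth_def divide_inverse
  by (intro open_Collect_less continuous_intros)

lemma vstar_cone: "0 < \<eta> \<Longrightarrow> vstar (cone \<eta> r)"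
  unfolding vstar_def cone_def depth_def
proof (clarsimp)
  fix u v :: complex and t :: real
  assume "0 < \<eta>" "cmod v / \<eta> < r - \<bar>Im u\<bar>" "0 \<le> t" "t \<le> 1"
  moreover from this have "t * cmod v / \<eta> \<le> cmod v / \<eta>"
    by (intro divide_right_mono mult_left_le_one_le) auto
  ultimately show "t * cmod v / \<eta> < r - \<bar>Im u\<bar>" by linarith
qed

text \<open>\<open>\<rho> - t * s\<close> is the depth at parameter \<open>t\<close> of a ray. The
  primitives \<open>- 2 M sqrt (\<rho> - t * s)\<close> and
  \<open>2 M / sqrt (\<rho> - t * s)\<close> show the gain of one power of the depth: the weight
  with exponent 1/2 integrates to something bounded, exponent 3/2 comes back to 1/2.\<close>

lemma integral_weight_bounds:
  fixes f :: "real \<Rightarrow> 'w::euclidean_space"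
  assumes "continuous_on {0..1} f" "0 \<le> s" "s < \<rho>" "0 \<le> M"
  shows "\<rho> \<le> 1 \<Longrightarrow> (\<And>t. t \<in> {0..1} \<Longrightarrow> norm (f t) \<le> M / sqrt (\<rho> - t * s)) \<Longrightarrow>
           s * norm (integral {0..1} f) \<le> 2 * M"
    "(\<And>t. t \<in> {0..1} \<Longrightarrow> norm (f t) \<le> M / ((\<rho> - t * s) * sqrt (\<rho> - t * s))) \<Longrightarrow>
           s * norm (integral {0..1} f) \<le> 2 * M / sqrt (\<rho> - s)"
proof -
  have pos: "0 < \<rho> - t * s" if "t \<in> {0..1}" for t
    using that assms(2,3) mult_left_le_one_le[of s t] by auto
  note int = integrable_continuous_real[OF assms(1)]
  have scale: "s * norm (integral {0..1} f) \<le> \<Phi> 1 - \<Phi> 0"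
    if \<Phi>: "\<And>t. t \<in> {0..1} \<Longrightarrow> (\<Phi> has_real_derivative s * \<phi> t) (at t within {0..1})"
      and le: "\<And>t. t \<in> {0..1} \<Longrightarrow> norm (f t) \<le> \<phi> t" for \<Phi> \<phi>
  proof -
    have I: "((\<lambda>t. s * \<phi> t) has_integral (\<Phi> 1 - \<Phi> 0)) {0..1}"
      by (rule fundamental_theorem_of_calculus) (use \<Phi> in \<open>auto simp: has_real_derivative_iff_has_vector_derivative\<close>)
    have "s * norm (integral {0..1} f) = norm (integral {0..1} (\<lambda>t. s *\<^sub>R f t))"
      using assms(2) by simp
    also have "\<dots> \<le> integral {0..1} (\<lambda>t. s * \<phi> t)"
      by (rule integral_norm_bound_integral)
         (use int I le assms(2) in \<open>auto intro!: mult_left_mono integrable_cmul\<close>)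
    finally show ?thesis unfolding integral_unique[OF I] .
  qed
  { assume "\<rho> \<le> 1" and le: "\<And>t. t \<in> {0..1} \<Longrightarrow> norm (f t) \<le> M / sqrt (\<rho> - t * s)"
    have "s * norm (integral {0..1} f) \<le> - (2 * M * sqrt (\<rho> - 1 * s)) - (- (2 * M * sqrt (\<rho> - 0 * s)))"
    proof (rule scale[OF _ le])
      fix t :: real assume t: "t \<in> {0..1}"
      have "0 < \<rho> - t * s" by (rule pos[OF t])
      then show "((\<lambda>t. - (2 * M * sqrt (\<rho> - t * s))) has_real_derivative s * (M / sqrt (\<rho> - t * s))) (at t within {0..1})"
        by (auto intro!: derivative_eq_intros simp: field_simps)
    qed
    also have "\<dots> \<le> 2 * M * sqrt \<rho>"
      using assms by simp
    also have "\<dots> \<le> 2 * M" using assms \<open>\<rho> \<le> 1\<close> by (simp add: mult_left_le)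
    finally show "s * norm (integral {0..1} f) \<le> 2 * M" . }
  { assume le: "\<And>t. t \<in> {0..1} \<Longrightarrow> norm (f t) \<le> M / ((\<rho> - t * s) * sqrt (\<rho> - t * s))"
    have "s * norm (integral {0..1} f) \<le> 2 * M / sqrt (\<rho> - 1 * s) - 2 * M / sqrt (\<rho> - 0 * s)"
    proof (rule scale[OF _ le])
      fix t :: real assume t: "t \<in> {0..1}"
      have p: "0 < \<rho> - t * s" by (rule pos[OF t])
      have "((\<lambda>t. 2 * M / sqrt (\<rho> - t * s)) has_real_derivative
          - (2 * M * (- s * (inverse (sqrt (\<rho> - t * s)) / 2))) / (sqrt (\<rho> - t * s) * sqrt (\<rho> - t * s))) (at t within {0..1})"
        using p by (auto intro!: derivative_eq_intros)
      then show "((\<lambda>t. 2 * M / sqrt (\<rho> - t * s)) has_real_derivative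
          s * (M / ((\<rho> - t * s) * sqrt (\<rho> - t * s)))) (at t within {0..1})"
        using p by (simp add: field_simps)
    qed
    also have "\<dots> \<le> 2 * M / sqrt (\<rho> - s)"
      using assms by simp
    finally show "s * norm (integral {0..1} f) \<le> 2 * M / sqrt (\<rho> - s)" . }
qed

text \<open>Moving \<open>u\<close> by at most half the depth \<open>d\<close> leaves at least
  \<open>d / 2\<close>. Cauchy's estimate on that disc gives \<open>2 sqrt 2 M / (d sqrt d)\<close>,
  and \<open>3\<close> rounds up \<open>2 sqrt 2\<close>.\<close>

lemma nagumo:
  assumes \<eta>: "0 < \<eta>" and g: "chol_on g (cone \<eta> r)"
    and M: "\<And>x. x \<in> cone \<eta> r \<Longrightarrow> norm (g x) \<le> M / sqrt (depth \<eta> r x)" and x: "x \<in> cone \<eta> r"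
  shows "norm (dd g x (1, 0)) \<le> 3 * M / (depth \<eta> r x * sqrt (depth \<eta> r x))"
proof -
  define d where "d = depth \<eta> r x"
  have d: "0 < d" using x by (simp add: cone_def d_def)
  have "0 \<le> M / sqrt d" using M[OF x] norm_ge_zero order_trans unfolding d_def by blast
  then have M0: "0 \<le> M" using d by (simp add: zero_le_divide_iff)
  have dl: "d / 2 \<le> depth \<eta> r (x + l *\<^sub>C (1, 0))" if "cmod l \<le> d / 2" for l
  proof -
    have "\<bar>Im (fst x + l)\<bar> \<le> \<bar>Im (fst x)\<bar> + d / 2"
      using abs_Im_le_cmod[of l] that by simp
    moreover have "depth \<eta> r (x + l *\<^sub>C (1, 0)) = r - \<bar>Im (fst x + l)\<bar> - cmod (snd x) / \<eta>"
      by (cases x) (simp add: depth_def)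
    ultimately show ?thesis by (simp add: depth_def d_def field_simps)
  qed
  have "norm (dd g x (1, 0)) \<le> (M / sqrt (d / 2)) / (d / 2)"
  proof (rule cauchy_line[OF g])
    fix l :: complex assume l: "cmod l \<le> d / 2"
    show c: "x + l *\<^sub>C (1, 0) \<in> cone \<eta> r" using dl[OF l] d unfolding cone_def by simp
    show "norm (g (x + l *\<^sub>C (1, 0))) \<le> M / sqrt (d / 2)"
      using M[OF c] dl[OF l] d M0
      by (meson divide_left_mono half_gt_zero mult_pos_pos order_trans order_less_le_trans real_sqrt_gt_zero real_sqrt_le_mono)
  qed (use d in simp)
  also have "\<dots> = (2 * sqrt 2) * (M / (d * sqrt d))"
    using d by (simp add: real_sqrt_divide mult_ac)
  also have "\<dots> \<le> 3 * (M / (d * sqrt d))"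
  proof (rule mult_right_mono)
    have "sqrt 2 \<le> 3 / 2" by (rule real_le_lsqrt) (auto simp: power2_eq_square)
    then show "2 * sqrt 2 \<le> (3::real)" by simp
  qed (use d M0 in simp)
  finally show ?thesis by (simp add: d_def)
qed

text \<open>The identity \<open>cmod (snd x) = \<eta> * s\<close> supplies the small factor
  \<open>\<eta>\<close>. The constant \<open>6\<close> is the \<open>2\<close> of the integral bound
  times the \<open>3\<close> paid in \<open>nagumo\<close>; the derivative of the primitive carries
  the same weight as \<open>g\<close>, so the estimate can be iterated.\<close>

lemma prim_bounds:
  assumes \<eta>: "0 < \<eta>" and r: "r \<le> 1" and g: "chol_on g (cone \<eta> r)"
    and M: "\<And>x. x \<in> cone \<eta> r \<Longrightarrow> norm (g x) \<le> M / sqrt (depth \<eta> r x)" and x: "x \<in> cone \<eta> r"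
  shows "norm (prim g x) \<le> 2 * \<eta> * M"
    "norm (dd (prim g) x (1, 0)) \<le> 6 * \<eta> * M / sqrt (depth \<eta> r x)"
proof -
  define s where "s = cmod (snd x) / \<eta>"
  define \<rho> where "\<rho> = r - \<bar>Im (fst x)\<bar>"
  have d: "depth \<eta> r x = \<rho> - s" by (simp add: depth_def s_def \<rho>_def)
  have s: "0 \<le> s" "s < \<rho>" "\<rho> \<le> 1" "cmod (snd x) = \<eta> * s"
    using x r \<eta> d by (auto simp: cone_def s_def \<rho>_def)
  have dray: "depth \<eta> r (fst x, t *\<^sub>R snd x) = \<rho> - t * s" if "t \<in> {0..1}" for t
    using that by (simp add: depth_def s_def \<rho>_def)
  note ray = vstarD[OF vstar_cone[OF \<eta>] x]
  have "0 \<le> M / sqrt (\<rho> - s)" using M[OF x] norm_ge_zero order_trans unfolding d by blast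
  then have M0: "0 \<le> M" using s by (simp add: zero_le_divide_iff)
  have "s * norm (integral {0..1} (\<lambda>t. g (fst x, t *\<^sub>R snd x))) \<le> 2 * M"
    by (rule integral_weight_bounds(1)[OF continuous_on_ray[OF chol_on_continuous[OF g] vstar_cone[OF \<eta>] x] s(1,2) M0 s(3)])
       (use M[OF ray] dray in auto)
  then have "\<eta> * (s * norm (integral {0..1} (\<lambda>t. g (fst x, t *\<^sub>R snd x)))) \<le> \<eta> * (2 * M)"
    using \<eta> by (intro mult_left_mono) auto
  then show "norm (prim g x) \<le> 2 * \<eta> * M"
    by (simp add: prim_def vmean_def s(4) mult.assoc mult.left_commute[of 2])
  have "s * norm (integral {0..1} (\<lambda>t. dd g (fst x, t *\<^sub>R snd x) (1, 0))) \<le> 2 * (3 * M) / sqrt (\<rho> - s)"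
    by (rule integral_weight_bounds(2)[OF continuous_on_ray[OF chol_on_continuous[OF chol_on_dd[OF open_cone g]] vstar_cone[OF \<eta>] x] s(1,2)])
       (use M0 nagumo[OF \<eta> g M ray] dray in auto)
  then have "\<eta> * (s * norm (integral {0..1} (\<lambda>t. dd g (fst x, t *\<^sub>R snd x) (1, 0)))) \<le> \<eta> * (2 * (3 * M) / sqrt (\<rho> - s))"
    using \<eta> by (intro mult_left_mono) auto
  then show "norm (dd (prim g) x (1, 0)) \<le> 6 * \<eta> * M / sqrt (depth \<eta> r x)"
    unfolding prim_cdiff(2)[OF open_cone vstar_cone[OF \<eta>] g x] d
    by (simp add: s(4) mult.assoc mult.left_commute[of 6])
qed

section \<open>The Cauchy problem for quasilinear systems\<close>

lemma LIMSEQ_const_eq: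
  fixes l :: "'a::t2_space"
  assumes "X \<longlonglongrightarrow> l" "\<And>n. X n = c" shows "l = c"
proof -
  have "X = (\<lambda>_. c)" using assms(2) by auto
  then show ?thesis using assms(1) LIMSEQ_const_iff[of c l] by simp
qed

lemma compact_image_norm_bound:
  assumes "compact T" "continuous_on T f"
  obtains K where "\<And>x. x \<in> T \<Longrightarrow> norm (f x) \<le> K"
  using compact_imp_bounded[OF compact_continuous_image[OF assms(2,1)]]
  unfolding bounded_iff by blast

lemma periodic_reduce:
  fixes f :: "real \<Rightarrow> 'a"
  assumes "\<And>u. f (u + 2 * pi) = f u"
  obtains s where "s \<in> {0..<2 * pi}" "f s = f u" "\<exists>k::int. u = s + 2 * pi * k"
proof -
  interpret periodic_fun_simple f "2 * pi" by standard (rule assms)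
  define k where "k = \<lfloor>u / (2 * pi)\<rfloor>"
  define s where "s = u - 2 * pi * k"
  have k: "real_of_int k \<le> u / (2 * pi)" "u / (2 * pi) < real_of_int k + 1"
    unfolding k_def by linarith+
  have "u = s + 2 * pi * k" by (simp add: s_def)
  moreover have "f s = f u"
    using plus_of_int[of s k] by (simp add: s_def mult.commute)
  moreover have "s \<in> {0..<2 * pi}"
    using k by (simp add: s_def field_simps)
  ultimately show thesis using that by blast
qed

text \<open>The data of a Cauchy problem \<open>w\<^sub>v = G w w\<^sub>u\<close>, \<open>w(u, 0) = w0 u\<close>; the map \<open>im\<close> cuts out the real subspace.\<close>

locale cauchy_problem =
  fixes G :: "'w::complex_space \<Rightarrow> 'w \<Rightarrow> 'w" and w0 :: "complex \<Rightarrow> 'w" and Q :: "'w set"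
    and r0 :: real and im :: "'w \<Rightarrow> 'b::euclidean_space"
  assumes Q: "open Q"
    and G: "chol_on (\<lambda>(x, m). G x m) (Q \<times> UNIV)"
    and G_linear: "x \<in> Q \<Longrightarrow> linear (G x)"
    and r0: "0 < r0"
    and w0: "chol_on w0 {u. \<bar>Im u\<bar> < r0}"
    and w0_periodic: "\<bar>Im u\<bar> < r0 \<Longrightarrow> w0 (u + 2 * pi) = w0 u"
    and w0_Q: "w0 (of_real t) \<in> Q"
    and im: "linear im"
    and w0_real: "im (w0 (of_real t)) = 0"
    and G_real: "x \<in> Q \<Longrightarrow> im x = 0 \<Longrightarrow> im m = 0 \<Longrightarrow> im (G x m) = 0"
begin

lemma G_cdiff: "x \<in> Q \<Longrightarrow> cdiff (\<lambda>x. G x m) x"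
  using cdiff_compose[of "\<lambda>(x, m). G x m" "\<lambda>x. (x, m)" x] G cdiff_Pair[OF cdiff_id[of x] cdiff_const[where c=m and x=x]]
  by (simp add: chol_on_def)

text \<open>By periodicity \<open>w0\<close> maps the real axis into a compact set, so a closed
  neighbourhood of fixed size lies in \<open>Q\<close> and the constants do not depend on
  \<open>t\<close>. Linearity extends the bound from the unit ball to all \<open>m\<close>, and
  Cauchy's estimate in \<open>x\<close> yields the Lipschitz constant.\<close>

lemma bounds_near_data:
  obtains \<rho> C L where "0 < \<rho>" "0 < C" "0 < L"
    "\<And>t x m. x \<in> cball (w0 (of_real t)) (2 * \<rho>) \<Longrightarrow> x \<in> Q \<and> norm (G x m) \<le> C * norm m"
    "\<And>t x y m. x \<in> cball (w0 (of_real t)) (2 * \<rho>) \<Longrightarrow> y \<in> cball (w0 (of_real t)) (2 * \<rho>) \<Longrightarrow>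
      norm (G x m - G y m) \<le> L * norm (x - y) * norm m"
proof -
  define K where "K = (\<lambda>t::real. w0 (of_real t)) ` {0..2 * pi}"
  have cont: "continuous_on UNIV (\<lambda>t::real. w0 (of_real t))"
    by (rule continuous_on_compose2[OF chol_on_continuous[OF w0]]) (use r0 in \<open>auto intro!: continuous_intros\<close>)
  have K: "compact K"
    unfolding K_def by (intro compact_continuous_image continuous_on_subset[OF cont]) auto
  have inK: "w0 (of_real t) \<in> K" for t :: real
  proof -
    obtain s where "s \<in> {0..<2*pi}" "w0 (of_real s) = w0 (of_real t)"
      by (rule periodic_reduce[of "\<lambda>t. w0 (of_real t)" t]) (use w0_periodic[of "of_real _"] r0 in auto)
    then show ?thesis unfolding K_def by (metis atLeastLessThan_iff atLeastAtMost_iff imageI less_imp_le)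
  qed
  have "K \<subseteq> Q" using w0_Q by (auto simp: K_def)
  then obtain e where e: "0 < e" "(\<Union>x\<in>K. cball x e) \<subseteq> Q"
    using compact_subset_open_imp_cball_epsilon_subset[OF K Q] by metis
  define T where "T = {x + y | x y. x \<in> K \<and> y \<in> cball (0::'w) e}"
  have T: "compact T" unfolding T_def by (intro compact_sums K compact_cball)
  have cb: "cball k e \<subseteq> T" if "k \<in> K" for k
  proof
    fix x assume "x \<in> cball k e"
    then have "x = k + (x - k)" "x - k \<in> cball 0 e" by (auto simp: dist_norm norm_minus_commute)
    then show "x \<in> T" unfolding T_def using that by blast
  qed
  have TQ: "T \<subseteq> Q"
  proof
    fix x assume "x \<in> T"
    then obtain k y where "x = k + y" "k \<in> K" "norm y \<le> e" by (auto simp: T_def)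
    then have "x \<in> cball k e" by (simp add: dist_norm)
    then show "x \<in> Q" using e \<open>k \<in> K\<close> by blast
  qed
  have "compact ((\<lambda>(x, m). G x m) ` (T \<times> cball 0 1))"
    by (rule compact_continuous_image[OF continuous_on_subset[OF chol_on_continuous[OF G]]])
       (use TQ T in \<open>auto intro: compact_Times\<close>)
  then obtain C0 where C0': "\<And>z. z \<in> (\<lambda>(x, m). G x m) ` (T \<times> cball 0 1) \<Longrightarrow> norm z \<le> C0"
    using compact_imp_bounded bounded_iff by metis
  have C0: "norm (G x m) \<le> C0" if "x \<in> T" "norm m \<le> 1" for x m
    by (rule C0') (use that in \<open>auto intro!: image_eqI[of _ _ "(x, m)"]\<close>)
  define C where "C = max C0 1"
  have CT: "norm (G x m) \<le> C * norm m" if "x \<in> T" for x m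
  proof (cases "m = 0")
    case True
    then show ?thesis using G_linear[of x] TQ that linear_0 by fastforce
  next
    case False
    have "norm (G x (m /\<^sub>R norm m)) \<le> C" using C0[OF that, of "m /\<^sub>R norm m"] False by (simp add: C_def)
    moreover have "G x (m /\<^sub>R norm m) = G x m /\<^sub>R norm m"
      using G_linear[of x] TQ that by (meson linear_cmul subsetD)
    ultimately show ?thesis using False by (simp add: field_simps)
  qed
  \<comment> \<open>With \<open>\<rho> = e / 4\<close>, a point at distance at most
    \<open>2 \<rho>\<close> from the curve is the centre of a ball of radius \<open>e / 2\<close>
    inside \<open>T\<close>, where \<open>G\<close> is bounded by \<open>C\<close>.\<close>
  define L where "L = C / (e / 2)"
  show thesis
  proof (rule that)
    show "0 < e / 4" "0 < C" "0 < L" using e by (auto simp: C_def L_def)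
    fix t m x assume x: "x \<in> cball (w0 (complex_of_real t)) (2 * (e / 4))"
    then have "x \<in> T" using cb[OF inK[of t]] e by auto
    then show "x \<in> Q \<and> norm (G x m) \<le> C * norm m" using TQ CT by auto
  next
    fix t m x y assume xy: "x \<in> cball (w0 (complex_of_real t)) (2 * (e / 4))" "y \<in> cball (w0 (complex_of_real t)) (2 * (e / 4))"
    define k where "k = w0 (complex_of_real t)"
    have zT: "cball z (e / 2) \<subseteq> T" if "z \<in> cball k (2 * (e / 4))" for z
    proof -
      have "cball z (e / 2) \<subseteq> cball k e"
      proof
        fix y assume "y \<in> cball z (e / 2)"
        then show "y \<in> cball k e" using that dist_triangle[of k y z] by simp
      qed
      then show ?thesis using cb[OF inK[of t]] by (auto simp: k_def)
    qed
    have "norm (G x m - G y m) \<le> (C * norm m / (e / 2)) * norm (x - y)"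
    proof (rule differentiable_bound[OF convex_cball[of k "2 * (e / 4)"]])
      fix z assume z: "z \<in> cball k (2 * (e / 4))"
      have zQ: "z \<in> Q" using zT[OF z] TQ e by fastforce
      show "((\<lambda>x. G x m) has_derivative dd (\<lambda>x. G x m) z) (at z within cball k (2 * (e / 4)))"
        using cdiff_has_derivative[OF G_cdiff[OF zQ]] has_derivative_at_withinI by blast
      have "norm (dd (\<lambda>x. G x m) z h) \<le> C * norm m / (e / 2) * norm h" for h
        by (rule cauchy_ball[of _ Q]) (use zT[OF z] TQ e CT G_cdiff in \<open>auto simp: chol_on_def\<close>)
      then show "onorm (dd (\<lambda>x. G x m) z) \<le> C * norm m / (e / 2)"
        using e by (intro onorm_bound) (auto simp: C_def)
    qed (use xy in \<open>auto simp: k_def\<close>)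
    then show "norm (G x m - G y m) \<le> L * norm (x - y) * norm m"
      by (simp add: L_def mult_ac)
  qed
qed

text \<open>The derivative of \<open>w0\<close> on the closed strip of half width is bounded by its
  maximum over one period; \<open>r \<le> \<rho> / K\<close> then keeps \<open>w0 u\<close> within
  \<open>\<rho>\<close> of its value at the real part of \<open>u\<close>.\<close>

lemma data_bounds:
  assumes "0 < \<rho>"
  obtains r K where "0 < r" "r \<le> 1" "r < r0" "0 < K"
    "\<And>u. \<bar>Im u\<bar> < r \<Longrightarrow> norm (dd w0 u 1) \<le> K \<and> norm (w0 u - w0 (Re u)) \<le> \<rho>"
proof -
  define T where "T = cbox (Complex 0 (- r0 / 2)) (Complex (2 * pi) (r0 / 2))"
  have open_strip: "open {u. \<bar>Im u\<bar> < r0}" by (intro open_Collect_less continuous_intros)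
  have TS: "T \<subseteq> {u. \<bar>Im u\<bar> < r0}" using r0 by (auto simp: T_def in_cbox_complex_iff)
  have cT: "compact T" by (simp add: T_def compact_cbox)
  obtain K0 where K0: "\<And>u. u \<in> T \<Longrightarrow> norm (dd w0 u 1) \<le> K0"
    by (rule compact_image_norm_bound[OF cT
        continuous_on_subset[OF chol_on_continuous[OF chol_on_dd[OF open_strip w0]] TS], of 1]) blast
  define K where "K = max K0 1"
  have cd: "cdiff w0 u" if "\<bar>Im u\<bar> < r0" for u using w0 that by (auto simp: chol_on_def)
  have per: "dd w0 (u + 2 * pi) 1 = dd w0 u 1" if u: "\<bar>Im u\<bar> < r0" for u
  proof -
    have "((\<lambda>u. u + 2 * pi) has_derivative (\<lambda>h. h)) (at u)" by (auto intro!: derivative_eq_intros)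
    moreover have "(w0 has_derivative dd w0 (u + 2 * pi)) (at (u + 2 * pi))"
      by (intro cdiff_has_derivative cd) (use u in simp)
    ultimately have "((\<lambda>u. w0 (u + 2 * pi)) has_derivative dd w0 (u + 2 * pi)) (at u)"
      by (rule has_derivative_compose)
    then have "(w0 has_derivative dd w0 (u + 2 * pi)) (at u)"
      by (rule has_derivative_transform_within_open[OF _ open_strip]) (use u w0_periodic in auto)
    then show ?thesis using dd_eq by metis
  qed
  have K: "norm (dd w0 u 1) \<le> K" if u: "\<bar>Im u\<bar> \<le> r0 / 2" for u
  proof -
    have "(\<lambda>s. dd w0 (Complex s (Im u)) 1) (s + 2 * pi) = (\<lambda>s. dd w0 (Complex s (Im u)) 1) s" for s
          proof -
      have "Complex (s + 2 * pi) (Im u) = Complex s (Im u) + 2 * pi" by (simp add: complex_eq_iff)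
      then show ?thesis using per[of "Complex s (Im u)"] u r0 by simp
    qed
    then obtain s where s: "s \<in> {0..<2*pi}" "dd w0 (Complex s (Im u)) 1 = dd w0 (Complex (Re u) (Im u)) 1"
      using periodic_reduce[of "\<lambda>s. dd w0 (Complex s (Im u)) 1" "Re u"] by metis
    have "Complex s (Im u) \<in> T" using s u by (auto simp: T_def in_cbox_complex_iff abs_le_iff)
    then show ?thesis using K0 s(2) by (fastforce simp: K_def)
  qed
  define r where "r = min (min (r0 / 2) 1) (\<rho> / K)"
  have Kpos: "0 < K" by (simp add: K_def)
  show thesis
  proof (rule that)
    show "0 < r" "r \<le> 1" "r < r0" "0 < K" using r0 assms Kpos by (auto simp: r_def)
    fix u assume u: "\<bar>Im u\<bar> < r"
    have u2: "\<bar>Im u\<bar> \<le> r0 / 2" using u by (simp add: r_def)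
    have "norm (w0 u - w0 (Re u)) \<le> K * norm (u - complex_of_real (Re u))"
    proof (rule differentiable_bound[of "{u. \<bar>Im u\<bar> \<le> r0 / 2}"])
      have "{u. \<bar>Im u\<bar> \<le> r0 / 2} = {u. Im u \<le> r0 / 2} \<inter> {u. Im u \<ge> - (r0 / 2)}" by (auto simp: abs_le_iff)
      then show "convex {u. \<bar>Im u\<bar> \<le> r0 / 2}"
        by (metis convex_Int convex_halfspace_Im_le convex_halfspace_Im_ge)
      fix z assume z: "z \<in> {u. \<bar>Im u\<bar> \<le> r0 / 2}"
      then have cz: "cdiff w0 z" using r0 by (intro cd) auto
      show "(w0 has_derivative dd w0 z) (at z within {u. \<bar>Im u\<bar> \<le> r0 / 2})"
        using cdiff_has_derivative[OF cz] has_derivative_at_withinI by blast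
      have "norm (dd w0 z h) \<le> K * norm h" for h
        using dd_cscale[OF cz, of h 1] K[of z] z mult_right_mono[of "norm (dd w0 z 1)" K "norm h"]
        by (simp add: mult.commute)
      then show "onorm (dd w0 z) \<le> K" using Kpos by (intro onorm_bound) auto
    qed (use u2 r0 in auto)
    also have "norm (u - complex_of_real (Re u)) = \<bar>Im u\<bar>" by (simp add: cmod_eq_Im)
    also have "K * \<bar>Im u\<bar> \<le> K * (\<rho> / K)" using u Kpos by (intro mult_left_mono) (auto simp: r_def)
    finally show "norm (dd w0 u 1) \<le> K \<and> norm (w0 u - w0 (Re u)) \<le> \<rho>" using K[OF u2] Kpos by simp
  qed
qed

text \<open>The values of the Picard iterates converge uniformly, and Weierstrass then gives
  convergence of the derivatives at each point. The weighted derivative bounds close the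
  contraction, because \<open>F\<close> involves the \<open>u\<close>-derivative.\<close>

lemma solution:
  obtains R w where "0 < R" "R \<le> r0" "chol_on w {x. \<bar>Im (fst x)\<bar> < R \<and> cmod (snd x) < R}"
    "\<And>u. \<bar>Im u\<bar> < R \<Longrightarrow> w (u, 0) = w0 u"
    "\<And>x. \<bar>Im (fst x)\<bar> < R \<Longrightarrow> cmod (snd x) < R \<Longrightarrow>
      w x \<in> Q \<and> dd w x (0, 1) = G (w x) (dd w x (1, 0)) \<and> w (x + (complex_of_real (2 * pi), 0)) = w x"
    "\<And>s t::real. \<bar>t\<bar> < R \<Longrightarrow> im (w (of_real s, of_real t)) = 0"
proof -
  obtain \<rho> C L where \<rho>: "0 < \<rho>" and CL: "0 < C" "0 < L"
    and CQ: "\<And>t x m. x \<in> cball (w0 (of_real t)) (2 * \<rho>) \<Longrightarrow> x \<in> Q \<and> norm (G x m) \<le> C * norm m"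
    and LQ: "\<And>t x y m. x \<in> cball (w0 (of_real t)) (2 * \<rho>) \<Longrightarrow> y \<in> cball (w0 (of_real t)) (2 * \<rho>) \<Longrightarrow>
      norm (G x m - G y m) \<le> L * norm (x - y) * norm m"
    using bounds_near_data by metis
  obtain r K where r: "0 < r" "r \<le> 1" "r < r0" and K: "0 < K"
    and w0b: "\<And>u. \<bar>Im u\<bar> < r \<Longrightarrow> norm (dd w0 u 1) \<le> K \<and> norm (w0 u - w0 (Re u)) \<le> \<rho>"
    using data_bounds[OF \<rho>] by metis
  \<comment> \<open>Collects three demands on the slope:
    \<open>4 * C * K * \<eta> \<le> \<rho>\<close> keeps the values near the data,
    \<open>12 * C * \<eta> \<le> 1\<close> keeps the weighted derivative below \<open>2 * K\<close>,
    and the last makes the Picard map halve distances.\<close>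
  define T where "T = 12 * C + 4 * C * K / \<rho> + 12 * (2 * L * K + C) + 1"
  define \<eta> where "\<eta> = 1 / T"
  have parts: "0 < C" "0 < 4 * C * K / \<rho>" "0 < 12 * (2 * L * K + C)"
    using CL K \<rho> by (auto intro!: add_pos_pos)
  have T: "0 < T" "12 * C \<le> T" "4 * C * K / \<rho> \<le> T" "12 * (2 * L * K + C) \<le> T"
    unfolding T_def using parts by linarith+
  have \<eta>: "0 < \<eta>" "12 * C * \<eta> \<le> 1" "4 * C * K * \<eta> \<le> \<rho>" "12 * (2 * L * K + C) * \<eta> \<le> 1"
    using T \<rho> by (auto simp: \<eta>_def divide_le_eq le_divide_eq mult.commute)
  define \<Omega> where "\<Omega> = cone \<eta> r"
  define d where "d = depth \<eta> r"
  have op: "open \<Omega>" and star: "vstar \<Omega>" unfolding \<Omega>_def using open_cone vstar_cone \<eta> by auto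
  have d: "0 < d x" "d x \<le> 1" "\<bar>Im (fst x)\<bar> < r" if "x \<in> \<Omega>" for x
  proof -
    have "0 \<le> cmod (snd x) / \<eta>" using \<eta> by simp
    then show "0 < d x" "d x \<le> 1" "\<bar>Im (fst x)\<bar> < r"
      using that r unfolding \<Omega>_def cone_def d_def depth_def by auto
  qed
  define p :: "complex \<times> complex" where "p = (complex_of_real (2 * pi), 0)"
  have shift: "x + p \<in> \<Omega> \<longleftrightarrow> x \<in> \<Omega>" for x
    by (simp add: \<Omega>_def cone_def depth_def p_def)
  define F :: "(complex \<times> complex \<Rightarrow> 'w) \<Rightarrow> complex \<times> complex \<Rightarrow> 'w" where "F w x = G (w x) (dd w x (1, 0))" for w x
  \<comment> \<open>The Picard map: a fixed point satisfies the equation integrated in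
    \<open>v\<close> from the axis.\<close>
  define A where "A w x = w0 (fst x) + prim (F w) x" for w x
  \<comment> \<open>The set preserved by the iteration. Periodicity and reality on real points are
    carried along from the start and pass to the limit.\<close>
  define Inv where "Inv w \<longleftrightarrow> chol_on w \<Omega> \<and>
      (\<forall>x\<in>\<Omega>. norm (w x - w0 (fst x)) \<le> \<rho> \<and> norm (dd w x (1, 0)) \<le> 2 * K / sqrt (d x) \<and> w (x + p) = w x) \<and>
      (\<forall>s t::real. (of_real s, of_real t) \<in> \<Omega> \<longrightarrow> im (w (of_real s, of_real t)) = 0)" for w
  have near: "y \<in> cball (w0 (of_real (Re (fst x)))) (2 * \<rho>)" if "x \<in> \<Omega>" "norm (y - w0 (fst x)) \<le> \<rho>" for x y
    using w0b[of "fst x"] d(3)[OF that(1)] that(2)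
      norm_triangle_ineq[of "y - w0 (fst x)" "w0 (fst x) - w0 (Re (fst x))"]
    by (simp add: dist_norm norm_minus_commute)
  have wnear: "w x \<in> cball (w0 (of_real (Re (fst x)))) (2 * \<rho>)" if "Inv w" "x \<in> \<Omega>" for w x
    using near[OF that(2)] that by (simp add: Inv_def)
  have cdw: "cdiff w x" if "Inv w" "x \<in> \<Omega>" for w x using that by (simp add: Inv_def chol_on_def)
  have FQ: "chol_on (F w) \<Omega>" if I: "Inv w" for w
    unfolding chol_on_def
  proof
    fix x assume x: "x \<in> \<Omega>"
    have 1: "cdiff (\<lambda>x. (w x, dd w x (1, 0))) x"
      using I chol_on_dd[OF op, of w] x by (intro cdiff_Pair) (auto simp: Inv_def chol_on_def)
    have "w x \<in> Q" using CQ wnear[OF I x] by blast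
    then have "cdiff (\<lambda>(x, m). G x m) (w x, dd w x (1, 0))" using G by (simp add: chol_on_def)
    from cdiff_compose[OF this 1] show "cdiff (F w) x" by (simp add: F_def[abs_def])
  qed
  have Fb: "norm (F w x) \<le> 2 * C * K / sqrt (d x)" if I: "Inv w" and x: "x \<in> \<Omega>" for w x
  proof -
    have "norm (F w x) \<le> C * norm (dd w x (1, 0))" unfolding F_def using CQ wnear[OF I x] by blast
    also have "\<dots> \<le> C * (2 * K / sqrt (d x))" using I x CL by (intro mult_left_mono) (auto simp: Inv_def)
    finally show ?thesis by (simp add: mult_ac)
  qed
  have w0f: "cdiff (\<lambda>x. w0 (fst x)) x" "dd (\<lambda>x. w0 (fst x)) x h = dd w0 (fst x) (fst h)"
    if "x \<in> \<Omega>" for x :: "complex \<times> complex" and h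
  proof -
    have 1: "cdiff w0 (fst x)" using w0 d(3)[OF that] r by (simp add: chol_on_def)
    have 2: "cdiff fst x" using cdiff_fst[OF cdiff_id] .
    show "cdiff (\<lambda>x. w0 (fst x)) x" by (rule cdiff_compose[OF 1 2])
    have "dd fst x = (fst :: complex \<times> complex \<Rightarrow> complex)"
      by (rule dd_eq) (auto intro!: derivative_eq_intros)
    then show "dd (\<lambda>x. w0 (fst x)) x h = dd w0 (fst x) (fst h)"
      using dd_compose[OF 1 2] by simp
  qed
  have w0K: "norm (dd (\<lambda>x. w0 (fst x)) x (1, 0)) \<le> K / sqrt (d x)" if "x \<in> \<Omega>" for x
  proof -
    have "sqrt (d x) \<le> 1" "0 < sqrt (d x)" using d[OF that] by auto
    then have "K \<le> K / sqrt (d x)" using K by (simp add: le_divide_eq mult_left_le)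
    moreover have "norm (dd w0 (fst x) 1) \<le> K" using w0b d(3)[OF that] by blast
    ultimately show ?thesis using w0f(2)[OF that, of "(1, 0)"] by simp
  qed
  have primF: "cdiff (prim (F w)) x" "norm (prim (F w) x) \<le> 2 * \<eta> * (2 * C * K)"
    "norm (dd (prim (F w)) x (1, 0)) \<le> 6 * \<eta> * (2 * C * K) / sqrt (d x)"
    "dd (prim (F w)) x (0, 1) = F w x" if I: "Inv w" and x: "x \<in> \<Omega>" for w x
    using prim_cdiff[OF op star FQ[OF I] x]
      prim_bounds[OF \<eta>(1) r(2) FQ[OF I, unfolded \<Omega>_def] Fb[OF I, unfolded \<Omega>_def d_def] x[unfolded \<Omega>_def]]
    by (auto simp: d_def)
  have dA: "cdiff (A w) x" "dd (A w) x h = dd w0 (fst x) (fst h) + dd (prim (F w)) x h"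
    if I: "Inv w" and x: "x \<in> \<Omega>" for w x h
    unfolding A_def[abs_def] using dd_add[OF w0f(1)[OF x] primF(1)[OF I x]] w0f(2)[OF x]
    by (auto intro: cdiff_add w0f(1)[OF x] primF(1)[OF I x])
  \<comment> \<open>Along a real line \<open>im\<close> of \<open>w\<close> vanishes identically,
    hence so does its derivative there, and \<open>w_u\<close> is real as \<open>G_real\<close>
    demands.\<close>
  have Freal: "im (F w (of_real s, of_real t)) = 0"
    if I: "Inv w" and x: "(of_real s, of_real t) \<in> \<Omega>" for w and s t :: real
  proof -
    have mem: "(of_real s', of_real t) \<in> \<Omega>" for s' :: real
      using x by (simp add: \<Omega>_def cone_def depth_def)
    have "((\<lambda>s'::real. (complex_of_real s', complex_of_real t)) has_derivative (\<lambda>h. (of_real h, 0))) (at s)"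
      by (auto intro!: derivative_eq_intros)
    from has_derivative_compose[OF this cdiff_has_derivative[OF cdw[OF I x]]]
    have "((\<lambda>s'. im (w (of_real s', of_real t))) has_derivative (\<lambda>h. im (dd w (of_real s, of_real t) (of_real h, 0)))) (at s)"
      using im linear_conv_bounded_linear bounded_linear.has_derivative by blast
    moreover have "(\<lambda>s'. im (w (of_real s', of_real t))) = (\<lambda>_. 0)"
      using I mem by (auto simp: Inv_def)
    ultimately have "(\<lambda>h. im (dd w (of_real s, of_real t) (of_real h, 0))) = (\<lambda>_. 0)"
      using has_derivative_unique has_derivative_const by metis
    then have "im (dd w (of_real s, of_real t) (1, 0)) = 0" by (metis of_real_1)
    moreover have "w (of_real s, of_real t) \<in> Q" using CQ wnear[OF I x] by blast
    ultimately show ?thesis using I x G_real by (auto simp: F_def Inv_def)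
  qed
  have InvA: "Inv (A w)" if I: "Inv w" for w
    unfolding Inv_def
  proof (intro conjI ballI allI impI)
    show "chol_on (A w) \<Omega>" using dA(1)[OF I] by (simp add: chol_on_def)
    fix x assume x: "x \<in> \<Omega>"
    have "norm (prim (F w) x) \<le> 4 * C * K * \<eta>" using primF(2)[OF I x] by (simp add: mult_ac)
    also have "\<dots> \<le> \<rho>" by (rule \<eta>)
    finally show "norm (A w x - w0 (fst x)) \<le> \<rho>" by (simp add: A_def)
    have "norm (dd (A w) x (1, 0)) \<le> norm (dd w0 (fst x) 1) + norm (dd (prim (F w)) x (1, 0))"
      using dA(2)[OF I x, of "(1, 0)"] norm_triangle_ineq by simp
    also have "\<dots> \<le> K / sqrt (d x) + (12 * C * \<eta>) * K / sqrt (d x)"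
      using w0K[OF x] w0f(2)[OF x, of "(1, 0)"] primF(3)[OF I x] by (simp add: mult_ac)
    also have "\<dots> \<le> K / sqrt (d x) + 1 * K / sqrt (d x)"
      using \<eta>(2) K d[OF x] by (intro add_left_mono divide_right_mono mult_right_mono) auto
    finally show "norm (dd (A w) x (1, 0)) \<le> 2 * K / sqrt (d x)" by simp
    have Fper: "F w (y + p) = F w y" if y: "y \<in> \<Omega>" for y
    proof -
      have "((\<lambda>y. y + p) has_derivative (\<lambda>h. h)) (at y)" by (auto intro!: derivative_eq_intros)
      moreover have "(w has_derivative dd w (y + p)) (at (y + p))"
        by (intro cdiff_has_derivative cdw[OF I]) (use shift y in simp)
      ultimately have "((\<lambda>y. w (y + p)) has_derivative dd w (y + p)) (at y)"
        by (rule has_derivative_compose)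
      then have "(w has_derivative dd w (y + p)) (at y)"
        by (rule has_derivative_transform_within_open[OF _ op y]) (use I in \<open>auto simp: Inv_def\<close>)
      then have "dd w y = dd w (y + p)" by (rule dd_eq)
      then show ?thesis using I y by (simp add: F_def Inv_def)
    qed
    have "vmean (F w) (x + p) = vmean (F w) x"
      unfolding vmean_def
    proof (rule integral_cong)
      fix t :: real assume "t \<in> {0..1}"
      from Fper[OF vstarD[OF star x this]]
      show "F w (fst (x + p), t *\<^sub>R snd (x + p)) = F w (fst x, t *\<^sub>R snd x)" by (simp add: p_def)
    qed
    moreover have "w0 (fst x + 2 * pi) = w0 (fst x)" using w0_periodic d(3)[OF x] r by simp
    ultimately show "A w (x + p) = A w x" by (simp add: A_def prim_def) (simp add: p_def)
  next
    fix s t :: real assume x: "(complex_of_real s, complex_of_real t) \<in> \<Omega>"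
    define y where "y = (complex_of_real s, complex_of_real t)"
    have y: "y \<in> \<Omega>" using x by (simp add: y_def)
    have bl: "bounded_linear im" using im linear_conv_bounded_linear by blast
    have "im (vmean (F w) y) = integral {0..1} (im \<circ> (\<lambda>t. F w (fst y, t *\<^sub>R snd y)))"
      unfolding vmean_def
      by (rule integral_linear[symmetric, OF integrable_continuous_real[OF continuous_on_ray[OF chol_on_continuous[OF FQ[OF I]] star y]] bl])
    also have "\<dots> = integral {0..1} (\<lambda>_::real. 0)"
    proof (rule integral_cong)
      fix k :: real assume "k \<in> {0..1}"
      from vstarD[OF star y this] have m: "(complex_of_real s, complex_of_real (k * t)) \<in> \<Omega>"
        by (simp add: y_def scaleR_conv_of_real)
      show "(im \<circ> (\<lambda>t. F w (fst y, t *\<^sub>R snd y))) k = 0"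
        using Freal[OF I m] by (simp add: y_def scaleR_conv_of_real)
    qed
    finally have "im (prim (F w) y) = 0"
      using linear_cmul[OF im] by (simp add: prim_def y_def)
    then show "im (A w (complex_of_real s, complex_of_real t)) = 0"
      using w0_real linear_add[OF im] by (simp add: A_def y_def)
  qed
  \<comment> \<open>Distance is the larger of the sup of the values and the sup of the
    \<open>u\<close>-derivatives weighted by the root of the depth; \<open>E\<close> bounds
    both.\<close>
  have contr: "norm (A w x - A w' x) \<le> E / 2 \<and> norm (dd (A w) x (1, 0) - dd (A w') x (1, 0)) \<le> (E / 2) / sqrt (d x)"
    if I: "Inv w" "Inv w'" and E: "\<And>x. x \<in> \<Omega> \<Longrightarrow> norm (w x - w' x) \<le> E \<and> norm (dd w x (1, 0) - dd w' x (1, 0)) \<le> E / sqrt (d x)"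
      and x: "x \<in> \<Omega>" for w w' E x
  proof -
    define H where "H x = F w x - F w' x" for x
    define M where "M = E * (2 * L * K + C)"
    have E0: "0 \<le> E" using E[OF x] norm_ge_zero order_trans by blast
    have H: "chol_on H \<Omega>" unfolding H_def[abs_def] by (intro chol_on_diff FQ I)
    have Hb: "norm (H y) \<le> M / sqrt (d y)" if y: "y \<in> \<Omega>" for y
    proof -
      let ?m = "dd w y (1, 0)" and ?m' = "dd w' y (1, 0)"
      have "w' y \<in> Q" using CQ wnear[OF I(2) y] by blast
      \<comment> \<open>Linearity in \<open>m\<close> separates the change of the coefficients,
        controlled by \<open>L\<close>, from the change of the derivative, controlled by
        \<open>C\<close>.\<close>
      then have "H y = (G (w y) ?m - G (w' y) ?m) + G (w' y) (?m - ?m')"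
        using linear_diff[OF G_linear] by (simp add: H_def F_def)
      then have "norm (H y) \<le> norm (G (w y) ?m - G (w' y) ?m) + norm (G (w' y) (?m - ?m'))"
        by (simp only: norm_triangle_ineq)
      also have "\<dots> \<le> L * norm (w y - w' y) * norm ?m + C * norm (?m - ?m')"
        using LQ[OF wnear[OF I(1) y] wnear[OF I(2) y]] CQ wnear[OF I(2) y] by (intro add_mono) blast+
      also have "\<dots> \<le> L * E * (2 * K / sqrt (d y)) + C * (E / sqrt (d y))"
        using E[OF y] I(1) y CL E0 by (intro add_mono mult_mono mult_nonneg_nonneg) (auto simp: Inv_def)
      also have "\<dots> = M / sqrt (d y)" by (simp add: M_def algebra_simps add_divide_distrib)
      finally show ?thesis .
    qed
    note pb = prim_bounds[OF \<eta>(1) r(2) H[unfolded \<Omega>_def] Hb[unfolded \<Omega>_def d_def] x[unfolded \<Omega>_def]]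
    have pd: "prim H y = prim (F w) y - prim (F w') y" if "y \<in> \<Omega>" for y
      unfolding H_def[abs_def] by (rule prim_diff[OF _ _ star that]) (auto intro!: chol_on_continuous FQ I)
    have small: "6 * \<eta> * M \<le> E / 2"
    proof -
      have "6 * \<eta> * M = (12 * (2 * L * K + C) * \<eta>) * (E / 2)" by (simp add: M_def algebra_simps)
      also have "\<dots> \<le> 1 * (E / 2)" by (intro mult_right_mono \<eta>) (use E0 in simp)
      finally show ?thesis by simp
    qed
    have M0: "0 \<le> M" using E0 CL K by (simp add: M_def)
    have "norm (A w x - A w' x) = norm (prim H x)" using pd[OF x] by (simp add: A_def)
    also have "\<dots> \<le> 2 * \<eta> * M" by (rule pb)
    also have "\<dots> \<le> E / 2" using small M0 \<eta>(1) mult_nonneg_nonneg[of \<eta> M] by linarith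
    finally have 1: "norm (A w x - A w' x) \<le> E / 2" .
    have "(prim H has_derivative (\<lambda>h. dd (prim (F w)) x h - dd (prim (F w')) x h)) (at x)"
      by (rule has_derivative_transform_within_open[OF has_derivative_diff[OF
            cdiff_has_derivative[OF primF(1)[OF I(1) x]] cdiff_has_derivative[OF primF(1)[OF I(2) x]]] op x])
         (simp add: pd)
    from dd_eq[OF this]
    have "norm (dd (A w) x (1, 0) - dd (A w') x (1, 0)) = norm (dd (prim H) x (1, 0))"
      using dA(2)[OF I(1) x] dA(2)[OF I(2) x] by simp
    also have "\<dots> \<le> 6 * \<eta> * M / sqrt (d x)" unfolding d_def by (rule pb)
    also have "\<dots> \<le> (E / 2) / sqrt (d x)" using small d[OF x] by (intro divide_right_mono) auto
    finally show ?thesis using 1 by simp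
  qed
  define W where "W n = (A ^^ n) (\<lambda>x. w0 (fst x))" for n
  have W_Suc: "W (Suc n) = A (W n)" for n by (simp add: W_def)
  have Inv0: "Inv (\<lambda>x. w0 (fst x))"
    unfolding Inv_def
  proof (intro conjI ballI allI impI)
    show "chol_on (\<lambda>x. w0 (fst x)) \<Omega>" using w0f by (simp add: chol_on_def)
    fix x assume x: "x \<in> \<Omega>"
    show "norm (w0 (fst x) - w0 (fst x)) \<le> \<rho>" using \<rho> by simp
    have "0 \<le> K / sqrt (d x)" using K d[OF x] by simp
    then show "norm (dd (\<lambda>x. w0 (fst x)) x (1, 0)) \<le> 2 * K / sqrt (d x)"
      using w0K[OF x] by simp
    show "w0 (fst (x + p)) = w0 (fst x)" using w0_periodic[of "fst x"] d(3)[OF x] r by (simp add: p_def)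
  qed (simp add: w0_real)
  have InvW: "Inv (W n)" for n
    by (induction n) (use Inv0 InvA in \<open>auto simp: W_def\<close>)
  \<comment> \<open>The first correction is at most \<open>\<rho>\<close> in value, and two
    derivative bounds \<open>2 * K\<close> add up to \<open>4 * K\<close>.\<close>
  define E0 where "E0 = max \<rho> (4 * K)"
  have Wdiff: "\<forall>x\<in>\<Omega>. norm (W (Suc n) x - W n x) \<le> E0 / 2 ^ n \<and>
      norm (dd (W (Suc n)) x (1, 0) - dd (W n) x (1, 0)) \<le> (E0 / 2 ^ n) / sqrt (d x)" for n
  proof (induction n)
    case 0
    show ?case
    proof
      fix x assume x: "x \<in> \<Omega>"
      have "W 0 x = w0 (fst x)" by (simp add: W_def)
      then have 1: "norm (W 1 x - W 0 x) \<le> \<rho>" using InvW[of 1] x by (simp add: Inv_def)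
      have "norm (dd (W 1) x (1, 0)) \<le> 2 * K / sqrt (d x)" "norm (dd (W 0) x (1, 0)) \<le> 2 * K / sqrt (d x)"
        using InvW x by (auto simp: Inv_def)
      then have "norm (dd (W 1) x (1, 0) - dd (W 0) x (1, 0)) \<le> 2 * K / sqrt (d x) + 2 * K / sqrt (d x)"
        using norm_triangle_ineq4 order_trans add_mono by meson
      also have "\<dots> = 4 * K / sqrt (d x)" by simp
      also have "\<dots> \<le> E0 / sqrt (d x)" using d[OF x] by (intro divide_right_mono) (auto simp: E0_def)
      finally show "norm (W (Suc 0) x - W 0 x) \<le> E0 / 2 ^ 0 \<and>
          norm (dd (W (Suc 0)) x (1, 0) - dd (W 0) x (1, 0)) \<le> (E0 / 2 ^ 0) / sqrt (d x)"
        using 1 by (simp add: E0_def)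
    qed
  next
    case (Suc n)
    show ?case
    proof
      fix x assume x: "x \<in> \<Omega>"
      from contr[OF InvW InvW _ x, of "Suc n" n "E0 / 2 ^ n"] Suc
      show "norm (W (Suc (Suc n)) x - W (Suc n) x) \<le> E0 / 2 ^ Suc n \<and>
          norm (dd (W (Suc (Suc n))) x (1, 0) - dd (W (Suc n)) x (1, 0)) \<le> (E0 / 2 ^ Suc n) / sqrt (d x)"
        by (simp add: W_Suc mult.commute)
    qed
  qed
  \<comment> \<open>The limit as a telescoping series, to which the Weierstrass M-test
    applies.\<close>
  define w where "w x = w0 (fst x) + (\<Sum>n. W (Suc n) x - W n x)" for x
  have lim: "uniform_limit \<Omega> W w sequentially"
  proof -
    have "uniform_limit \<Omega> (\<lambda>n x. \<Sum>i<n. W (Suc i) x - W i x) (\<lambda>x. \<Sum>n. W (Suc n) x - W n x) sequentially"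
    proof (rule Weierstrass_m_test)
      show "norm (W (Suc n) x - W n x) \<le> E0 * (1 / 2) ^ n" if "x \<in> \<Omega>" for n x
        using Wdiff[of n] that by (simp add: power_one_over)
    qed (intro summable_mult summable_geometric, simp)
    then have "uniform_limit \<Omega> (\<lambda>n x. w0 (fst x) + (\<Sum>i<n. W (Suc i) x - W i x)) w sequentially"
      unfolding w_def[abs_def] by (intro uniform_limit_intros)
    moreover have "w0 (fst x) + (\<Sum>i<n. W (Suc i) x - W i x) = W n x" for n x
      unfolding sum_lessThan_telescope[of "\<lambda>i. W i x" n] by (simp add: W_def)
    ultimately show ?thesis by simp
  qed
  have Wchol: "chol_on (W n) \<Omega>" for n using InvW by (simp add: Inv_def)
  note cw = cdiff_uniform_limit[OF op Wchol lim]
  note ptw = tendsto_uniform_limitI[OF lim]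
  \<comment> \<open>Less than half of \<open>r\<close> is spent on the imaginary part of
    \<open>u\<close> and less than half on \<open>v\<close>, so this product domain lies in the
    cone.\<close>
  define R where "R = min (r / 2) (\<eta> * r / 2)"
  have RO: "x \<in> \<Omega>" if "\<bar>Im (fst x)\<bar> < R" "cmod (snd x) < R" for x
  proof -
    have "cmod (snd x) / \<eta> < r / 2" using that(2) \<eta>(1) by (simp add: R_def divide_less_eq mult.commute)
    moreover have "\<bar>Im (fst x)\<bar> < r / 2" using that(1) by (simp add: R_def)
    ultimately have "0 < r - \<bar>Im (fst x)\<bar> - cmod (snd x) / \<eta>" by linarith
    then show ?thesis by (simp add: \<Omega>_def cone_def depth_def)
  qed
  have R: "0 < R" using r \<eta> by (simp add: R_def)
  show thesis
  proof (rule that[OF R])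
    show "R \<le> r0" using r by (simp add: R_def)
    show "chol_on w {x. \<bar>Im (fst x)\<bar> < R \<and> cmod (snd x) < R}"
      using cw(1) RO by (auto simp: chol_on_def)
    fix u assume u: "\<bar>Im u\<bar> < R"
    have Wu: "W n (u, 0) = w0 u" for n
      by (cases n) (auto simp: W_Suc A_def prim_0, simp add: W_def)
    have "(u, 0) \<in> \<Omega>" by (rule RO) (use u R in auto)
    then show "w (u, 0) = w0 u" by (rule LIMSEQ_const_eq[OF ptw Wu])
  next
    fix x assume x': "\<bar>Im (fst x)\<bar> < R" "cmod (snd x) < R"
    then have x: "x \<in> \<Omega>" by (rule RO)
    have "norm (w x - w0 (fst x)) \<le> \<rho>"
    proof (rule tendsto_upperbound)
      show "(\<lambda>n. norm (W n x - w0 (fst x))) \<longlonglongrightarrow> norm (w x - w0 (fst x))"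
        by (intro tendsto_intros ptw x)
      show "\<forall>\<^sub>F n in sequentially. norm (W n x - w0 (fst x)) \<le> \<rho>"
        using InvW x by (auto simp: Inv_def)
    qed simp
    then have wQ: "w x \<in> Q" using near[OF x] CQ by blast
    have "cdiff (\<lambda>(x, m). G x m) (w x, dd w x (1, 0))" using G wQ by (simp add: chol_on_def)
    then have "isCont (\<lambda>(x, m). G x m) (w x, dd w x (1, 0))" by (rule cdiff_isCont)
    then have "(\<lambda>n. (\<lambda>(x, m). G x m) (W n x, dd (W n) x (1, 0))) \<longlonglongrightarrow> (\<lambda>(x, m). G x m) (w x, dd w x (1, 0))"
      by (rule isCont_tendsto_compose) (intro tendsto_Pair ptw x cw)
    moreover have "dd (W (Suc n)) x (0, 1) = (\<lambda>(x, m). G x m) (W n x, dd (W n) x (1, 0))" for n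
    proof -
      have "linear (dd w0 (fst x))" using w0 d(3)[OF x] r by (intro dd_linear) (simp add: chol_on_def)
      then have "dd w0 (fst x) 0 = 0" by (rule linear_0)
      then show ?thesis
        using dA(2)[OF InvW x, of n "(0, 1)"] primF(4)[OF InvW x, of n] by (simp add: W_Suc F_def)
    qed
    ultimately have "(\<lambda>n. dd (W (Suc n)) x (0, 1)) \<longlonglongrightarrow> G (w x) (dd w x (1, 0))" by simp
    moreover have "(\<lambda>n. dd (W (Suc n)) x (0, 1)) \<longlonglongrightarrow> dd w x (0, 1)"
      by (rule LIMSEQ_Suc) (rule cw(2)[OF x])
    ultimately have eq: "dd w x (0, 1) = G (w x) (dd w x (1, 0))" by (rule LIMSEQ_unique[rotated])
    have "(\<lambda>n. W n (x + p)) \<longlonglongrightarrow> w (x + p)" by (rule ptw) (simp add: shift x)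
    moreover have "W n (x + p) = W n x" for n using InvW x by (simp add: Inv_def)
    ultimately have "(\<lambda>n. W n x) \<longlonglongrightarrow> w (x + p)" by simp
    then have "w (x + p) = w x" by (rule LIMSEQ_unique[OF _ ptw[OF x]])
    then show "w x \<in> Q \<and> dd w x (0, 1) = G (w x) (dd w x (1, 0)) \<and> w (x + (complex_of_real (2 * pi), 0)) = w x"
      using wQ eq by (simp add: p_def)
  next
    fix s t :: real assume t: "\<bar>t\<bar> < R"
    have x: "(complex_of_real s, complex_of_real t) \<in> \<Omega>" by (rule RO) (use t R in auto)
    have "(\<lambda>n. im (W n (of_real s, of_real t))) \<longlonglongrightarrow> im (w (of_real s, of_real t))"
      using bounded_linear.tendsto[OF _ ptw[OF x]] im linear_conv_bounded_linear by blast
    moreover have "im (W n (of_real s, of_real t)) = 0" for n using InvW x by (simp add: Inv_def)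
    ultimately show "im (w (of_real s, of_real t)) = 0" by (rule LIMSEQ_const_eq)
  qed
qed

end

section \<open>Holomorphic extension of real analytic functions\<close>

text \<open>The inclusion of R^n in C^n with its real and imaginary parts. The extension theory is
  developed once and serves the real line, the parameter plane and the five-dimensional space of
  jets.\<close>

locale complexification =
  fixes \<iota> :: "'a::euclidean_space \<Rightarrow> 'c::complex_space" and re im :: "'c \<Rightarrow> 'a"
  assumes linear_iota: "linear \<iota>" and linear_re: "linear re" and linear_im: "linear im"
    and decomp: "\<iota> (re z) + jop (\<iota> (im z)) = z"
    and re_iota [simp]: "re (\<iota> x) = x" and im_iota [simp]: "im (\<iota> x) = 0"
    and re_jop: "re (jop z) = - im z" and im_jop: "im (jop z) = re z"
    and norm_iota [simp]: "norm (\<iota> x) = norm x" and norm_re: "norm (re z) \<le> norm z"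
begin

lemma norm_im: "norm (im z) \<le> norm z"
  using norm_re[of "jop z"] by (simp add: re_jop)

lemma dist_iota [simp]: "dist (\<iota> x) (\<iota> y) = dist x y"
  by (simp add: dist_norm flip: linear_diff[OF linear_iota])

lemma iota_re_ball: "z \<in> ball (\<iota> a) r \<Longrightarrow> \<iota> (re z) \<in> ball (\<iota> a) r"
  using norm_re[of "\<iota> a - z"] by (simp add: dist_norm linear_diff[OF linear_re] flip: linear_diff[OF linear_iota])

text \<open>A point \<open>x + iy\<close> lies on the complex line through \<open>x\<close> with real direction \<open>y\<close>.\<close>

lemma identity_theorem:
  fixes f :: "'c \<Rightarrow> complex"
  assumes T: "open T" "convex T" "\<And>z. z \<in> T \<Longrightarrow> \<iota> (re z) \<in> T"
    and f: "chol_on f T" and 0: "\<And>x. \<iota> x \<in> T \<Longrightarrow> f (\<iota> x) = 0" and z: "z \<in> T"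
  shows "f z = 0"
proof -
  define line where "line l = \<iota> (re z) + l *\<^sub>C \<iota> (im z)" for l
  define T' where "T' = line -` T"
  have line_i: "line \<i> = z" using decomp[of z] by (simp add: line_def cscale_def)
  have line_real: "line (of_real t) = \<iota> (re z + t *\<^sub>R im z)" for t
    by (simp add: line_def linear_add[OF linear_iota] linear_cmul[OF linear_iota])
  have cl: "cdiff line l" for l unfolding line_def[abs_def] by (rule cdiff_line)
  have T'op: "open T'"
    unfolding T'_def using T(1) by (rule open_vimage)
      (meson cl cdiff_isCont continuous_at_imp_continuous_on)
  have "convex T'"
    unfolding convex_alt
  proof (intro ballI allI impI)
    fix x y and u :: real assume xy: "x \<in> T'" "y \<in> T'" and u: "0 \<le> u \<and> u \<le> 1"
    have "line ((1 - u) *\<^sub>R x + u *\<^sub>R y) = (1 - u) *\<^sub>R line x + u *\<^sub>R line y"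
      by (simp add: line_def cscale_def algebra_simps)
    also have "\<dots> \<in> T" using T(2) xy u unfolding convex_alt T'_def by blast
    finally show "(1 - u) *\<^sub>R x + u *\<^sub>R y \<in> T'" by (simp add: T'_def)
  qed
  then have T'con: "connected T'" by (rule convex_connected)
  have 0: "0 \<in> T'" using T(3)[OF z] by (simp add: T'_def line_def)
  have "f (line \<i>) = 0"
  proof (rule analytic_continuation[where f="\<lambda>l. f (line l)" and S=T' and U="T' \<inter> \<real>" and \<xi>=0 and w=\<i>])
    have "chol_on (\<lambda>l. f (line l)) T'"
      using f cl by (auto simp: chol_on_def T'_def intro: cdiff_compose)
    then show "(\<lambda>l. f (line l)) holomorphic_on T'" by (rule chol_on_imp_holomorphic)
    obtain e where e: "0 < e" "ball 0 e \<subseteq> T'" using T'op 0 open_contains_ball by blast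
    show "0 islimpt T' \<inter> \<real>"
      unfolding islimpt_approachable
    proof (intro allI impI)
      fix d :: real assume d: "0 < d"
      define t where "t = min d e / 2"
      have t: "0 < t" "t < d" "t < e" using d e by (auto simp: t_def)
      then have "complex_of_real t \<in> ball 0 e" by simp
      then show "\<exists>x'\<in>T' \<inter> \<real>. x' \<noteq> 0 \<and> dist x' 0 < d"
        using e t by (intro bexI[of _ "complex_of_real t"]) auto
    qed
    show "f (line l) = 0" if "l \<in> T' \<inter> \<real>" for l
      using that assms(5) by (auto simp: T'_def Reals_def line_real)
  qed (use T'op T'con 0 line_i z in \<open>auto simp: T'_def\<close>)
  then show ?thesis by (simp add: line_i)
qed

text \<open>Real convergence at one diagonal point with all increments equal to
  \<open>\<rho>\<close> is absolute, hence dominates the series at all complex points whose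
  increments have modulus at most \<open>\<rho>\<close>. Enumerating the multi-indices by
  \<open>e\<close> turns it into an ordinary series, and Weierstrass gives holomorphy.\<close>

lemma local_extension:
  fixes f :: "'a \<Rightarrow> real"
  assumes "real_analytic_at f a"
  obtains r F where "0 < r" "chol_on F (ball (\<iota> a) r)"
    "\<And>x. \<iota> x \<in> ball (\<iota> a) r \<Longrightarrow> F (\<iota> x) = complex_of_real (f x)"
proof -
  obtain R and c :: "('a \<Rightarrow> nat) \<Rightarrow> real" where R: "0 < R"
    and sums: "\<And>x. x \<in> ball a R \<Longrightarrow>
      ((\<lambda>m. (\<Prod>b\<in>Basis. ((x - a) \<bullet> b) ^ m b) *\<^sub>R c m) has_sum f x) (Basis \<rightarrow>\<^sub>E UNIV)"
    using assms unfolding real_analytic_at_def by blast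
  define I where "I = (Basis :: 'a set) \<rightarrow>\<^sub>E (UNIV :: nat set)"
  have "inj (\<lambda>n::nat. restrict (\<lambda>_. n) (Basis :: 'a set))"
  proof (rule injI)
    fix m n :: nat assume eq: "restrict (\<lambda>_. m) (Basis :: 'a set) = restrict (\<lambda>_. n) Basis"
    obtain b :: 'a where "b \<in> Basis" using nonempty_Basis by blast
    then show "m = n" using fun_cong[OF eq, of b] by simp
  qed
  moreover have "range (\<lambda>n::nat. restrict (\<lambda>_. n) (Basis :: 'a set)) \<subseteq> I" by (auto simp: I_def)
  ultimately have inf: "infinite I" using finite_imageD finite_subset infinite_UNIV_nat by metis
  have "countable I" unfolding I_def by (intro countable_PiE) auto
  define e where "e = from_nat_into I"
  have e: "bij_betw e UNIV I" unfolding e_def using bij_betw_from_nat_into[OF \<open>countable I\<close> inf] .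
  \<comment> \<open>Half of the largest diagonal increment allowed, so that the test point
    \<open>y\<close> lies at distance \<open>R / 2\<close> from \<open>a\<close>.\<close>
  define \<rho> where "\<rho> = R / (2 * norm (\<Sum>b\<in>Basis. b :: 'a))"
  have nB: "0 < norm (\<Sum>b\<in>Basis. b :: 'a)"
  proof -
    obtain b0 :: 'a where b0: "b0 \<in> Basis" using nonempty_Basis by blast
    then have "(\<Sum>b\<in>Basis. b) \<bullet> b0 = 1"
      by (simp add: inner_sum_left inner_Basis sum.delta' if_distrib cong: if_cong)
    then show ?thesis by (metis inner_zero_left zero_less_norm_iff zero_neq_one)
  qed
  have \<rho>: "0 < \<rho>" using R nB by (simp add: \<rho>_def)
  define y where "y = a + \<rho> *\<^sub>R (\<Sum>b\<in>Basis. b)"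
  have "y \<in> ball a R" using R nB \<rho> by (simp add: y_def dist_norm) (simp add: \<rho>_def)
  from sums[OF this] have "(\<lambda>m. (\<Prod>b\<in>Basis. ((y - a) \<bullet> b) ^ m b) *\<^sub>R c m) summable_on I"
    unfolding I_def using has_sum_imp_summable by blast
  then have "(\<lambda>m. norm ((\<Prod>b\<in>Basis. ((y - a) \<bullet> b) ^ m b) *\<^sub>R c m)) summable_on I"
    by (rule summable_on_iff_abs_summable_on_real[THEN iffD1])
  moreover have "(y - a) \<bullet> b = \<rho>" if "b \<in> Basis" for b
    using that by (simp add: y_def inner_sum_left inner_Basis sum.delta' if_distrib cong: if_cong)
  ultimately have "(\<lambda>m. (\<Prod>b\<in>Basis. \<rho> ^ m b) * \<bar>c m\<bar>) summable_on I"
    using \<rho> by (simp add: abs_mult abs_prod)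
  then have "(\<lambda>n. (\<Prod>b\<in>Basis. \<rho> ^ e n b) * \<bar>c (e n)\<bar>) summable_on UNIV"
    using summable_on_reindex_bij_betw[OF e, of "\<lambda>m. (\<Prod>b\<in>Basis. \<rho> ^ m b) * \<bar>c m\<bar>"] by simp
  then have summ: "summable (\<lambda>n. (\<Prod>b\<in>Basis. \<rho> ^ e n b) * \<bar>c (e n)\<bar>)"
    using \<rho> by (subst (asm) summable_on_UNIV_nonneg_real_iff) (auto intro!: prod_nonneg mult_nonneg_nonneg)
  define cx where "cx b z = Complex (re z \<bullet> b) (im z \<bullet> b)" for b z
  have cx: "linear (cx b)" "cx b (jop z) = jop (cx b z)" "cx b (\<iota> x) = of_real (x \<bullet> b)" for b z x
    by (auto intro!: linearI simp: cx_def complex_eq_iff inner_add_left re_jop im_jop jop_complex_def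
        linear_add[OF linear_re] linear_add[OF linear_im] linear_cmul[OF linear_re] linear_cmul[OF linear_im])
  have cx_le: "cmod (cx b z) \<le> 2 * norm z" if "b \<in> Basis" for b z
  proof -
    have "cmod (cx b z) \<le> \<bar>re z \<bullet> b\<bar> + \<bar>im z \<bullet> b\<bar>"
      using cmod_le[of "cx b z"] by (simp add: cx_def)
    also have "\<dots> \<le> norm z + norm z"
      using Basis_le_norm[OF that, of "re z"] Basis_le_norm[OF that, of "im z"] norm_re[of z] norm_im[of z] by linarith
    finally show ?thesis by simp
  qed
  define P where "P n z = (\<Prod>b\<in>Basis. cx b (z - \<iota> a) ^ e n b) * of_real (c (e n))" for n z
  define F where "F z = (\<Sum>n. P n z)" for z
  \<comment> \<open>The factor \<open>1 / 2\<close> compensates the factor \<open>2\<close> in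
    \<open>cx_le\<close>.\<close>
  define r where "r = min (\<rho> / 2) R"
  have r: "0 < r" using \<rho> R by (simp add: r_def)
  have ul: "uniform_limit (ball (\<iota> a) r) (\<lambda>n z. \<Sum>i<n. P i z) F sequentially"
    unfolding F_def[abs_def]
  proof (rule Weierstrass_m_test[OF _ summ])
    fix n z assume z: "z \<in> ball (\<iota> a) r"
    have "cmod (cx b (z - \<iota> a)) \<le> \<rho>" if "b \<in> Basis" for b
      using cx_le[OF that, of "z - \<iota> a"] z by (simp add: r_def dist_norm norm_minus_commute)
    then show "norm (P n z) \<le> (\<Prod>b\<in>Basis. \<rho> ^ e n b) * \<bar>c (e n)\<bar>"
      unfolding P_def norm_mult norm_of_real
      by (intro mult_right_mono) (auto simp: prod_norm[symmetric] norm_power intro!: prod_mono power_mono)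
  qed
  have cP: "cdiff (P n) z" for n z
  proof -
    have "cdiff (\<lambda>z. cx b (z - \<iota> a)) z" for b
      by (rule cdiff_compose[where f="cx b"]) (auto intro: cdiff_linear cx cdiff_diff)
    then show ?thesis unfolding P_def[abs_def] by (intro cdiff_mult cdiff_prod cdiff_power) auto
  qed
  show thesis
  proof (rule that[OF r])
    show "chol_on F (ball (\<iota> a) r)"
      unfolding chol_on_def
      by (intro ballI cdiff_uniform_limit(1)[OF open_ball _ ul]) (auto simp: chol_on_def intro!: cdiff_sum cP)
    fix x assume "\<iota> x \<in> ball (\<iota> a) r"
    then have "x \<in> ball a R" by (simp add: r_def)
    from has_sum_reindex_bij_betw[OF e, THEN iffD2, OF sums[OF this, folded I_def]]
    have "(\<lambda>n. (\<Prod>b\<in>Basis. ((x - a) \<bullet> b) ^ e n b) * c (e n)) sums f x"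
      by (intro has_sum_imp_sums) simp
    then have "(\<lambda>n. complex_of_real ((\<Prod>b\<in>Basis. ((x - a) \<bullet> b) ^ e n b) * c (e n))) sums of_real (f x)"
      by (rule sums_of_real)
    moreover have "complex_of_real ((\<Prod>b\<in>Basis. ((x - a) \<bullet> b) ^ e n b) * c (e n)) = P n (\<iota> x)" for n
      by (simp add: P_def cx(3) flip: linear_diff[OF linear_iota])
    ultimately show "F (\<iota> x) = complex_of_real (f x)" by (simp add: F_def sums_iff)
  qed
qed

text \<open>An intersection of two balls with real centres is convex and contains the real part of
  each of its points, so the identity theorem makes the local extensions agree there, whichever
  centre the choice operator picks.\<close>

lemma glue:
  fixes f :: "'a \<Rightarrow> real"
  assumes "\<And>a. a \<in> S \<Longrightarrow> chol_on (Fa a) (ball (\<iota> a) (rad a))"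
    "\<And>a x. a \<in> S \<Longrightarrow> \<iota> x \<in> ball (\<iota> a) (rad a) \<Longrightarrow> Fa a (\<iota> x) = complex_of_real (f x)"
  shows "\<exists>F. chol_on F (\<Union>a\<in>S. ball (\<iota> a) (rad a)) \<and> (\<forall>a\<in>S. \<forall>z\<in>ball (\<iota> a) (rad a). F z = Fa a z)"
proof -
  define F where "F z = Fa (SOME a. a \<in> S \<and> z \<in> ball (\<iota> a) (rad a)) z" for z
  have F: "F z = Fa a z" if a: "a \<in> S" "z \<in> ball (\<iota> a) (rad a)" for a z
  proof -
    define a' where "a' = (SOME a. a \<in> S \<and> z \<in> ball (\<iota> a) (rad a))"
    have a': "a' \<in> S" "z \<in> ball (\<iota> a') (rad a')"
      using someI[of "\<lambda>a. a \<in> S \<and> z \<in> ball (\<iota> a) (rad a)" a] a by (auto simp: a'_def)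
    have "Fa a' z - Fa a z = 0"
    proof (rule identity_theorem[where T="ball (\<iota> a) (rad a) \<inter> ball (\<iota> a') (rad a')" and f="\<lambda>z. Fa a' z - Fa a z" and z=z])
      show "chol_on (\<lambda>z. Fa a' z - Fa a z) (ball (\<iota> a) (rad a) \<inter> ball (\<iota> a') (rad a'))"
        using assms(1) a a' by (intro chol_on_diff) (auto intro: chol_on_subset)
    qed (use assms(2) a a' iota_re_ball in \<open>auto intro: convex_Int\<close>)
    then show ?thesis by (simp add: F_def a'_def)
  qed
  show ?thesis
  proof (intro exI[of _ F] conjI ballI F)
    show "chol_on F (\<Union>a\<in>S. ball (\<iota> a) (rad a))"
      unfolding chol_on_def
    proof clarify
      fix z a assume a: "a \<in> S" "z \<in> ball (\<iota> a) (rad a)"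
      then have "cdiff (Fa a) z" using assms(1) by (auto simp: chol_on_def)
      then show "cdiff F z" by (rule cdiff_cong[OF _ open_ball a(2)]) (use F a in auto)
    qed
  qed
qed

text \<open>The radii are cut down so that real points of \<open>Q\<close> lie in \<open>S\<close>:
  a complex solution with values in \<open>Q\<close> then has its real values in the original
  domain.\<close>

lemma extension:
  fixes f :: "'a \<Rightarrow> real"
  assumes S: "open S" and f: "real_analytic_on f S"
  obtains Q F where "open Q" "\<And>x. x \<in> S \<Longrightarrow> \<iota> x \<in> Q" "chol_on F Q"
    "\<And>x. \<iota> x \<in> Q \<Longrightarrow> x \<in> S \<and> F (\<iota> x) = complex_of_real (f x)"
proof -
  have "\<exists>r F. 0 < r \<and> ball a r \<subseteq> S \<and> chol_on F (ball (\<iota> a) r) \<and>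
      (\<forall>x. \<iota> x \<in> ball (\<iota> a) r \<longrightarrow> F (\<iota> x) = complex_of_real (f x))" if a: "a \<in> S" for a
  proof -
    have fa: "real_analytic_at f a" using f a by (simp add: real_analytic_on_def)
    obtain r F where r: "0 < r" "chol_on F (ball (\<iota> a) r)"
      "\<And>x. \<iota> x \<in> ball (\<iota> a) r \<Longrightarrow> F (\<iota> x) = complex_of_real (f x)"
      using local_extension[OF fa] by blast
    obtain r' where r': "0 < r'" "ball a r' \<subseteq> S" using S a open_contains_ball by blast
    have "ball a (min r r') \<subseteq> S" "chol_on F (ball (\<iota> a) (min r r'))"
      using r' chol_on_subset[OF r(2)] by (auto simp: subset_iff)
    then show ?thesis using r r' by (intro exI[of _ "min r r'"] exI[of _ F]) auto
  qed
  then obtain rad Fa where rad: "\<And>a. a \<in> S \<Longrightarrow> 0 < rad a \<and> ball a (rad a) \<subseteq> S \<and> chol_on (Fa a) (ball (\<iota> a) (rad a)) \<and>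
      (\<forall>x. \<iota> x \<in> ball (\<iota> a) (rad a) \<longrightarrow> Fa a (\<iota> x) = complex_of_real (f x))"
    by metis
  have "\<exists>F. chol_on F (\<Union>a\<in>S. ball (\<iota> a) (rad a)) \<and> (\<forall>a\<in>S. \<forall>z\<in>ball (\<iota> a) (rad a). F z = Fa a z)"
    by (rule glue[of S Fa rad f]) (use rad in auto)
  then obtain F where F: "chol_on F (\<Union>a\<in>S. ball (\<iota> a) (rad a))"
    "\<And>a z. a \<in> S \<Longrightarrow> z \<in> ball (\<iota> a) (rad a) \<Longrightarrow> F z = Fa a z" by blast
  show thesis
  proof (rule that[of "\<Union>a\<in>S. ball (\<iota> a) (rad a)" F])
    show "\<iota> x \<in> (\<Union>a\<in>S. ball (\<iota> a) (rad a))" if "x \<in> S" for x using rad that by force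
    fix x assume "\<iota> x \<in> (\<Union>a\<in>S. ball (\<iota> a) (rad a))"
    then obtain a where a: "a \<in> S" "\<iota> x \<in> ball (\<iota> a) (rad a)" by blast
    then show "x \<in> S \<and> F (\<iota> x) = complex_of_real (f x)" using F(2)[OF a] rad[OF a(1)] by auto
  qed (use F in auto)
qed

end

interpretation cpx_real: complexification complex_of_real Re Im
proof (rule complexification.intro)
  show "linear complex_of_real" "linear Re" "linear Im" by (auto intro!: linearI)
  show "complex_of_real (Re z) + jop (complex_of_real (Im z)) = z" for z
    by (simp add: jop_complex_def complex_eq_iff)
  show "Re (jop z) = - Im z" "Im (jop z) = Re z" for z by (simp_all add: jop_complex_def)
  show "norm (Re z) \<le> norm z" for z using abs_Re_le_cmod by simp
qed auto

lemma complexification_prod: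
  assumes "complexification \<iota> re im" "complexification \<iota>' re' im'"
  shows "complexification (map_prod \<iota> \<iota>') (map_prod re re') (map_prod im im')"
proof -
  interpret a: complexification \<iota> re im by fact
  interpret b: complexification \<iota>' re' im' by fact
  have lin: "linear (map_prod f g)" if "linear f" "linear g"
    for f :: "'x::real_vector \<Rightarrow> 'y::real_vector" and g :: "'u::real_vector \<Rightarrow> 'v::real_vector"
    using that by (auto intro!: linearI simp: linear_add linear_cmul)
  show ?thesis
  proof (rule complexification.intro)
    show "linear (map_prod \<iota> \<iota>')" "linear (map_prod re re')" "linear (map_prod im im')"
      by (auto intro!: lin a.linear_iota b.linear_iota a.linear_re b.linear_re a.linear_im b.linear_im)
    show "map_prod \<iota> \<iota>' (map_prod re re' z) + jop (map_prod \<iota> \<iota>' (map_prod im im' z)) = z" for z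
      by (cases z) (simp add: a.decomp b.decomp)
    show "map_prod re re' (map_prod \<iota> \<iota>' x) = x" "map_prod im im' (map_prod \<iota> \<iota>' x) = 0"
      "norm (map_prod \<iota> \<iota>' x) = norm x" for x
      by (cases x, simp add: norm_Pair zero_prod_def)+
    show "map_prod re re' (jop z) = - map_prod im im' z" "map_prod im im' (jop z) = map_prod re re' z" for z
      by (cases z, simp add: a.re_jop b.re_jop a.im_jop b.im_jop)+
    show "norm (map_prod re re' z) \<le> norm z" for z
      by (cases z) (auto simp: norm_Pair intro!: add_mono power_mono a.norm_re b.norm_re)
  qed
qed

text \<open>A Lebesgue number for a cover of one period, carried along by translations, gives discs
  of one radius about all real points, which fill a strip. Periodicity of the glued map is the
  identity theorem for \<open>F (u + 2 * pi) - F u\<close>.\<close>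

lemma periodic_strip_extension:
  fixes f :: "real \<Rightarrow> real"
  assumes f: "real_analytic_on f UNIV" and per: "\<And>t. f (t + 2 * pi) = f t"
  obtains r F where "0 < r" "chol_on F {u. \<bar>Im u\<bar> < r}" "\<And>t. F (of_real t) = complex_of_real (f t)"
    "\<And>u. \<bar>Im u\<bar> < r \<Longrightarrow> F (u + 2 * pi) = F u"
proof -
  define good where "good a r F \<longleftrightarrow> chol_on F (ball (complex_of_real a) r) \<and>
      (\<forall>x. complex_of_real x \<in> ball (complex_of_real a) r \<longrightarrow> F (complex_of_real x) = complex_of_real (f x))" for a r F
  have "\<exists>r F. 0 < r \<and> good a r F" for a
  proof -
    have fa: "real_analytic_at f a" using f by (simp add: real_analytic_on_def)
    show ?thesis unfolding good_def using cpx_real.local_extension[OF fa] by blast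
  qed
  then obtain rad Fa where rad: "\<And>a. 0 < rad a \<and> good a (rad a) (Fa a)" by metis
  have cov: "{0..2*pi} \<subseteq> \<Union>(range (\<lambda>a. ball a (rad a)))"
  proof
    fix x :: real
    have "x \<in> ball x (rad x)" using rad[of x] by simp
    then show "x \<in> \<Union>(range (\<lambda>a. ball a (rad a)))" by blast
  qed
  have opn: "open B" if "B \<in> range (\<lambda>a. ball a (rad a))" for B using that by auto
  obtain e where e: "0 < e" "\<And>x. x \<in> {0..2*pi} \<Longrightarrow> \<exists>B \<in> range (\<lambda>a. ball a (rad a)). ball x e \<subseteq> B"
    using Heine_Borel_lemma[OF compact_Icc cov opn] by blast
  have "\<exists>F. good t e F" for t
  proof -
    define k where "k = \<lfloor>t / (2 * pi)\<rfloor>"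
    define s where "s = t - 2 * pi * k"
    have k: "real_of_int k \<le> t / (2 * pi)" "t / (2 * pi) < real_of_int k + 1"
      unfolding k_def by linarith+
    have s: "s \<in> {0..2*pi}" using k by (simp add: s_def field_simps)
    interpret pf: periodic_fun_simple f "2 * pi" by standard (rule per)
    have fs: "f (x - 2 * pi * k) = f x" for x
      using pf.plus_of_int[of "x - 2 * pi * k" k] by (simp add: mult.commute)
    obtain a where a: "ball s e \<subseteq> ball a (rad a)" using e(2)[OF s] by blast
    then have sub: "dist a s + e \<le> rad a" using e(1) by (simp add: ball_subset_ball_iff dist_commute)
    define F where "F u = Fa a (u - of_real (2 * pi * k))" for u
    have inb: "u - of_real (2 * pi * k) \<in> ball (complex_of_real a) (rad a)" if u: "u \<in> ball (complex_of_real t) e" for u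
    proof -
      have "dist (complex_of_real s) (u - of_real (2 * pi * k)) < e"
        using u by (simp add: s_def dist_norm algebra_simps)
      moreover have "dist (complex_of_real a) (complex_of_real s) = dist a s"
        by simp
      ultimately show ?thesis using sub dist_triangle[of "complex_of_real a" "u - of_real (2 * pi * k)" "complex_of_real s"] by simp
    qed
    have "good t e F"
      unfolding good_def chol_on_def
    proof (intro conjI ballI allI impI)
      fix u assume "u \<in> ball (complex_of_real t) e"
      from inb[OF this] have "cdiff (Fa a) (u - of_real (2 * pi * k))"
        using rad[of a] by (simp only: good_def chol_on_def)
      then show "cdiff F u" unfolding F_def[abs_def] by (rule cdiff_compose) (intro cdiff_diff cdiff_id cdiff_const)
    next
      fix x assume "complex_of_real x \<in> ball (complex_of_real t) e"
      from inb[OF this] have "complex_of_real (x - 2 * pi * k) \<in> ball (complex_of_real a) (rad a)" by simp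
      then have "Fa a (complex_of_real (x - 2 * pi * k)) = complex_of_real (f (x - 2 * pi * k))"
        using rad[of a] by (simp only: good_def)
      then show "F (complex_of_real x) = complex_of_real (f x)" using fs[of x] by (simp add: F_def)
    qed
    then show ?thesis by blast
  qed
  then obtain Fb where Fb: "\<And>t. good t e (Fb t)" by metis
  have "\<exists>F. chol_on F (\<Union>a\<in>UNIV. ball (complex_of_real a) e) \<and> (\<forall>a\<in>UNIV. \<forall>z\<in>ball (complex_of_real a) e. F z = Fb a z)"
    by (rule cpx_real.glue[of UNIV Fb "\<lambda>_. e" f]) (use Fb in \<open>auto simp: good_def\<close>)
  then obtain F where F: "chol_on F (\<Union>a\<in>UNIV. ball (complex_of_real a) e)"
    "\<And>a z. z \<in> ball (complex_of_real a) e \<Longrightarrow> F z = Fb a z" by blast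
  have strip: "{u. \<bar>Im u\<bar> < e} \<subseteq> (\<Union>a\<in>UNIV. ball (complex_of_real a) e)"
  proof
    fix u assume "u \<in> {u. \<bar>Im u\<bar> < e}"
    then have "u \<in> ball (complex_of_real (Re u)) e" by (simp add: dist_norm norm_minus_commute cmod_eq_Im)
    then show "u \<in> (\<Union>a\<in>UNIV. ball (complex_of_real a) e)" by blast
  qed
  have Fs: "chol_on F {u. \<bar>Im u\<bar> < e}" by (rule chol_on_subset[OF F(1) strip])
  have Fr: "F (of_real t) = complex_of_real (f t)" for t
    using F(2)[of "of_real t" t] Fb[of t] e(1) by (simp add: good_def)
  show thesis
  proof (rule that[OF e(1) Fs Fr])
    fix u assume u: "\<bar>Im u\<bar> < e"
    have "F (u + 2 * pi) - F u = 0"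
    proof (rule cpx_real.identity_theorem[where T="{u. \<bar>Im u\<bar> < e}" and f="\<lambda>u. F (u + 2 * pi) - F u" and z=u])
      show "open {u. \<bar>Im u\<bar> < e}" by (intro open_Collect_less continuous_intros)
      have "{u. \<bar>Im u\<bar> < e} = {u. Im u < e} \<inter> {u. Im u > - e}" by auto
      then show "convex {u. \<bar>Im u\<bar> < e}"
        by (metis convex_Int convex_halfspace_Im_lt convex_halfspace_Im_gt)
      show "chol_on (\<lambda>u. F (u + 2 * pi) - F u) {u. \<bar>Im u\<bar> < e}"
        unfolding chol_on_def
      proof (intro ballI cdiff_diff)
        fix u assume u: "u \<in> {u. \<bar>Im u\<bar> < e}"
        show "cdiff F u" using Fs u by (simp add: chol_on_def)
        show "cdiff (\<lambda>u. F (u + 2 * pi)) u"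
          by (rule cdiff_compose[where f=F]) (use Fs u in \<open>auto simp: chol_on_def intro!: cdiff_add\<close>)
      qed
      show "F (complex_of_real x + 2 * pi) - F (complex_of_real x) = 0" for x
        using Fr[of "x + 2 * pi"] Fr[of x] per[of x] by simp
    qed (use u e in auto)
    then show "F (u + 2 * pi) = F u" by simp
  qed
qed

section \<open>Double power series\<close>

lemma cdiff_line_field:
  fixes f :: "'a::complex_space \<Rightarrow> complex"
  assumes "cdiff f (x + l *\<^sub>C h)"
  shows "((\<lambda>l. f (x + l *\<^sub>C h)) has_field_derivative dd f (x + l *\<^sub>C h) h) (at l)"
  using cdiff_imp_field[OF cdiff_compose[of f "\<lambda>l. x + l *\<^sub>C h", OF assms cdiff_line]]
  unfolding dd_compose[of f "\<lambda>l. x + l *\<^sub>C h", OF assms cdiff_line] by (simp add: dd_line)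

lemma summable_on_double_geometric:
  fixes q1 q2 :: real
  assumes "0 \<le> q1" "q1 < 1" "0 \<le> q2" "q2 < 1"
  shows "(\<lambda>(j, k). B * q1 ^ j * q2 ^ k) summable_on UNIV \<times> (UNIV :: nat set)"
proof -
  have geo: "((\<lambda>k. q ^ k) has_sum (1 / (1 - q))) UNIV" if "0 \<le> q" "q < 1" for q :: real
    by (rule norm_summable_imp_has_sum) (use that in \<open>auto intro: geometric_sums summable_geometric\<close>)
  have "(\<lambda>(j, k). q1 ^ j * q2 ^ k) summable_on Sigma UNIV (\<lambda>_. UNIV :: nat set)"
  proof (rule summable_on_SigmaI)
    show "((\<lambda>k. case (j, k) of (j, k) \<Rightarrow> q1 ^ j * q2 ^ k) has_sum q1 ^ j * (1 / (1 - q2))) UNIV" for j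
      using has_sum_cmult_right[OF geo[OF assms(3,4)], of "q1 ^ j"] by simp
    show "(\<lambda>j. q1 ^ j * (1 / (1 - q2))) summable_on UNIV"
      using has_sum_cmult_left[OF geo[OF assms(1,2)], of "1 / (1 - q2)"] has_sum_imp_summable by blast
  qed (use assms in auto)
  then have "(\<lambda>z. B * (case z of (j, k) \<Rightarrow> q1 ^ j * q2 ^ k)) summable_on UNIV \<times> (UNIV :: nat set)"
    by (rule summable_on_cmult_right)
  then show ?thesis by (simp add: case_prod_unfold mult.assoc)
qed

text \<open>Expand in \<open>s\<close> with coefficients \<open>a j t\<close>, then each coefficient
  in \<open>t\<close>. Cauchy's inequality, used twice, bounds \<open>c j k\<close> by
  \<open>B / \<rho> ^ j / \<rho> ^ k\<close>, and a dominating double geometric series turns the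
  iterated sum into an unconditional one.\<close>

lemma double_power_series:
  fixes F :: "complex \<times> complex \<Rightarrow> complex"
  assumes S: "open S" and F: "chol_on F S" and \<rho>: "0 < \<rho>"
    and sub: "\<And>s t. cmod s \<le> \<rho> \<Longrightarrow> cmod t \<le> \<rho> \<Longrightarrow> (a1 + s, a2 + t) \<in> S"
    and B: "\<And>s t. cmod s \<le> \<rho> \<Longrightarrow> cmod t \<le> \<rho> \<Longrightarrow> cmod (F (a1 + s, a2 + t)) \<le> B"
  shows "\<exists>c. \<forall>s t. cmod s < \<rho> \<longrightarrow> cmod t < \<rho> \<longrightarrow>
    ((\<lambda>(j, k). c j k * s ^ j * t ^ k) has_sum F (a1 + s, a2 + t)) (UNIV \<times> UNIV)"
proof -
  \<comment> \<open>Iterated derivatives in the first variable, taken on all of \<open>S\<close>, so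
    that \<open>chol_on_dd\<close> makes the coefficients holomorphic in the second.\<close>
  define E where "E j = ((\<lambda>H x. dd H x (1, 0)) ^^ j) F" for j
  have E_Suc: "E (Suc j) = (\<lambda>x. dd (E j) x (1, 0))" for j by (simp add: E_def)
  have E: "chol_on (E j) S" for j
    by (induction j) (auto simp: E_Suc intro: chol_on_dd[OF S], simp add: E_def F)
  have Ed: "((\<lambda>s. E j (a1 + s, y)) has_field_derivative E (Suc j) (a1 + s, y)) (at s)"
    if "(a1 + s, y) \<in> S" for j s y
    using cdiff_line_field[of "E j" "(a1, y)" s "(1, 0)"] E that by (simp add: chol_on_def E_Suc)
  have op: "open {s. (a1 + s, y) \<in> S}" for y
    using S by (rule open_vimage[of S "\<lambda>s. (a1 + s, y)", unfolded vimage_def]) (auto intro!: continuous_intros)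
  have der: "(deriv ^^ j) (\<lambda>s. F (a1 + s, y)) s = E j (a1 + s, y)" if "(a1 + s, y) \<in> S" for j s y
    using that
  proof (induction j arbitrary: s)
    case 0
    then show ?case by (simp add: E_def)
  next
    case (Suc j)
    have "((deriv ^^ j) (\<lambda>s. F (a1 + s, y)) has_field_derivative E (Suc j) (a1 + s, y)) (at s)"
      by (rule has_field_derivative_transform_within_open[OF Ed[OF Suc.prems] op]) (use Suc in auto)
    then show ?case by (simp add: DERIV_imp_deriv)
  qed
  have holF: "(\<lambda>s. F (a1 + s, a2 + t)) holomorphic_on ball 0 \<rho>"
    and conF: "continuous_on (cball 0 \<rho>) (\<lambda>s. F (a1 + s, a2 + t))" if t: "cmod t \<le> \<rho>" for t
  proof -
    have d: "((\<lambda>s. F (a1 + s, a2 + t)) has_field_derivative E 1 (a1 + s, a2 + t)) (at s)" if "cmod s \<le> \<rho>" for s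
      using Ed[OF sub[OF that t], of 0] by (simp add: E_def)
    show "(\<lambda>s. F (a1 + s, a2 + t)) holomorphic_on ball 0 \<rho>"
      unfolding holomorphic_on_open[OF open_ball] using d by (metis less_imp_le mem_ball_0)
    show "continuous_on (cball 0 \<rho>) (\<lambda>s. F (a1 + s, a2 + t))"
      by (intro continuous_at_imp_continuous_on ballI DERIV_isCont[OF d]) auto
  qed
  define a where "a j t = E j (a1, a2 + t) / fact j" for j t
  have a_eq: "a j t = (deriv ^^ j) (\<lambda>s. F (a1 + s, a2 + t)) 0 / fact j" if "cmod t \<le> \<rho>" for j t
    using der[of 0 "a2 + t" j] sub[OF _ that, of 0] \<rho> by (simp add: a_def)
  have a_le: "cmod (a j t) \<le> B / \<rho> ^ j" if t: "cmod t \<le> \<rho>" for j t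
  proof -
    have "cmod ((deriv ^^ j) (\<lambda>s. F (a1 + s, a2 + t)) 0) \<le> fact j * B / \<rho> ^ j"
      by (rule Cauchy_inequality[OF holF[OF t] conF[OF t] \<rho>]) (use B t in auto)
    then show ?thesis unfolding a_eq[OF t] by (simp add: norm_divide divide_le_eq field_simps)
  qed
  have ad: "\<exists>d. (a j has_field_derivative d) (at t)" if "cmod t \<le> \<rho>" for j t
  proof -
    have "((\<lambda>t. E j ((a1, a2) + t *\<^sub>C (0, 1))) has_field_derivative dd (E j) ((a1, a2) + t *\<^sub>C (0, 1)) (0, 1)) (at t)"
      by (rule cdiff_line_field) (use E sub[of 0 t] that \<rho> in \<open>simp add: chol_on_def\<close>)
    from DERIV_cdivide[OF this, of "fact j"] show ?thesis
      by (auto simp: a_def[abs_def])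
  qed
  have hola: "a j holomorphic_on ball 0 \<rho>" and cona: "continuous_on (cball 0 \<rho>) (a j)" for j
  proof -
    show "a j holomorphic_on ball 0 \<rho>"
      unfolding holomorphic_on_open[OF open_ball] using ad by (metis less_imp_le mem_ball_0)
    show "continuous_on (cball 0 \<rho>) (a j)"
      by (intro continuous_at_imp_continuous_on ballI) (use ad DERIV_isCont in fastforce)
  qed
  define c where "c j k = (deriv ^^ k) (a j) 0 / fact k" for j k
  have c_le: "cmod (c j k) \<le> B / \<rho> ^ j / \<rho> ^ k" for j k
  proof -
    have "cmod ((deriv ^^ k) (a j) 0) \<le> fact k * (B / \<rho> ^ j) / \<rho> ^ k"
      by (rule Cauchy_inequality[OF hola cona \<rho>]) (use a_le in auto)
    then show ?thesis unfolding c_def by (simp add: norm_divide divide_le_eq field_simps)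
  qed
  have B0: "0 \<le> B" using B[of 0 0] \<rho> norm_ge_zero order_trans by (metis less_imp_le norm_zero)
  show ?thesis
  proof (intro exI[of _ c] allI impI)
    fix s t assume s: "cmod s < \<rho>" and t: "cmod t < \<rho>"
    define q1 q2 where "q1 = cmod s / \<rho>" and "q2 = cmod t / \<rho>"
    have q: "0 \<le> q1" "q1 < 1" "0 \<le> q2" "q2 < 1" using s t \<rho> by (auto simp: q1_def q2_def)
    have term_le: "cmod (c j k * s ^ j * t ^ k) \<le> B * q1 ^ j * q2 ^ k" for j k
    proof -
      have "cmod (c j k * s ^ j * t ^ k) \<le> B / \<rho> ^ j / \<rho> ^ k * cmod s ^ j * cmod t ^ k"
        unfolding norm_mult norm_power by (intro mult_right_mono c_le) auto
      also have "\<dots> = B * q1 ^ j * q2 ^ k" by (simp add: q1_def q2_def power_divide)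
      finally show ?thesis .
    qed
    have geo: "summable (\<lambda>k. M * q ^ k)" if "0 \<le> q" "q < 1" for M q :: real
      using that by (intro summable_mult summable_geometric) simp
    show "((\<lambda>(j, k). c j k * s ^ j * t ^ k) has_sum F (a1 + s, a2 + t)) (UNIV \<times> UNIV)"
    proof (rule has_sum_SigmaI)
      fix j :: nat
      have "(\<lambda>k. c j k * (t - 0) ^ k) sums a j t"
        unfolding c_def by (rule holomorphic_power_series[OF hola]) (use t in simp)
      then have "(\<lambda>k. s ^ j * (c j k * t ^ k)) sums (s ^ j * a j t)" by (intro sums_mult) simp
      then have s1: "(\<lambda>k. c j k * s ^ j * t ^ k) sums (a j t * s ^ j)" by (simp add: mult_ac)
      have "summable (\<lambda>k. norm (c j k * s ^ j * t ^ k))"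
        by (rule summable_comparison_test'[OF geo[OF q(3,4)], of 0 _ "B * q1 ^ j"]) (use term_le in auto)
      from norm_summable_imp_has_sum[OF this s1]
      show "((\<lambda>k. case (j, k) of (j, k) \<Rightarrow> c j k * s ^ j * t ^ k) has_sum a j t * s ^ j) UNIV" by simp
    next
      have "(\<lambda>j. (deriv ^^ j) (\<lambda>s. F (a1 + s, a2 + t)) 0 / fact j * (s - 0) ^ j) sums F (a1 + s, a2 + t)"
        by (rule holomorphic_power_series[OF holF]) (use s t in auto)
      then have s1: "(\<lambda>j. a j t * s ^ j) sums F (a1 + s, a2 + t)" using a_eq t by simp
      have "summable (\<lambda>j. norm (a j t * s ^ j))"
      proof (rule summable_comparison_test'[OF geo[OF q(1,2)], of 0 _ B])
        fix j
        have "cmod (a j t) * cmod s ^ j \<le> B / \<rho> ^ j * cmod s ^ j"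
          using a_le t by (intro mult_right_mono) auto
        then show "norm (norm (a j t * s ^ j)) \<le> B * q1 ^ j"
          by (simp add: norm_mult norm_power q1_def power_divide)
      qed
      from norm_summable_imp_has_sum[OF this s1]
      show "((\<lambda>j. a j t * s ^ j) has_sum F (a1 + s, a2 + t)) UNIV" .
    next
      show "(\<lambda>(j, k). c j k * s ^ j * t ^ k) summable_on UNIV \<times> UNIV"
      proof (rule abs_summable_summable, rule summable_on_comparison_test[OF summable_on_double_geometric[OF q]])
        show "norm (case z of (j, k) \<Rightarrow> c j k * s ^ j * t ^ k) \<le> (case z of (j, k) \<Rightarrow> B * q1 ^ j * q2 ^ k)" for z
          using term_le by (cases z) simp
      qed auto
    qed
  qed
qed

section \<open>Real functions of two variables with a local holomorphic extension\<close>

abbreviation cvec :: "real \<times> real \<Rightarrow> complex \<times> complex" where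
  "cvec \<equiv> map_prod complex_of_real complex_of_real"

interpretation cpx2: complexification cvec "map_prod Re Re" "map_prod Im Im"
  by (rule complexification_prod) (rule cpx_real.complexification_axioms)+

text \<open>The working form of analyticity: it passes to sums, products, quotients, compositions,
  derivatives and local inverses without any manipulation of series.
  \<open>ext_at_real_analytic\<close> converts it back.\<close>

definition ext_at :: "(real \<times> real \<Rightarrow> real) \<Rightarrow> real \<times> real \<Rightarrow> bool" where
  "ext_at f a \<longleftrightarrow> (\<exists>F r. 0 < r \<and> chol_on F (ball (cvec a) r) \<and>
     (\<forall>x\<in>ball a r. F (cvec x) = complex_of_real (f x)))"

lemma ext_atI:
  assumes S: "open S" "cvec a \<in> S" and F: "chol_on F S" and T: "open T" "a \<in> T"
    and eq: "\<And>x. x \<in> T \<Longrightarrow> cvec x \<in> S \<Longrightarrow> F (cvec x) = complex_of_real (f x)"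
  shows "ext_at f a"
proof -
  obtain r1 where r1: "0 < r1" "ball (cvec a) r1 \<subseteq> S" using S open_contains_ball by blast
  obtain r2 where r2: "0 < r2" "ball a r2 \<subseteq> T" using T open_contains_ball by blast
  have "F (cvec x) = complex_of_real (f x)" if "x \<in> ball a (min r1 r2)" for x
  proof (rule eq)
    show "x \<in> T" using that r2 by auto
    have "cvec x \<in> ball (cvec a) r1" using that by simp
    then show "cvec x \<in> S" using r1 by blast
  qed
  moreover have "chol_on F (ball (cvec a) (min r1 r2))"
    using r1 by (intro chol_on_subset[OF F]) auto
  ultimately show ?thesis using r1 r2 unfolding ext_at_def
    by (intro exI[of _ F] exI[of _ "min r1 r2"]) auto
qed

lemma ext_atE:
  assumes "ext_at f a"
  obtains F r where "0 < r" "chol_on F (ball (cvec a) r)"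
    "\<And>x. x \<in> ball a r \<Longrightarrow> F (cvec x) = complex_of_real (f x)"
  using assms unfolding ext_at_def by blast

lemma ext_at_nhd:
  assumes "ext_at f a"
  obtains r where "0 < r" "\<And>b. b \<in> ball a r \<Longrightarrow> ext_at f b"
proof -
  obtain F r where r: "0 < r" "chol_on F (ball (cvec a) r)"
    "\<And>x. x \<in> ball a r \<Longrightarrow> F (cvec x) = complex_of_real (f x)"
    by (rule ext_atE[OF assms]) blast
  show thesis
  proof (rule that[OF r(1)])
    fix b assume b: "b \<in> ball a r"
    then have cb: "cvec b \<in> ball (cvec a) r" by simp
    show "ext_at f b" by (rule ext_atI[OF open_ball cb r(2) open_ball b]) (rule r(3))
  qed
qed

lemma ext_at_cong:
  assumes "ext_at f a" "open S" "a \<in> S" "\<And>x. x \<in> S \<Longrightarrow> f x = g x"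
  shows "ext_at g a"
proof -
  obtain F r where r: "0 < r" "chol_on F (ball (cvec a) r)"
    "\<And>x. x \<in> ball a r \<Longrightarrow> F (cvec x) = complex_of_real (f x)"
    by (rule ext_atE[OF assms(1)]) blast
  show ?thesis
    by (rule ext_atI[OF open_ball _ r(2), where T="S \<inter> ball a r"]) (use assms r in auto)
qed

lemma ext_at_Re:
  assumes S: "open S" and F: "chol_on F S" and re: "\<And>x. cvec x \<in> S \<Longrightarrow> Im (F (cvec x)) = 0" and a: "cvec a \<in> S"
  shows "ext_at (\<lambda>x. Re (F (cvec x))) a"
  by (rule ext_atI[OF S a F open_UNIV]) (use re in \<open>auto simp: complex_eq_iff\<close>)

text \<open>On real points the imaginary part of \<open>F\<close> vanishes identically, so its
  derivative vanishes in real directions and the remaining real part is the derivative of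
  \<open>f\<close>.\<close>

lemma ext_at_has_derivative_aux:
  assumes F: "cdiff F (cvec a)" and T: "open T" "a \<in> T"
    and eq: "\<And>x. x \<in> T \<Longrightarrow> F (cvec x) = complex_of_real (f x)"
  shows "(f has_derivative dd f a) (at a)" "complex_of_real (dd f a h) = dd F (cvec a) (cvec h)"
proof -
  have "(cvec has_derivative cvec) (at a)"
    using cpx2.linear_iota linear_conv_bounded_linear bounded_linear_imp_has_derivative by blast
  from has_derivative_compose[OF this cdiff_has_derivative[OF F]]
  have d: "((\<lambda>x. F (cvec x)) has_derivative (\<lambda>h. dd F (cvec a) (cvec h))) (at a)" .
  have "((\<lambda>x. Im (F (cvec x))) has_derivative (\<lambda>h. Im (dd F (cvec a) (cvec h)))) (at a)"
    by (rule has_derivative_Im[OF d])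
  then have "((\<lambda>x. 0) has_derivative (\<lambda>h. Im (dd F (cvec a) (cvec h)))) (at a)"
    by (rule has_derivative_transform_within_open[OF _ T]) (simp add: eq)
  then have im: "(\<lambda>h. Im (dd F (cvec a) (cvec h))) = (\<lambda>h. 0)"
    using has_derivative_unique has_derivative_const by blast
  have "((\<lambda>x. Re (F (cvec x))) has_derivative (\<lambda>h. Re (dd F (cvec a) (cvec h)))) (at a)"
    by (rule has_derivative_Re[OF d])
  then have fd: "(f has_derivative (\<lambda>h. Re (dd F (cvec a) (cvec h)))) (at a)"
    by (rule has_derivative_transform_within_open[OF _ T]) (simp add: eq)
  then show "(f has_derivative dd f a) (at a)" using dd_eq by metis
  show "complex_of_real (dd f a h) = dd F (cvec a) (cvec h)"
    using dd_eq[OF fd] fun_cong[OF im, of h] by (simp add: complex_eq_iff)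
qed

lemma ext_at_has_derivative:
  assumes "ext_at f a"
  shows "(f has_derivative dd f a) (at a)"
proof (rule ext_atE[OF assms])
  fix F r assume r: "0 < r" "chol_on F (ball (cvec a) r)"
    and e: "\<And>x. x \<in> ball a r \<Longrightarrow> F (cvec x) = complex_of_real (f x)"
  show ?thesis by (rule ext_at_has_derivative_aux(1)[of F _ "ball a r"]) (use r e in \<open>auto simp: chol_on_def\<close>)
qed

text \<open>A derivative of the extension extends the derivative, and the symmetry of second
  derivatives is inherited from \<open>dd_commute\<close>.\<close>

lemma ext_at_dd:
  assumes "ext_at f a"
  shows "ext_at (\<lambda>x. dd f x h) a" "dd (\<lambda>x. dd f x h) a k = dd (\<lambda>x. dd f x k) a h"
proof -
  obtain F r where r: "0 < r" "chol_on F (ball (cvec a) r)"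
    "\<And>x. x \<in> ball a r \<Longrightarrow> F (cvec x) = complex_of_real (f x)"
    by (rule ext_atE[OF assms]) blast
  have d: "dd F (cvec x) (cvec h) = complex_of_real (dd f x h)" if "x \<in> ball a r" for x h
    by (rule ext_at_has_derivative_aux(2)[of F _ "ball a r", symmetric]) (use that r in \<open>auto simp: chol_on_def\<close>)
  have a: "a \<in> ball a r" "cvec a \<in> ball (cvec a) r" using r by auto
  have c: "chol_on (\<lambda>x. dd F x (cvec h)) (ball (cvec a) r)" for h by (rule chol_on_dd[OF open_ball r(2)])
  show "ext_at (\<lambda>x. dd f x h) a" by (rule ext_atI[OF open_ball a(2) c open_ball a(1)]) (rule d)
  have "complex_of_real (dd (\<lambda>x. dd f x h) a k) = dd (\<lambda>x. dd F x (cvec h)) (cvec a) (cvec k)" for h k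
    by (rule ext_at_has_derivative_aux(2)[of _ _ "ball a r"]) (use a c d in \<open>auto simp: chol_on_def\<close>)
  then show "dd (\<lambda>x. dd f x h) a k = dd (\<lambda>x. dd f x k) a h"
    using dd_commute[OF open_ball r(2) a(2), of "cvec h" "cvec k"] by (metis of_real_eq_iff)
qed

lemma ext_at_D:
  assumes "ext_at f a"
  shows "ext_at (D1 f) a" "ext_at (D2 f) a" "D2 (D1 f) a = D1 (D2 f) a"
    "dd f a h = D1 f a * fst h + D2 f a * snd h"
    "(f has_derivative (\<lambda>h. D1 f a * fst h + D2 f a * snd h)) (at a)"
proof -
  show "ext_at (D1 f) a" "ext_at (D2 f) a"
    using ext_at_dd(1)[OF assms] by (simp_all add: D1_def[abs_def] D2_def[abs_def])
  show "D2 (D1 f) a = D1 (D2 f) a"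
    using ext_at_dd(2)[OF assms, of "(1, 0)" "(0, 1)"] by (simp add: D1_def[abs_def] D2_def[abs_def])
  have l: "linear (dd f a)"
    using ext_at_has_derivative[OF assms] has_derivative_linear by blast
  have e: "dd f a h = D1 f a * fst h + D2 f a * snd h" for h
  proof -
    have "h = fst h *\<^sub>R (1, 0) + snd h *\<^sub>R (0, 1)" by (cases h) simp
    then have "dd f a h = dd f a (fst h *\<^sub>R (1, 0) + snd h *\<^sub>R (0, 1))" by simp
    also have "\<dots> = fst h * dd f a (1, 0) + snd h * dd f a (0, 1)"
      by (simp only: linear_add[OF l] linear_cmul[OF l] real_scaleR_def)
    finally show ?thesis by (simp add: D1_def D2_def mult.commute)
  qed
  then show "dd f a h = D1 f a * fst h + D2 f a * snd h" .
  have "dd f a = (\<lambda>h. D1 f a * fst h + D2 f a * snd h)" using e by auto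
  then show "(f has_derivative (\<lambda>h. D1 f a * fst h + D2 f a * snd h)) (at a)"
    using ext_at_has_derivative[OF assms] by simp
qed

lemma D_eqI:
  assumes "(f has_derivative (\<lambda>h. a * fst h + b * snd h)) (at x)"
  shows "D1 f x = a" "D2 f x = b"
  using dd_eq[OF assms] by (simp_all add: D1_def D2_def)

lemma ext_at_isCont: "ext_at f a \<Longrightarrow> isCont f a"
  using ext_at_has_derivative has_derivative_continuous by blast

lemma ext_at_continuous_on: "(\<And>a. a \<in> S \<Longrightarrow> ext_at f a) \<Longrightarrow> continuous_on S f"
  by (intro continuous_at_imp_continuous_on ballI ext_at_isCont)

section \<open>Closure under algebraic operations and composition\<close>

lemma ext_at_combine:
  assumes f: "ext_at f a" and g: "ext_at g a"
    and op: "\<And>F G (z :: complex \<times> complex). cdiff F z \<Longrightarrow> cdiff G z \<Longrightarrow> cdiff (\<lambda>z. H (F z) (G z)) z"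
    and H: "\<And>s t. H (complex_of_real s) (complex_of_real t) = complex_of_real (h s t)"
  shows "ext_at (\<lambda>x. h (f x) (g x)) a"
proof -
  obtain F r where r: "0 < r" "chol_on F (ball (cvec a) r)"
    "\<And>x. x \<in> ball a r \<Longrightarrow> F (cvec x) = complex_of_real (f x)"
    by (rule ext_atE[OF f]) blast
  obtain G r' where r': "0 < r'" "chol_on G (ball (cvec a) r')"
    "\<And>x. x \<in> ball a r' \<Longrightarrow> G (cvec x) = complex_of_real (g x)"
    by (rule ext_atE[OF g]) blast
  show ?thesis
  proof (rule ext_atI)
    show "chol_on (\<lambda>z. H (F z) (G z)) (ball (cvec a) r \<inter> ball (cvec a) r')"
      unfolding chol_on_def by (intro ballI op) (use r(2) r'(2) in \<open>auto simp: chol_on_def\<close>)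
    fix x assume "x \<in> ball a r \<inter> ball a r'"
    then show "H (F (cvec x)) (G (cvec x)) = complex_of_real (h (f x) (g x))" using r(3) r'(3) H by simp
  qed (use r r' in auto)
qed

lemma ext_at_add: "ext_at f a \<Longrightarrow> ext_at g a \<Longrightarrow> ext_at (\<lambda>x. f x + g x) a"
  by (rule ext_at_combine[where H="\<lambda>x y. x + y"]) (auto intro: cdiff_add)

lemma ext_at_diff: "ext_at f a \<Longrightarrow> ext_at g a \<Longrightarrow> ext_at (\<lambda>x. f x - g x) a"
  by (rule ext_at_combine[where H="\<lambda>x y. x - y"]) (auto intro: cdiff_diff)

lemma ext_at_mult: "ext_at f a \<Longrightarrow> ext_at g a \<Longrightarrow> ext_at (\<lambda>x. f x * g x) a"
  by (rule ext_at_combine[where H="\<lambda>x y. x * y"]) (auto intro: cdiff_mult)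

lemma ext_at_const: "ext_at (\<lambda>x. c) a"
  by (rule ext_atI[OF open_UNIV _ _ open_UNIV, where F="\<lambda>_. of_real c"]) (auto simp: chol_on_def)

lemma ext_at_compose:
  assumes f: "ext_at f (g1 b, g2 b)" and g: "ext_at g1 b" "ext_at g2 b"
  shows "ext_at (\<lambda>y. f (g1 y, g2 y)) b"
proof -
  obtain F r where r: "0 < r" "chol_on F (ball (cvec (g1 b, g2 b)) r)"
    "\<And>x. x \<in> ball (g1 b, g2 b) r \<Longrightarrow> F (cvec x) = complex_of_real (f x)"
    by (rule ext_atE[OF f]) blast
  obtain G1 r1 where r1: "0 < r1" "chol_on G1 (ball (cvec b) r1)"
    "\<And>x. x \<in> ball b r1 \<Longrightarrow> G1 (cvec x) = complex_of_real (g1 x)"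
    by (rule ext_atE[OF g(1)]) blast
  obtain G2 r2 where r2: "0 < r2" "chol_on G2 (ball (cvec b) r2)"
    "\<And>x. x \<in> ball b r2 \<Longrightarrow> G2 (cvec x) = complex_of_real (g2 x)"
    by (rule ext_atE[OF g(2)]) blast
  define S0 where "S0 = ball (cvec b) r1 \<inter> ball (cvec b) r2"
  define G where "G z = (G1 z, G2 z)" for z
  have cG: "chol_on G S0"
    using r1(2) r2(2) unfolding G_def[abs_def] S0_def by (auto simp: chol_on_def intro: cdiff_Pair)
  define S where "S = S0 \<inter> G -` ball (cvec (g1 b, g2 b)) r"
  have S0: "open S0" unfolding S0_def by auto
  have S: "open S" unfolding S_def
    by (rule continuous_open_preimage[OF chol_on_continuous[OF cG] S0 open_ball])
  have Gx: "G (cvec x) = cvec (g1 x, g2 x)" if "x \<in> ball b (min r1 r2)" for x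
    using r1(3) r2(3) that by (simp add: G_def)
  show ?thesis
  proof (rule ext_atI[OF S, where F="\<lambda>z. F (G z)" and T="ball b (min r1 r2)"])
    show "cvec b \<in> S" using Gx[of b] r r1 r2 by (auto simp: S_def S0_def)
    show "chol_on (\<lambda>z. F (G z)) S"
      using r(2) cG by (auto simp: chol_on_def S_def intro!: cdiff_compose[of F G])
    fix x assume x: "x \<in> ball b (min r1 r2)" "cvec x \<in> S"
    then have "cvec (g1 x, g2 x) \<in> ball (cvec (g1 b, g2 b)) r" using Gx[of x] by (auto simp: S_def)
    then have "(g1 x, g2 x) \<in> ball (g1 b, g2 b) r" by (simp only: mem_ball cpx2.dist_iota)
    then show "F (G (cvec x)) = complex_of_real (f (g1 x, g2 x))"
      unfolding Gx[OF x(1)] by (rule r(3))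
  qed (use r1 r2 in auto)
qed

lemma Ck_on_ext_at:
  assumes "open S" "\<And>a. a \<in> S \<Longrightarrow> ext_at f a"
  shows "Ck_on k f S"
  using assms(2)
proof (induction k arbitrary: f)
  case 0
  then show ?case by (simp add: ext_at_continuous_on)
next
  case (Suc k)
  have "f differentiable (at w)" if "w \<in> S" for w
    using ext_at_has_derivative[OF Suc.prems[OF that]] by (auto simp: differentiable_def)
  moreover have "Ck_on k (\<lambda>w. frechet_derivative f (at w) h) S" for h
    by (rule Suc.IH) (rule ext_at_dd[OF Suc.prems])
  ultimately show ?case by simp
qed

text \<open>The double power series of the extension, with pairs of exponents reindexed as
  multi-indices; at real increments the real parts of the coefficients represent
  \<open>f\<close>.\<close>

lemma ext_at_real_analytic:
  assumes "ext_at f a"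
  shows "real_analytic_at f a"
proof -
  obtain F r where r: "0 < r" "chol_on F (ball (cvec a) r)"
    "\<And>x. x \<in> ball a r \<Longrightarrow> F (cvec x) = complex_of_real (f x)"
    by (rule ext_atE[OF assms]) blast
  \<comment> \<open>Two increments of modulus at most \<open>r / 4\<close> stay in the closed ball
    of radius \<open>r / 2\<close>, which is compact, so that \<open>F\<close> is bounded
    there.\<close>
  define \<rho> where "\<rho> = r / 4"
  have \<rho>: "0 < \<rho>" using r by (simp add: \<rho>_def)
  define a1 a2 where "a1 = complex_of_real (fst a)" and "a2 = complex_of_real (snd a)"
  have cva: "cvec a = (a1, a2)" by (cases a) (simp add: a1_def a2_def)
  have sub: "(a1 + s, a2 + t) \<in> cball (cvec a) (r / 2)" if "cmod s \<le> \<rho>" "cmod t \<le> \<rho>" for s t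
  proof -
    have "dist (a1, a2) (a1 + s, a2 + t) = norm (s, t)" by (simp add: dist_norm norm_Pair)
    also have "\<dots> \<le> norm s + norm t" by (rule norm_Pair_le)
    finally show ?thesis using that by (simp add: cva \<rho>_def)
  qed
  have cb: "cball (cvec a) (r / 2) \<subseteq> ball (cvec a) r" using r by auto
  obtain B where B: "\<And>z. z \<in> cball (cvec a) (r / 2) \<Longrightarrow> norm (F z) \<le> B"
    by (rule compact_image_norm_bound[OF compact_cball chol_on_continuous[OF chol_on_subset[OF r(2) cb]]]) blast
  have "\<exists>c. \<forall>s t. cmod s < \<rho> \<longrightarrow> cmod t < \<rho> \<longrightarrow>
      ((\<lambda>(j, k). c j k * s ^ j * t ^ k) has_sum F (a1 + s, a2 + t)) (UNIV \<times> UNIV)"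
    by (rule double_power_series[OF open_ball r(2) \<rho>]) (use sub cb B in blast)+
  then obtain c where c: "\<And>s t. cmod s < \<rho> \<Longrightarrow> cmod t < \<rho> \<Longrightarrow>
      ((\<lambda>(j, k). c j k * s ^ j * t ^ k) has_sum F (a1 + s, a2 + t)) (UNIV \<times> UNIV)" by blast
  define e where "e = (\<lambda>(j, k). \<lambda>b\<in>(Basis :: (real \<times> real) set). if b = (1, 0) then j else k :: nat)"
  have Bas: "(Basis :: (real \<times> real) set) = {(1, 0), (0, 1)}" by (auto simp: Basis_prod_def)
  have e: "bij_betw e (UNIV \<times> UNIV) (Basis \<rightarrow>\<^sub>E UNIV)"
  proof (rule bij_betwI[where g="\<lambda>m. (m (1, 0), m (0, 1))"])
    show "e \<in> UNIV \<times> UNIV \<rightarrow> Basis \<rightarrow>\<^sub>E UNIV" by (auto simp: e_def)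
    show "((e z) (1, 0), (e z) (0, 1)) = z" for z by (cases z) (simp add: e_def Bas)
    show "e (m (1, 0), m (0, 1)) = m" if "m \<in> Basis \<rightarrow>\<^sub>E UNIV" for m
      using that by (auto simp: e_def Bas fun_eq_iff PiE_def extensional_def)
  qed auto
  show ?thesis
    unfolding real_analytic_at_def
  proof (intro exI[of _ \<rho>] exI[of _ "\<lambda>m. Re (c (m (1, 0)) (m (0, 1)))"] conjI ballI \<rho>)
    fix x assume x: "x \<in> ball a \<rho>"
    define s t where "s = fst x - fst a" and "t = snd x - snd a"
    have st: "\<bar>s\<bar> < \<rho>" "\<bar>t\<bar> < \<rho>"
      using x dist_fst_le[of a x] dist_snd_le[of a x] by (auto simp: s_def t_def dist_real_def)
    have "(a1 + of_real s, a2 + of_real t) = cvec x" by (cases x) (simp add: a1_def a2_def s_def t_def)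
    with c[of "of_real s" "of_real t"] st
    have "((\<lambda>(j, k). c j k * of_real s ^ j * of_real t ^ k) has_sum F (cvec x)) (UNIV \<times> UNIV)" by simp
    moreover have "F (cvec x) = complex_of_real (f x)"
    proof (rule r(3))
      show "x \<in> ball a r" using x r(1) zero_le_dist[of a x] unfolding \<rho>_def mem_ball by linarith
    qed
    ultimately have "((\<lambda>(j, k). c j k * of_real s ^ j * of_real t ^ k) has_sum complex_of_real (f x)) (UNIV \<times> UNIV)" by simp
    from has_sum_bounded_linear[OF bounded_linear_Re this]
    have "((\<lambda>z. Re (case z of (j, k) \<Rightarrow> c j k * of_real s ^ j * of_real t ^ k)) has_sum f x) (UNIV \<times> UNIV)" by simp
    moreover have "Re (case z of (j, k) \<Rightarrow> c j k * of_real s ^ j * of_real t ^ k) =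
        (\<Prod>b\<in>Basis. ((x - a) \<bullet> b) ^ (e z) b) *\<^sub>R Re (c ((e z) (1, 0)) ((e z) (0, 1)))" for z
      by (cases z; cases x; cases a) (simp add: e_def Bas s_def t_def flip: of_real_power of_real_diff of_real_mult)
    ultimately have "((\<lambda>z. (\<Prod>b\<in>Basis. ((x - a) \<bullet> b) ^ (e z) b) *\<^sub>R Re (c ((e z) (1, 0)) ((e z) (0, 1))))
        has_sum f x) (UNIV \<times> UNIV)" by simp
    then show "((\<lambda>m. (\<Prod>b\<in>Basis. ((x - a) \<bullet> b) ^ m b) *\<^sub>R Re (c (m (1, 0)) (m (0, 1)))) has_sum f x) (Basis \<rightarrow>\<^sub>E UNIV)"
      using has_sum_reindex_bij_betw[OF e, of "\<lambda>m. (\<Prod>b\<in>Basis. ((x - a) \<bullet> b) ^ m b) *\<^sub>R Re (c (m (1, 0)) (m (0, 1)))"]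
      by simp
  qed
qed

lemma real_analytic_at_Pair:
  assumes "real_analytic_at f a" "real_analytic_at g a"
  shows "real_analytic_at (\<lambda>x. (f x, g x)) a"
proof -
  obtain r c where r: "0 < r" "\<And>x. x \<in> ball a r \<Longrightarrow>
      ((\<lambda>m. (\<Prod>b\<in>Basis. ((x - a) \<bullet> b) ^ m b) *\<^sub>R c m) has_sum f x) (Basis \<rightarrow>\<^sub>E UNIV)"
    using assms(1) unfolding real_analytic_at_def by blast
  obtain r' c' where r': "0 < r'" "\<And>x. x \<in> ball a r' \<Longrightarrow>
      ((\<lambda>m. (\<Prod>b\<in>Basis. ((x - a) \<bullet> b) ^ m b) *\<^sub>R c' m) has_sum g x) (Basis \<rightarrow>\<^sub>E UNIV)"
    using assms(2) unfolding real_analytic_at_def by blast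
  have bl: "bounded_linear (\<lambda>x. (x, 0))" "bounded_linear (\<lambda>y. (0, y))"
    by (auto intro!: bounded_linear_Pair bounded_linear_ident bounded_linear_zero)
  show ?thesis
    unfolding real_analytic_at_def
  proof (intro exI[of _ "min r r'"] exI[of _ "\<lambda>m. (c m, c' m)"] conjI ballI)
    fix x assume x: "x \<in> ball a (min r r')"
    then have "x \<in> ball a r" "x \<in> ball a r'" by auto
    from has_sum_add[OF has_sum_bounded_linear[OF bl(1) r(2)[OF this(1)]] has_sum_bounded_linear[OF bl(2) r'(2)[OF this(2)]]]
    show "((\<lambda>m. (\<Prod>b\<in>Basis. ((x - a) \<bullet> b) ^ m b) *\<^sub>R (c m, c' m)) has_sum (f x, g x)) (Basis \<rightarrow>\<^sub>E UNIV)"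
      by simp
  qed (use r r' in simp)
qed

lemma real_analytic_at_bounded_linear:
  assumes "real_analytic_at f a" "bounded_linear h"
  shows "real_analytic_at (\<lambda>x. h (f x)) a"
proof -
  obtain r c where r: "0 < r" "\<And>x. x \<in> ball a r \<Longrightarrow>
      ((\<lambda>m. (\<Prod>b\<in>Basis. ((x - a) \<bullet> b) ^ m b) *\<^sub>R c m) has_sum f x) (Basis \<rightarrow>\<^sub>E UNIV)"
    using assms(1) unfolding real_analytic_at_def by blast
  show ?thesis
    unfolding real_analytic_at_def
  proof (intro exI[of _ r] exI[of _ "\<lambda>m. h (c m)"] conjI ballI r)
    fix x assume "x \<in> ball a r"
    from has_sum_bounded_linear[OF assms(2) r(2)[OF this]]
    show "((\<lambda>m. (\<Prod>b\<in>Basis. ((x - a) \<bullet> b) ^ m b) *\<^sub>R h (c m)) has_sum h (f x)) (Basis \<rightarrow>\<^sub>E UNIV)"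
      by (simp add: linear_cmul bounded_linear.linear[OF assms(2)])
  qed
qed

section \<open>Local inverses\<close>

text \<open>Derivatives enter as plain maps, continuous direction by direction, so that one
  statement covers a real map of the plane and its holomorphic extension to C^2.\<close>

lemma inverse_function_C1:
  fixes f :: "'a::euclidean_space \<Rightarrow> 'a"
  assumes U: "open U" and f': "\<And>x. x \<in> U \<Longrightarrow> (f has_derivative f' x) (at x)"
    and cont: "\<And>h. continuous_on U (\<lambda>x. f' x h)" and x0: "x0 \<in> U"
    and L: "linear L" "\<And>h. L (f' x0 h) = h"
  shows "\<exists>U' V g. open U' \<and> U' \<subseteq> U \<and> x0 \<in> U' \<and> open V \<and> homeomorphism U' V f g \<and>
    (\<forall>y\<in>V. (g has_derivative inv (f' (g y))) (at y) \<and> bij (f' (g y)))"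
proof -
  have bl: "blinfun_apply (Blinfun (f' x)) = f' x" if "x \<in> U" for x
    using f'[OF that] has_derivative_bounded_linear bounded_linear_Blinfun_apply by blast
  have blg: "blinfun_apply (Blinfun L) = L"
    using L(1) linear_conv_bounded_linear bounded_linear_Blinfun_apply by blast
  have c: "continuous_on U (\<lambda>x. Blinfun (f' x))"
  proof (rule continuous_on_blinfun_componentwise)
    fix i :: 'a
    show "continuous_on U (\<lambda>x. blinfun_apply (Blinfun (f' x)) i)"
      using cont[of i] by (rule continuous_on_eq) (simp add: bl)
  qed
  have inv: "Blinfun L o\<^sub>L Blinfun (f' x0) = id_blinfun"
    by (rule blinfun_eqI) (simp add: bl[OF x0] blg L(2))
  have d: "(f has_derivative blinfun_apply (Blinfun (f' x))) (at x)" if "x \<in> U" for x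
    using f'[OF that] bl[OF that] by simp
  obtain U' V g g' where g: "open U'" "U' \<subseteq> U" "x0 \<in> U'" "open V" "f x0 \<in> V" "homeomorphism U' V f g"
    and dg: "\<And>y. y \<in> V \<Longrightarrow> (g has_derivative (g' y)) (at y)"
      "\<And>y. y \<in> V \<Longrightarrow> g' y = inv (blinfun_apply (Blinfun (f' (g y))))"
      "\<And>y. y \<in> V \<Longrightarrow> bij (blinfun_apply (Blinfun (f' (g y))))"
    by (rule inverse_function_theorem[of U f "\<lambda>x. Blinfun (f' x)" x0 "Blinfun L"]) (use U d c x0 inv in auto)
  have gU: "g y \<in> U" if "y \<in> V" for y using g(2,6) that by (auto simp: homeomorphism_def)
  show ?thesis
    using g dg bl[OF gU] by (intro exI[of _ U'] exI[of _ V] exI[of _ g]) auto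
qed

lemma dd_complex2:
  fixes F :: "complex \<times> complex \<Rightarrow> complex"
  assumes "cdiff F z"
  shows "dd F z h = fst h * dd F z (1, 0) + snd h * dd F z (0, 1)"
proof -
  have "h = fst h *\<^sub>C (1, 0) + snd h *\<^sub>C (0, 1)" by (cases h) simp
  then have "dd F z h = dd F z (fst h *\<^sub>C (1, 0) + snd h *\<^sub>C (0, 1))" by simp
  also have "\<dots> = fst h *\<^sub>C dd F z (1, 0) + snd h *\<^sub>C dd F z (0, 1)"
    by (simp only: linear_add[OF dd_linear[OF assms]] dd_cscale[OF assms])
  finally show ?thesis by simp
qed

lemma cdiff_inverse_map:
  assumes f: "cdiff f x" and g: "(g has_derivative inv (dd f x)) (at y)" and b: "bij (dd f x)"
  shows "cdiff g y"
proof (rule cdiffI[OF g])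
  fix h
  have "dd f x (jop (inv (dd f x) h)) = jop h"
    using dd_jop[OF f] b by (simp add: bij_is_surj surj_f_inv_f)
  then show "inv (dd f x) (jop h) = jop (inv (dd f x) h)"
    using b by (metis bij_inv_eq_iff)
qed

text \<open>The inverse function theorem is applied twice, to the real map and to its holomorphic
  extension. The complex inverse is holomorphic and coincides on real points with the real one,
  which is therefore analytic.\<close>

lemma local_inverse:
  assumes x: "ext_at x a" and y: "ext_at y a" and det: "D1 x a * D2 y a - D2 x a * D1 y a \<noteq> 0"
    and N: "open N" "a \<in> N"
  shows "\<exists>V V' g. open V \<and> a \<in> V \<and> V \<subseteq> N \<and> open V' \<and> homeomorphism V V' (\<lambda>w. (x w, y w)) g \<and>
    (\<forall>b\<in>V'. ext_at (\<lambda>b. fst (g b)) b \<and> ext_at (\<lambda>b. snd (g b)) b)"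
proof -
  define \<Phi> where "\<Phi> w = (x w, y w)" for w
  obtain X r1 where r1: "0 < r1" "chol_on X (ball (cvec a) r1)"
    "\<And>w. w \<in> ball a r1 \<Longrightarrow> X (cvec w) = complex_of_real (x w)"
    by (rule ext_atE[OF x]) blast
  obtain Y r2 where r2: "0 < r2" "chol_on Y (ball (cvec a) r2)"
    "\<And>w. w \<in> ball a r2 \<Longrightarrow> Y (cvec w) = complex_of_real (y w)"
    by (rule ext_atE[OF y]) blast
  obtain r3 where r3: "0 < r3" "ball a r3 \<subseteq> N" using N open_contains_ball by blast
  obtain r4 where r4: "0 < r4" "\<And>b. b \<in> ball a r4 \<Longrightarrow> ext_at x b"
    by (rule ext_at_nhd[OF x]) blast
  obtain r5 where r5: "0 < r5" "\<And>b. b \<in> ball a r5 \<Longrightarrow> ext_at y b"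
    by (rule ext_at_nhd[OF y]) blast
  define r where "r = Min {r1, r2, r3, r4, r5}"
  have r: "0 < r" "r \<le> r1" "r \<le> r2" "r \<le> r3" "r \<le> r4" "r \<le> r5"
    using r1 r2 r3 r4 r5 by (auto simp: r_def)
  define Bc where "Bc = ball (cvec a) r"
  define Br where "Br = ball a r"
  have a: "cvec a \<in> Bc" "a \<in> Br" using r by (auto simp: Bc_def Br_def)
  define \<Psi> where "\<Psi> z = (X z, Y z)" for z
  have cXY: "chol_on X Bc" "chol_on Y Bc"
    unfolding Bc_def
    by (rule chol_on_subset[OF r1(2) subset_ball[OF r(2)]], rule chol_on_subset[OF r2(2) subset_ball[OF r(3)]])
  have c\<Psi>: "chol_on \<Psi> Bc"
    using cXY unfolding \<Psi>_def[abs_def] by (auto simp: chol_on_def intro: cdiff_Pair)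
  have \<Psi>r: "\<Psi> (cvec w) = cvec (\<Phi> w)" if "w \<in> Br" for w
    using r1(3)[of w] r2(3)[of w] r that by (simp add: \<Psi>_def \<Phi>_def Br_def)
  have dX: "dd X (cvec a) (cvec h) = of_real (dd x a h)" "dd Y (cvec a) (cvec h) = of_real (dd y a h)" for h
    using ext_at_has_derivative_aux(2)[of X a "ball a r1" x h] ext_at_has_derivative_aux(2)[of Y a "ball a r2" y h]
      r1 r2 by (auto simp: chol_on_def)
  have dX': "dd X (cvec a) (1, 0) = of_real (D1 x a)" "dd X (cvec a) (0, 1) = of_real (D2 x a)"
    "dd Y (cvec a) (1, 0) = of_real (D1 y a)" "dd Y (cvec a) (0, 1) = of_real (D2 y a)"
    using dX[of "(1, 0)"] dX[of "(0, 1)"] by (simp_all add: D1_def D2_def)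
  define \<Delta> where "\<Delta> = D1 x a * D2 y a - D2 x a * D1 y a"
  have \<Delta>: "\<Delta> \<noteq> 0" using det by (simp add: \<Delta>_def)
  have dd\<Psi>: "dd \<Psi> z h = (dd X z h, dd Y z h)" if "z \<in> Bc" for z h
  proof -
    have "cdiff X z" "cdiff Y z" using cXY that by (simp_all add: chol_on_def)
    from dd_eq[OF has_derivative_Pair[OF cdiff_has_derivative[OF this(1)] cdiff_has_derivative[OF this(2)]]]
    show ?thesis by (simp add: \<Psi>_def[abs_def])
  qed
  have "\<exists>U' V g. open U' \<and> U' \<subseteq> Bc \<and> cvec a \<in> U' \<and> open V \<and> homeomorphism U' V \<Psi> g \<and>
      (\<forall>y\<in>V. (g has_derivative inv (dd \<Psi> (g y))) (at y) \<and> bij (dd \<Psi> (g y)))"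
  proof (rule inverse_function_C1[where L = "\<lambda>(k1, k2). ((of_real (D2 y a) * k1 - of_real (D2 x a) * k2) / of_real \<Delta>,
      (of_real (D1 x a) * k2 - of_real (D1 y a) * k1) / of_real \<Delta>)"])
    show "(\<Psi> has_derivative dd \<Psi> z) (at z)" if "z \<in> Bc" for z
      using c\<Psi> that cdiff_has_derivative by (auto simp: chol_on_def)
    show "continuous_on Bc (\<lambda>z. dd \<Psi> z h)" for h
      by (intro chol_on_continuous chol_on_dd c\<Psi>) (simp add: Bc_def)
    show "linear (\<lambda>(k1, k2). ((complex_of_real (D2 y a) * k1 - of_real (D2 x a) * k2) / of_real \<Delta>,
      (of_real (D1 x a) * k2 - of_real (D1 y a) * k1) / of_real \<Delta>))"
      by (rule linearI) (auto simp: algebra_simps add_divide_distrib diff_divide_distrib scaleR_conv_of_real)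
    fix h :: "complex \<times> complex"
    have c: "cdiff X (cvec a)" "cdiff Y (cvec a)" using cXY a by (auto simp: chol_on_def)
    have "complex_of_real \<Delta> \<noteq> 0" using \<Delta> by simp
    then show "(case dd \<Psi> (cvec a) h of (k1, k2) \<Rightarrow> ((complex_of_real (D2 y a) * k1 - of_real (D2 x a) * k2) / of_real \<Delta>,
      (of_real (D1 x a) * k2 - of_real (D1 y a) * k1) / of_real \<Delta>)) = h"
      unfolding dd\<Psi>[OF a(1)] dd_complex2[OF c(1), of h] dd_complex2[OF c(2), of h] dX'
      by (cases h) (simp add: field_simps, simp add: \<Delta>_def algebra_simps)
  qed (use a in \<open>auto simp: Bc_def\<close>)
  then obtain Uc Vc gc where gc: "open Uc" "Uc \<subseteq> Bc" "cvec a \<in> Uc" "open Vc" "homeomorphism Uc Vc \<Psi> gc"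
    "\<And>y. y \<in> Vc \<Longrightarrow> (gc has_derivative inv (dd \<Psi> (gc y))) (at y)" "\<And>y. y \<in> Vc \<Longrightarrow> bij (dd \<Psi> (gc y))"
    by blast
  have gcB: "gc y \<in> Bc" if "y \<in> Vc" for y using gc(2,5) that by (auto simp: homeomorphism_def)
  have cgc: "chol_on gc Vc"
    unfolding chol_on_def
    by (intro ballI cdiff_inverse_map[OF _ gc(6) gc(7)]) (use gcB c\<Psi> in \<open>auto simp: chol_on_def\<close>)
  have ex: "ext_at x b" "ext_at y b" if "b \<in> Br" for b using r4 r5 r that by (auto simp: Br_def)
  have "\<exists>U' V g. open U' \<and> U' \<subseteq> Br \<and> a \<in> U' \<and> open V \<and> homeomorphism U' V \<Phi> g \<and>
      (\<forall>b\<in>V. (g has_derivative inv ((\<lambda>w h. (dd x w h, dd y w h)) (g b))) (at b) \<and> bij ((\<lambda>w h. (dd x w h, dd y w h)) (g b)))"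
  proof (rule inverse_function_C1[where L = "\<lambda>(k1, k2). ((D2 y a * k1 - D2 x a * k2) / \<Delta>, (D1 x a * k2 - D1 y a * k1) / \<Delta>)"])
    show "(\<Phi> has_derivative (\<lambda>h. (dd x w h, dd y w h))) (at w)" if "w \<in> Br" for w
      unfolding \<Phi>_def[abs_def] by (intro has_derivative_Pair ext_at_has_derivative ex that)
    show "continuous_on Br (\<lambda>w. (dd x w h, dd y w h))" for h
      by (intro continuous_on_Pair ext_at_continuous_on ext_at_dd ex)
    show "linear (\<lambda>(k1, k2). ((D2 y a * k1 - D2 x a * k2) / \<Delta>, (D1 x a * k2 - D1 y a * k1) / \<Delta>))"
      by (rule linearI) (auto simp: algebra_simps add_divide_distrib diff_divide_distrib)
    fix h :: "real \<times> real"
    show "(case (dd x a h, dd y a h) of (k1, k2) \<Rightarrow> ((D2 y a * k1 - D2 x a * k2) / \<Delta>, (D1 x a * k2 - D1 y a * k1) / \<Delta>)) = h"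
      unfolding ext_at_D(4)[OF x] ext_at_D(4)[OF y] using \<Delta>
      by (cases h) (simp add: field_simps, simp add: \<Delta>_def algebra_simps)
  qed (use a in \<open>auto simp: Br_def\<close>)
  then obtain Ur Vr gr where gr: "open Ur" "Ur \<subseteq> Br" "a \<in> Ur" "open Vr" "homeomorphism Ur Vr \<Phi> gr"
    by blast
  define V where "V = Ur \<inter> cvec -` Uc"
  have "continuous_on UNIV cvec"
    using cpx2.linear_iota linear_conv_bounded_linear linear_continuous_on by blast
  then have V: "open V" unfolding V_def using gr(1) gc(1) by (simp add: open_Int open_vimage)
  have aV: "a \<in> V" using gr gc by (simp add: V_def)
  define V' where "V' = \<Phi> ` V"
  have V'_eq: "V' = Vr \<inter> gr -` V"
    using gr(5) unfolding V'_def V_def homeomorphism_def by (auto simp: image_iff) 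
  have V': "open V'"
    unfolding V'_eq using gr(4,5) V by (intro continuous_open_preimage) (auto simp: homeomorphism_def)
  have hom: "homeomorphism V V' \<Phi> gr"
    by (rule homeomorphism_of_subsets[OF gr(5)]) (auto simp: V_def V'_def)
  \<comment> \<open>The real preimage of \<open>b\<close>, seen as a complex point, lies in
    \<open>Uc\<close> and is a preimage under \<open>\<Psi>\<close>, so \<open>gc\<close> must
    return it.\<close>
  have link: "cvec b \<in> Vc \<and> gc (cvec b) = cvec (gr b)" if "b \<in> V'" for b
  proof -
    have g: "gr b \<in> V" "\<Phi> (gr b) = b" using hom that by (auto simp: homeomorphism_def)
    then have "gr b \<in> Br" "cvec (gr b) \<in> Uc" using gr(2) by (auto simp: V_def)
    then have "\<Psi> (cvec (gr b)) = cvec b" using \<Psi>r g by simp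
    then show ?thesis using gc(5) \<open>cvec (gr b) \<in> Uc\<close> unfolding homeomorphism_def by (metis imageI)
  qed
  have e: "ext_at (\<lambda>b. fst (gr b)) b \<and> ext_at (\<lambda>b. snd (gr b)) b" if b: "b \<in> V'" for b
  proof
    have cb: "cvec b \<in> Vc" using link[OF b] by blast
    have eq: "gc (cvec w) = cvec (gr w)" if "w \<in> V'" for w using link[OF that] by blast
    show "ext_at (\<lambda>b. fst (gr b)) b"
    proof (rule ext_atI[OF gc(4) cb _ V' b])
      show "chol_on (\<lambda>z. fst (gc z)) Vc" using cgc by (auto simp: chol_on_def intro: cdiff_fst)
      show "fst (gc (cvec w)) = complex_of_real (fst (gr w))" if "w \<in> V'" for w
        using eq[OF that] by (cases "gr w") simp
    qed
    show "ext_at (\<lambda>b. snd (gr b)) b"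
    proof (rule ext_atI[OF gc(4) cb _ V' b])
      show "chol_on (\<lambda>z. snd (gc z)) Vc" using cgc by (auto simp: chol_on_def intro: cdiff_snd)
      show "snd (gc (cvec w)) = complex_of_real (snd (gr w))" if "w \<in> V'" for w
        using eq[OF that] by (cases "gr w") simp
    qed
  qed
  have "V \<subseteq> N" using gr(2) r3(2) subset_ball[OF r(4), of a] unfolding V_def Br_def by blast
  then show ?thesis
    using V aV V' hom e unfolding \<Phi>_def[abs_def] by (intro exI[of _ V] exI[of _ V'] exI[of _ gr]) auto
qed

lemma chain2:
  assumes f: "ext_at f (x w, y w)" and x: "ext_at x w" and y: "ext_at y w"
    and V: "open V" "w \<in> V" and eq: "\<And>w. w \<in> V \<Longrightarrow> f (x w, y w) = k w"
  shows "D1 k w = D1 f (x w, y w) * D1 x w + D2 f (x w, y w) * D1 y w"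
    "D2 k w = D1 f (x w, y w) * D2 x w + D2 f (x w, y w) * D2 y w"
proof -
  have "((\<lambda>w. (x w, y w)) has_derivative (\<lambda>h. (D1 x w * fst h + D2 x w * snd h, D1 y w * fst h + D2 y w * snd h))) (at w)"
    by (intro has_derivative_Pair ext_at_D(5) x y)
  from has_derivative_compose[OF this ext_at_D(5)[OF f]]
  have "((\<lambda>w. f (x w, y w)) has_derivative (\<lambda>h. D1 f (x w, y w) * (D1 x w * fst h + D2 x w * snd h) +
      D2 f (x w, y w) * (D1 y w * fst h + D2 y w * snd h))) (at w)" by simp
  then have "(k has_derivative (\<lambda>h. D1 f (x w, y w) * (D1 x w * fst h + D2 x w * snd h) +
      D2 f (x w, y w) * (D1 y w * fst h + D2 y w * snd h))) (at w)"
    by (rule has_derivative_transform_within_open[OF _ V]) (simp_all add: eq)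
  then have "(k has_derivative (\<lambda>h. (D1 f (x w, y w) * D1 x w + D2 f (x w, y w) * D1 y w) * fst h +
      (D1 f (x w, y w) * D2 x w + D2 f (x w, y w) * D2 y w) * snd h)) (at w)"
    by (rule has_derivative_eq_rhs) (auto simp: algebra_simps)
  from D_eqI[OF this] show "D1 k w = D1 f (x w, y w) * D1 x w + D2 f (x w, y w) * D1 y w"
    "D2 k w = D1 f (x w, y w) * D2 x w + D2 f (x w, y w) * D2 y w" .
qed

section \<open>The characteristic system\<close>

lemma cramer_unique:
  fixes a b c d x1 x2 y1 y2 :: real
  assumes "a * x1 + b * y1 = c * x1 + d * y1" "a * x2 + b * y2 = c * x2 + d * y2" "x1 * y2 - x2 * y1 \<noteq> 0"
  shows "a = c" "b = d"
proof -
  have "(a - c) * (x1 * y2 - x2 * y1) = 0" "(b - d) * (x1 * y2 - x2 * y1) = 0"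
    using assms(1,2) by algebra+
  then show "a = c" "b = d" using assms(3) by auto
qed

text \<open>With \<open>a = C + r\<close>, \<open>b = s - B\<close>, \<open>c = A + t\<close> the system says that \<open>\<partial>\<^sub>v\<close> is the rotation of \<open>\<partial>\<^sub>u\<close>
  in the metric \<open>a dx\<^sup>2 + 2 b dx dy + c dy\<^sup>2\<close> of determinant \<open>S\<^sup>2\<close>.\<close>

lemma conformal_algebra:
  fixes A B C E r s t S xu xv yu yv :: real
  assumes S: "S\<^sup>2 = A * C - B\<^sup>2 + E" "0 < S" and J: "xu * yv - xv * yu > 0"
    and 1: "S * xv = - (s * xu + t * yu) + B * xu - A * yu"
    and 2: "S * yv = (r * xu + s * yu) + C * xu - B * yu"
    and 3: "r * xv + s * yv = - S * yu - C * xv + B * yv"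
    and 4: "s * xv + t * yv = S * xu + B * xv - A * yv"
  shows "A * r + 2 * B * s + C * t + r * t - s\<^sup>2 = E" "C + r > 0"
proof -
  define a b c where "a = C + r" and "b = s - B" and "c = A + t"
  have e: "S * xv = - (b * xu + c * yu)" "S * yv = a * xu + b * yu"
    "S * yu = - (a * xv + b * yv)" "S * xu = b * xv + c * yv"
    using 1 2 3 4 by (auto simp: a_def b_def c_def algebra_simps)
  have "S\<^sup>2 * (xu * yv - xv * yu) = (S * xu) * (S * yv) - (S * xv) * (S * yu)"
    by (simp add: power2_eq_square algebra_simps)
  also have "\<dots> = (a * c - b\<^sup>2) * (xu * yv - xv * yu)"
    unfolding e by (simp add: power2_eq_square algebra_simps)
  \<comment> \<open>The same product was evaluated once through the \<open>v\<close>-derivatives and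
    once through the metric; the Jacobian cancels and leaves the equation in determinant
    form.\<close>
  finally have det: "a * c - b\<^sup>2 = S\<^sup>2" using J by simp
  then show "A * r + 2 * B * s + C * t + r * t - s\<^sup>2 = E"
    using S(1) by (simp add: a_def b_def c_def power2_eq_square algebra_simps)
  \<comment> \<open>The metric evaluated on \<open>(x_u, y_u)\<close>; it is positive because the
    orientation is preserved. Completing the square in \<open>a * Q\<close> shows
    \<open>0 \<le> a\<close>, and \<open>a = 0\<close> would contradict the positive
    determinant.\<close>
  define Q where "Q = S * (xu * yv - xv * yu)"
  have Q: "0 < Q" using S(2) J by (simp add: Q_def)
  have "Q = xu * (S * yv) - yu * (S * xv)" by (simp add: Q_def algebra_simps)
  also have "\<dots> = a * xu\<^sup>2 + 2 * b * xu * yu + c * yu\<^sup>2" unfolding e by (simp add: power2_eq_square algebra_simps)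
  finally have "a * Q = (a * xu + b * yu)\<^sup>2 + (a * c - b\<^sup>2) * yu\<^sup>2"
    by (simp add: power2_eq_square algebra_simps)
  then have aQ: "0 \<le> a * Q" by (simp add: det)
  then have "0 \<le> a" using Q by (simp add: zero_le_mult_iff)
  moreover have "a \<noteq> 0"
  proof
    assume "a = 0"
    then have "- b\<^sup>2 = S\<^sup>2" using det by simp
    then have "S\<^sup>2 \<le> 0" by (metis neg_le_0_iff_le zero_le_power2)
    then show False using S(2) by simp
  qed
  ultimately show "C + r > 0" by (simp add: a_def)
qed

text \<open>The data live on the strip including the axis, where \<open>(x, y)\<close> degenerates
  for the solutions in question. In \<open>system\<close> the bound \<open>X\<close> and
  \<open>S\<close> are names for the jet at \<open>w\<close> and for the root of the
  discriminant.\<close>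

locale ma_param =
  fixes U :: "R5 set" and A B C E :: "R5 \<Rightarrow> real" and R :: real
    and x y z p q :: "real \<times> real \<Rightarrow> real"
  assumes elliptic: "\<And>w. w \<in> U \<Longrightarrow> A w * C w - (B w)\<^sup>2 + E w > 0"
    and ext: "w \<in> Strip_hat R \<Longrightarrow> ext_at x w" "w \<in> Strip_hat R \<Longrightarrow> ext_at y w" "w \<in> Strip_hat R \<Longrightarrow> ext_at z w"
      "w \<in> Strip_hat R \<Longrightarrow> ext_at p w" "w \<in> Strip_hat R \<Longrightarrow> ext_at q w"
    and mem: "w \<in> Strip_hat R \<Longrightarrow> (x w, y w, z w, p w, q w) \<in> U"
    and system: "\<And>w X S. w \<in> Strip_hat R \<Longrightarrow> X = (x w, y w, z w, p w, q w) \<Longrightarrow>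
      S = sqrt (A X * C X - (B X)\<^sup>2 + E X) \<Longrightarrow>
      S * D2 x w = - D1 q w + B X * D1 x w - A X * D1 y w \<and>
      S * D2 y w = D1 p w + C X * D1 x w - B X * D1 y w \<and>
      D2 p w = - S * D1 y w - C X * D2 x w + B X * D2 y w \<and>
      D2 q w = S * D1 x w + B X * D2 x w - A X * D2 y w"
    and dz: "w \<in> Strip_hat R \<Longrightarrow> D1 z w = p w * D1 x w + q w * D1 y w"
      "w \<in> Strip_hat R \<Longrightarrow> D2 z w = p w * D2 x w + q w * D2 y w"
begin

definition jac :: "real \<times> real \<Rightarrow> real" where
  "jac w = D1 x w * D2 y w - D2 x w * D1 y w"

lemma open_Strip_hat: "open (Strip_hat R)"
  unfolding Strip_hat_def case_prod_unfold by (intro open_Collect_conj open_Collect_less continuous_intros)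

text \<open>\<open>local_inverse\<close> makes \<open>\<zeta>\<close> analytic near each image
  point. The chain rule for \<open>z\<close> and Cramer's rule identify its gradient as
  \<open>(p, q)\<close>, the chain rule for \<open>p\<close> and \<open>q\<close> brings in the
  second derivatives, and \<open>conformal_algebra\<close> concludes. Asking only for
  \<open>\<zeta> (x w, y w) = z w\<close> on \<open>V\<close> treats a small neighbourhood and a
  whole annulus alike.\<close>

lemma local_graph:
  assumes V: "open V" "V \<subseteq> Strip_hat R" "\<And>w. w \<in> V \<Longrightarrow> jac w > 0"
    and \<zeta>: "\<And>w. w \<in> V \<Longrightarrow> \<zeta> (x w, y w) = z w"
  defines "\<Omega> \<equiv> (\<lambda>w. (x w, y w)) ` V"
  shows "open \<Omega>" "\<And>b. b \<in> \<Omega> \<Longrightarrow> ext_at \<zeta> b" "\<And>w. w \<in> V \<Longrightarrow> grad \<zeta> (x w, y w) = (p w, q w)"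
    "MA_solution U A B C E \<Omega> \<zeta>" "\<forall>w\<in>\<Omega>. C (jet1 \<zeta> w) + D1 (D1 \<zeta>) w > 0"
proof -
  have loc: "\<exists>T. open T \<and> (x w, y w) \<in> T \<and> T \<subseteq> \<Omega> \<and> ext_at \<zeta> (x w, y w)" if w: "w \<in> V" for w
  proof -
    have wS: "w \<in> Strip_hat R" using w V by blast
    have "D1 x w * D2 y w - D2 x w * D1 y w \<noteq> 0" using V(3)[OF w] by (simp add: jac_def)
    from local_inverse[OF ext(1)[OF wS] ext(2)[OF wS] this V(1) w]
    obtain W W' g where W: "open W" "w \<in> W" "W \<subseteq> V" "open W'" "homeomorphism W W' (\<lambda>w. (x w, y w)) g"
      "\<And>b. b \<in> W' \<Longrightarrow> ext_at (\<lambda>b. fst (g b)) b" "\<And>b. b \<in> W' \<Longrightarrow> ext_at (\<lambda>b. snd (g b)) b" by blast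
    have W'_eq: "W' = (\<lambda>w. (x w, y w)) ` W" using W(5) by (simp add: homeomorphism_def)
    have b: "(x w, y w) \<in> W'" using W(2) W'_eq by blast
    have gw: "g (x w', y w') = w'" if "w' \<in> W" for w' using W(5) that by (simp add: homeomorphism_def)
    have "ext_at (\<lambda>b. z (fst (g b), snd (g b))) (x w, y w)"
      by (rule ext_at_compose) (use ext(3)[OF wS] gw[OF W(2)] W(6,7)[OF b] in auto)
    then have "ext_at \<zeta> (x w, y w)"
    proof (rule ext_at_cong[OF _ W(4) b])
      fix b assume "b \<in> W'"
      then obtain w' where w': "w' \<in> W" "b = (x w', y w')" using W'_eq by blast
      then show "z (fst (g b), snd (g b)) = \<zeta> b" using gw[OF w'(1)] \<zeta>[of w'] W(3) by auto
    qed
    then show ?thesis using W b W'_eq by (intro exI[of _ W']) (auto simp: \<Omega>_def)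
  qed
  show op: "open \<Omega>"
  proof (subst open_subopen, intro ballI)
    fix b assume "b \<in> \<Omega>"
    then obtain w where "w \<in> V" "b = (x w, y w)" by (auto simp: \<Omega>_def)
    then show "\<exists>T. open T \<and> b \<in> T \<and> T \<subseteq> \<Omega>" using loc by blast
  qed
  show e: "ext_at \<zeta> b" if "b \<in> \<Omega>" for b using that loc by (auto simp: \<Omega>_def)
  have in\<Omega>: "(x w, y w) \<in> \<Omega>" if "w \<in> V" for w using that by (auto simp: \<Omega>_def)
  have D\<zeta>: "D1 \<zeta> (x w, y w) = p w" "D2 \<zeta> (x w, y w) = q w" if w: "w \<in> V" for w
  proof -
    have wS: "w \<in> Strip_hat R" using w V by blast
    have c: "D1 z w = D1 \<zeta> (x w, y w) * D1 x w + D2 \<zeta> (x w, y w) * D1 y w"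
      "D2 z w = D1 \<zeta> (x w, y w) * D2 x w + D2 \<zeta> (x w, y w) * D2 y w"
      by (rule chain2[OF e[OF in\<Omega>[OF w]] ext(1)[OF wS] ext(2)[OF wS] V(1) w], rule \<zeta>, assumption)+
    have j: "D1 x w * D2 y w - D2 x w * D1 y w \<noteq> 0" using V(3)[OF w] by (simp add: jac_def)
    show "D1 \<zeta> (x w, y w) = p w" "D2 \<zeta> (x w, y w) = q w"
      using cramer_unique[OF _ _ j] c dz[OF wS] by metis+
  qed
  show "grad \<zeta> (x w, y w) = (p w, q w)" if "w \<in> V" for w
    using D\<zeta>[OF that] by (simp add: grad_def)
  have jet: "jet1 \<zeta> (x w, y w) = (x w, y w, z w, p w, q w)" if "w \<in> V" for w
    using D\<zeta>[OF that] \<zeta>[OF that] by (simp add: jet1_def)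
  have main: "A X * D1 (D1 \<zeta>) b + 2 * B X * D2 (D1 \<zeta>) b + C X * D2 (D2 \<zeta>) b
          + D1 (D1 \<zeta>) b * D2 (D2 \<zeta>) b - (D2 (D1 \<zeta>) b)\<^sup>2 = E X \<and> C X + D1 (D1 \<zeta>) b > 0"
    if w: "w \<in> V" and b: "b = (x w, y w)" and X: "X = (x w, y w, z w, p w, q w)" for w b X
  proof -
    have wS: "w \<in> Strip_hat R" using w V by blast
    define S where "S = sqrt (A X * C X - (B X)\<^sup>2 + E X)"
    have XU: "X \<in> U" using mem[OF wS] X by simp
    have S: "S\<^sup>2 = A X * C X - (B X)\<^sup>2 + E X" "0 < S"
      using elliptic[OF XU] by (simp_all add: S_def)
    note eb = e[OF in\<Omega>[OF w]]
    have sym: "D1 (D2 \<zeta>) b = D2 (D1 \<zeta>) b" using ext_at_D(3)[OF eb] b by simp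
    have P: "D1 p w = D1 (D1 \<zeta>) b * D1 x w + D2 (D1 \<zeta>) b * D1 y w"
      "D2 p w = D1 (D1 \<zeta>) b * D2 x w + D2 (D1 \<zeta>) b * D2 y w"
      unfolding b
      by (rule chain2[OF ext_at_D(1)[OF eb] ext(1)[OF wS] ext(2)[OF wS] V(1) w], rule D\<zeta>, assumption)+
    have Q: "D1 q w = D2 (D1 \<zeta>) b * D1 x w + D2 (D2 \<zeta>) b * D1 y w"
      "D2 q w = D2 (D1 \<zeta>) b * D2 x w + D2 (D2 \<zeta>) b * D2 y w"
      unfolding sym[symmetric] unfolding b
      by (rule chain2[OF ext_at_D(2)[OF eb] ext(1)[OF wS] ext(2)[OF wS] V(1) w], rule D\<zeta>, assumption)+
    note sys = system[OF wS X S_def]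
    have J: "D1 x w * D2 y w - D2 x w * D1 y w > 0" using V(3)[OF w] by (simp add: jac_def)
    have e1: "S * D2 x w = - (D2 (D1 \<zeta>) b * D1 x w + D2 (D2 \<zeta>) b * D1 y w) + B X * D1 x w - A X * D1 y w"
      "S * D2 y w = (D1 (D1 \<zeta>) b * D1 x w + D2 (D1 \<zeta>) b * D1 y w) + C X * D1 x w - B X * D1 y w"
      "D1 (D1 \<zeta>) b * D2 x w + D2 (D1 \<zeta>) b * D2 y w = - S * D1 y w - C X * D2 x w + B X * D2 y w"
      "D2 (D1 \<zeta>) b * D2 x w + D2 (D2 \<zeta>) b * D2 y w = S * D1 x w + B X * D2 x w - A X * D2 y w"
      using sys P Q by auto
    show ?thesis using conformal_algebra[OF S J e1] by simp
  qed
  show "MA_solution U A B C E \<Omega> \<zeta>"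
    unfolding MA_solution_def
  proof (intro conjI ballI op Ck_on_ext_at e)
    fix b assume "b \<in> \<Omega>"
    then obtain w where w: "w \<in> V" "b = (x w, y w)" by (auto simp: \<Omega>_def)
    show "jet1 \<zeta> b \<in> U" using jet[OF w(1)] w(2) mem[of w] subsetD[OF V(2) w(1)] by simp
    show "A (jet1 \<zeta> b) * D1 (D1 \<zeta>) b + 2 * B (jet1 \<zeta> b) * D2 (D1 \<zeta>) b + C (jet1 \<zeta> b) * D2 (D2 \<zeta>) b
          + D1 (D1 \<zeta>) b * D2 (D2 \<zeta>) b - (D2 (D1 \<zeta>) b)\<^sup>2 = E (jet1 \<zeta> b)"
      using main[OF w, of "jet1 \<zeta> b"] jet[OF w(1)] w(2) by simp
  qed
  show "\<forall>b\<in>\<Omega>. C (jet1 \<zeta> b) + D1 (D1 \<zeta>) b > 0"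
  proof
    fix b assume "b \<in> \<Omega>"
    then obtain w where w: "w \<in> V" "b = (x w, y w)" by (auto simp: \<Omega>_def)
    show "C (jet1 \<zeta> b) + D1 (D1 \<zeta>) b > 0"
      using main[OF w, of "jet1 \<zeta> b"] jet[OF w(1)] w(2) by simp
  qed
qed

text \<open>Positivity of the Jacobian is an open condition, and near \<open>w\<close> the graph
  function is \<open>z\<close> composed with the local inverse of \<open>(x, y)\<close>.\<close>

lemma local_graph_near:
  assumes w: "w \<in> Strip R" "jac w > 0"
  shows "\<exists>V \<Omega> \<zeta>. open V \<and> w \<in> V \<and> V \<subseteq> Strip R \<and> (\<lambda>w. (x w, y w, z w)) ` V = graph_over \<Omega> \<zeta> \<and>
    real_analytic_on \<zeta> \<Omega> \<and> MA_solution U A B C E \<Omega> \<zeta> \<and> (\<forall>w\<in>\<Omega>. C (jet1 \<zeta> w) + D1 (D1 \<zeta>) w > 0)"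
proof -
  have sub: "Strip R \<subseteq> Strip_hat R" by (auto simp: Strip_def Strip_hat_def)
  have wS: "w \<in> Strip_hat R" using w sub by blast
  have opS: "open (Strip R)"
    unfolding Strip_def case_prod_unfold by (intro open_Collect_conj open_Collect_less continuous_intros)
  have ej: "continuous_on (Strip R) jac"
    unfolding jac_def[abs_def]
    by (intro ext_at_continuous_on ext_at_diff ext_at_mult ext_at_D ext) (use sub in auto)
  define N where "N = Strip R \<inter> jac -` {0<..}"
  have N: "open N" unfolding N_def by (rule continuous_open_preimage[OF ej opS]) simp
  have wN: "w \<in> N" using w by (simp add: N_def)
  have "D1 x w * D2 y w - D2 x w * D1 y w \<noteq> 0" using w by (simp add: jac_def)
  from local_inverse[OF ext(1)[OF wS] ext(2)[OF wS] this N wN]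
  obtain V V' g where V: "open V" "w \<in> V" "V \<subseteq> N" "open V'" "homeomorphism V V' (\<lambda>w. (x w, y w)) g" by blast
  define \<zeta> where "\<zeta> b = z (g b)" for b
  have \<zeta>: "\<zeta> (x w, y w) = z w" if "w \<in> V" for w using V(5) that by (simp add: \<zeta>_def homeomorphism_def)
  have Vs: "V \<subseteq> Strip R" "V \<subseteq> Strip_hat R" using V(3) sub by (auto simp: N_def)
  have j: "jac w > 0" if "w \<in> V" for w using V(3) that by (auto simp: N_def)
  note lg = local_graph[OF V(1) Vs(2) j \<zeta>]
  have "(\<lambda>w. (x w, y w, z w)) ` V = graph_over ((\<lambda>w. (x w, y w)) ` V) \<zeta>"
    using \<zeta> by (force simp: graph_over_def image_iff)
  moreover have "real_analytic_on \<zeta> ((\<lambda>w. (x w, y w)) ` V)"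
    unfolding real_analytic_on_def by (intro ballI ext_at_real_analytic lg(2))
  ultimately show ?thesis
    using V(1,2) Vs lg(4,5) by (intro exI[of _ V] exI[of _ "(\<lambda>w. (x w, y w)) ` V"] exI[of _ \<zeta>]) auto
qed

end

section \<open>Solving the characteristic system\<close>

lemma D_line:
  assumes "ext_at f (u, v)"
  shows "((\<lambda>s. f (s, v)) has_real_derivative D1 f (u, v)) (at u)"
    "((\<lambda>t. f (u, t)) has_real_derivative D2 f (u, v)) (at v)"
proof -
  have "((\<lambda>s. (s, v)) has_derivative (\<lambda>h. (h, 0))) (at u)" "((\<lambda>t. (u, t)) has_derivative (\<lambda>h. (0, h))) (at v)"
    by (auto intro!: derivative_eq_intros)
  from has_derivative_compose[OF this(1) ext_at_D(5)[OF assms]] has_derivative_compose[OF this(2) ext_at_D(5)[OF assms]]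
  show "((\<lambda>s. f (s, v)) has_real_derivative D1 f (u, v)) (at u)"
    "((\<lambda>t. f (u, t)) has_real_derivative D2 f (u, v)) (at v)"
    by (auto simp: has_field_derivative_def)
qed

lemma D_cong:
  assumes "ext_at f a" "open S" "a \<in> S" "\<And>w. w \<in> S \<Longrightarrow> f w = g w"
  shows "D1 f a = D1 g a" "D2 f a = D2 g a"
proof -
  have "(g has_derivative (\<lambda>h. D1 f a * fst h + D2 f a * snd h)) (at a)"
    by (rule has_derivative_transform_within_open[OF ext_at_D(5)[OF assms(1)] assms(2,3)]) (rule assms(4))
  from D_eqI[OF this] show "D1 f a = D1 g a" "D2 f a = D2 g a" by simp_all
qed

lemma D_mult:
  assumes "ext_at f a" "ext_at g a"
  shows "D1 (\<lambda>w. f w * g w) a = f a * D1 g a + D1 f a * g a"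
    "D2 (\<lambda>w. f w * g w) a = f a * D2 g a + D2 f a * g a"
proof -
  have "((\<lambda>w. f w * g w) has_derivative
      (\<lambda>h. (f a * D1 g a + D1 f a * g a) * fst h + (f a * D2 g a + D2 f a * g a) * snd h)) (at a)"
    by (rule has_derivative_eq_rhs[OF has_derivative_mult[OF ext_at_D(5)[OF assms(1)] ext_at_D(5)[OF assms(2)]]])
       (auto simp: algebra_simps)
  from D_eqI[OF this] show "D1 (\<lambda>w. f w * g w) a = f a * D1 g a + D1 f a * g a"
    "D2 (\<lambda>w. f w * g w) a = f a * D2 g a + D2 f a * g a" .
qed

lemma D_add:
  assumes "ext_at f a" "ext_at g a"
  shows "D1 (\<lambda>w. f w + g w) a = D1 f a + D1 g a" "D2 (\<lambda>w. f w + g w) a = D2 f a + D2 g a"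
proof -
  have "((\<lambda>w. f w + g w) has_derivative
      (\<lambda>h. (D1 f a + D1 g a) * fst h + (D2 f a + D2 g a) * snd h)) (at a)"
    by (rule has_derivative_eq_rhs[OF has_derivative_add[OF ext_at_D(5)[OF assms(1)] ext_at_D(5)[OF assms(2)]]])
       (auto simp: algebra_simps)
  from D_eqI[OF this] show "D1 (\<lambda>w. f w + g w) a = D1 f a + D1 g a" "D2 (\<lambda>w. f w + g w) a = D2 f a + D2 g a" .
qed

lemma D_diff:
  assumes "ext_at f a" "ext_at g a"
  shows "D1 (\<lambda>w. f w - g w) a = D1 f a - D1 g a" "D2 (\<lambda>w. f w - g w) a = D2 f a - D2 g a"
proof -
  have "((\<lambda>w. f w - g w) has_derivative
      (\<lambda>h. (D1 f a - D1 g a) * fst h + (D2 f a - D2 g a) * snd h)) (at a)"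
    by (rule has_derivative_eq_rhs[OF has_derivative_diff[OF ext_at_D(5)[OF assms(1)] ext_at_D(5)[OF assms(2)]]])
       (auto simp: algebra_simps)
  from D_eqI[OF this] show "D1 (\<lambda>w. f w - g w) a = D1 f a - D1 g a" "D2 (\<lambda>w. f w - g w) a = D2 f a - D2 g a" .
qed

text \<open>Integrability: \<open>z\<^sub>u - p x\<^sub>u - q y\<^sub>u\<close> is constant in \<open>v\<close>, the mixed terms cancelling by the system.\<close>

lemma contact_form:
  fixes x y z p q a b c S :: "real \<times> real \<Rightarrow> real"
  assumes ext: "\<And>w. w \<in> Strip_hat R \<Longrightarrow> ext_at x w \<and> ext_at y w \<and> ext_at z w \<and> ext_at p w \<and> ext_at q w"
    and S: "\<And>w. w \<in> Strip_hat R \<Longrightarrow> S w \<noteq> 0"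
    and sys: "\<And>w. w \<in> Strip_hat R \<Longrightarrow> S w * D2 x w = - D1 q w + b w * D1 x w - a w * D1 y w \<and>
      S w * D2 y w = D1 p w + c w * D1 x w - b w * D1 y w \<and>
      D2 p w = - S w * D1 y w - c w * D2 x w + b w * D2 y w \<and>
      D2 q w = S w * D1 x w + b w * D2 x w - a w * D2 y w"
    and z2: "\<And>w. w \<in> Strip_hat R \<Longrightarrow> D2 z w = p w * D2 x w + q w * D2 y w"
    and init: "\<And>u. x (u, 0) = 0" "\<And>u. y (u, 0) = 0" "\<And>u. z (u, 0) = 0"
    and w: "w \<in> Strip_hat R"
  shows "D1 z w = p w * D1 x w + q w * D1 y w"
proof -
  have opS: "open (Strip_hat R)"
    unfolding Strip_hat_def case_prod_unfold by (intro open_Collect_conj open_Collect_less continuous_intros)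
  define \<omega> where "\<omega> w = D1 z w - (p w * D1 x w + q w * D1 y w)" for w
  have e: "ext_at x w" "ext_at y w" "ext_at z w" "ext_at p w" "ext_at q w" if "w \<in> Strip_hat R" for w
    using ext[OF that] by auto
  have e\<omega>: "ext_at \<omega> w" if "w \<in> Strip_hat R" for w
    unfolding \<omega>_def[abs_def] by (intro ext_at_diff ext_at_add ext_at_mult ext_at_D e that)
  have D2\<omega>: "D2 \<omega> w = 0" if w: "w \<in> Strip_hat R" for w
  proof -
    note ew = e[OF w]
    \<comment> \<open>The relation for \<open>z_v\<close> holds on an open set and may be
      differentiated in \<open>u\<close>, which eliminates the mixed derivative of
      \<open>z\<close>.\<close>
    have z12: "D2 (D1 z) w = D1 (\<lambda>w. p w * D2 x w + q w * D2 y w) w"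
      unfolding ext_at_D(3)[OF ew(3)] by (rule D_cong(1)[OF ext_at_D(2)[OF ew(3)] opS w z2])
    have "D2 \<omega> w = D1 p w * D2 x w + D1 q w * D2 y w - (D2 p w * D1 x w + D2 q w * D1 y w)"
      unfolding \<omega>_def[abs_def]
      by (simp add: D_diff D_add D_mult z12 ew ext_at_D(1,2)[OF ew(1)] ext_at_D(1,2)[OF ew(2)]
          ext_at_D(1)[OF ew(3)] ext_at_D(3)[OF ew(1)] ext_at_D(3)[OF ew(2)] ext_at_add ext_at_mult algebra_simps)
    also have "\<dots> = 0"
    proof -
      have "D1 p w = S w * D2 y w - c w * D1 x w + b w * D1 y w" "D1 q w = - S w * D2 x w + b w * D1 x w - a w * D1 y w"
        "D2 p w = - S w * D1 y w - c w * D2 x w + b w * D2 y w" "D2 q w = S w * D1 x w + b w * D2 x w - a w * D2 y w"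
        using sys[OF w] by auto
      then show ?thesis by (simp only:) (simp add: algebra_simps)
    qed
    finally show ?thesis .
  qed
  obtain u v where uv: "w = (u, v)" by (cases w)
  have R: "\<bar>v\<bar> < R" using w uv by (auto simp: Strip_hat_def)
  have in_S: "(u, t) \<in> Strip_hat R" if "t \<in> {- \<bar>v\<bar>..\<bar>v\<bar>}" for t
    using that R by (auto simp: Strip_hat_def)
  have "((\<lambda>t. \<omega> (u, t)) has_real_derivative 0) (at t within {- \<bar>v\<bar>..\<bar>v\<bar>})" if "t \<in> {- \<bar>v\<bar>..\<bar>v\<bar>}" for t
    using D_line(2)[OF e\<omega>[OF in_S[OF that]]] D2\<omega>[OF in_S[OF that]] by (simp add: has_field_derivative_at_within)
  then have "\<exists>c. \<forall>t\<in>{- \<bar>v\<bar>..\<bar>v\<bar>}. \<omega> (u, t) = c"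
    by (intro has_field_derivative_zero_constant convex_real_interval) auto
  then obtain c where c: "\<And>t. t \<in> {- \<bar>v\<bar>..\<bar>v\<bar>} \<Longrightarrow> \<omega> (u, t) = c" by blast
  have "v \<in> {- \<bar>v\<bar>..\<bar>v\<bar>}" "0 \<in> {- \<bar>v\<bar>..\<bar>v\<bar>}" by auto
  then have "\<omega> (u, v) = \<omega> (u, 0)" using c by metis
  also have "\<omega> (u, 0) = 0"
  proof -
    have 0: "(u, 0) \<in> Strip_hat R" using R by (auto simp: Strip_hat_def)
    have "D1 f (u, 0) = 0" if "ext_at f (u, 0)" "\<And>u. f (u, 0) = 0" for f
    proof -
      have "(\<lambda>s. f (s, 0)) = (\<lambda>_. 0)" using that(2) by auto
      then have "((\<lambda>_. 0) has_real_derivative D1 f (u, 0)) (at u)" using D_line(1)[OF that(1)] by simp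
      then show ?thesis by (rule DERIV_unique[OF _ DERIV_const])
    qed
    then show ?thesis using e[OF 0] init by (simp add: \<omega>_def)
  qed
  finally show ?thesis by (simp add: uv \<omega>_def)
qed

section \<open>The complexified system\<close>

type_synonym C5 = "complex \<times> complex \<times> complex \<times> complex \<times> complex"

abbreviation cvec5 :: "R5 \<Rightarrow> C5" where
  "cvec5 \<equiv> map_prod of_real (map_prod of_real (map_prod of_real (map_prod of_real of_real)))"

abbreviation im5 :: "C5 \<Rightarrow> R5" where
  "im5 \<equiv> map_prod Im (map_prod Im (map_prod Im (map_prod Im Im)))"

abbreviation re5 :: "C5 \<Rightarrow> R5" where
  "re5 \<equiv> map_prod Re (map_prod Re (map_prod Re (map_prod Re Re)))"

interpretation cpx5: complexification cvec5 re5 im5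
  by (intro complexification_prod cpx_real.complexification_axioms)

text \<open>The right-hand side of the system solved for the \<open>v\<close>-derivatives:
  \<open>xv\<close> and \<open>yv\<close> come first, the third slot is the contact condition, and
  the last two reuse \<open>xv\<close> and \<open>yv\<close>. One formula over an arbitrary field
  covers the real and the complex system.\<close>

definition char_map :: "'a::field \<Rightarrow> 'a \<Rightarrow> 'a \<Rightarrow> 'a \<Rightarrow> 'a \<Rightarrow> 'a \<Rightarrow>
    'a \<times> 'a \<times> 'a \<times> 'a \<times> 'a \<Rightarrow> 'a \<times> 'a \<times> 'a \<times> 'a \<times> 'a" where
  "char_map a b c S p q m = (let xu = fst m; yu = fst (snd m); pu = fst (snd (snd (snd m))); qu = snd (snd (snd (snd m)));
     xv = (- qu + b * xu - a * yu) / S; yv = (pu + c * xu - b * yu) / S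
     in (xv, yv, p * xv + q * yv, - S * yu - c * xv + b * yv, S * xu + b * xv - a * yv))"

lemma char_map_of_real:
  "char_map (of_real a) (of_real b) (of_real c) (of_real S) (of_real p) (of_real q) (cvec5 m) = cvec5 (char_map a b c S p q m)"
  by (cases m) (simp add: char_map_def Let_def)

lemma linear_char_map: "linear (char_map a b c S p q :: C5 \<Rightarrow> C5)"
  by (rule linearI) (auto simp: char_map_def Let_def scaleR_conv_of_real algebra_simps add_divide_distrib diff_divide_distrib)

lemma cdiff_char_map:
  assumes "cdiff a z" "cdiff b z" "cdiff c z" "cdiff S z" "cdiff p z" "cdiff q z" "cdiff m z" "S z \<noteq> 0"
  shows "cdiff (\<lambda>z. char_map (a z) (b z) (c z) (S z) (p z) (q z) (m z) :: C5) z"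
  unfolding char_map_def Let_def
  by (intro cdiff_Pair cdiff_add cdiff_diff cdiff_mult cdiff_minus cdiff_divide cdiff_fst cdiff_snd assms)

text \<open>Coefficients, square root and curve are extended, the complex Cauchy problem is solved,
  and the solution is restricted to real points, where it is real. Ellipticity is what allows taking
  the root and dividing by it.\<close>

lemma exists_param:
  fixes U :: "R5 set" and A B C E :: "R5 \<Rightarrow> real" and \<gamma> :: "real \<Rightarrow> real \<times> real"
  assumes U: "open U"
    and an: "real_analytic_on A U" "real_analytic_on B U" "real_analytic_on C U" "real_analytic_on E U"
    and elliptic: "\<forall>w\<in>U. A w * C w - (B w)\<^sup>2 + E w > 0"
    and \<gamma>: "real_analytic_on \<gamma> UNIV" and per: "\<forall>u. \<gamma> (u + 2 * pi) = \<gamma> u"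
    and init: "\<forall>u. (0, 0, 0, fst (\<gamma> u), snd (\<gamma> u)) \<in> U"
  obtains R x y z p q where "0 < R" "ma_param U A B C E R x y z p q"
    "\<And>u. (x (u, 0), y (u, 0), z (u, 0), p (u, 0), q (u, 0)) = (0, 0, 0, \<gamma> u)"
    "\<And>u v. (u, v) \<in> Strip_hat R \<Longrightarrow> (x (u + 2 * pi, v), y (u + 2 * pi, v), z (u + 2 * pi, v), p (u + 2 * pi, v), q (u + 2 * pi, v))
      = (x (u, v), y (u, v), z (u, v), p (u, v), q (u, v))"
proof -
  obtain QA FA where A: "open QA" "\<And>x. x \<in> U \<Longrightarrow> cvec5 x \<in> QA" "chol_on FA QA"
    "\<And>x. cvec5 x \<in> QA \<Longrightarrow> x \<in> U \<and> FA (cvec5 x) = complex_of_real (A x)"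
    using cpx5.extension[OF U an(1)] by blast
  obtain QB FB where B: "open QB" "\<And>x. x \<in> U \<Longrightarrow> cvec5 x \<in> QB" "chol_on FB QB"
    "\<And>x. cvec5 x \<in> QB \<Longrightarrow> x \<in> U \<and> FB (cvec5 x) = complex_of_real (B x)"
    using cpx5.extension[OF U an(2)] by blast
  obtain QC FC where C: "open QC" "\<And>x. x \<in> U \<Longrightarrow> cvec5 x \<in> QC" "chol_on FC QC"
    "\<And>x. cvec5 x \<in> QC \<Longrightarrow> x \<in> U \<and> FC (cvec5 x) = complex_of_real (C x)"
    using cpx5.extension[OF U an(3)] by blast
  obtain QE FE where E: "open QE" "\<And>x. x \<in> U \<Longrightarrow> cvec5 x \<in> QE" "chol_on FE QE"
    "\<And>x. cvec5 x \<in> QE \<Longrightarrow> x \<in> U \<and> FE (cvec5 x) = complex_of_real (E x)"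
    using cpx5.extension[OF U an(4)] by blast
  define D where "D \<xi> = A \<xi> * C \<xi> - (B \<xi>)\<^sup>2 + E \<xi>" for \<xi>
  define FD where "FD \<zeta> = FA \<zeta> * FC \<zeta> - FB \<zeta> * FB \<zeta> + FE \<zeta>" for \<zeta>
  define Q0 where "Q0 = QA \<inter> QB \<inter> QC \<inter> QE"
  have Q0: "open Q0" using A(1) B(1) C(1) E(1) by (simp add: Q0_def open_Int)
  have F: "cdiff FA \<zeta>" "cdiff FB \<zeta>" "cdiff FC \<zeta>" "cdiff FE \<zeta>" if "\<zeta> \<in> Q0" for \<zeta>
    using A(3) B(3) C(3) E(3) that by (auto simp: Q0_def chol_on_def)
  have FD: "chol_on FD Q0"
    unfolding chol_on_def FD_def[abs_def] by (intro ballI cdiff_add cdiff_diff cdiff_mult F)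
  \<comment> \<open>A positive real part keeps the extended discriminant off the branch cut of
    \<open>csqrt\<close>; by ellipticity no real point of \<open>U\<close> is lost.\<close>
  define Q where "Q = Q0 \<inter> (\<lambda>\<zeta>. Re (FD \<zeta>)) -` {0<..}"
  have Q: "open Q" unfolding Q_def
    by (intro continuous_open_preimage continuous_intros chol_on_continuous[OF FD] Q0)
  have real_F: "FA (cvec5 \<xi>) = of_real (A \<xi>)" "FB (cvec5 \<xi>) = of_real (B \<xi>)" "FC (cvec5 \<xi>) = of_real (C \<xi>)"
    "FD (cvec5 \<xi>) = of_real (D \<xi>)" "\<xi> \<in> U" if "cvec5 \<xi> \<in> Q0" for \<xi>
    using A(4)[of \<xi>] B(4)[of \<xi>] C(4)[of \<xi>] E(4)[of \<xi>] that by (simp_all add: Q0_def FD_def D_def power2_eq_square)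
  have UQ: "cvec5 \<xi> \<in> Q" if "\<xi> \<in> U" for \<xi>
  proof -
    have m: "cvec5 \<xi> \<in> Q0" unfolding Q0_def by (intro IntI A(2) B(2) C(2) E(2) that)
    have "0 < D \<xi>" using elliptic that by (simp add: D_def)
    then show ?thesis using real_F(4)[OF m] m by (simp add: Q_def)
  qed
  have QU: "cvec5 \<xi> \<in> Q0" "\<xi> \<in> U" "0 < D \<xi>" if "cvec5 \<xi> \<in> Q" for \<xi>
    using that real_F(4,5)[of \<xi>] by (simp_all add: Q_def)
  define S where "S \<zeta> = csqrt (FD \<zeta>)" for \<zeta>
  have S: "cdiff S \<zeta>" "S \<zeta> \<noteq> 0" if "\<zeta> \<in> Q" for \<zeta>
  proof -
    have "FD \<zeta> \<notin> \<real>\<^sub>\<le>\<^sub>0" "FD \<zeta> \<noteq> 0" "cdiff FD \<zeta>"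
      using that FD by (auto simp: Q_def complex_nonpos_Reals_iff chol_on_def)
    then show "cdiff S \<zeta>" "S \<zeta> \<noteq> 0" unfolding S_def[abs_def] by (auto intro: cdiff_csqrt)
  qed
  have Sreal: "S (cvec5 \<xi>) = of_real (sqrt (D \<xi>))" if "cvec5 \<xi> \<in> Q" for \<xi>
    unfolding S_def real_F(4)[OF QU(1)[OF that]] using QU(3)[OF that] by simp
  define pc qc where "pc \<zeta> = fst (snd (snd (snd \<zeta>)))" and "qc \<zeta> = snd (snd (snd (snd \<zeta>)))" for \<zeta> :: C5
  define G where "G \<zeta> = char_map (FA \<zeta>) (FB \<zeta>) (FC \<zeta>) (S \<zeta>) (pc \<zeta>) (qc \<zeta>)" for \<zeta>
  define Gr where "Gr \<xi> = char_map (A \<xi>) (B \<xi>) (C \<xi>) (sqrt (D \<xi>)) (fst (snd (snd (snd \<xi>)))) (snd (snd (snd (snd \<xi>))))" for \<xi>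
  have Greal: "G (cvec5 \<xi>) (cvec5 \<mu>) = cvec5 (Gr \<xi> \<mu>)" if "cvec5 \<xi> \<in> Q" for \<xi> \<mu>
  proof -
    have pq: "pc (cvec5 \<xi>) = of_real (fst (snd (snd (snd \<xi>))))" "qc (cvec5 \<xi>) = of_real (snd (snd (snd (snd \<xi>))))"
      by (cases \<xi>, simp add: pc_def qc_def)+
    show ?thesis
      unfolding G_def Gr_def real_F(1-3)[OF QU(1)[OF that]] Sreal[OF that] pq by (rule char_map_of_real)
  qed
  have im0: "cvec5 (re5 \<zeta>) = \<zeta>" if "im5 \<zeta> = 0" for \<zeta>
    using cpx5.decomp[of \<zeta>] unfolding that linear_0[OF cpx5.linear_iota] by simp
  have \<gamma>12: "real_analytic_on (\<lambda>u. fst (\<gamma> u)) UNIV" "real_analytic_on (\<lambda>u. snd (\<gamma> u)) UNIV"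
    using \<gamma> unfolding real_analytic_on_def
    by (auto intro: real_analytic_at_bounded_linear bounded_linear_fst bounded_linear_snd)
  obtain r1 \<alpha> where \<alpha>: "0 < r1" "chol_on \<alpha> {u. \<bar>Im u\<bar> < r1}" "\<And>t. \<alpha> (of_real t) = complex_of_real (fst (\<gamma> t))"
    "\<And>u. \<bar>Im u\<bar> < r1 \<Longrightarrow> \<alpha> (u + 2 * pi) = \<alpha> u"
    using periodic_strip_extension[OF \<gamma>12(1)] per by auto
  obtain r2 \<beta> where \<beta>: "0 < r2" "chol_on \<beta> {u. \<bar>Im u\<bar> < r2}" "\<And>t. \<beta> (of_real t) = complex_of_real (snd (\<gamma> t))"
    "\<And>u. \<bar>Im u\<bar> < r2 \<Longrightarrow> \<beta> (u + 2 * pi) = \<beta> u"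
    using periodic_strip_extension[OF \<gamma>12(2)] per by auto
  define w0 :: "complex \<Rightarrow> C5" where "w0 u = (0, 0, 0, \<alpha> u, \<beta> u)" for u
  define r0 where "r0 = min r1 r2"
  have w0_of_real: "w0 (of_real t) = cvec5 (0, 0, 0, \<gamma> t)" for t
    by (cases "\<gamma> t") (simp add: w0_def \<alpha>(3) \<beta>(3))
  interpret cauchy_problem G w0 Q r0 im5
  proof (rule cauchy_problem.intro)
    show "open Q" by (rule Q)
    show "chol_on (\<lambda>(\<zeta>, m). G \<zeta> m) (Q \<times> UNIV)"
      unfolding chol_on_def
    proof clarify
      fix \<zeta> m :: C5 assume \<zeta>: "\<zeta> \<in> Q"
      then have \<zeta>0: "\<zeta> \<in> Q0" by (simp add: Q_def)
      have c: "cdiff (\<lambda>y. f (fst y)) (\<zeta>, m)" if "cdiff f \<zeta>" for f :: "C5 \<Rightarrow> complex"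
        by (rule cdiff_compose[where f=f and g=fst]) (use that in \<open>auto intro: cdiff_fst[OF cdiff_id]\<close>)
      have "cdiff (\<lambda>y. char_map (FA (fst y)) (FB (fst y)) (FC (fst y)) (S (fst y)) (pc (fst y)) (qc (fst y)) (snd y)) (\<zeta>, m)"
        unfolding pc_def qc_def
        by (rule cdiff_char_map) (use c F[OF \<zeta>0] S[OF \<zeta>] in \<open>auto intro!: cdiff_fst cdiff_snd cdiff_id\<close>)
      then show "cdiff (\<lambda>(\<zeta>, m). G \<zeta> m) (\<zeta>, m)"
        by (simp add: G_def case_prod_unfold)
    qed
    show "linear (G \<zeta>)" for \<zeta> unfolding G_def by (rule linear_char_map)
    show "0 < r0" using \<alpha> \<beta> by (simp add: r0_def)
    show "chol_on w0 {u. \<bar>Im u\<bar> < r0}"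
      using \<alpha>(2) \<beta>(2) unfolding w0_def[abs_def] chol_on_def r0_def by (auto intro!: cdiff_Pair)
    show "w0 (u + complex_of_real (2 * pi)) = w0 u" if "\<bar>Im u\<bar> < r0" for u
      using \<alpha>(4) \<beta>(4) that by (simp add: w0_def r0_def)
    show "w0 (of_real t) \<in> Q" for t
    proof -
      have "(0, 0, 0, \<gamma> t) \<in> U" using init[rule_format, of t] by simp
      then show ?thesis unfolding w0_of_real by (rule UQ)
    qed
    show "linear im5" by (rule cpx5.linear_im)
    show "im5 (w0 (of_real t)) = 0" for t unfolding w0_of_real by (rule cpx5.im_iota)
    show "im5 (G \<zeta> m) = 0" if "\<zeta> \<in> Q" "im5 \<zeta> = 0" "im5 m = 0" for \<zeta> m
    proof -
      have "G \<zeta> m = cvec5 (Gr (re5 \<zeta>) (re5 m))"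
        using Greal[of "re5 \<zeta>" "re5 m"] that(1) unfolding im0[OF that(2)] im0[OF that(3)] by simp
      then show ?thesis using cpx5.im_iota by metis
    qed
  qed
  obtain R w where R: "0 < R" and wh: "chol_on w {x. \<bar>Im (fst x)\<bar> < R \<and> cmod (snd x) < R}"
    and w_init: "\<And>u. \<bar>Im u\<bar> < R \<Longrightarrow> w (u, 0) = w0 u"
    and w_eq: "\<And>x. \<bar>Im (fst x)\<bar> < R \<Longrightarrow> cmod (snd x) < R \<Longrightarrow>
      w x \<in> Q \<and> dd w x (0, 1) = G (w x) (dd w x (1, 0)) \<and> w (x + (complex_of_real (2 * pi), 0)) = w x"
    and w_real: "\<And>s t::real. \<bar>t\<bar> < R \<Longrightarrow> im5 (w (of_real s, of_real t)) = 0"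
    by (rule solution) blast
  define \<Omega> where "\<Omega> = {x :: complex \<times> complex. \<bar>Im (fst x)\<bar> < R \<and> cmod (snd x) < R}"
  have op\<Omega>: "open \<Omega>" unfolding \<Omega>_def by (intro open_Collect_conj open_Collect_less continuous_intros)
  have SH: "a \<in> Strip_hat R \<longleftrightarrow> \<bar>snd a\<bar> < R" for a by (cases a) (auto simp: Strip_hat_def)
  have c\<Omega>: "cvec a \<in> \<Omega> \<longleftrightarrow> a \<in> Strip_hat R" for a using R by (cases a) (auto simp: \<Omega>_def SH)
  have opS: "open (Strip_hat R)"
    unfolding Strip_hat_def case_prod_unfold by (intro open_Collect_conj open_Collect_less continuous_intros)
  define X where "X a = re5 (w (cvec a))" for a
  have wX: "w (cvec a) = cvec5 (X a)" if "a \<in> Strip_hat R" for a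
    using im0[OF w_real[of "snd a" "fst a"]] that by (cases a) (simp add: X_def SH)
  \<comment> \<open>One argument for all five coordinates: a complex linear \<open>\<pi>\<close>
    that is real on real points gives a real coordinate extended by \<open>\<pi>\<close> after
    \<open>w\<close>.\<close>
  have comp: "ext_at (\<lambda>a. Re (\<pi> (w (cvec a)))) a \<and>
      (\<forall>h. complex_of_real (dd (\<lambda>a. Re (\<pi> (w (cvec a)))) a h) = \<pi> (dd w (cvec a) (cvec h)))"
    if a: "a \<in> Strip_hat R" and \<pi>: "linear \<pi>" "\<And>h. \<pi> (jop h) = jop (\<pi> h)" "\<And>\<xi>. Im (\<pi> (cvec5 \<xi>)) = 0"
    for a and \<pi> :: "C5 \<Rightarrow> complex"
  proof -
    have "chol_on w \<Omega>" using wh by (simp only: \<Omega>_def)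
    then have cw: "cdiff w z" if "z \<in> \<Omega>" for z using that unfolding chol_on_def by blast
    have c: "chol_on (\<lambda>z. \<pi> (w z)) \<Omega>"
      unfolding chol_on_def
      by (intro ballI cdiff_compose[where f=\<pi> and g=w, OF cdiff_linear[OF \<pi>(1,2)] cw])
    have r: "Im (\<pi> (w (cvec x))) = 0" if "cvec x \<in> \<Omega>" for x
      using wX[of x] that \<pi>(3) by (simp only: c\<Omega>)
    have 1: "ext_at (\<lambda>a. Re (\<pi> (w (cvec a)))) a" by (rule ext_at_Re[OF op\<Omega> c r]) (simp_all add: c\<Omega> a)
    have "complex_of_real (dd (\<lambda>a. Re (\<pi> (w (cvec a)))) a h) = dd (\<lambda>z. \<pi> (w z)) (cvec a) (cvec h)" for h
    proof (rule ext_at_has_derivative_aux(2)[OF _ opS a])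
      show "cdiff (\<lambda>z. \<pi> (w z)) (cvec a)" using c a by (simp add: chol_on_def c\<Omega>)
      show "\<pi> (w (cvec x)) = complex_of_real (Re (\<pi> (w (cvec x))))" if "x \<in> Strip_hat R" for x
        using r[of x] that by (simp add: c\<Omega> complex_eq_iff)
    qed
    moreover have "dd (\<lambda>z. \<pi> (w z)) (cvec a) h = \<pi> (dd w (cvec a) h)" for h
      using dd_eq[OF bounded_linear.has_derivative[of \<pi>, OF _ cdiff_has_derivative[OF cw]], of "cvec a"] a \<pi>(1)
      by (simp add: c\<Omega> linear_conv_bounded_linear)
    ultimately show ?thesis using 1 by simp
  qed
  define x y z p q where "x a = fst (X a)" and "y a = fst (snd (X a))" and "z a = fst (snd (snd (X a)))"
    and "p a = fst (snd (snd (snd (X a))))" and "q a = snd (snd (snd (snd (X a))))" for a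
  have X: "X a = (x a, y a, z a, p a, q a)" for a by (simp add: x_def y_def z_def p_def q_def)
  have coords: "x = (\<lambda>a. Re (fst (w (cvec a))))" "y = (\<lambda>a. Re (fst (snd (w (cvec a)))))"
    "z = (\<lambda>a. Re (fst (snd (snd (w (cvec a))))))" "p = (\<lambda>a. Re (fst (snd (snd (snd (w (cvec a)))))))"
    "q = (\<lambda>a. Re (snd (snd (snd (snd (w (cvec a)))))))"
    by (auto simp: x_def y_def z_def p_def q_def X_def)
  have lin: "linear (fst :: C5 \<Rightarrow> complex)" "linear (\<lambda>h::C5. fst (snd h))" "linear (\<lambda>h::C5. fst (snd (snd h)))"
    "linear (\<lambda>h::C5. fst (snd (snd (snd h))))" "linear (\<lambda>h::C5. snd (snd (snd (snd h))))"
    by (auto intro!: linearI)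
  have ext: "ext_at x a" "ext_at y a" "ext_at z a" "ext_at p a" "ext_at q a"
    and dX: "cvec5 (dd x a h, dd y a h, dd z a h, dd p a h, dd q a h) = dd w (cvec a) (cvec h)" if a: "a \<in> Strip_hat R" for a h
  proof -
    note cs = comp[OF a lin(1)] comp[OF a lin(2)] comp[OF a lin(3)] comp[OF a lin(4)] comp[OF a lin(5)]
    have cs': "ext_at x a \<and> (\<forall>h. complex_of_real (dd x a h) = fst (dd w (cvec a) (cvec h)))"
      "ext_at y a \<and> (\<forall>h. complex_of_real (dd y a h) = fst (snd (dd w (cvec a) (cvec h))))"
      "ext_at z a \<and> (\<forall>h. complex_of_real (dd z a h) = fst (snd (snd (dd w (cvec a) (cvec h)))))"
      "ext_at p a \<and> (\<forall>h. complex_of_real (dd p a h) = fst (snd (snd (snd (dd w (cvec a) (cvec h))))))"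
      "ext_at q a \<and> (\<forall>h. complex_of_real (dd q a h) = snd (snd (snd (snd (dd w (cvec a) (cvec h))))))"
      unfolding coords by (rule cs; simp add: jop_prod_def)+
    then show "ext_at x a" "ext_at y a" "ext_at z a" "ext_at p a" "ext_at q a" by auto
    show "cvec5 (dd x a h, dd y a h, dd z a h, dd p a h, dd q a h) = dd w (cvec a) (cvec h)"
      using cs'[THEN conjunct2, rule_format, of h] by (simp add: prod_eq_iff)
  qed
  have inj5: "\<xi> = \<xi>'" if "cvec5 \<xi> = cvec5 \<xi>'" for \<xi> \<xi>'
    using cpx5.re_iota[of \<xi>] cpx5.re_iota[of \<xi>'] that by metis
  have eqs: "(D2 x a, D2 y a, D2 z a, D2 p a, D2 q a) = Gr (X a) (D1 x a, D1 y a, D1 z a, D1 p a, D1 q a) \<and> X a \<in> U \<and> 0 < D (X a)"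
    if a: "a \<in> Strip_hat R" for a
  proof -
    have "cvec a \<in> \<Omega>" using a by (simp only: c\<Omega>)
    then have "\<bar>Im (fst (cvec a))\<bar> < R \<and> cmod (snd (cvec a)) < R" by (simp only: \<Omega>_def mem_Collect_eq)
    note we = w_eq[OF this[THEN conjunct1] this[THEN conjunct2]]
    have XQ: "cvec5 (X a) \<in> Q" using we wX[OF a] by simp
    have d1: "dd w (cvec a) (1, 0) = cvec5 (D1 x a, D1 y a, D1 z a, D1 p a, D1 q a)"
      using dX[OF a, of "(1, 0)"] by (simp add: D1_def)
    have d2: "dd w (cvec a) (0, 1) = cvec5 (D2 x a, D2 y a, D2 z a, D2 p a, D2 q a)"
      using dX[OF a, of "(0, 1)"] by (simp add: D2_def)
    have "dd w (cvec a) (0, 1) = G (w (cvec a)) (dd w (cvec a) (1, 0))" using we by blast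
    then have "cvec5 (D2 x a, D2 y a, D2 z a, D2 p a, D2 q a) = cvec5 (Gr (X a) (D1 x a, D1 y a, D1 z a, D1 p a, D1 q a))"
      unfolding d1 d2 wX[OF a] Greal[OF XQ] .
    from inj5[OF this] show ?thesis using QU[OF XQ] by simp
  qed
  have sys: "sqrt (D (X a)) * D2 x a = - D1 q a + B (X a) * D1 x a - A (X a) * D1 y a \<and>
      sqrt (D (X a)) * D2 y a = D1 p a + C (X a) * D1 x a - B (X a) * D1 y a \<and>
      D2 p a = - sqrt (D (X a)) * D1 y a - C (X a) * D2 x a + B (X a) * D2 y a \<and>
      D2 q a = sqrt (D (X a)) * D1 x a + B (X a) * D2 x a - A (X a) * D2 y a"
    and dz2: "D2 z a = p a * D2 x a + q a * D2 y a" if a: "a \<in> Strip_hat R" for a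
  proof -
    have "sqrt (D (X a)) \<noteq> 0" using eqs[OF a] by simp
    then show "sqrt (D (X a)) * D2 x a = - D1 q a + B (X a) * D1 x a - A (X a) * D1 y a \<and>
      sqrt (D (X a)) * D2 y a = D1 p a + C (X a) * D1 x a - B (X a) * D1 y a \<and>
      D2 p a = - sqrt (D (X a)) * D1 y a - C (X a) * D2 x a + B (X a) * D2 y a \<and>
      D2 q a = sqrt (D (X a)) * D1 x a + B (X a) * D2 x a - A (X a) * D2 y a"
      "D2 z a = p a * D2 x a + q a * D2 y a"
      using eqs[OF a] by (auto simp: Gr_def char_map_def Let_def p_def q_def)
  qed
  have ini: "(x (u, 0), y (u, 0), z (u, 0), p (u, 0), q (u, 0)) = (0, 0, 0, \<gamma> u)" for u
  proof -
    have "w (cvec (u, 0)) = cvec5 (0, 0, 0, \<gamma> u)" using w_init[of "of_real u"] w0_of_real R by simp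
    then have "X (u, 0) = (0, 0, 0, \<gamma> u)" unfolding X_def by (simp only: cpx5.re_iota)
    then show ?thesis by (simp add: X)
  qed
  show thesis
  proof (rule that[OF R _ ini])
    show "ma_param U A B C E R x y z p q"
    proof
      show "A w * C w - (B w)\<^sup>2 + E w > 0" if "w \<in> U" for w using elliptic that by blast
      fix a assume a: "a \<in> Strip_hat R"
      show "ext_at x a" "ext_at y a" "ext_at z a" "ext_at p a" "ext_at q a" by (rule ext[OF a])+
      show "(x a, y a, z a, p a, q a) \<in> U" using eqs[OF a] X by simp
      show "D2 z a = p a * D2 x a + q a * D2 y a" by (rule dz2[OF a])
      show "D1 z a = p a * D1 x a + q a * D1 y a"
      proof (rule contact_form[where S = "\<lambda>a. sqrt (D (X a))" and a = "\<lambda>a. A (X a)" and b = "\<lambda>a. B (X a)" and c = "\<lambda>a. C (X a)", OF _ _ _ _ _ _ _ a])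
        show "sqrt (D (X b)) \<noteq> 0" if "b \<in> Strip_hat R" for b using eqs[OF that] by simp
      qed (use ext sys dz2 ini in auto)
      fix Y S assume "Y = (x a, y a, z a, p a, q a)" "S = sqrt (A Y * C Y - (B Y)\<^sup>2 + E Y)"
      then have "Y = X a" "S = sqrt (D (X a))" by (simp_all add: X D_def)
      then show "S * D2 x a = - D1 q a + B Y * D1 x a - A Y * D1 y a \<and>
        S * D2 y a = D1 p a + C Y * D1 x a - B Y * D1 y a \<and>
        D2 p a = - S * D1 y a - C Y * D2 x a + B Y * D2 y a \<and>
        D2 q a = S * D1 x a + B Y * D2 x a - A Y * D2 y a" using sys[OF a] by simp
    qed
    fix u v assume uv: "(u, v) \<in> Strip_hat R"
    then have "\<bar>v\<bar> < R" by (simp add: SH)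
    then have "w (cvec (u, v) + (complex_of_real (2 * pi), 0)) = w (cvec (u, v))" using w_eq[of "cvec (u, v)"] R by simp
    then have "X (u + 2 * pi, v) = X (u, v)" by (simp add: X_def)
    then show "(x (u + 2 * pi, v), y (u + 2 * pi, v), z (u + 2 * pi, v), p (u + 2 * pi, v), q (u + 2 * pi, v))
      = (x (u, v), y (u, v), z (u, v), p (u, v), q (u, v))" by (simp add: X)
  qed
qed

section \<open>The rotation of the tangent of a convex Jordan curve\<close>

text \<open>A larger variation would cover an interval longer than \<open>pi\<close> by the
  intermediate value theorem. Where \<open>y\<close> and \<open>y + pi\<close> both lie in it,
  \<open>sin y\<close> and \<open>- sin y\<close> are nonnegative, so \<open>sin y = 0\<close>; this
  cannot happen at two points at distance \<open>d \<le> 1\<close>.\<close>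

lemma angle_variation_le_pi:
  fixes \<theta> :: "real \<Rightarrow> real"
  assumes c: "continuous_on {a..b} \<theta>" and ab: "a \<le> b" and s: "\<And>t. t \<in> {a..b} \<Longrightarrow> 0 \<le> sin (\<theta> t)"
  shows "\<bar>\<theta> b - \<theta> a\<bar> \<le> pi"
proof (rule ccontr)
  assume "\<not> ?thesis"
  then have far: "\<bar>\<theta> b - \<theta> a\<bar> > pi" by simp
  define lo hi where "lo = min (\<theta> a) (\<theta> b)" and "hi = max (\<theta> a) (\<theta> b)"
  have lh: "hi - lo > pi" using far by (auto simp: lo_def hi_def)
  have val: "0 \<le> sin y" if "lo \<le> y" "y \<le> hi" for y
  proof -
    have "\<exists>t. a \<le> t \<and> t \<le> b \<and> \<theta> t = y"
    proof (cases "\<theta> a \<le> \<theta> b")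
      case True
      then show ?thesis using that by (intro IVT' ab c) (auto simp: lo_def hi_def)
    next
      case False
      then show ?thesis using that by (intro IVT2' ab c) (auto simp: lo_def hi_def)
    qed
    then show ?thesis using s by force
  qed
  define d where "d = min ((hi - lo - pi) / 2) 1"
  have d: "0 < d" "d \<le> 1" "lo + 2 * d + pi \<le> hi" using lh by (auto simp: d_def field_simps min_def)
  have zero: "sin y = 0" if "lo \<le> y" "y + pi \<le> hi" for y
    using val[of y] val[of "y + pi"] that pi_gt_zero by simp
  have z: "sin (lo + d) = 0" using d by (intro zero) simp_all
  have "sin ((lo + d) + d) = 0" using d by (intro zero) simp_all
  with z sin_add[of "lo + d" d] have "cos (lo + d) * sin d = 0" by simp
  moreover have "sin d > 0" using d pi_gt3 by (intro sin_gt_zero) auto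
  ultimately have "cos (lo + d) = 0" by simp
  then show False using sin_cos_squared_add[of "lo + d"] \<open>sin (lo + d) = 0\<close> by simp
qed

lemma angle_constant:
  fixes h :: "'a::topological_space \<Rightarrow> real"
  assumes S: "connected S" "continuous_on S h"
    and k: "\<And>x y. x \<in> S \<Longrightarrow> y \<in> S \<Longrightarrow> \<exists>k::int. h x - h y = 2 * pi * k"
    and xy: "x \<in> S" "y \<in> S"
  shows "h x = h y"
proof -
  have "h constant_on S"
  proof (rule continuous_discrete_range_constant[OF S])
    fix x assume x: "x \<in> S"
    have "2 * pi \<le> norm (h y - h x)" if y: "y \<in> S" "h y \<noteq> h x" for y
    proof -
      obtain j :: int where j: "h y - h x = 2 * pi * j" using k[OF y(1) x] by blast
      then have "j \<noteq> 0" using y(2) by auto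
      then have "1 \<le> \<bar>real_of_int j\<bar>" by linarith
      then have "2 * pi * 1 \<le> 2 * pi * \<bar>real_of_int j\<bar>" by (intro mult_left_mono) auto
      then show ?thesis using j by (simp add: abs_mult)
    qed
    then show "\<exists>e>0. \<forall>y. y \<in> S \<and> h y \<noteq> h x \<longrightarrow> e \<le> norm (h y - h x)"
      by (intro exI[of _ "2 * pi"]) auto
  qed
  then show ?thesis using xy by (auto simp: constant_on_def)
qed

lemma exp_eq_imp_Im:
  assumes "exp a = of_real r * exp b" "0 < r"
  shows "\<exists>k::int. Im a - Im b = 2 * pi * k"
proof -
  have "exp a = exp (of_real (ln r) + b)" using assms by (simp add: exp_add exp_of_real)
  then obtain n :: int where "a = of_real (ln r) + b + complex_of_real (real_of_int (2 * n) * pi) * \<i>"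
    unfolding exp_eq by blast
  then have "Im a - Im b = 2 * pi * n" by simp
  then show ?thesis by blast
qed

text \<open>Hopf's argument: lift the direction of the secant \<open>(f (s + d) - f s) / d\<close>, \<open>0 \<le> d \<le> \<pi>\<close>, with the tangent at \<open>d = 0\<close>.
  At \<open>d = \<pi>\<close> the secant changes sign under \<open>s \<mapsto> s + \<pi>\<close>; seen from a lowest point of the curve
  it turns by at most \<open>2\<pi>\<close> between these two positions, hence by exactly \<open>\<pm>\<pi>\<close>.\<close>

lemma tangent_angle:
  fixes f f1 f2 :: "real \<Rightarrow> complex"
  assumes f: "\<And>u. (f has_vector_derivative f1 u) (at u)" and f1: "\<And>u. (f1 has_vector_derivative f2 u) (at u)"
    and per: "\<And>u. f (u + 2 * pi) = f u" and inj: "inj_on f {0..<2 * pi}"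
    and nz: "\<And>u. f1 u \<noteq> 0" and neg: "\<And>u. Im (f2 u * cnj (f1 u)) < 0"
    and par: "f1 u1 = of_real r * f1 u2" "0 < r"
  shows "\<exists>k::int. u1 = u2 + 2 * pi * k"
proof -
  have f1c: "continuous_on UNIV f1"
    using f1 by (auto intro!: continuous_at_imp_continuous_on has_vector_derivative_continuous)
  \<comment> \<open>The secant quotient as a mean of tangents is continuous across
    \<open>d = 0\<close>, where a quotient would be undefined.\<close>
  define E where "E x = integral {0..1} (\<lambda>t. f1 (fst x + t * snd x))" for x :: "real \<times> real"
  have Ec: "continuous_on UNIV E"
  proof -
    have "continuous_on (UNIV \<times> cbox 0 1) (\<lambda>(x, t). f1 (fst x + t * snd x))"
      unfolding case_prod_unfold by (rule continuous_on_compose2[OF f1c]) (auto intro!: continuous_intros)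
    from integral_continuous_on_param[OF this] show ?thesis by (simp add: E_def[abs_def])
  qed
  have Eint: "of_real d * E (s, d) = f (s + d) - f s" for s d
  proof -
    have "((\<lambda>t. d *\<^sub>R f1 (s + t * d)) has_integral f (s + 1 * d) - f (s + 0 * d)) {0..1}"
    proof (rule fundamental_theorem_of_calculus)
      fix t :: real
      have "((\<lambda>t. s + t * d) has_vector_derivative d) (at t within {0..1})"
        by (auto intro!: derivative_eq_intros simp flip: has_real_derivative_iff_has_vector_derivative)
      from vector_diff_chain_within[OF this has_vector_derivative_at_within[OF f]]
      show "((\<lambda>t. f (s + t * d)) has_vector_derivative d *\<^sub>R f1 (s + t * d)) (at t within {0..1})"
        by (simp add: o_def)
    qed simp
    from integral_unique[OF this]
    show ?thesis by (simp add: E_def scaleR_conv_of_real)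
  qed
  have E0: "E (s, 0) = f1 s" for s by (simp add: E_def)
  define S where "S = {x :: real \<times> real. 0 \<le> snd x \<and> snd x \<le> pi}"
  have S_eq: "S = UNIV \<times> {0..pi}" by (auto simp: S_def)
  have convS: "convex S" unfolding S_eq by (intro convex_Times) auto
  interpret pf: periodic_fun_simple f "2 * pi" by standard (rule per)
  \<comment> \<open>At \<open>d = 0\<close> this is regularity. For \<open>0 < d \<le> pi\<close> a
    zero would be a double point within one period; the shift to \<open>s'\<close> and the case
    split bring both parameters into the half-open interval.\<close>
  have Enz: "E x \<noteq> 0" if "x \<in> S" for x
  proof (cases "snd x = 0")
    case True
    then show ?thesis using E0[of "fst x"] nz by (cases x) simp
  next
    case False
    obtain s d where x: "x = (s, d)" by (cases x)
    have d: "0 < d" "d \<le> pi" using that False x by (auto simp: S_def)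
    obtain s' where s': "s' \<in> {0..<2 * pi}" "f s' = f s" "\<exists>k::int. s = s' + 2 * pi * k"
      by (rule periodic_reduce[where f=f and u=s, OF per]) blast
    then obtain k :: int where k: "s = s' + 2 * pi * k" by blast
    have "f (s + d) \<noteq> f s"
    proof
      assume eq: "f (s + d) = f s"
      have "f (s' + d) = f (s + d)" using pf.plus_of_int[of "s' + d" k] by (simp add: k algebra_simps)
      then have e: "f (s' + d) = f s'" using eq s'(2) by simp
      show False
      proof (cases "s' + d < 2 * pi")
        case True
        then have "s' + d = s'" using e inj s'(1) d by (intro inj_onD[OF inj]) auto
        then show False using d by simp
      next
        case False
        have "f (s' + d - 2 * pi) = f (s' + d)" using per[of "s' + d - 2 * pi"] by simp
        then have "s' + d - 2 * pi = s'" using e s'(1) d False pi_gt_zero by (intro inj_onD[OF inj]) auto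
        then show False using d pi_gt_zero by simp
      qed
    qed
    then show ?thesis using Eint[of d s] x by auto
  qed
  have cE: "continuous_on S E" and cS: "contractible S"
    using Ec convS by (auto intro: continuous_on_subset convex_imp_contractible)
  \<comment> \<open>The strip is contractible, so the nowhere vanishing \<open>E\<close> has a
    continuous logarithm; its imaginary part is the lifted angle.\<close>
  have "\<exists>g. continuous_on S g \<and> (\<forall>x\<in>S. E x = exp (g x))"
    using continuous_logarithm_on_contractible[OF cE cS Enz] by metis
  then obtain g where g: "continuous_on S g" "\<And>x. x \<in> S \<Longrightarrow> E x = exp (g x)" by blast
  define \<theta> where "\<theta> x = Im (g x)" for x
  have \<theta>c: "continuous_on S \<theta>" unfolding \<theta>_def[abs_def] by (intro continuous_intros g)
  have Epi: "E (s + pi, pi) = - E (s, pi)" for s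
  proof -
    have "of_real pi * E (s + pi, pi) = - (of_real pi * E (s, pi))"
      unfolding Eint using per[of s] by (simp add: algebra_simps)
    then show ?thesis by (metis mult_cancel_left mult_minus_right of_real_eq_0_iff pi_neq_zero)
  qed
  have Eper: "E (s + 2 * pi, d) = E (s, d)" for s d
  proof -
    have "f1 (t + 2 * pi) = f1 t" for t
    proof -
      have "((\<lambda>t. t + 2 * pi) has_vector_derivative 1) (at t)"
        by (auto intro!: derivative_eq_intros simp flip: has_real_derivative_iff_has_vector_derivative)
      from vector_diff_chain_at[OF this f]
      have "(f has_vector_derivative f1 (t + 2 * pi)) (at t)" by (simp add: o_def per)
      then show ?thesis using f vector_derivative_unique_at by blast
    qed
    from this[of "s + _ * d"] show ?thesis by (simp add: E_def algebra_simps)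
  qed
  have inS: "(s, pi) \<in> S" "(s, 0) \<in> S" for s by (auto simp: S_def)
  \<comment> \<open>The chord from \<open>s + pi\<close> to \<open>s + 2 * pi\<close> is the chord
    from \<open>s\<close> to \<open>s + pi\<close> traversed backwards.\<close>
  have odd: "\<exists>m::int. \<theta> (s + pi, pi) - \<theta> (s, pi) = pi + 2 * pi * m" for s
  proof -
    have "exp (g (s + pi, pi)) = of_real 1 * exp (\<i> * pi + g (s, pi))"
      using Epi[of s] g(2)[OF inS(1)] by (simp add: exp_add mult.commute)
    then obtain m :: int where "Im (g (s + pi, pi)) - Im (\<i> * pi + g (s, pi)) = 2 * pi * m"
      using exp_eq_imp_Im by (metis zero_less_one)
    then show ?thesis by (auto simp: \<theta>_def algebra_simps intro!: exI[of _ m])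
  qed
  define \<Delta> where "\<Delta> s = \<theta> (s + pi, pi) - \<theta> (s, pi)" for s
  have \<Delta>_const: "\<Delta> s = \<Delta> t" for s t
  proof (rule angle_constant[where S=UNIV and h=\<Delta>])
    show "continuous_on UNIV \<Delta>"
      unfolding \<Delta>_def[abs_def]
      by (intro continuous_on_diff continuous_on_compose2[OF \<theta>c]) (auto intro!: continuous_intros simp: S_def)
    show "\<exists>k::int. \<Delta> x - \<Delta> y = 2 * pi * k" for x y
    proof -
      obtain m n :: int where "\<Delta> x = pi + 2 * pi * m" "\<Delta> y = pi + 2 * pi * n"
        using odd[of x] odd[of y] by (auto simp: \<Delta>_def)
      then show ?thesis by (intro exI[of _ "m - n"]) (simp add: algebra_simps)
    qed
  qed auto
  \<comment> \<open>The turning over a full period. It is constant on the strip, so the turning of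
    the tangent at \<open>d = 0\<close> can be computed from the chords at
    \<open>d = pi\<close>.\<close>
  define \<phi> where "\<phi> x = \<theta> (fst x + 2 * pi, snd x) - \<theta> x" for x
  have \<phi>_const: "\<phi> x = \<phi> y" if "x \<in> S" "y \<in> S" for x y
  proof (rule angle_constant[where S=S and h=\<phi>, OF convex_connected[OF convS] _ _ that])
    show "continuous_on S \<phi>"
      unfolding \<phi>_def[abs_def]
      by (intro continuous_on_diff \<theta>c continuous_on_compose2[OF \<theta>c]) (auto intro!: continuous_intros simp: S_def)
    have "\<exists>k::int. \<phi> x = 2 * pi * k" if x: "x \<in> S" for x
    proof -
      have "(fst x + 2 * pi, snd x) \<in> S" using x by (simp add: S_def)
      then have "exp (g (fst x + 2 * pi, snd x)) = of_real 1 * exp (g x)"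
        using Eper[of "fst x" "snd x"] g(2)[of x] g(2)[of "(fst x + 2 * pi, snd x)"] x by simp
      then show ?thesis unfolding \<phi>_def \<theta>_def using exp_eq_imp_Im by (metis zero_less_one)
    qed
    then show "\<exists>k::int. \<phi> x - \<phi> y = 2 * pi * k" if "x \<in> S" "y \<in> S" for x y
      using that by (metis of_int_diff right_diff_distrib)
  qed
  have imf: "((\<lambda>u. Im (f u)) has_real_derivative Im (f1 u)) (at u)" for u
    using bounded_linear.has_vector_derivative[OF bounded_linear_Im f] by (simp add: has_real_derivative_iff_has_vector_derivative)
  \<comment> \<open>A lowest point of the curve: chords issuing from it point weakly upwards, chords
    ending in it weakly downwards.\<close>
  obtain u0 where u0: "\<And>u. Im (f u0) \<le> Im (f u)"
  proof -
    have "continuous_on {0..2 * pi} (\<lambda>u. Im (f u))"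
      using imf by (auto intro!: continuous_at_imp_continuous_on DERIV_isCont)
    then obtain u0 where u0: "\<forall>u\<in>{0..2 * pi}. Im (f u0) \<le> Im (f u)"
      using continuous_attains_inf[of "{0..2 * pi}" "\<lambda>u. Im (f u)"] by auto
    show thesis
    proof (rule that)
      fix u
      obtain s where "s \<in> {0..<2 * pi}" "f s = f u" by (rule periodic_reduce[where f=f and u=u, OF per]) blast
      then show "Im (f u0) \<le> Im (f u)" using u0 by (metis atLeastAtMost_iff atLeastLessThan_iff less_imp_le)
    qed
  qed
  have "Im (f1 u0) = 0" by (rule DERIV_local_min[OF imf zero_less_one]) (use u0 in auto)
  have sin_sign: "sgn (sin (\<theta> x)) = sgn (Im (E x))" if "x \<in> S" for x
    using g(2)[OF that] by (simp add: \<theta>_def Im_exp sgn_mult)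
  have ImE: "d * Im (E (s, d)) = Im (f (s + d)) - Im (f s)" for s d
    using arg_cong[OF Eint[of d s], of Im] by simp
  have up: "0 \<le> sin (\<theta> (u0, d))" if d: "d \<in> {0..pi}" for d
  proof -
    have "0 \<le> Im (E (u0, d))"
    proof (cases "d = 0")
      case False
      then have "0 < d" using d by simp
      moreover have "0 \<le> d * Im (E (u0, d))" unfolding ImE using u0 by simp
      ultimately show ?thesis by (simp add: zero_le_mult_iff)
    qed (simp add: E0 \<open>Im (f1 u0) = 0\<close>)
    then show ?thesis using sin_sign[of "(u0, d)"] d
      by (auto simp: S_def sgn_if split: if_splits)
  qed
  have down: "0 \<le> sin (- \<theta> (u0 - d, d))" if d: "d \<in> {0..pi}" for d
  proof -
    have "Im (E (u0 - d, d)) \<le> 0"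
    proof (cases "d = 0")
      case False
      then have "0 < d" using d by simp
      moreover have "d * Im (E (u0 - d, d)) \<le> 0" unfolding ImE using u0 by simp
      ultimately show ?thesis by (simp add: mult_le_0_iff)
    qed (simp add: E0 \<open>Im (f1 u0) = 0\<close>)
    then show ?thesis using sin_sign[of "(u0 - d, d)"] d
      by (auto simp: S_def sgn_if split: if_splits)
  qed
  have "\<bar>\<theta> (u0, pi) - \<theta> (u0, 0)\<bar> \<le> pi"
    by (rule angle_variation_le_pi[where a=0 and b=pi and \<theta>="\<lambda>d. \<theta> (u0, d)", OF _ _ up])
       (auto intro!: continuous_on_compose2[OF \<theta>c] continuous_intros simp: S_def)
  moreover have "\<bar>- \<theta> (u0 - pi, pi) - - \<theta> (u0 - 0, 0)\<bar> \<le> pi"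
    by (rule angle_variation_le_pi[where a=0 and b=pi and \<theta>="\<lambda>d. - \<theta> (u0 - d, d)", OF _ _ down])
       (auto intro!: continuous_on_compose2[OF \<theta>c] continuous_intros simp: S_def)
  moreover have "\<Delta> (u0 - pi) = \<theta> (u0, pi) - \<theta> (u0 - pi, pi)" by (simp add: \<Delta>_def)
  \<comment> \<open>Both families of chords start from the tangent at \<open>u0\<close> and turn by
    at most \<open>pi\<close>; an odd multiple of \<open>pi\<close> of size at most
    \<open>2 * pi\<close> can only be \<open>pi\<close> or \<open>- pi\<close>.\<close>
  ultimately have small: "\<bar>\<Delta> (u0 - pi)\<bar> \<le> 2 * pi" by simp
  have \<Delta>: "\<bar>\<Delta> s\<bar> = pi" for s
  proof -
    obtain m :: int where m: "\<Delta> (u0 - pi) = pi + 2 * pi * m" using odd[of "u0 - pi"] by (auto simp: \<Delta>_def)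
    then have "\<bar>pi * (1 + 2 * m)\<bar> \<le> pi * 2" using small by (simp add: algebra_simps)
    then have "\<bar>1 + 2 * real_of_int m\<bar> \<le> 2" by (simp add: abs_mult)
    then have "m = 0 \<or> m = - 1" by linarith
    then show ?thesis using m \<Delta>_const[of s "u0 - pi"] by auto
  qed
  define \<Theta> where "\<Theta> u = \<theta> (u, 0)" for u
  define c where "c = \<phi> (0, 0)"
  have \<Theta>c: "\<Theta> (u + 2 * pi) = \<Theta> u + c" for u
    using \<phi>_const[of "(u, 0)" "(0, 0)"] inS by (simp add: \<Theta>_def c_def \<phi>_def)
  have "c = \<phi> (0, pi)" unfolding c_def by (rule \<phi>_const) (auto simp: inS)
  also have "\<dots> = \<Delta> pi + \<Delta> 0" by (simp add: \<phi>_def \<Delta>_def)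
  finally have c_val: "c = 2 * \<Delta> 0" using \<Delta>_const[of pi 0] by simp
  have exp\<Theta>: "f1 u = exp (g (u, 0))" for u using g(2)[OF inS(2)] E0 by simp
  \<comment> \<open>Near \<open>u\<close> the lift differs by a constant from the imaginary part of
    \<open>Ln (f1 t / f1 u)\<close>; the set \<open>T\<close> keeps that argument away from the
    branch cut.\<close>
  have d\<Theta>: "(\<Theta> has_real_derivative Im (f2 u / f1 u)) (at u)" for u
  proof -
    define G where "G t = g (t, 0)" for t
    have Gc: "continuous_on UNIV G"
      unfolding G_def[abs_def] by (intro continuous_on_compose2[OF g(1)]) (auto intro!: continuous_intros simp: S_def)
    define T where "T = (\<lambda>t. Im (G t)) -` {Im (G u) - pi <..< Im (G u) + pi}"
    have T: "open T" unfolding T_def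
      by (rule open_vimage) (auto intro!: continuous_intros Gc)
    have uT: "u \<in> T" by (simp add: T_def)
    have eq: "Im (G u) + Im (Ln (f1 t / f1 u)) = \<Theta> t" if "t \<in> T" for t
    proof -
      have "f1 t / f1 u = exp (G t - G u)" by (simp add: exp_diff exp\<Theta> G_def)
      moreover have "Ln (exp (G t - G u)) = G t - G u" using that by (intro Ln_exp) (auto simp: T_def)
      ultimately show ?thesis by (simp add: \<Theta>_def \<theta>_def G_def)
    qed
    have q: "((\<lambda>t. f1 t / f1 u) has_vector_derivative f2 u / f1 u) (at u)"
      by (rule has_vector_derivative_divide[OF f1])
    have "(Ln has_field_derivative inverse 1) (at (f1 u / f1 u))"
      using nz[of u] has_field_derivative_Ln[of 1] by simp
    from field_vector_diff_chain_at[OF q this]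
    have "((\<lambda>t. Ln (f1 t / f1 u)) has_vector_derivative f2 u / f1 u) (at u)" by (simp add: o_def)
    from bounded_linear.has_vector_derivative[OF bounded_linear_Im this]
    have "((\<lambda>t. Im (G u) + Im (Ln (f1 t / f1 u))) has_real_derivative Im (f2 u / f1 u)) (at u)"
      by (auto intro!: derivative_eq_intros simp: has_real_derivative_iff_has_vector_derivative)
    then show ?thesis
      by (rule has_field_derivative_transform_within_open[OF _ T uT]) (rule eq)
  qed
  have decr: "\<Theta> t < \<Theta> s" if "s < t" for s t
  proof (rule DERIV_neg_imp_decreasing[OF that])
    fix u
    have "Im (f2 u / f1 u) < 0"
      using neg[of u] nz[of u] by (simp add: Im_divide_Reals complex_div_cnj[of "f2 u"] divide_less_0_iff flip: of_real_power)
    then show "\<exists>y. (\<Theta> has_real_derivative y) (at u) \<and> y < 0" using d\<Theta> by blast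
  qed
  \<comment> \<open>The sign of the curvature makes the angle decrease, which rules out the value
    \<open>2 * pi\<close>.\<close>
  have cm: "c = - 2 * pi"
  proof -
    have "c < 0" using \<Theta>c[of 0] decr[of 0 "2 * pi"] by simp
    then show ?thesis using \<Delta>[of 0] c_val by (auto simp: abs_if split: if_splits)
  qed
  have \<Theta>k: "\<Theta> (u + 2 * pi * of_int k) = \<Theta> u - 2 * pi * of_int k" for u and k :: int
  proof -
    interpret ps: periodic_fun_simple "\<lambda>u. \<Theta> u + u" "2 * pi"
      by standard (simp add: \<Theta>c cm)
    show ?thesis using ps.plus_of_int[of u k] by (simp add: algebra_simps)
  qed
  obtain k :: int where "Im (g (u1, 0)) - Im (g (u2, 0)) = 2 * pi * k"
    using exp_eq_imp_Im par unfolding exp\<Theta> by blast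
  \<comment> \<open>Codirectional tangents have angles differing by a multiple of the total turning,
    which a shift by whole periods absorbs; strict monotonicity then identifies the
    parameters.\<close>
  then have "\<Theta> u1 = \<Theta> (u2 + 2 * pi * of_int (- k))" unfolding \<Theta>k by (simp add: \<Theta>_def \<theta>_def)
  then have "u1 = u2 + 2 * pi * of_int (- k)" using decr by (metis less_irrefl linorder_less_linear)
  then show ?thesis by blast
qed

section \<open>Behaviour near the axis\<close>

text \<open>\<open>\<delta>\<close> is both the radius of a neighbourhood and a parameter of
  \<open>P\<close>. As \<open>P\<close> survives decreasing it, the minimum over a finite subcover
  works; the entry \<open>1\<close> covers an empty subcover.\<close>

lemma compact_uniform:
  fixes K :: "'a::metric_space set"
  assumes K: "compact K" and loc: "\<And>a. a \<in> K \<Longrightarrow> \<exists>\<delta>>0. \<forall>b. dist a b < \<delta> \<longrightarrow> P b \<delta>"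
    and mono: "\<And>a \<delta> \<delta>'. P a \<delta> \<Longrightarrow> \<delta>' \<le> \<delta> \<Longrightarrow> P a \<delta>'"
  shows "\<exists>\<delta>>(0::real). \<forall>a\<in>K. P a \<delta>"
proof -
  obtain D where D: "\<And>a. a \<in> K \<Longrightarrow> 0 < D a" "\<And>a b. a \<in> K \<Longrightarrow> dist a b < D a \<Longrightarrow> P b (D a)"
    using loc by metis
  obtain F where F: "F \<subseteq> K" "finite F" "K \<subseteq> (\<Union>a\<in>F. ball a (D a))"
  proof (rule compactE_image[OF K, of K "\<lambda>a. ball a (D a)"])
    show "K \<subseteq> (\<Union>a\<in>K. ball a (D a))" using D(1) by force
  qed auto
  define \<delta> where "\<delta> = Min (insert 1 (D ` F))"
  have \<delta>: "0 < \<delta>" "\<And>a. a \<in> F \<Longrightarrow> \<delta> \<le> D a"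
    unfolding \<delta>_def using F D(1) by (auto simp: subset_iff)
  show ?thesis
  proof (intro exI[of _ \<delta>] conjI ballI \<delta>(1))
    fix a assume "a \<in> K"
    then obtain b where "b \<in> F" "dist b a < D b" using F(3) by auto
    then show "P a \<delta>" using D(2)[of b a] F(1) mono[OF _ \<delta>(2)] by blast
  qed
qed

lemma ext_at_inverse:
  assumes f: "ext_at f a" and nz: "f a \<noteq> 0"
  shows "ext_at (\<lambda>x. inverse (f x)) a"
proof -
  obtain F r where r: "0 < r" "chol_on F (ball (cvec a) r)"
    "\<And>x. x \<in> ball a r \<Longrightarrow> F (cvec x) = complex_of_real (f x)"
    by (rule ext_atE[OF f]) blast
  define S where "S = ball (cvec a) r \<inter> F -` (- {0})"
  have S: "open S" unfolding S_def
    by (rule continuous_open_preimage[OF chol_on_continuous[OF r(2)] open_ball]) auto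
  show ?thesis
  proof (rule ext_atI[OF S, where F="\<lambda>z. inverse (F z)" and T="ball a r"])
    show "cvec a \<in> S" using r nz by (simp add: S_def)
    show "chol_on (\<lambda>z. inverse (F z)) S"
      using r(2) unfolding chol_on_def S_def by (intro ballI cdiff_inverse) auto
    show "inverse (F (cvec x)) = complex_of_real (inverse (f x))" if "x \<in> ball a r" for x
      using r(3)[OF that] by simp
  qed (use r in auto)
qed

text \<open>Hadamard's lemma: the quotient by \<open>v\<close> is the mean of the
  \<open>v\<close>-derivative over the segment from the axis, and \<open>vmean\<close> of the
  extended derivative makes it analytic across \<open>v = 0\<close>.\<close>

lemma axis_quotient:
  assumes f: "ext_at f (u0, 0)" and f0: "\<And>u. f (u, 0) = 0"
  shows "\<exists>g r. 0 < r \<and> ext_at g (u0, 0) \<and> (\<forall>u v. (u, v) \<in> ball (u0, 0) r \<longrightarrow> f (u, v) = v * g (u, v)) \<and>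
    (\<forall>u. dist u0 u < r \<longrightarrow> g (u, 0) = D2 f (u, 0))"
proof -
  define a where "a = (u0, 0 :: real)"
  obtain F r where r: "0 < r" "chol_on F (ball (cvec a) r)"
    "\<And>x. x \<in> ball a r \<Longrightarrow> F (cvec x) = complex_of_real (f x)"
    by (rule ext_atE[OF f[folded a_def]]) blast
  define S where "S = ball (cvec a) r"
  have opS: "open S" by (simp add: S_def)
  have star: "vstar S"
    unfolding vstar_def
  proof (intro allI ballI impI)
    fix u v :: complex and t :: real assume t: "t \<in> {0..1}" and uv: "(u, v) \<in> S"
    have "norm (complex_of_real u0 - u, - (t *\<^sub>R v)) \<le> norm (complex_of_real u0 - u, - v)"
      using t by (auto simp: norm_Pair power_mult_distrib intro!: mult_left_le_one_le power_le_one)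
    then show "(u, t *\<^sub>R v) \<in> S" using uv by (simp add: S_def a_def dist_norm)
  qed
  define h where "h x = dd F x (0, 1)" for x
  have h: "chol_on h S" unfolding h_def[abs_def] S_def by (rule chol_on_dd[OF open_ball r(2)])
  have ftc: "F x - F (fst x, 0) = snd x * vmean h x" if x: "x \<in> S" for x
  proof -
    have cd: "cdiff F (fst x, t *\<^sub>R snd x)" if "t \<in> {0..1}" for t
      using vstarD[OF star x that] r(2) by (simp add: chol_on_def S_def)
    have "((\<lambda>t. snd x * h (fst x, t *\<^sub>R snd x)) has_integral (F (fst x, 1 *\<^sub>R snd x) - F (fst x, 0 *\<^sub>R snd x))) {0..1}"
    proof (rule fundamental_theorem_of_calculus)
      fix t :: real assume t: "t \<in> {0..1}"
      have "((\<lambda>t. (fst x, t *\<^sub>R snd x)) has_derivative (\<lambda>k. (0, k *\<^sub>R snd x))) (at t within {0..1})"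
        by (auto intro!: derivative_eq_intros)
      from has_derivative_compose[OF this cdiff_has_derivative[OF cd[OF t]]]
      have "((\<lambda>t. F (fst x, t *\<^sub>R snd x)) has_derivative (\<lambda>k. dd F (fst x, t *\<^sub>R snd x) (0, k *\<^sub>R snd x))) (at t within {0..1})" .
      moreover have "dd F (fst x, t *\<^sub>R snd x) (0, k *\<^sub>R snd x) = k *\<^sub>R (snd x * h (fst x, t *\<^sub>R snd x))" for k
        unfolding h_def using dd_complex2[OF cd[OF t], of "(0, k *\<^sub>R snd x)"] by simp
      ultimately show "((\<lambda>t. F (fst x, t *\<^sub>R snd x)) has_vector_derivative snd x * h (fst x, t *\<^sub>R snd x)) (at t within {0..1})"
        by (simp add: has_vector_derivative_def)
    qed simp
    from integral_unique[OF this]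
    show ?thesis by (simp add: vmean_def)
  qed
  have cv: "cvec w \<in> S \<longleftrightarrow> w \<in> ball a r" for w by (simp only: S_def mem_ball cpx2.dist_iota)
  have axis: "(fst w, 0) \<in> ball a r" if "w \<in> ball a r" for w
  proof -
    have "dist a (fst w, 0) = dist (fst a) (fst w)" by (simp add: a_def dist_Pair_Pair)
    also have "\<dots> \<le> dist a w" by (rule dist_fst_le)
    finally show ?thesis using that by simp
  qed
  have val: "F (cvec w) = of_real (snd w) * vmean h (cvec w)" if w: "w \<in> ball a r" for w
  proof -
    have "F (fst (cvec w), 0) = 0"
      using r(3)[OF axis[OF w]] f0 by (cases w) simp
    then show ?thesis using ftc[of "cvec w"] w by (cases w) (simp only: cv, simp)
  qed
  have h_real: "h (cvec w) = complex_of_real (D2 f w)" if w: "w \<in> ball a r" for w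
  proof -
    have "complex_of_real (dd f w (0, 1)) = dd F (cvec w) (cvec (0, 1))"
      by (rule ext_at_has_derivative_aux(2)[of F w "ball a r"]) (use w r cv in \<open>auto simp: chol_on_def S_def\<close>)
    then show ?thesis by (simp add: h_def D2_def)
  qed
  \<comment> \<open>Off the axis reality is read off from the quotient \<open>f w / snd w\<close>,
    on the axis from the derivative itself.\<close>
  have im: "Im (vmean h (cvec w)) = 0" if "cvec w \<in> S" for w
  proof (cases "snd w = 0")
    case True
    then have "vmean h (cvec w) = h (cvec w)" by (cases w) (simp add: vmean_0)
    then show ?thesis using h_real that cv by simp
  next
    case False
    have w: "w \<in> ball a r" using that by (simp only: cv)
    have "of_real (snd w) * vmean h (cvec w) = of_real (f w)" using val[OF w] r(3)[OF w] by simp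
    then have "vmean h (cvec w) = of_real (f w / snd w)" using False by (simp add: field_simps)
    then show ?thesis by simp
  qed
  define g where "g w = Re (vmean h (cvec w))" for w
  have hv: "chol_on (vmean h) S" using vmean_cdiff(1)[OF opS star h] by (simp add: chol_on_def)
  have q1: "ext_at g a" unfolding g_def[abs_def]
    by (rule ext_at_Re[OF opS hv im]) (use r in \<open>auto simp: S_def\<close>)
  have q2: "f (u, v) = v * g (u, v)" if "(u, v) \<in> ball a r" for u v
    using arg_cong[OF val[OF that], of Re] r(3)[OF that] by (simp add: g_def)
  have q3: "g (u, 0) = D2 f (u, 0)" if "dist u0 u < r" for u
    using h_real[of "(u, 0)"] that by (simp add: g_def vmean_0 a_def dist_Pair_Pair)
  show ?thesis
    unfolding a_def[symmetric]
    by (rule exI[of _ g], rule exI[of _ r]) (intro conjI allI impI r(1) q1; (rule q2 | rule q3), assumption)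
qed

section \<open>Uniformity in the angular variable near the axis\<close>

lemma D_const: "D1 (\<lambda>w. c :: real) a = 0" "D2 (\<lambda>w. c :: real) a = 0"
  using D_eqI[of "\<lambda>w. c" 0 0 a] by simp_all

lemma D1_axis:
  assumes "ext_at f (u, 0)" "\<And>s. f (s, 0) = c"
  shows "D1 f (u, 0) = 0"
proof -
  have "(\<lambda>s. f (s, 0)) = (\<lambda>_. c)" using assms(2) by auto
  then have "((\<lambda>_. c) has_real_derivative D1 f (u, 0)) (at u)" using D_line(1)[OF assms(1)] by simp
  then show ?thesis by (rule DERIV_unique[OF _ DERIV_const])
qed

lemma D_shift:
  assumes f: "ext_at f (a + c)" and S: "open S" "a \<in> S" and eq: "\<And>w. w \<in> S \<Longrightarrow> f (w + c) = f w"
  shows "D1 f (a + c) = D1 f a" "D2 f (a + c) = D2 f a"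
proof -
  have "((\<lambda>w. w + c) has_derivative (\<lambda>h. h)) (at a)" by (auto intro!: derivative_eq_intros)
  from has_derivative_compose[OF this ext_at_D(5)[OF f]]
  have "(f has_derivative (\<lambda>h. D1 f (a + c) * fst h + D2 f (a + c) * snd h)) (at a)"
    by (rule has_derivative_transform_within_open[OF _ S]) (rule eq)
  from D_eqI[OF this] show "D1 f (a + c) = D1 f a" "D2 f (a + c) = D2 f a" by simp_all
qed

lemma box_in_ball:
  assumes "\<bar>u - u0\<bar> < r / 2" "\<bar>v\<bar> < r / 2"
  shows "(u, v) \<in> ball (u0, 0) r"
proof -
  have "dist (u0, 0) (u, v) \<le> norm (u0 - u) + norm (0 - v)"
    unfolding dist_norm diff_Pair by (rule norm_Pair_le)
  then show ?thesis using assms abs_minus_commute[of u u0] unfolding mem_ball by simp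
qed

lemma isCont_box:
  assumes "isCont g (u0, 0 :: real)" "open A" "g (u0, 0) \<in> A"
  obtains \<delta> where "0 < \<delta>" "\<And>u v :: real. \<bar>u - u0\<bar> < \<delta> \<Longrightarrow> \<bar>v\<bar> < \<delta> \<Longrightarrow> g (u, v) \<in> A"
proof -
  have "(g \<longlongrightarrow> g (u0, 0)) (nhds (u0, 0))"
    using assms(1) unfolding isCont_def tendsto_at_iff_tendsto_nhds .
  from topological_tendstoD[OF this assms(2,3)] have "\<forall>\<^sub>F w in nhds (u0, 0). g w \<in> A" .
  then obtain r where r: "0 < r" "\<And>w. dist w (u0, 0) < r \<Longrightarrow> g w \<in> A"
    unfolding eventually_nhds_metric by blast
  show thesis
  proof (rule that[of "r / 2"])
    fix u v :: real assume "\<bar>u - u0\<bar> < r / 2" "\<bar>v\<bar> < r / 2"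
    from box_in_ball[OF this] show "g (u, v) \<in> A" using r(2) by (simp add: dist_commute)
  qed (use r in simp)
qed

text \<open>Compactness of one period makes a local property uniform in \<open>u\<close>.
  \<open>P\<close> may depend on \<open>\<delta>\<close>, so that a constant can be produced
  together with the width of the strip.\<close>

lemma near_axis:
  fixes P :: "real \<Rightarrow> real \<Rightarrow> real \<Rightarrow> bool"
  assumes R: "0 < R" and per: "\<And>u v \<delta>. 0 < v \<Longrightarrow> v < R \<Longrightarrow> P (u + 2 * pi) v \<delta> = P u v \<delta>"
    and loc: "\<And>u0. \<exists>\<delta>>0. \<forall>u v. \<bar>u - u0\<bar> < \<delta> \<longrightarrow> 0 < v \<longrightarrow> v < \<delta> \<longrightarrow> v < R \<longrightarrow> P u v \<delta>"
    and mono: "\<And>u v \<delta> \<delta>'. P u v \<delta> \<Longrightarrow> \<delta>' \<le> \<delta> \<Longrightarrow> P u v \<delta>'"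
  obtains \<delta> where "0 < \<delta>" "\<delta> \<le> R" "\<And>u v. 0 < v \<Longrightarrow> v < \<delta> \<Longrightarrow> P u v \<delta>"
proof -
  have "\<exists>\<delta>>0. \<forall>u\<in>{0..2 * pi}. \<forall>v. 0 < v \<longrightarrow> v < \<delta> \<longrightarrow> v < R \<longrightarrow> P u v \<delta>"
  proof (rule compact_uniform[where K="{0..2 * pi}" and P="\<lambda>u \<delta>. \<forall>v. 0 < v \<longrightarrow> v < \<delta> \<longrightarrow> v < R \<longrightarrow> P u v \<delta>"])
    fix u0 :: real
    obtain \<delta> where "0 < \<delta>" "\<And>u v. \<bar>u - u0\<bar> < \<delta> \<Longrightarrow> 0 < v \<Longrightarrow> v < \<delta> \<Longrightarrow> v < R \<Longrightarrow> P u v \<delta>"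
      using loc by metis
    then show "\<exists>\<delta>>0. \<forall>b. dist u0 b < \<delta> \<longrightarrow> (\<forall>v. 0 < v \<longrightarrow> v < \<delta> \<longrightarrow> v < R \<longrightarrow> P b v \<delta>)"
      by (intro exI[of _ \<delta>]) (auto simp: dist_real_def abs_minus_commute)
  next
    fix a \<delta> \<delta>' :: real
    assume "\<forall>v. 0 < v \<longrightarrow> v < \<delta> \<longrightarrow> v < R \<longrightarrow> P a v \<delta>" "\<delta>' \<le> \<delta>"
    then show "\<forall>v. 0 < v \<longrightarrow> v < \<delta>' \<longrightarrow> v < R \<longrightarrow> P a v \<delta>'" using mono by fastforce
  qed simp
  then obtain \<delta> where \<delta>: "0 < \<delta>" "\<And>u v. u \<in> {0..2 * pi} \<Longrightarrow> 0 < v \<Longrightarrow> v < \<delta> \<Longrightarrow> v < R \<Longrightarrow> P u v \<delta>"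
    by blast
  show thesis
  proof (rule that[of "min \<delta> R"])
    fix u v assume v: "0 < v" "v < min \<delta> R"
    obtain s where s: "s \<in> {0..<2 * pi}" "P s v \<delta> = P u v \<delta>"
      by (rule periodic_reduce[where f="\<lambda>s. P s v \<delta>" and u=u]) (use per v in auto)
    then have "P u v \<delta>" using \<delta>(2)[of s v] v by auto
    then show "P u v (min \<delta> R)" by (rule mono) simp
  qed (use \<delta> R in auto)
qed

lemma parallel_vectors:
  fixes a b c d :: real
  assumes "a * d = b * c" "0 \<le> a * c + b * d" "(a, b) \<noteq> (0, 0)" "(c, d) \<noteq> (0, 0)"
  obtains l where "0 < l" "a = l * c" "b = l * d"
proof -
  define n where "n = c\<^sup>2 + d\<^sup>2"
  have n: "0 < n" using assms(4) by (auto simp: n_def sum_power2_gt_zero_iff)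
  define l where "l = (a * c + b * d) / n"
  have "a * n = (a * c + b * d) * c" "b * n = (a * c + b * d) * d"
    using assms(1) by (auto simp: n_def power2_eq_square algebra_simps)
  then have l: "a = l * c" "b = l * d" using n by (auto simp: l_def field_simps)
  have "0 \<le> l" using assms(2) n by (simp add: l_def)
  moreover have "l \<noteq> 0" using l assms(3) by auto
  ultimately have "0 < l" by simp
  from that[OF this l] show thesis .
qed

section \<open>The isolated singularity\<close>

locale ma_cone = ma_param +
  fixes \<gamma> :: "real \<Rightarrow> real \<times> real"
  assumes R: "0 < R"
    and init: "\<And>u. (x (u, 0), y (u, 0), z (u, 0), p (u, 0), q (u, 0)) = (0, 0, 0, \<gamma> u)"
    and periodic: "\<And>u v. (u, v) \<in> Strip_hat R \<Longrightarrow>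
      (x (u + 2 * pi, v), y (u + 2 * pi, v), z (u + 2 * pi, v), p (u + 2 * pi, v), q (u + 2 * pi, v))
      = (x (u, v), y (u, v), z (u, v), p (u, v), q (u, v))"
    and jordan: "neg_convex_Jordan \<gamma>"
begin

abbreviation \<Phi> :: "real \<times> real \<Rightarrow> real \<times> real" where "\<Phi> w \<equiv> (x w, y w)"

lemma strip_iff: "(u, v) \<in> Strip_hat R \<longleftrightarrow> \<bar>v\<bar> < R"
  by (auto simp: Strip_hat_def)

lemma axis: "(u, 0) \<in> Strip_hat R"
  using R by (simp add: strip_iff)

lemma init': "x (u, 0) = 0" "y (u, 0) = 0" "z (u, 0) = 0" "(p (u, 0), q (u, 0)) = \<gamma> u"
  using init[of u] by auto

lemma periodic_int:
  assumes "\<bar>v\<bar> < R"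
  shows "(x (u + 2 * pi * of_int k, v), y (u + 2 * pi * of_int k, v), z (u + 2 * pi * of_int k, v),
    p (u + 2 * pi * of_int k, v), q (u + 2 * pi * of_int k, v)) = (x (u, v), y (u, v), z (u, v), p (u, v), q (u, v))"
proof -
  interpret pf: periodic_fun_simple "\<lambda>s. (x (s, v), y (s, v), z (s, v), p (s, v), q (s, v))" "2 * pi"
    by standard (rule periodic, simp add: strip_iff assms)
  show ?thesis using pf.plus_of_int[of u k] by (simp add: mult.commute)
qed

lemma D1_xy: "D1 x (u, 0) = 0" "D1 y (u, 0) = 0"
  using D1_axis[OF ext(1)[OF axis]] D1_axis[OF ext(2)[OF axis]] init' by blast+

text \<open>\<open>\<gamma>\<close> is the trace of \<open>(p, q)\<close> on the axis, which turns
  the \<open>deriv\<close> terms of \<open>neg_convex_Jordan\<close> into partial derivatives of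
  \<open>p\<close> and \<open>q\<close>.\<close>

lemma gamma_derivs:
  shows "((\<lambda>u. fst (\<gamma> u)) has_real_derivative D1 p (u, 0)) (at u)" "((\<lambda>u. snd (\<gamma> u)) has_real_derivative D1 q (u, 0)) (at u)"
    "((\<lambda>u. D1 p (u, 0)) has_real_derivative D1 (D1 p) (u, 0)) (at u)"
    "((\<lambda>u. D1 q (u, 0)) has_real_derivative D1 (D1 q) (u, 0)) (at u)"
    "D1 (D1 p) (u, 0) * D1 q (u, 0) - D1 p (u, 0) * D1 (D1 q) (u, 0) > 0"
    "(D1 p (u, 0), D1 q (u, 0)) \<noteq> (0, 0)"
proof -
  have ab: "(\<lambda>u. fst (\<gamma> u)) = (\<lambda>u. p (u, 0))" "(\<lambda>u. snd (\<gamma> u)) = (\<lambda>u. q (u, 0))"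
    using init'(4) by (metis fst_conv, metis snd_conv)
  have d1: "((\<lambda>u. fst (\<gamma> u)) has_real_derivative D1 p (u, 0)) (at u)" "((\<lambda>u. snd (\<gamma> u)) has_real_derivative D1 q (u, 0)) (at u)" for u
    unfolding ab by (rule D_line ext axis)+
  have d2: "((\<lambda>u. D1 p (u, 0)) has_real_derivative D1 (D1 p) (u, 0)) (at u)"
    "((\<lambda>u. D1 q (u, 0)) has_real_derivative D1 (D1 q) (u, 0)) (at u)" for u
    by (rule D_line ext_at_D(1) ext axis)+
  have e1: "deriv (\<lambda>u. fst (\<gamma> u)) = (\<lambda>u. D1 p (u, 0))" "deriv (\<lambda>u. snd (\<gamma> u)) = (\<lambda>u. D1 q (u, 0))"
    using DERIV_imp_deriv[OF d1(1)] DERIV_imp_deriv[OF d1(2)] by auto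
  have e2: "deriv (\<lambda>u. D1 p (u, 0)) = (\<lambda>u. D1 (D1 p) (u, 0))" "deriv (\<lambda>u. D1 q (u, 0)) = (\<lambda>u. D1 (D1 q) (u, 0))"
    using DERIV_imp_deriv[OF d2(1)] DERIV_imp_deriv[OF d2(2)] by auto
  show "((\<lambda>u. fst (\<gamma> u)) has_real_derivative D1 p (u, 0)) (at u)" "((\<lambda>u. snd (\<gamma> u)) has_real_derivative D1 q (u, 0)) (at u)"
    "((\<lambda>u. D1 p (u, 0)) has_real_derivative D1 (D1 p) (u, 0)) (at u)"
    "((\<lambda>u. D1 q (u, 0)) has_real_derivative D1 (D1 q) (u, 0)) (at u)" by (rule d1 d2)+
  show "D1 (D1 p) (u, 0) * D1 q (u, 0) - D1 p (u, 0) * D1 (D1 q) (u, 0) > 0"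
    "(D1 p (u, 0), D1 q (u, 0)) \<noteq> (0, 0)"
    using jordan unfolding neg_convex_Jordan_def Let_def e1 e2 by blast+
qed

text \<open>On the axis \<open>x_u = y_u = 0\<close>, so the first two equations reduce to
  \<open>S x_v = - q_u\<close> and \<open>S y_v = p_u\<close>: the normal is the tangent of
  \<open>\<gamma>\<close> turned by a right angle and divided by \<open>S\<close>.\<close>

lemma normal_direction:
  obtains S where "0 < S" "D1 p (u, 0) = S * D2 y (u, 0)" "D1 q (u, 0) = - S * D2 x (u, 0)"
proof -
  define X where "X = (x (u, 0), y (u, 0), z (u, 0), p (u, 0), q (u, 0))"
  define S where "S = sqrt (A X * C X - (B X)\<^sup>2 + E X)"
  have "0 < S" using elliptic mem[OF axis] by (simp add: S_def X_def)
  moreover have "D1 p (u, 0) = S * D2 y (u, 0)" "D1 q (u, 0) = - S * D2 x (u, 0)"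
    using system[OF axis X_def S_def] D1_xy by auto
  ultimately show thesis using that by blast
qed

lemma normal_nz: "(D2 x (u, 0), D2 y (u, 0)) \<noteq> (0, 0)"
proof -
  obtain S where "0 < S" "D1 p (u, 0) = S * D2 y (u, 0)" "D1 q (u, 0) = - S * D2 x (u, 0)"
    by (rule normal_direction)
  then show ?thesis using gamma_derivs(6)[of u] by auto
qed

section \<open>The Jacobian off the axis\<close>

lemma ext_jac: "w \<in> Strip_hat R \<Longrightarrow> ext_at jac w"
  unfolding jac_def[abs_def] by (intro ext_at_diff ext_at_mult ext_at_D ext)

lemma jac_axis: "jac (u, 0) = 0"
  by (simp add: jac_def D1_xy)

text \<open>The normal direction \<open>(x\<^sub>v, y\<^sub>v)\<close> is orthogonal to \<open>\<gamma>'\<close>, and rotates with it.\<close>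

lemma D2_jac: "D2 jac (u, 0) = D1 (D2 x) (u, 0) * D2 y (u, 0) - D2 x (u, 0) * D1 (D2 y) (u, 0)"
  "D2 jac (u, 0) > 0"
proof -
  note e = ext[OF axis[of u]]
  have "D2 jac (u, 0) = D2 (D1 x) (u, 0) * D2 y (u, 0) - D2 x (u, 0) * D2 (D1 y) (u, 0)"
    unfolding jac_def[abs_def]
    by (simp add: D_diff D_mult ext_at_mult ext_at_D(1,2)[OF e(1)] ext_at_D(1,2)[OF e(2)] D1_xy)
  then show eq: "D2 jac (u, 0) = D1 (D2 x) (u, 0) * D2 y (u, 0) - D2 x (u, 0) * D1 (D2 y) (u, 0)"
    using ext_at_D(3)[OF e(1)] ext_at_D(3)[OF e(2)] by simp
  \<comment> \<open>Differentiating the orthogonality \<open>h = 0\<close> along the axis trades the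
    derivative of the normal for the second derivative of \<open>\<gamma>\<close>, and avoids
    differentiating \<open>S\<close>.\<close>
  define h where "h w = D2 x w * D1 p w + D2 y w * D1 q w" for w
  have "h (s, 0) = 0" for s
  proof -
    obtain S where "0 < S" "D1 p (s, 0) = S * D2 y (s, 0)" "D1 q (s, 0) = - S * D2 x (s, 0)"
      by (rule normal_direction)
    then show ?thesis by (simp add: h_def)
  qed
  moreover have "ext_at h (u, 0)"
    unfolding h_def[abs_def] by (intro ext_at_add ext_at_mult ext_at_D e)
  ultimately have "D1 h (u, 0) = 0" by (rule D1_axis[rotated])
  moreover have "D1 h (u, 0) = D2 x (u, 0) * D1 (D1 p) (u, 0) + D1 (D2 x) (u, 0) * D1 p (u, 0) +
      (D2 y (u, 0) * D1 (D1 q) (u, 0) + D1 (D2 y) (u, 0) * D1 q (u, 0))"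
    unfolding h_def[abs_def]
    by (simp add: D_add D_mult ext_at_mult ext_at_D(2)[OF e(1)] ext_at_D(2)[OF e(2)] ext_at_D(1)[OF e(4)] ext_at_D(1)[OF e(5)])
  ultimately have h0: "D2 x (u, 0) * D1 (D1 p) (u, 0) + D1 (D2 x) (u, 0) * D1 p (u, 0) +
      (D2 y (u, 0) * D1 (D1 q) (u, 0) + D1 (D2 y) (u, 0) * D1 q (u, 0)) = 0" by simp
  obtain S where S: "0 < S" "D1 p (u, 0) = S * D2 y (u, 0)" "D1 q (u, 0) = - S * D2 x (u, 0)"
    by (rule normal_direction)
  have "S\<^sup>2 * D2 jac (u, 0) = S * (D1 (D2 x) (u, 0) * D1 p (u, 0) + D1 (D2 y) (u, 0) * D1 q (u, 0))"
    unfolding eq S by (simp add: power2_eq_square algebra_simps)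
  also have "\<dots> = S * (- (D2 x (u, 0) * D1 (D1 p) (u, 0) + D2 y (u, 0) * D1 (D1 q) (u, 0)))"
    using h0 by (intro arg_cong[where f="\<lambda>t. S * t"]) linarith
  also have "\<dots> = D1 (D1 p) (u, 0) * D1 q (u, 0) - D1 p (u, 0) * D1 (D1 q) (u, 0)"
    unfolding S by (simp add: algebra_simps)
  finally have "0 < S\<^sup>2 * D2 jac (u, 0)" using gamma_derivs(5)[of u] by simp
  then show "D2 jac (u, 0) > 0" using S(1) by (simp add: zero_less_mult_iff)
qed

lemma periodic_xy:
  assumes "\<bar>v\<bar> < R"
  shows "\<Phi> (u + 2 * pi, v) = \<Phi> (u, v)" "\<Phi> (u + 2 * pi * of_int k, v) = \<Phi> (u, v)"
    "z (u + 2 * pi * of_int k, v) = z (u, v)" "(p (u + 2 * pi, v), q (u + 2 * pi, v)) = (p (u, v), q (u, v))"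
    "z (u + 2 * pi, v) = z (u, v)"
  using periodic_int[OF assms, of u k] periodic[of u v] assms by (auto simp: strip_iff)

lemma jac_periodic:
  assumes "\<bar>v\<bar> < R"
  shows "jac (u + 2 * pi, v) = jac (u, v)"
proof -
  have s: "(u, v) + (2 * pi, 0) \<in> Strip_hat R" "(u, v) \<in> Strip_hat R" using assms by (auto simp: strip_iff)
  have e: "x (w + (2 * pi, 0)) = x w" "y (w + (2 * pi, 0)) = y w" if "w \<in> Strip_hat R" for w
    using that periodic[of "fst w" "snd w"] by (cases w; simp)+
  show ?thesis
    using D_shift[OF ext(1)[OF s(1)] open_Strip_hat s(2) e(1)] D_shift[OF ext(2)[OF s(1)] open_Strip_hat s(2) e(2)]
    by (simp add: jac_def)
qed

text \<open>\<open>jac\<close> vanishes on the axis, so locally \<open>jac = v g\<close>, where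
  \<open>g\<close> equals the positive \<open>v\<close>-derivative of \<open>jac\<close> on the
  axis; continuity of \<open>g\<close> and compactness do the rest.\<close>

lemma jac_pos:
  obtains \<delta> where "0 < \<delta>" "\<delta> \<le> R" "\<And>u v. 0 < v \<Longrightarrow> v < \<delta> \<Longrightarrow> jac (u, v) > 0"
proof (rule near_axis[OF R, of "\<lambda>u v _. jac (u, v) > 0"])
  show "(jac (u + 2 * pi, v) > 0) = (jac (u, v) > 0)" if "0 < v" "v < R" for u v
    using jac_periodic[of v u] that by simp
  fix u0
  obtain g r where g: "0 < r" "ext_at g (u0, 0)" "\<And>u v. (u, v) \<in> ball (u0, 0) r \<Longrightarrow> jac (u, v) = v * g (u, v)"
    "\<And>u. dist u0 u < r \<Longrightarrow> g (u, 0) = D2 jac (u, 0)"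
    using axis_quotient[OF ext_jac[OF axis] jac_axis, of u0] by blast
  have "g (u0, 0) \<in> {0<..}" using g(4)[of u0] g(1) D2_jac(2)[of u0] by simp
  then obtain d where d: "0 < d" "\<And>u v. \<bar>u - u0\<bar> < d \<Longrightarrow> \<bar>v\<bar> < d \<Longrightarrow> g (u, v) \<in> {0<..}"
    using isCont_box[OF ext_at_isCont[OF g(2)] open_greaterThan] by metis
  have "jac (u, v) > 0" if "\<bar>u - u0\<bar> < min d (r / 2)" "0 < v" "v < min d (r / 2)" for u v
  proof -
    have "jac (u, v) = v * g (u, v)" by (rule g(3), rule box_in_ball) (use that in auto)
    then show ?thesis using d(2)[of u v] that by simp
  qed
  then show "\<exists>\<delta>>0. \<forall>u v. \<bar>u - u0\<bar> < \<delta> \<longrightarrow> 0 < v \<longrightarrow> v < \<delta> \<longrightarrow> v < R \<longrightarrow> jac (u, v) > 0"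
    using d(1) g(1) by (intro exI[of _ "min d (r / 2)"]) auto
qed (use that in auto)

section \<open>Polar form of the map and injectivity\<close>

lemma polar_quotient:
  obtains g1 g2 r where "0 < r" "ext_at g1 (u0, 0)" "ext_at g2 (u0, 0)"
    "\<And>u v. (u, v) \<in> ball (u0, 0) r \<Longrightarrow> x (u, v) = v * g1 (u, v) \<and> y (u, v) = v * g2 (u, v)"
    "\<And>u. dist u0 u < r \<Longrightarrow> g1 (u, 0) = D2 x (u, 0) \<and> g2 (u, 0) = D2 y (u, 0)"
proof -
  obtain g1 r1 where g1: "0 < r1" "ext_at g1 (u0, 0)" "\<And>u v. (u, v) \<in> ball (u0, 0) r1 \<Longrightarrow> x (u, v) = v * g1 (u, v)"
    "\<And>u. dist u0 u < r1 \<Longrightarrow> g1 (u, 0) = D2 x (u, 0)"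
    using axis_quotient[OF ext(1)[OF axis] init'(1), of u0] by blast
  obtain g2 r2 where g2: "0 < r2" "ext_at g2 (u0, 0)" "\<And>u v. (u, v) \<in> ball (u0, 0) r2 \<Longrightarrow> y (u, v) = v * g2 (u, v)"
    "\<And>u. dist u0 u < r2 \<Longrightarrow> g2 (u, 0) = D2 y (u, 0)"
    using axis_quotient[OF ext(2)[OF axis] init'(2), of u0] by blast
  show thesis
    by (rule that[of "min r1 r2" g1 g2]) (use g1 g2 in auto)
qed

text \<open>\<open>\<Phi> (u, v)\<close> divided by \<open>v\<close> tends to the normal, which is
  nonzero. The same number is slope of the bound and width of the strip, the form in which
  \<open>near_axis\<close> delivers it.\<close>

lemma radial_bound:
  obtains c where "0 < c" "c \<le> R" "\<And>u v. 0 < v \<Longrightarrow> v < c \<Longrightarrow> c * v \<le> norm (\<Phi> (u, v))"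
proof (rule near_axis[OF R, of "\<lambda>u v c. 0 < v \<longrightarrow> c * v \<le> norm (\<Phi> (u, v))"])
  show "(0 < v \<longrightarrow> c * v \<le> norm (\<Phi> (u + 2 * pi, v))) = (0 < v \<longrightarrow> c * v \<le> norm (\<Phi> (u, v)))" if "0 < v" "v < R" for u v c
    using periodic_xy(1)[of v u] that by simp
  show "0 < v \<longrightarrow> \<delta>' * v \<le> norm (\<Phi> (u, v))" if "0 < v \<longrightarrow> \<delta> * v \<le> norm (\<Phi> (u, v))" "\<delta>' \<le> \<delta>" for u v \<delta> \<delta>'
    using that by (meson mult_right_mono less_imp_le order_trans)
  fix u0
  obtain g1 g2 r where g: "0 < r" "ext_at g1 (u0, 0)" "ext_at g2 (u0, 0)"
    "\<And>u v. (u, v) \<in> ball (u0, 0) r \<Longrightarrow> x (u, v) = v * g1 (u, v) \<and> y (u, v) = v * g2 (u, v)"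
    "\<And>u. dist u0 u < r \<Longrightarrow> g1 (u, 0) = D2 x (u, 0) \<and> g2 (u, 0) = D2 y (u, 0)"
    by (rule polar_quotient) blast
  define m where "m = norm (g1 (u0, 0), g2 (u0, 0)) / 2"
  have "(g1 (u0, 0), g2 (u0, 0)) \<noteq> (0, 0)" using g(5)[of u0] g(1) normal_nz[of u0] by simp
  then have "norm (g1 (u0, 0), g2 (u0, 0)) > 0" by (simp add: zero_prod_def)
  then have m: "0 < m" "norm (g1 (u0, 0), g2 (u0, 0)) \<in> {m<..}" by (auto simp: m_def)
  have "isCont (\<lambda>w. norm (g1 w, g2 w)) (u0, 0)"
    by (intro continuous_intros ext_at_isCont g)
  then obtain d where d: "0 < d" "\<And>u v. \<bar>u - u0\<bar> < d \<Longrightarrow> \<bar>v\<bar> < d \<Longrightarrow> norm (g1 (u, v), g2 (u, v)) \<in> {m<..}"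
    using isCont_box[where g="\<lambda>w. norm (g1 w, g2 w)", OF _ open_greaterThan m(2)] by blast
  define \<delta> where "\<delta> = Min {d, r / 2, m}"
  have \<delta>: "0 < \<delta>" "\<delta> \<le> d" "\<delta> \<le> r / 2" "\<delta> \<le> m" using d g m by (auto simp: \<delta>_def)
  have "\<delta> * v \<le> norm (\<Phi> (u, v))" if "\<bar>u - u0\<bar> < \<delta>" "0 < v" "v < \<delta>" for u v
  proof -
    have "x (u, v) = v * g1 (u, v) \<and> y (u, v) = v * g2 (u, v)"
      by (rule g(4), rule box_in_ball) (use that \<delta> in auto)
    then have "\<Phi> (u, v) = v *\<^sub>R (g1 (u, v), g2 (u, v))" by simp
    then have "norm (\<Phi> (u, v)) = v * norm (g1 (u, v), g2 (u, v))"
      using that by (simp only: norm_scaleR abs_of_pos)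
    moreover have "\<delta> \<le> norm (g1 (u, v), g2 (u, v))" using d(2)[of u v] that \<delta> by force
    ultimately show ?thesis using that by (simp add: mult.commute[of \<delta>])
  qed
  then show "\<exists>\<delta>>0. \<forall>u v. \<bar>u - u0\<bar> < \<delta> \<longrightarrow> 0 < v \<longrightarrow> v < \<delta> \<longrightarrow> v < R \<longrightarrow> 0 < v \<longrightarrow> \<delta> * v \<le> norm (\<Phi> (u, v))"
    using \<delta>(1) by blast
qed (use that in auto)

text \<open>In the chart (radial part, slope) adapted to the direction \<open>n\<close> the map \<open>\<Phi>\<close> stays regular on the axis.\<close>

lemma local_injectivity:
  obtains \<delta> where "0 < \<delta>"
    "\<And>u v u' v'. \<bar>u - u0\<bar> < \<delta> \<Longrightarrow> \<bar>u' - u0\<bar> < \<delta> \<Longrightarrow> 0 < v \<Longrightarrow> v < \<delta> \<Longrightarrow> 0 < v' \<Longrightarrow> v' < \<delta> \<Longrightarrow>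
      \<Phi> (u, v) = \<Phi> (u', v') \<Longrightarrow> u = u' \<and> v = v'"
proof -
  obtain g1 g2 r where g: "0 < r" "ext_at g1 (u0, 0)" "ext_at g2 (u0, 0)"
    "\<And>u v. (u, v) \<in> ball (u0, 0) r \<Longrightarrow> x (u, v) = v * g1 (u, v) \<and> y (u, v) = v * g2 (u, v)"
    "\<And>u. dist u0 u < r \<Longrightarrow> g1 (u, 0) = D2 x (u, 0) \<and> g2 (u, 0) = D2 y (u, 0)"
    by (rule polar_quotient) blast
  define n1 n2 where "n1 = D2 x (u0, 0)" and "n2 = D2 y (u0, 0)"
  have gn: "g1 (u0, 0) = n1" "g2 (u0, 0) = n2" using g(1,5) by (auto simp: n1_def n2_def)
  have n: "0 < n1 * n1 + n2 * n2"
    using normal_nz[of u0] by (auto simp: n1_def n2_def sum_squares_gt_zero_iff)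
  define den num where "den w = g1 w * n1 + g2 w * n2" and "num w = g2 w * n1 - g1 w * n2" for w
  have ed: "ext_at den (u0, 0)" "ext_at num (u0, 0)"
    unfolding den_def[abs_def] num_def[abs_def] by (intro ext_at_add ext_at_diff ext_at_mult ext_at_const g)+
  have d0: "den (u0, 0) \<noteq> 0" "num (u0, 0) = 0" using n by (auto simp: den_def num_def gn)
  note ei = ext_at_inverse[OF ed(1) d0(1)]
  \<comment> \<open>\<open>M1\<close> is, up to the length of \<open>n\<close>, the component of
    \<open>\<Phi>\<close> along \<open>n\<close>; \<open>M2\<close> is the ratio of the orthogonal
    to the parallel component, analytic at \<open>v = 0\<close> because the common factor
    \<open>v\<close> is cancelled.\<close>
  define M1 M2 where "M1 w = x w * n1 + y w * n2" and "M2 w = num w * inverse (den w)" for w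
  note e = ext[OF axis[of u0]]
  have eM: "ext_at M1 (u0, 0)" "ext_at M2 (u0, 0)"
    unfolding M1_def[abs_def] M2_def[abs_def] by (intro ext_at_add ext_at_mult ext_at_const ei ed e)+
  have Dg: "D1 g1 (u0, 0) = D1 (D2 x) (u0, 0)" "D1 g2 (u0, 0) = D1 (D2 y) (u0, 0)"
  proof -
    have "((\<lambda>s. g1 (s, 0)) has_real_derivative D1 (D2 x) (u0, 0)) (at u0)"
      by (rule has_field_derivative_transform_within_open[OF D_line(1)[OF ext_at_D(2)[OF e(1)]] open_ball[of u0 r]])
         (use g in auto)
    then show "D1 g1 (u0, 0) = D1 (D2 x) (u0, 0)" by (rule DERIV_unique[OF D_line(1)[OF g(2)]])
    have "((\<lambda>s. g2 (s, 0)) has_real_derivative D1 (D2 y) (u0, 0)) (at u0)"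
      by (rule has_field_derivative_transform_within_open[OF D_line(1)[OF ext_at_D(2)[OF e(2)]] open_ball[of u0 r]])
         (use g in auto)
    then show "D1 g2 (u0, 0) = D1 (D2 y) (u0, 0)" by (rule DERIV_unique[OF D_line(1)[OF g(3)]])
  qed
  have "D1 M1 (u0, 0) = 0" "D2 M1 (u0, 0) = n1 * n1 + n2 * n2"
    unfolding M1_def[abs_def]
    by (simp_all add: D_add D_mult ext_at_mult ext_at_const e D_const D1_xy n1_def n2_def)
  moreover have "D1 M2 (u0, 0) = (D1 (D2 y) (u0, 0) * n1 - D1 (D2 x) (u0, 0) * n2) / (n1 * n1 + n2 * n2)"
  proof -
    have "D1 M2 (u0, 0) = D1 num (u0, 0) * inverse (den (u0, 0))"
      unfolding M2_def[abs_def] by (simp add: D_mult ei ed d0)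
    moreover have "D1 num (u0, 0) = D1 (D2 y) (u0, 0) * n1 - D1 (D2 x) (u0, 0) * n2"
      unfolding num_def[abs_def] by (simp add: D_diff D_mult ext_at_mult ext_at_const g D_const Dg)
    ultimately show ?thesis by (simp add: den_def gn divide_inverse)
  qed
  ultimately have "D1 M1 (u0, 0) * D2 M2 (u0, 0) - D2 M1 (u0, 0) * D1 M2 (u0, 0) =
      D1 (D2 x) (u0, 0) * n2 - D1 (D2 y) (u0, 0) * n1"
    using n by simp
  \<comment> \<open>The Jacobian of the chart map equals the \<open>v\<close>-derivative of
    \<open>jac\<close>, already known to be positive on the axis.\<close>
  then have "D1 M1 (u0, 0) * D2 M2 (u0, 0) - D2 M1 (u0, 0) * D1 M2 (u0, 0) \<noteq> 0"
    using D2_jac[of u0] by (simp add: n1_def n2_def mult.commute)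
  from local_inverse[OF eM this open_UNIV UNIV_I]
  obtain V V' g where V: "open V" "(u0, 0) \<in> V" "homeomorphism V V' (\<lambda>w. (M1 w, M2 w)) g" by blast
  then obtain s where s: "0 < s" "ball (u0, 0) s \<subseteq> V" using open_contains_ball by blast
  define \<delta> where "\<delta> = min (r / 2) (s / 2)"
  \<comment> \<open>For \<open>v > 0\<close> the slope depends on the image point alone, so equal
    images have equal \<open>(M1, M2)\<close>.\<close>
  have M2_eq: "M2 (u, v) = (y (u, v) * n1 - x (u, v) * n2) * inverse (x (u, v) * n1 + y (u, v) * n2)"
    if "\<bar>u - u0\<bar> < \<delta>" "0 < v" "v < \<delta>" for u v
  proof -
    have "x (u, v) = v * g1 (u, v) \<and> y (u, v) = v * g2 (u, v)"
      by (rule g(4), rule box_in_ball) (use that in \<open>auto simp: \<delta>_def\<close>)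
    then have "y (u, v) * n1 - x (u, v) * n2 = v * num (u, v)" "x (u, v) * n1 + y (u, v) * n2 = v * den (u, v)"
      by (simp_all add: num_def den_def algebra_simps)
    then show ?thesis using that by (simp add: M2_def)
  qed
  show thesis
  proof (rule that[of \<delta>])
    show "0 < \<delta>" using g s by (simp add: \<delta>_def)
    fix u v u' v' assume a: "\<bar>u - u0\<bar> < \<delta>" "\<bar>u' - u0\<bar> < \<delta>" "0 < v" "v < \<delta>" "0 < v'" "v' < \<delta>"
      and eq: "\<Phi> (u, v) = \<Phi> (u', v')"
    have "(M1 (u, v), M2 (u, v)) = (M1 (u', v'), M2 (u', v'))"
      using M2_eq[of u v] M2_eq[of u' v'] a eq by (simp add: M1_def)
    moreover have "(u, v) \<in> V" "(u', v') \<in> V"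
      using box_in_ball[of u u0 s v] box_in_ball[of u' u0 s v'] a s by (auto simp: \<delta>_def)
    ultimately have "(u, v) = (u', v')" using V(3) unfolding homeomorphism_def by metis
    then show "u = u' \<and> v = v'" by simp
  qed
qed

text \<open>Normal and tangent correspond under a right-angle rotation and a positive factor, so
  codirectional normals mean codirectional tangents and \<open>tangent_angle\<close>
  applies.\<close>

lemma normal_parallel:
  assumes "D2 x (u1, 0) = l * D2 x (u2, 0)" "D2 y (u1, 0) = l * D2 y (u2, 0)" "0 < l"
  shows "\<exists>k::int. u1 = u2 + 2 * pi * k"
proof -
  define f where "f u = Complex (fst (\<gamma> u)) (snd (\<gamma> u))" for u
  define f1 where "f1 u = Complex (D1 p (u, 0)) (D1 q (u, 0))" for u
  define f2 where "f2 u = Complex (D1 (D1 p) (u, 0)) (D1 (D1 q) (u, 0))" for u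
  obtain S1 where S1: "0 < S1" "D1 p (u1, 0) = S1 * D2 y (u1, 0)" "D1 q (u1, 0) = - S1 * D2 x (u1, 0)"
    by (rule normal_direction)
  obtain S2 where S2: "0 < S2" "D1 p (u2, 0) = S2 * D2 y (u2, 0)" "D1 q (u2, 0) = - S2 * D2 x (u2, 0)"
    by (rule normal_direction)
  have cx: "((\<lambda>u. Complex (a u) (b u)) has_vector_derivative Complex a' b') (at u)"
    if "(a has_real_derivative a') (at u)" "(b has_real_derivative b') (at u)" for a b a' b' u
    using that by (simp add: has_vector_derivative_complex_iff)
  show ?thesis
  proof (rule tangent_angle[of f f1 f2 u1 "S1 * l / S2" u2])
    show "(f has_vector_derivative f1 u) (at u)" for u
      unfolding f_def[abs_def] f1_def by (rule cx) (rule gamma_derivs)+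
    show "(f1 has_vector_derivative f2 u) (at u)" for u
      unfolding f1_def[abs_def] f2_def by (rule cx) (rule gamma_derivs)+
    show "f (u + 2 * pi) = f u" for u using jordan by (simp add: f_def neg_convex_Jordan_def)
    show "inj_on f {0..<2 * pi}"
      using jordan by (auto simp: f_def neg_convex_Jordan_def inj_on_def prod_eq_iff)
    show "f1 u \<noteq> 0" for u using gamma_derivs(6)[of u] by (auto simp: f1_def complex_eq_iff)
    show "Im (f2 u * cnj (f1 u)) < 0" for u
      using gamma_derivs(5)[of u] by (simp add: f1_def f2_def algebra_simps)
    show "f1 u1 = complex_of_real (S1 * l / S2) * f1 u2"
    proof -
      have "S2 \<noteq> 0" using S2(1) by simp
      then show ?thesis by (simp add: f1_def complex_eq_iff S1(2,3) S2(2,3) assms)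
    qed
    show "0 < S1 * l / S2" using S1 S2 assms by simp
  qed
qed

text \<open>Compactness over pairs of angles. Near a pair congruent modulo \<open>2 * pi\<close>, a
  shift reduces to \<open>local_injectivity\<close>. Near any other pair the normals have different
  directions, hence so do the nearby quotients of \<open>\<Phi>\<close> by \<open>v\<close>, and no
  image can be common.\<close>

lemma injectivity:
  obtains \<delta> where "0 < \<delta>" "\<delta> \<le> R" "\<And>u v u' v'. 0 < v \<Longrightarrow> v < \<delta> \<Longrightarrow> 0 < v' \<Longrightarrow> v' < \<delta> \<Longrightarrow>
      \<Phi> (u, v) = \<Phi> (u', v') \<Longrightarrow> v = v' \<and> (\<exists>k::int. u = u' + 2 * pi * k)"
proof -
  define P where "P a \<delta> \<longleftrightarrow> (\<forall>v v'. 0 < v \<longrightarrow> v < \<delta> \<longrightarrow> v < R \<longrightarrow> 0 < v' \<longrightarrow> v' < \<delta> \<longrightarrow> v' < R \<longrightarrow>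
      \<Phi> (fst a, v) = \<Phi> (snd a, v') \<longrightarrow> v = v' \<and> (\<exists>k::int. fst a = snd a + 2 * pi * k))" for a \<delta>
  have "\<exists>\<delta>>0. \<forall>a\<in>{0..2 * pi} \<times> {0..2 * pi}. P a \<delta>"
  proof (rule compact_uniform)
    show "compact ({0..2 * pi} \<times> {0..2 * pi})" by (intro compact_Times compact_Icc)
    show "P a \<delta>'" if "P a \<delta>" "\<delta>' \<le> \<delta>" for a \<delta> \<delta>'
      using that unfolding P_def by (meson order_less_le_trans)
    fix a :: "real \<times> real"
    obtain u0 u0' where a: "a = (u0, u0')" by (cases a)
    show "\<exists>\<delta>>0. \<forall>b. dist a b < \<delta> \<longrightarrow> P b \<delta>"
    proof (cases "\<exists>k::int. u0 = u0' + 2 * pi * k")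
      case True
      then obtain k :: int where k: "u0 = u0' + 2 * pi * k" by blast
      obtain \<delta> where \<delta>: "0 < \<delta>"
        "\<And>u v u' v'. \<bar>u - u0\<bar> < \<delta> \<Longrightarrow> \<bar>u' - u0\<bar> < \<delta> \<Longrightarrow> 0 < v \<Longrightarrow> v < \<delta> \<Longrightarrow> 0 < v' \<Longrightarrow> v' < \<delta> \<Longrightarrow>
          \<Phi> (u, v) = \<Phi> (u', v') \<Longrightarrow> u = u' \<and> v = v'"
        by (rule local_injectivity) blast
      have "P b \<delta>" if b: "dist a b < \<delta>" for b
        unfolding P_def
      proof (intro allI impI)
        fix v v' assume v: "0 < v" "v < \<delta>" "v < R" "0 < v'" "v' < \<delta>" "v' < R" and eq: "\<Phi> (fst b, v) = \<Phi> (snd b, v')"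
        have "\<bar>fst b - u0\<bar> < \<delta>" "\<bar>snd b - u0'\<bar> < \<delta>"
          using b dist_fst_le[of a b] dist_snd_le[of a b] by (auto simp: a dist_real_def)
        moreover have "\<Phi> (snd b + 2 * pi * k, v') = \<Phi> (snd b, v')" using periodic_xy(2)[of v' "snd b" k] v by simp
        ultimately have "fst b = snd b + 2 * pi * k \<and> v = v'"
          using v eq by (intro \<delta>(2)) (auto simp: k)
        then show "v = v' \<and> (\<exists>k::int. fst b = snd b + 2 * pi * k)" by blast
      qed
      then show ?thesis using \<delta>(1) by blast
    next
      case False
      obtain g1 g2 r where g: "0 < r" "ext_at g1 (u0, 0)" "ext_at g2 (u0, 0)"
        "\<And>u v. (u, v) \<in> ball (u0, 0) r \<Longrightarrow> x (u, v) = v * g1 (u, v) \<and> y (u, v) = v * g2 (u, v)"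
        "\<And>u. dist u0 u < r \<Longrightarrow> g1 (u, 0) = D2 x (u, 0) \<and> g2 (u, 0) = D2 y (u, 0)"
        by (rule polar_quotient) blast
      obtain h1 h2 r' where h: "0 < r'" "ext_at h1 (u0', 0)" "ext_at h2 (u0', 0)"
        "\<And>u v. (u, v) \<in> ball (u0', 0) r' \<Longrightarrow> x (u, v) = v * h1 (u, v) \<and> y (u, v) = v * h2 (u, v)"
        "\<And>u. dist u0' u < r' \<Longrightarrow> h1 (u, 0) = D2 x (u, 0) \<and> h2 (u, 0) = D2 y (u, 0)"
        by (rule polar_quotient) blast
      \<comment> \<open>Different directions expressed as an open condition on a pair of vectors:
        independent, or at an obtuse angle.\<close>
      define T where "T = {w :: (real \<times> real) \<times> (real \<times> real).
        fst (fst w) * snd (snd w) - snd (fst w) * fst (snd w) \<noteq> 0 \<or> fst (fst w) * fst (snd w) + snd (fst w) * snd (snd w) < 0}"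
      have T: "open T" unfolding T_def
        by (intro open_Collect_disj open_Collect_neq open_Collect_less continuous_intros)
      define N N' where "N = (g1 (u0, 0), g2 (u0, 0))" and "N' = (h1 (u0', 0), h2 (u0', 0))"
      have "(N, N') \<in> T"
      proof (rule ccontr)
        assume "(N, N') \<notin> T"
        then have "D2 x (u0, 0) * D2 y (u0', 0) = D2 y (u0, 0) * D2 x (u0', 0)"
          "0 \<le> D2 x (u0, 0) * D2 x (u0', 0) + D2 y (u0, 0) * D2 y (u0', 0)"
          using g(1,5) h(1,5) by (auto simp: T_def N_def N'_def)
        from parallel_vectors[OF this normal_nz normal_nz]
        obtain l where "0 < l" "D2 x (u0, 0) = l * D2 x (u0', 0)" "D2 y (u0, 0) = l * D2 y (u0', 0)" by blast
        then show False using normal_parallel False by blast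
      qed
      then obtain s where s: "0 < s" "ball (N, N') s \<subseteq> T" using T open_contains_ball by blast
      have c1: "isCont (\<lambda>w. (g1 w, g2 w)) (u0, 0)" "isCont (\<lambda>w. (h1 w, h2 w)) (u0', 0)"
        by (intro continuous_intros ext_at_isCont g h)+
      obtain d where d: "0 < d" "\<And>u v. \<bar>u - u0\<bar> < d \<Longrightarrow> \<bar>v\<bar> < d \<Longrightarrow> (g1 (u, v), g2 (u, v)) \<in> ball N (s / 2)"
        using isCont_box[OF c1(1) open_ball, of N "s / 2"] s by (auto simp: N_def)
      obtain d' where d': "0 < d'" "\<And>u v. \<bar>u - u0'\<bar> < d' \<Longrightarrow> \<bar>v\<bar> < d' \<Longrightarrow> (h1 (u, v), h2 (u, v)) \<in> ball N' (s / 2)"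
        using isCont_box[OF c1(2) open_ball, of N' "s / 2"] s by (auto simp: N'_def)
      define \<delta> where "\<delta> = Min {d, d', r / 2, r' / 2}"
      have \<delta>: "0 < \<delta>" "\<delta> \<le> d" "\<delta> \<le> d'" "\<delta> \<le> r / 2" "\<delta> \<le> r' / 2" using d d' g h by (auto simp: \<delta>_def)
      have "P b \<delta>" if b: "dist a b < \<delta>" for b
        unfolding P_def
      proof (intro allI impI)
        fix v v' assume v: "0 < v" "v < \<delta>" "v < R" "0 < v'" "v' < \<delta>" "v' < R" and eq: "\<Phi> (fst b, v) = \<Phi> (snd b, v')"
        have bb: "\<bar>fst b - u0\<bar> < \<delta>" "\<bar>snd b - u0'\<bar> < \<delta>"
          using b dist_fst_le[of a b] dist_snd_le[of a b] by (auto simp: a dist_real_def)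
        define G1 G2 H1 H2 where "G1 = g1 (fst b, v)" and "G2 = g2 (fst b, v)" and "H1 = h1 (snd b, v')" and "H2 = h2 (snd b, v')"
        have "x (fst b, v) = v * G1 \<and> y (fst b, v) = v * G2"
          unfolding G1_def G2_def by (rule g(4), rule box_in_ball) (use bb \<delta> v in auto)
        moreover have "x (snd b, v') = v' * H1 \<and> y (snd b, v') = v' * H2"
          unfolding H1_def H2_def by (rule h(4), rule box_in_ball) (use bb \<delta> v in auto)
        ultimately have e: "v * G1 = v' * H1" "v * G2 = v' * H2" using eq by auto
        have "dist (N, N') ((G1, G2), (H1, H2)) \<le> dist N (G1, G2) + dist N' (H1, H2)"
          unfolding dist_norm diff_Pair by (rule norm_Pair_le)
        also have "\<dots> < s" using d(2)[of "fst b" v] d'(2)[of "snd b" v'] bb v \<delta>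
          by (simp add: G1_def G2_def H1_def H2_def)
        finally have "((G1, G2), (H1, H2)) \<in> T" using s by auto
        moreover have "v * (G1 * H2 - G2 * H1) = 0" "v * (G1 * H1 + G2 * H2) = v' * (H1 * H1 + H2 * H2)"
          using e by algebra+
        moreover have "0 \<le> v' * (H1 * H1 + H2 * H2)" using v by simp
        ultimately have "G1 * H2 - G2 * H1 = 0 \<and> 0 \<le> v * (G1 * H1 + G2 * H2)" "((G1, G2), (H1, H2)) \<in> T"
          using v by auto
        then have False using v(1) by (auto simp: T_def mult_less_0_iff not_less[symmetric])
        then show "v = v' \<and> (\<exists>k::int. fst b = snd b + 2 * pi * k)" ..
      qed
      then show ?thesis using \<delta>(1) by blast
    qed
  qed
  then obtain \<delta> where \<delta>: "0 < \<delta>" "\<And>a. a \<in> {0..2 * pi} \<times> {0..2 * pi} \<Longrightarrow> P a \<delta>" by blast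
  show thesis
  proof (rule that[of "min \<delta> R"])
    fix u v u' v' assume v: "0 < v" "v < min \<delta> R" "0 < v'" "v' < min \<delta> R" and eq: "\<Phi> (u, v) = \<Phi> (u', v')"
    obtain s where s: "s \<in> {0..<2 * pi}" "\<Phi> (s, v) = \<Phi> (u, v)" "\<exists>k::int. u = s + 2 * pi * k"
      by (rule periodic_reduce[where f="\<lambda>s. \<Phi> (s, v)" and u=u]) (use periodic_xy(1)[of v] v in auto)
    obtain s' where s': "s' \<in> {0..<2 * pi}" "\<Phi> (s', v') = \<Phi> (u', v')" "\<exists>k::int. u' = s' + 2 * pi * k"
      by (rule periodic_reduce[where f="\<lambda>s. \<Phi> (s, v')" and u=u']) (use periodic_xy(1)[of v'] v in auto)
    obtain j j' :: int where j: "u = s + 2 * pi * j" "u' = s' + 2 * pi * j'" using s(3) s'(3) by blast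
    have "P (s, s') \<delta>" by (rule \<delta>(2)) (use s s' in auto)
    then have "v = v' \<and> (\<exists>k::int. s = s' + 2 * pi * k)" using v eq s(2) s'(2) by (simp add: P_def)
    then obtain k :: int where "v = v'" "s = s' + 2 * pi * k" by blast
    then show "v = v' \<and> (\<exists>k::int. u = u' + 2 * pi * k)"
      using j by (auto intro!: exI[of _ "j - j' + k"] simp: algebra_simps)
  qed (use \<delta> R in auto)
qed

section \<open>Passage to the puncture\<close>

lemma near_axis_limit:
  assumes h: "\<And>w. w \<in> Strip_hat R \<Longrightarrow> isCont h w" and per: "\<And>u v. \<bar>v\<bar> < R \<Longrightarrow> h (u + 2 * pi, v) = h (u, v)"
    and e: "0 < e"
  shows "\<exists>\<delta>>0. \<forall>u v. 0 < v \<longrightarrow> v < \<delta> \<longrightarrow> dist (h (u, v)) (h (u, 0)) < e"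
proof (rule near_axis[OF R, of "\<lambda>u v _. dist (h (u, v)) (h (u, 0)) < e"])
  show "(dist (h (u + 2 * pi, v)) (h (u + 2 * pi, 0)) < e) = (dist (h (u, v)) (h (u, 0)) < e)" if "0 < v" "v < R" for u v
    using per[of v u] per[of 0 u] that by simp
  fix u0
  obtain d where d: "0 < d" "\<And>u v. \<bar>u - u0\<bar> < d \<Longrightarrow> \<bar>v\<bar> < d \<Longrightarrow> h (u, v) \<in> ball (h (u0, 0)) (e / 2)"
    using isCont_box[OF h[OF axis] open_ball, of u0 "h (u0, 0)" "e / 2"] e by auto
  have "dist (h (u, v)) (h (u, 0)) < e" if "\<bar>u - u0\<bar> < d" "0 < v" "v < d" for u v
    using d(2)[of u v] d(2)[of u 0] that d(1) dist_triangle_half_r[of "h (u0, 0)" "h (u, v)" e "h (u, 0)"] by auto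
  then show "\<exists>\<delta>>0. \<forall>u v. \<bar>u - u0\<bar> < \<delta> \<longrightarrow> 0 < v \<longrightarrow> v < \<delta> \<longrightarrow> v < R \<longrightarrow> dist (h (u, v)) (h (u, 0)) < e"
    using d(1) by blast
qed auto

text \<open>Everything is drawn from three facts on the annulus, positive Jacobian, radial bound and
  injectivity modulo the period, which persist on thinner annuli. The radial bound is what converts
  closeness to the origin into small \<open>v\<close>.\<close>

lemma cone_singularity:
  assumes r: "0 < r" "r \<le> R"
    and jac: "\<And>u v. 0 < v \<Longrightarrow> v < r \<Longrightarrow> jac (u, v) > 0"
    and c: "0 < c" "\<And>u v. 0 < v \<Longrightarrow> v < r \<Longrightarrow> c * v \<le> norm (\<Phi> (u, v))"
    and inj: "\<And>u v u' v'. 0 < v \<Longrightarrow> v < r \<Longrightarrow> 0 < v' \<Longrightarrow> v' < r \<Longrightarrow>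
      \<Phi> (u, v) = \<Phi> (u', v') \<Longrightarrow> v = v' \<and> (\<exists>k::int. u = u' + 2 * pi * k)"
  shows "\<exists>W \<zeta>. punctured_nhd W \<and> (\<lambda>w. (x w, y w, z w)) ` Strip r = graph_over W \<zeta> \<and>
    MA_solution U A B C E W \<zeta> \<and> isolated_sing W \<zeta> \<and> limit_gradient W \<zeta> = range \<gamma> \<and>
    (\<forall>w\<in>W. C (jet1 \<zeta> w) + D1 (D1 \<zeta>) w > 0)"
proof -
  define W where "W = \<Phi> ` Strip r"
  \<comment> \<open>Any preimage will do: two of them differ by a multiple of the period in
    \<open>u\<close>, and \<open>z\<close> is periodic.\<close>
  define \<zeta> where "\<zeta> b = z (SOME w. w \<in> Strip r \<and> \<Phi> w = b)" for b
  have sub: "Strip r \<subseteq> Strip_hat R" using r by (auto simp: Strip_def Strip_hat_def)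
  have opS: "open (Strip r)"
    unfolding Strip_def case_prod_unfold by (intro open_Collect_conj open_Collect_less continuous_intros)
  have Si: "(u, v) \<in> Strip r \<longleftrightarrow> 0 < v \<and> v < r" for u v by (simp add: Strip_def)
  have \<zeta>: "\<zeta> (\<Phi> w) = z w" if w: "w \<in> Strip r" for w
  proof -
    define w' where "w' = (SOME w'. w' \<in> Strip r \<and> \<Phi> w' = \<Phi> w)"
    have w': "w' \<in> Strip r \<and> \<Phi> w' = \<Phi> w"
      unfolding w'_def by (rule someI[of _ w]) (use w in simp)
    obtain u v u' v' where uv: "w = (u, v)" "w' = (u', v')" by (cases w, cases w')
    have v: "0 < v" "v < r" "0 < v'" "v' < r" using w w' uv by (auto simp: Si)
    obtain k :: int where "v' = v" "u' = u + 2 * pi * k"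
      using inj[OF v(3,4,1,2), of u' u] w' uv by auto
    then have "z w' = z w" using periodic_xy(3)[of v u k] uv v r by simp
    then show ?thesis by (simp add: \<zeta>_def w'_def)
  qed
  have jS: "jac w > 0" if "w \<in> Strip r" for w using jac that by (cases w) (auto simp: Si)
  have lg: "open W" "\<And>b. b \<in> W \<Longrightarrow> ext_at \<zeta> b"
    "\<And>w. w \<in> Strip r \<Longrightarrow> grad \<zeta> (\<Phi> w) = (p w, q w)" "MA_solution U A B C E W \<zeta>"
    "\<forall>w\<in>W. C (jet1 \<zeta> w) + D1 (D1 \<zeta>) w > 0"
    unfolding W_def by (rule local_graph[OF opS sub jS \<zeta>]; assumption)+
  have W_pos: "\<Phi> (u, v) \<in> W \<and> c * v \<le> norm (\<Phi> (u, v))" if "0 < v" "v < r" for u v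
    using c(2)[OF that] that by (auto simp: W_def Si intro!: imageI)
  have WE: "\<exists>u v. 0 < v \<and> v < r \<and> b = \<Phi> (u, v)" if b: "b \<in> W" for b
  proof -
    obtain w where "w \<in> Strip r" "b = \<Phi> w" using b by (auto simp: W_def)
    then show ?thesis by (cases w) (auto simp: Si)
  qed
  have W0: "(0, 0) \<notin> W"
  proof
    assume "(0, 0) \<in> W"
    then obtain u v where v: "0 < v" "v < r" "(0, 0) = \<Phi> (u, v)" using WE by blast
    then have "c * v \<le> 0" using W_pos[OF v(1,2), of u] by (simp flip: zero_prod_def)
    then show False using v c(1) by (simp add: mult_le_0_iff)
  qed
  have contXY: "isCont x w" "isCont y w" "isCont z w" "isCont p w" "isCont q w" if "w \<in> Strip_hat R" for w
    using ext[OF that] by (auto intro: ext_at_isCont)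
  have \<Phi>_axis: "(\<lambda>v. \<Phi> (u, v)) \<midarrow>0\<rightarrow> (0, 0)" for u
  proof -
    have "isCont (\<lambda>v. (u, v)) (0::real)" by (intro continuous_intros)
    then have "isCont (\<lambda>v. \<Phi> (u, v)) 0"
      using isCont_o2[where f="\<lambda>v. (u, v)" and g=x, OF _ contXY(1)[OF axis]]
        isCont_o2[where f="\<lambda>v. (u, v)" and g=y, OF _ contXY(2)[OF axis]] by (intro continuous_Pair) auto
    then show ?thesis by (simp add: isCont_def init')
  qed
  \<comment> \<open>A clopen argument in the connected punctured disc: the image is open by
    \<open>local_graph\<close>, and within the disc it coincides with the image of a compact
    rectangle, hence is relatively closed.\<close>
  have ball_sub: "ball (0, 0) (c * (r / 2)) - {(0, 0)} \<subseteq> W"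
  proof -
    define Bp where "Bp = ball (0::real \<times> real) (c * (r / 2)) - {0}"
    have conB: "connected Bp" unfolding Bp_def by (rule connected_punctured_ball) simp
    \<comment> \<open>By the radial bound, points with \<open>v \<ge> r / 2\<close> land outside of
      the disc of radius \<open>c * (r / 2)\<close>. The axis is included for compactness and
      contributes only the origin.\<close>
    define K where "K = \<Phi> ` ({0..2 * pi} \<times> {0..r / 2})"
    have "compact K" unfolding K_def
    proof (rule compact_continuous_image)
      show "continuous_on ({0..2 * pi} \<times> {0..r / 2}) \<Phi>"
        by (intro continuous_at_imp_continuous_on ballI continuous_Pair contXY) (use r in \<open>auto simp: strip_iff\<close>)
    qed (intro compact_Times compact_Icc)
    then have closedK: "closed K" by (rule compact_imp_closed)
    have eq: "Bp \<inter> W = Bp \<inter> K"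
    proof (intro equalityI subsetI)
      fix b assume b: "b \<in> Bp \<inter> W"
      then obtain u v where v: "0 < v" "v < r" "b = \<Phi> (u, v)" using WE by blast
      have "norm b < c * (r / 2)" using b by (simp add: Bp_def)
      then have "c * v < c * (r / 2)" using W_pos[OF v(1,2), of u] v(3) by simp
      then have v2: "v < r / 2" using c(1) by simp
      obtain s where s: "s \<in> {0..<2 * pi}" "\<Phi> (s, v) = \<Phi> (u, v)"
        by (rule periodic_reduce[where f="\<lambda>s. \<Phi> (s, v)" and u=u]) (use periodic_xy(1)[of v] v r in auto)
      then have "b = \<Phi> (s, v)" "(s, v) \<in> {0..2 * pi} \<times> {0..r / 2}" using v v2 by auto
      then show "b \<in> Bp \<inter> K" using b unfolding K_def by blast
    next
      fix b assume b: "b \<in> Bp \<inter> K"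
      then obtain u v where v: "0 \<le> v" "v \<le> r / 2" "b = \<Phi> (u, v)" by (auto simp: K_def)
      have "v \<noteq> 0" using b v(3) init' by (auto simp: Bp_def zero_prod_def)
      then show "b \<in> Bp \<inter> W" using b v r W_pos[of v u] by auto
    qed
    have "openin (top_of_set Bp) (Bp \<inter> W)" using lg(1) by (rule openin_open_Int)
    moreover have "closedin (top_of_set Bp) (Bp \<inter> W)" unfolding eq using closedK by (rule closedin_closed_Int)
    moreover have "Bp \<inter> W \<noteq> {}"
    proof -
      have "0 < c * (r / 2)" using c r by simp
      then have "\<forall>\<^sub>F v in at 0. dist (\<Phi> (0, v)) (0, 0) < c * (r / 2)"
        using \<Phi>_axis[of 0] tendstoD by blast
      then obtain d where d: "0 < d" "\<And>v. v \<noteq> 0 \<Longrightarrow> dist v 0 < d \<Longrightarrow> dist (\<Phi> (0, v)) (0, 0) < c * (r / 2)"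
        unfolding eventually_at by blast
      define v where "v = min (d / 2) (r / 2)"
      have v: "0 < v" "v < d" "v < r" using d r by (auto simp: v_def)
      have "\<Phi> (0, v) \<in> W" using W_pos v by blast
      moreover have "dist (0, 0) (\<Phi> (0, v)) < c * (r / 2)"
        unfolding dist_commute[of "(0, 0)"] by (rule d(2)) (use v in auto)
      ultimately have "\<Phi> (0, v) \<in> Bp" "\<Phi> (0, v) \<in> W"
        using W0 unfolding Bp_def zero_prod_def mem_ball Diff_iff by auto
      then show ?thesis by blast
    qed
    ultimately have "Bp \<inter> W = Bp" using conB unfolding connected_clopen by blast
    then show ?thesis unfolding Bp_def zero_prod_def by blast
  qed
  have punct: "punctured_nhd W"
  proof -
    have "insert (0, 0) W = W \<union> ball (0, 0) (c * (r / 2))" using ball_sub c r by auto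
    then have "open (insert (0, 0) W)" using lg(1) by (metis open_Un open_ball)
    then show ?thesis using W0 by (simp add: punctured_nhd_def)
  qed
  have gr: "(\<lambda>w. (x w, y w, z w)) ` Strip r = graph_over W \<zeta>"
    using \<zeta> by (force simp: graph_over_def W_def image_iff)
  have grad: "grad \<zeta> (\<Phi> (u, v)) = (p (u, v), q (u, v))" if "0 < v" "v < r" for u v
  proof -
    have "(u, v) \<in> Strip r" using Si[of u v] that by blast
    then show ?thesis by (rule lg(3))
  qed
  have pqc: "isCont (\<lambda>w. (p w, q w)) w" if "w \<in> Strip_hat R" for w
    using contXY that by (intro continuous_Pair) auto
  have pqp: "(p (u + 2 * pi, v), q (u + 2 * pi, v)) = (p (u, v), q (u, v))" if "\<bar>v\<bar> < R" for u v
    by (rule periodic_xy(4)[OF that])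
  have range_closed: "closed (range \<gamma>)"
  proof -
    have "range \<gamma> = (\<lambda>u. (p (u, 0), q (u, 0))) ` {0..2 * pi}"
    proof (intro equalityI subsetI)
      fix \<xi> assume "\<xi> \<in> range \<gamma>"
      then obtain u where u: "\<xi> = \<gamma> u" by blast
      obtain s where s: "s \<in> {0..<2 * pi}" "\<gamma> s = \<gamma> u"
        by (rule periodic_reduce[where f=\<gamma> and u=u]) (use jordan in \<open>auto simp: neg_convex_Jordan_def\<close>)
      then show "\<xi> \<in> (\<lambda>u. (p (u, 0), q (u, 0))) ` {0..2 * pi}" using u init'(4) by (intro image_eqI[of _ _ s]) auto
    qed (use init'(4) in auto)
    moreover have "compact ((\<lambda>u. (p (u, 0), q (u, 0))) ` {0..2 * pi})"
      by (intro compact_continuous_image compact_Icc continuous_at_imp_continuous_on ballI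
          isCont_o2[where g="\<lambda>w. (p w, q w)" and f="\<lambda>u. (u, 0)"] pqc axis continuous_intros)
    ultimately show ?thesis by (simp add: compact_imp_closed)
  qed
  \<comment> \<open>Points near the origin have small \<open>v\<close>, so their gradients are close
    to \<open>\<gamma> u\<close> uniformly in \<open>u\<close>; a limit lies in the closure of the
    curve, which is closed.\<close>
  have lim_sub: "limit_gradient W \<zeta> \<subseteq> range \<gamma>"
  proof
    fix \<xi> assume "\<xi> \<in> limit_gradient W \<zeta>"
    then obtain s where s: "\<And>n. s n \<in> W" "s \<longlonglongrightarrow> (0, 0)" "(\<lambda>n. grad \<zeta> (s n)) \<longlonglongrightarrow> \<xi>"
      by (auto simp: limit_gradient_def)
    have "\<exists>\<eta>\<in>range \<gamma>. dist \<eta> \<xi> < e" if e: "0 < e" for e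
    proof -
      have "\<exists>\<delta>>0. \<forall>u v. 0 < v \<longrightarrow> v < \<delta> \<longrightarrow> dist (p (u, v), q (u, v)) (p (u, 0), q (u, 0)) < e / 2"
        by (rule near_axis_limit[where h="\<lambda>w. (p w, q w)" and e="e / 2", OF pqc pqp]) (use e in auto)
      then obtain \<delta> where \<delta>: "0 < \<delta>" "\<And>u v. 0 < v \<Longrightarrow> v < \<delta> \<Longrightarrow> dist (p (u, v), q (u, v)) (p (u, 0), q (u, 0)) < e / 2"
        by blast
      have "\<forall>\<^sub>F n in sequentially. dist (s n) (0, 0) < c * \<delta>"
        by (rule tendstoD[OF s(2)]) (use c \<delta> in simp)
      moreover have "\<forall>\<^sub>F n in sequentially. dist (grad \<zeta> (s n)) \<xi> < e / 2"
        by (rule tendstoD[OF s(3)]) (use e in simp)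
      ultimately have "\<forall>\<^sub>F n in sequentially. dist (s n) (0, 0) < c * \<delta> \<and> dist (grad \<zeta> (s n)) \<xi> < e / 2"
        by eventually_elim simp
      then obtain n where n: "dist (s n) (0, 0) < c * \<delta>" "dist (grad \<zeta> (s n)) \<xi> < e / 2"
        by (auto simp: eventually_sequentially)
      obtain u v where v: "0 < v" "v < r" "s n = \<Phi> (u, v)" using WE[OF s(1)] by blast
      have "norm (s n) < c * \<delta>" using n(1) by (simp add: dist_norm flip: zero_prod_def)
      then have "c * v < c * \<delta>" using W_pos[OF v(1,2), of u] v(3) by simp
      then have "v < \<delta>" using c(1) by simp
      then have "dist (p (u, v), q (u, v)) (\<gamma> u) < e / 2" using \<delta>(2)[OF v(1), of u] init'(4)[of u] by simp
      moreover have "dist (p (u, v), q (u, v)) \<xi> < e / 2" using n(2) grad[OF v(1,2), of u] v(3) by simp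
      ultimately have "dist (\<gamma> u) \<xi> < e" using dist_triangle_half_r by blast
      then show ?thesis by blast
    qed
    then have "\<xi> \<in> closure (range \<gamma>)" by (simp add: closure_approachable)
    then show "\<xi> \<in> range \<gamma>" using range_closed by simp
  qed
  have lim_sup: "\<gamma> u \<in> limit_gradient W \<zeta>" for u
  proof -
    \<comment> \<open>The shift by \<open>2\<close> keeps \<open>t n\<close> strictly below
      \<open>r\<close> already at \<open>n = 0\<close>.\<close>
    define t where "t n = r / real (n + 2)" for n
    have t: "0 < t n" "t n < r" for n using r by (auto simp: t_def divide_less_eq)
    have t0: "t \<longlonglongrightarrow> 0"
      unfolding t_def[abs_def]
      by (rule LIMSEQ_ignore_initial_segment[of "\<lambda>n. r / real n" 0 2, OF lim_const_over_n])
    define s where "s n = \<Phi> (u, t n)" for n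
    have "t n \<noteq> 0" for n using t(1)[of n] by simp
    then have "filterlim t (at 0) sequentially"
      using t0 by (intro filterlim_atI always_eventually) auto
    then have "s \<longlonglongrightarrow> (0, 0)" unfolding s_def[abs_def] by (rule filterlim_compose[OF \<Phi>_axis])
    moreover have "(\<lambda>n. grad \<zeta> (s n)) \<longlonglongrightarrow> \<gamma> u"
    proof -
      have "(\<lambda>n. (u, t n)) \<longlonglongrightarrow> (u, 0)" by (intro tendsto_intros t0)
      from isCont_tendsto_compose[OF pqc[OF axis] this]
      have "(\<lambda>n. (p (u, t n), q (u, t n))) \<longlonglongrightarrow> \<gamma> u" unfolding init'(4) .
      then show ?thesis using grad[OF t] by (simp add: s_def)
    qed
    moreover have "s n \<in> W" for n using W_pos[OF t] by (simp add: s_def)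
    ultimately show ?thesis by (auto simp: limit_gradient_def)
  qed
  have lim: "limit_gradient W \<zeta> = range \<gamma>" using lim_sub lim_sup by blast
  define \<zeta>0 where "\<zeta>0 = \<zeta>((0, 0) := 0)"
  have agree: "\<zeta> b = \<zeta>0 b" if "b \<in> W" for b using that W0 by (auto simp: \<zeta>0_def)
  have isol: "isolated_sing W \<zeta>"
    unfolding isolated_sing_def \<zeta>0_def[symmetric]
  proof (intro conjI punct notI)
    show "continuous_on (insert (0, 0) W) \<zeta>0"
    proof (intro continuous_at_imp_continuous_on ballI)
      fix b assume "b \<in> insert (0, 0) W"
      then consider "b \<in> W" | "b = (0, 0)" by blast
      then show "isCont \<zeta>0 b"
      proof cases
        case 1
        then show ?thesis by (intro ext_at_isCont ext_at_cong[OF lg(2) lg(1) 1 agree])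
      next
        case 2
        have "\<zeta>0 \<midarrow>(0, 0)\<rightarrow> 0"
        proof (rule tendstoI)
          fix e :: real assume e: "0 < e"
          have "\<exists>\<delta>>0. \<forall>u v. 0 < v \<longrightarrow> v < \<delta> \<longrightarrow> dist (z (u, v)) (z (u, 0)) < e"
            by (rule near_axis_limit[where h=z and e=e, OF contXY(3) periodic_xy(5)]) (use e in auto)
          then obtain \<delta> where \<delta>: "0 < \<delta>" "\<And>u v. 0 < v \<Longrightarrow> v < \<delta> \<Longrightarrow> dist (z (u, v)) (z (u, 0)) < e"
            by blast
          have "open (insert (0, 0) W)" using punct by (simp add: punctured_nhd_def)
          then have "\<forall>\<^sub>F b in at (0, 0). b \<in> insert (0, 0) W" by (intro eventually_at_topological[THEN iffD2]) auto
          moreover have "\<forall>\<^sub>F b in at (0, 0). dist b (0, 0) < c * \<delta>"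
            unfolding eventually_at using c \<delta> by (intro exI[of _ "c * \<delta>"]) auto
          moreover have "\<forall>\<^sub>F b in at (0 :: real, 0 :: real). b \<noteq> (0, 0)" by (simp add: eventually_at_filter)
          ultimately show "\<forall>\<^sub>F b in at (0, 0). dist (\<zeta>0 b) 0 < e"
          proof eventually_elim
            case (elim b)
            then have bW: "b \<in> W" by simp
            then obtain u v where v: "0 < v" "v < r" "b = \<Phi> (u, v)" using WE by blast
            have "norm b < c * \<delta>" using elim by (simp add: dist_norm flip: zero_prod_def)
            then have "c * v < c * \<delta>" using W_pos[OF v(1,2), of u] v(3) by simp
            then have "v < \<delta>" using c(1) by simp
            then have "dist (z (u, v)) 0 < e" using \<delta>(2)[OF v(1), of u] init'(3) by simp
            moreover have "\<zeta>0 b = z (u, v)" using agree[OF bW] \<zeta>[of "(u, v)"] v by (simp add: Si)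
            ultimately show ?case by simp
          qed
        qed
        then show ?thesis using 2 by (simp add: isCont_def \<zeta>0_def)
      qed
    qed
    \<comment> \<open>A C^2 extension would have a gradient continuous at the origin, equal there to
      every limit \<open>\<gamma> u\<close>; but \<open>\<gamma>\<close> takes different values at
      \<open>0\<close> and \<open>pi\<close>.\<close>
    assume "\<exists>V. open V \<and> (0, 0) \<in> V \<and> V \<subseteq> insert (0, 0) W \<and> Ck_on 2 \<zeta>0 V"
    then obtain V where V: "open V" "(0, 0) \<in> V" "Ck_on 2 \<zeta>0 V" by blast
    have "isCont (\<lambda>w. dd \<zeta>0 w h) (0, 0)" for h
    proof -
      have "Ck_on (Suc 0) (\<lambda>w. dd \<zeta>0 w h) V"
        using V(3) unfolding numeral_2_eq_2 Ck_on.simps(2)[of "Suc 0"] by blast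
      then have "(\<lambda>w. dd \<zeta>0 w h) differentiable (at (0, 0))"
        using V(2) unfolding Ck_on.simps(2) by blast
      then show ?thesis by (rule differentiable_imp_continuous_within)
    qed
    then have cg: "isCont (grad \<zeta>0) (0, 0)"
      unfolding grad_def[abs_def] D1_def D2_def by (intro continuous_Pair)
    have geq: "grad \<zeta>0 b = grad \<zeta> b" if b: "b \<in> W" for b
      using D_cong[OF lg(2)[OF b] lg(1) b agree] by (simp add: grad_def)
    have "\<gamma> u = grad \<zeta>0 (0, 0)" for u
    proof -
      obtain s where s: "\<And>n. s n \<in> W" "s \<longlonglongrightarrow> (0, 0)" "(\<lambda>n. grad \<zeta> (s n)) \<longlonglongrightarrow> \<gamma> u"
        using lim_sup[of u] by (auto simp: limit_gradient_def)
      have "(\<lambda>n. grad \<zeta>0 (s n)) \<longlonglongrightarrow> grad \<zeta>0 (0, 0)" by (rule isCont_tendsto_compose[OF cg s(2)])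
      then show ?thesis using s(3) LIMSEQ_unique by (simp add: geq[OF s(1)]) blast
    qed
    then have "\<gamma> 0 = \<gamma> pi" by metis
    moreover have "inj_on \<gamma> {0..<2 * pi}" using jordan by (simp add: neg_convex_Jordan_def)
    ultimately have "0 = pi" by (intro inj_onD[of \<gamma> "{0..<2 * pi}" 0 pi]) auto
    then show False using pi_gt_zero by simp
  qed
  show ?thesis
    using punct gr lg(4,5) isol lim by blast
qed

lemma small_annuli:
  "\<exists>R\<^sub>0. 0 < R\<^sub>0 \<and> R\<^sub>0 \<le> R \<and> (\<forall>r. 0 < r \<and> r \<le> R\<^sub>0 \<longrightarrow>
    (\<exists>W \<zeta>. punctured_nhd W \<and> (\<lambda>w. (x w, y w, z w)) ` Strip r = graph_over W \<zeta> \<and>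
      MA_solution U A B C E W \<zeta> \<and> isolated_sing W \<zeta> \<and> limit_gradient W \<zeta> = range \<gamma> \<and>
      (\<forall>w\<in>W. C (jet1 \<zeta> w) + D1 (D1 \<zeta>) w > 0)))"
proof -
  obtain d1 where d1: "0 < d1" "d1 \<le> R" "\<And>u v. 0 < v \<Longrightarrow> v < d1 \<Longrightarrow> jac (u, v) > 0"
    by (rule jac_pos) blast
  obtain c where c: "0 < c" "c \<le> R" "\<And>u v. 0 < v \<Longrightarrow> v < c \<Longrightarrow> c * v \<le> norm (\<Phi> (u, v))"
    by (rule radial_bound) blast
  obtain d2 where d2: "0 < d2" "d2 \<le> R" "\<And>u v u' v'. 0 < v \<Longrightarrow> v < d2 \<Longrightarrow> 0 < v' \<Longrightarrow> v' < d2 \<Longrightarrow>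
      \<Phi> (u, v) = \<Phi> (u', v') \<Longrightarrow> v = v' \<and> (\<exists>k::int. u = u' + 2 * pi * k)"
    by (rule injectivity) blast
  show ?thesis
  proof (intro exI[of _ "Min {d1, c, d2}"] conjI allI impI)
    fix r assume r: "0 < r \<and> r \<le> Min {d1, c, d2}"
    show "\<exists>W \<zeta>. punctured_nhd W \<and> (\<lambda>w. (x w, y w, z w)) ` Strip r = graph_over W \<zeta> \<and>
      MA_solution U A B C E W \<zeta> \<and> isolated_sing W \<zeta> \<and> limit_gradient W \<zeta> = range \<gamma> \<and>
      (\<forall>w\<in>W. C (jet1 \<zeta> w) + D1 (D1 \<zeta>) w > 0)"
    proof (rule cone_singularity[of r c])
      show "v = v' \<and> (\<exists>k::int. u = u' + 2 * pi * k)"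
        if "0 < v" "v < r" "0 < v'" "v' < r" "\<Phi> (u, v) = \<Phi> (u', v')" for u v u' v'
        by (rule d2(3)) (use that r in auto)
    qed (use r d1 c in auto)
  qed (use d1 c d2 in auto)
qed

end

lemma D_Pair:
  assumes "ext_at f a" "(g has_derivative g') (at a)"
  shows "D1 (\<lambda>w. (f w, g w)) a = (D1 f a, D1 g a)" "D2 (\<lambda>w. (f w, g w)) a = (D2 f a, D2 g a)"
  using dd_eq[OF has_derivative_Pair[OF ext_at_has_derivative[OF assms(1)] assms(2)]] dd_eq[OF assms(2)]
  by (simp_all add: D1_def D2_def)

theorem theorem3:
  fixes U :: "R5 set" and A B C E :: "R5 \<Rightarrow> real" and \<gamma> :: "real \<Rightarrow> real \<times> real"
  assumes "open U"
    and "real_analytic_on A U" "real_analytic_on B U" "real_analytic_on C U" "real_analytic_on E U"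
    and elliptic: "\<forall>w\<in>U. A w * C w - (B w)\<^sup>2 + E w > 0"
    and "real_analytic_on \<gamma> UNIV"
    and "\<forall>u. \<gamma> (u + 2 * pi) = \<gamma> u"
    and "\<forall>u. (0, 0, 0, fst (\<gamma> u), snd (\<gamma> u)) \<in> U"
  shows "\<exists>R \<psi> x y z.
      R > 0 \<and> \<psi> = (\<lambda>w. (x w, y w, z w)) \<and>
      real_analytic_on \<psi> (Strip_hat R) \<and> periodic_on \<psi> (Strip_hat R) \<and>
      \<comment> \<open>1\<close>
      (\<forall>u. \<psi> (u, 0) = (0, 0, 0)) \<and>
      \<comment> \<open>2\<close>
      (\<exists>p q. real_analytic_on (\<lambda>w. (p w, q w)) (Strip_hat R) \<and>
         periodic_on (\<lambda>w. (p w, q w)) (Strip_hat R) \<and>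
         (\<forall>u. (p (u, 0), q (u, 0)) = \<gamma> u) \<and>
         (\<forall>w\<in>Strip R. (x w, y w, z w, p w, q w) \<in> U) \<and>
         (\<forall>w\<in>Strip R. D1 \<psi> w \<bullet> unit_normal (p w, q w) = 0 \<and>
                       D2 \<psi> w \<bullet> unit_normal (p w, q w) = 0)) \<and>
      \<comment> \<open>3\<close>
      (\<forall>w\<^sub>0\<in>Strip R. or_pres_local_diffeo_at (\<lambda>w. (x w, y w)) w\<^sub>0 \<longrightarrow>
         (\<exists>V \<Omega> \<zeta>. open V \<and> w\<^sub>0 \<in> V \<and> V \<subseteq> Strip R \<and>
            \<psi> ` V = graph_over \<Omega> \<zeta> \<and>
            real_analytic_on \<zeta> \<Omega> \<and> MA_solution U A B C E \<Omega> \<zeta> \<and>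
            (\<forall>w\<in>\<Omega>. C (jet1 \<zeta> w) + D1 (D1 \<zeta>) w > 0))) \<and>
      \<comment> \<open>4\<close>
      (neg_convex_Jordan \<gamma> \<longrightarrow>
         (\<exists>R\<^sub>0. 0 < R\<^sub>0 \<and> R\<^sub>0 \<le> R \<and>
            (\<forall>r. 0 < r \<and> r \<le> R\<^sub>0 \<longrightarrow>
               (\<exists>W \<zeta>. punctured_nhd W \<and> \<psi> ` Strip r = graph_over W \<zeta> \<and>
                  MA_solution U A B C E W \<zeta> \<and> isolated_sing W \<zeta> \<and>
                  limit_gradient W \<zeta> = range \<gamma> \<and>
                  (\<forall>w\<in>W. C (jet1 \<zeta> w) + D1 (D1 \<zeta>) w > 0)))))"
proof -
  obtain R x y z p q where R: "0 < R" and mp: "ma_param U A B C E R x y z p q"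
    and ini: "\<And>u. (x (u, 0), y (u, 0), z (u, 0), p (u, 0), q (u, 0)) = (0, 0, 0, \<gamma> u)"
    and per: "\<And>u v. (u, v) \<in> Strip_hat R \<Longrightarrow> (x (u + 2 * pi, v), y (u + 2 * pi, v), z (u + 2 * pi, v), p (u + 2 * pi, v), q (u + 2 * pi, v))
      = (x (u, v), y (u, v), z (u, v), p (u, v), q (u, v))"
    by (rule exists_param[OF assms]) blast
  interpret ma_param U A B C E R x y z p q by (rule mp)
  define \<psi> where "\<psi> w = (x w, y w, z w)" for w
  have sub: "Strip R \<subseteq> Strip_hat R" using R by (auto simp: Strip_def Strip_hat_def)
  have D\<psi>: "D1 \<psi> w = (D1 x w, D1 y w, D1 z w)" "D2 \<psi> w = (D2 x w, D2 y w, D2 z w)"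
    and Dxy: "D1 (\<lambda>w. (x w, y w)) w = (D1 x w, D1 y w)" "D2 (\<lambda>w. (x w, y w)) w = (D2 x w, D2 y w)"
    if w: "w \<in> Strip R" for w
  proof -
    note e = ext[OF subsetD[OF sub w]]
    note yz = has_derivative_Pair[OF ext_at_has_derivative[OF e(2)] ext_at_has_derivative[OF e(3)]]
    show "D1 \<psi> w = (D1 x w, D1 y w, D1 z w)" "D2 \<psi> w = (D2 x w, D2 y w, D2 z w)"
      unfolding \<psi>_def[abs_def] D_Pair[OF e(1) yz] D_Pair[OF e(2) ext_at_has_derivative[OF e(3)]] by simp_all
    show "D1 (\<lambda>w. (x w, y w)) w = (D1 x w, D1 y w)" "D2 (\<lambda>w. (x w, y w)) w = (D2 x w, D2 y w)"
      by (rule D_Pair[OF e(1) ext_at_has_derivative[OF e(2)]])+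
  qed
  have an: "real_analytic_on \<psi> (Strip_hat R)" "real_analytic_on (\<lambda>w. (p w, q w)) (Strip_hat R)"
    unfolding real_analytic_on_def \<psi>_def[abs_def]
    by (intro ballI real_analytic_at_Pair ext_at_real_analytic ext; assumption)+
  have pe: "periodic_on \<psi> (Strip_hat R)" "periodic_on (\<lambda>w. (p w, q w)) (Strip_hat R)"
    unfolding periodic_on_def \<psi>_def using per by auto
  \<comment> \<open>The two contact equations say that both tangent vectors are orthogonal to
    \<open>(- p, - q, 1)\<close>.\<close>
  have normal: "D1 \<psi> w \<bullet> unit_normal (p w, q w) = 0 \<and> D2 \<psi> w \<bullet> unit_normal (p w, q w) = 0" if w: "w \<in> Strip R" for w
    using dz[OF subsetD[OF sub w]] unfolding D\<psi>[OF w] unit_normal_def by (simp add: field_simps add_divide_distrib)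
  have part3: "\<exists>V \<Omega> \<zeta>. open V \<and> w \<in> V \<and> V \<subseteq> Strip R \<and> \<psi> ` V = graph_over \<Omega> \<zeta> \<and>
      real_analytic_on \<zeta> \<Omega> \<and> MA_solution U A B C E \<Omega> \<zeta> \<and> (\<forall>w\<in>\<Omega>. C (jet1 \<zeta> w) + D1 (D1 \<zeta>) w > 0)"
    if w: "w \<in> Strip R" and d: "or_pres_local_diffeo_at (\<lambda>w. (x w, y w)) w" for w
  proof -
    have "jac w > 0" using d unfolding or_pres_local_diffeo_at_def jac_def by (auto simp: Dxy[OF w])
    then show ?thesis unfolding \<psi>_def[abs_def] by (rule local_graph_near[OF w])
  qed
  have part4: "\<exists>R\<^sub>0. 0 < R\<^sub>0 \<and> R\<^sub>0 \<le> R \<and> (\<forall>r. 0 < r \<and> r \<le> R\<^sub>0 \<longrightarrow>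
      (\<exists>W \<zeta>. punctured_nhd W \<and> \<psi> ` Strip r = graph_over W \<zeta> \<and>
        MA_solution U A B C E W \<zeta> \<and> isolated_sing W \<zeta> \<and> limit_gradient W \<zeta> = range \<gamma> \<and>
        (\<forall>w\<in>W. C (jet1 \<zeta> w) + D1 (D1 \<zeta>) w > 0)))" if "neg_convex_Jordan \<gamma>"
  proof -
    interpret ma_cone U A B C E R x y z p q \<gamma>
      by unfold_locales (use R ini per that in auto)
    show ?thesis unfolding \<psi>_def[abs_def] by (rule small_annuli)
  qed
  have ini': "\<psi> (u, 0) = (0, 0, 0)" "(p (u, 0), q (u, 0)) = \<gamma> u" for u
    using ini[of u] by (auto simp: \<psi>_def)
  have inU: "(x w, y w, z w, p w, q w) \<in> U" if "w \<in> Strip R" for w using mem sub that by blast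
  show ?thesis
  proof (rule exI[of _ R], rule exI[of _ \<psi>], rule exI[of _ x], rule exI[of _ y], rule exI[of _ z],
      intro conjI allI ballI impI)
    show "\<psi> = (\<lambda>w. (x w, y w, z w))" by (simp add: \<psi>_def[abs_def])
    show "\<exists>p q. real_analytic_on (\<lambda>w. (p w, q w)) (Strip_hat R) \<and>
         periodic_on (\<lambda>w. (p w, q w)) (Strip_hat R) \<and>
         (\<forall>u. (p (u, 0), q (u, 0)) = \<gamma> u) \<and>
         (\<forall>w\<in>Strip R. (x w, y w, z w, p w, q w) \<in> U) \<and>
         (\<forall>w\<in>Strip R. D1 \<psi> w \<bullet> unit_normal (p w, q w) = 0 \<and>
                       D2 \<psi> w \<bullet> unit_normal (p w, q w) = 0)"
      by (rule exI[of _ p], rule exI[of _ q]) (intro conjI allI ballI an pe ini' inU normal[THEN conjunct1] normal[THEN conjunct2])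
  qed (rule R an pe ini' part3 part4; assumption)+
qed

end
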